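(* Let $\mathcal{A}$ be an abelian category with enough projectives. For any $F\in\mathrm{fp}(\mathcal{A}^{\mathrm{op}},\mathrm{Ab})$, the following are equivalent. 1. $F\in\mathrm{fp}_!(\mathcal{A}^{\mathrm{op}},\mathrm{Ab})$. 2. For any exact sequence $0\to A\xrightarrow{f}B\xrightarrow{g}C$ in $\mathcal{A}$ which gives a projective presentation $$0\to\mathrm{Hom}_{\mathcal{A}}(-,A)\xrightarrow{f_*}\mathrm{Hom}_{\mathcal{A}}(-,B)\xrightarrow{g_*}\mathrm{Hom}_{\mathcal{A}}(-,C)\to F\to 0$$ of $F$, $\underline{g}:\underline{B}\to\underline{C}$ is a split epimorphism in $\underline{\mathcal{A}}$ and $\underline{f}:\underline{A}\to\underline{B}$ is a weak kernel of $\underline{g}:\underline{B}\to\underline{C}$. 3. There is an exact sequence $0\to A\xrightarrow{f}B\xrightarrow{g}C$ in $\mathcal{A}$ which gives a projective presentation $$0\to\mathrm{Hom}_{\mathcal{A}}(-,A)\xrightarrow{f_*}\mathrm{Hom}_{\mathcal{A}}(-,B)\xrightarrow{g_*}\mathrm{Hom}_{\mathcal{A}}(-,C)\to F\to 0$$ of $F$ such that $\underline{g}:\underline{B}\to\underline{C}$ is a split epimorphism in $\underline{\mathcal{A}}$ and $\underline{f}:\underline{A}\to\underline{B}$ is a weak kernel of $\underline{g}:\underline{B}\to\underline{C}$. 4. $(F,G)\cong\mathrm{Ext}^1(F,G)=0$ for any additive functor $G:\mathcal{A}^{\mathrm{op}}\to\mathrm{Ab}$ which vanishes on projectives in $\mathcal{A}$.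 5. $(F,\mathrm{Ext}^1_{\mathcal{A}}(-,X))\cong\mathrm{Ext}^1(F,\mathrm{Ext}^1_{\mathcal{A}}(-,X))\cong 0$ for any $X\in\mathcal{A}$. 6. $(F,G)\cong\mathrm{Ext}^1(F,G)=0$ for any $G\in\mathrm{fp}_0(\mathcal{A}^{\mathrm{op}},\mathrm{Ab})$.
   Context: A functor $F:\mathcal{A}^{\mathrm{op}}\to\mathrm{Ab}$ is finitely presented if there is an exact sequence $\mathrm{Hom}_{\mathcal{A}}(-,B)\to\mathrm{Hom}_{\mathcal{A}}(-,C)\to F\to 0$ with $B,C\in\mathcal{A}$; $\mathrm{fp}(\mathcal{A}^{\mathrm{op}},\mathrm{Ab})$ is the (abelian) category of such functors, whose projectives are the representables. $\mathrm{fp}_0(\mathcal{A}^{\mathrm{op}},\mathrm{Ab})$ is the full subcategory of those $F$ with $FP=0$ for every projective $P\in\mathcal{A}$. $(-)^0:\mathrm{fp}(\mathcal{A}^{\mathrm{op}},\mathrm{Ab})\to\mathrm{fp}_0(\mathcal{A}^{\mathrm{op}},\mathrm{Ab})$ is the left adjoint of the inclusion, $\mathrm{L}_1((-)^0)$ is its first left derived functor, and $$\mathrm{fp}_!(\mathcal{A}^{\mathrm{op}},\mathrm{Ab})=\{F\in\mathrm{fp}(\mathcal{A}^{\mathrm{op}},\mathrm{Ab}):F^0=0\text{ and }\mathrm{L}_1((-)^0)(F)=0\}.$$ For additive functors $F,G:\mathcal{A}^{\mathrm{op}}\to\mathrm{Ab}$, $(F,G)$ denotes the group of natural transformations $F\to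 G$; for $F$ finitely presented, $\mathrm{Ext}^1(F,G)$ is the first cohomology of $(P_\bullet,G)$, where $P_\bullet$ is a resolution of $F$ by representable functors. $\mathrm{Ext}^n_{\mathcal{A}}(A,B)$ is computed with a projective resolution of $A$ in $\mathcal{A}$. $\underline{\mathcal{A}}$ is the projective stabilisation: it has the same objects as $\mathcal{A}$ and morphism groups $\underline{\mathrm{Hom}}_{\mathcal{A}}(A,B)=\mathrm{Hom}_{\mathcal{A}}(A,B)/\mathcal{P}(A,B)$, where $\mathcal{P}(A,B)$ is the subgroup of morphisms factoring through a projective object; $\underline{A}$ and $\underline{f}$ denote the images in $\underline{\mathcal{A}}$ of an object $A$ and a morphism $f$. For $f:A\to B$, $g:B\to C$ in $\mathcal{A}$, $\underline{f}$ is a weak kernel of $\underline{g}$ if the induced sequence $\underline{\mathrm{Hom}}_{\mathcal{A}}(-,A)\xrightarrow{\underline{f}_*}\underline{\mathrm{Hom}}_{\mathcal{A}}(-,B)\xrightarrow{\underline{g}_*}\underline{\mathrm{Hom}}_{\mathcal{A}}(-,C)$ is exact. *)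

theory Defs
  imports "HOL-Algebra.Elementary_Groups"
begin

section \<open>Preadditive and abelian categories\<close>

text \<open>
  Hom-groups have type \<^typ>\<open>'m monoid\<close>, so abelian groups are written multiplicatively:
  \<open>\<one>\<^bsub>G\<^esub>\<close> is the zero element and \<open>x \<otimes>\<^bsub>G\<^esub> y\<close> the sum.  Different hom-groups
  need not be disjoint, which is why composition takes the three objects as arguments:
  \<open>Comp C X Y Z g f\<close> is the composite of \<open>f : X \<rightarrow> Y\<close> and \<open>g : Y \<rightarrow> Z\<close>.

  Abelian groups form a class relative to a universe, which here is a type: Ab is the category of
  abelian groups with carrier in a given type.  Hom-groups, hence representable functors, have
  values in the type \<open>'m\<close> of arrows, and so do finitely presented functors up to isomorphism,
  because their values are quotients of hom-groups.  Hom-groups need not exhaust \<open>'m\<close>.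
  For a universe \<open>'v\<close> to serve as the target of arbitrary functors, the category must be locally
  small relative to it, i.e. every hom-set must inject into \<open>'v\<close>; \<open>'v = 'm\<close> always qualifies.
\<close>

record ('o, 'm) precat =
  Ob :: "'o set"
  Hom :: "'o \<Rightarrow> 'o \<Rightarrow> 'm monoid"
  Comp :: "'o \<Rightarrow> 'o \<Rightarrow> 'o \<Rightarrow> 'm \<Rightarrow> 'm \<Rightarrow> 'm"
  Ident :: "'o \<Rightarrow> 'm"

abbreviation Arr :: "('o, 'm) precat \<Rightarrow> 'o \<Rightarrow> 'o \<Rightarrow> 'm set" where
  "Arr C X Y \<equiv> carrier (Hom C X Y)"

abbreviation zero_arr :: "('o, 'm) precat \<Rightarrow> 'o \<Rightarrow> 'o \<Rightarrow> 'm" where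
  "zero_arr C X Y \<equiv> \<one>\<^bsub>Hom C X Y\<^esub>"

locale preadditive_category =
  fixes C :: "('o, 'm) precat"
  assumes Hom_comm_group: "\<lbrakk>X \<in> Ob C; Y \<in> Ob C\<rbrakk> \<Longrightarrow> comm_group (Hom C X Y)"
    and Ident_closed: "X \<in> Ob C \<Longrightarrow> Ident C X \<in> Arr C X X"
    and Comp_hom_left: "\<lbrakk>X \<in> Ob C; Y \<in> Ob C; Z \<in> Ob C; f \<in> Arr C X Y\<rbrakk>
        \<Longrightarrow> (\<lambda>g. Comp C X Y Z g f) \<in> hom (Hom C Y Z) (Hom C X Z)"
    and Comp_hom_right: "\<lbrakk>X \<in> Ob C; Y \<in> Ob C; Z \<in> Ob C; g \<in> Arr C Y Z\<rbrakk>
        \<Longrightarrow> (\<lambda>f. Comp C X Y Z g f) \<in> hom (Hom C X Y) (Hom C X Z)"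
    and Comp_Ident_left: "\<lbrakk>X \<in> Ob C; Y \<in> Ob C; f \<in> Arr C X Y\<rbrakk>
        \<Longrightarrow> Comp C X Y Y (Ident C Y) f = f"
    and Comp_Ident_right: "\<lbrakk>X \<in> Ob C; Y \<in> Ob C; f \<in> Arr C X Y\<rbrakk>
        \<Longrightarrow> Comp C X X Y f (Ident C X) = f"
    and Comp_assoc: "\<lbrakk>W \<in> Ob C; X \<in> Ob C; Y \<in> Ob C; Z \<in> Ob C;
          f \<in> Arr C W X; g \<in> Arr C X Y; h \<in> Arr C Y Z\<rbrakk>
        \<Longrightarrow> Comp C W Y Z h (Comp C W X Y g f) = Comp C W X Z (Comp C X Y Z h g) f"

definition is_zero_object :: "('o, 'm) precat \<Rightarrow> 'o \<Rightarrow> bool" where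
  "is_zero_object C Z \<longleftrightarrow> Z \<in> Ob C \<and>
     (\<forall>X\<in>Ob C. (\<exists>!f. f \<in> Arr C X Z) \<and> (\<exists>!f. f \<in> Arr C Z X))"

definition monic :: "('o, 'm) precat \<Rightarrow> 'o \<Rightarrow> 'o \<Rightarrow> 'm \<Rightarrow> bool" where
  "monic C X Y f \<longleftrightarrow> f \<in> Arr C X Y \<and>
     (\<forall>W\<in>Ob C. \<forall>u\<in>Arr C W X. \<forall>v\<in>Arr C W X. Comp C W X Y f u = Comp C W X Y f v \<longrightarrow> u = v)"

definition epic :: "('o, 'm) precat \<Rightarrow> 'o \<Rightarrow> 'o \<Rightarrow> 'm \<Rightarrow> bool" where
  "epic C X Y f \<longleftrightarrow> f \<in> Arr C X Y \<and>
     (\<forall>W\<in>Ob C. \<forall>u\<in>Arr C Y W. \<forall>v\<in>Arr C Y W. Comp C X Y W u f = Comp C X Y W v f \<longrightarrow> u = v)"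

definition split_epic :: "('o, 'm) precat \<Rightarrow> 'o \<Rightarrow> 'o \<Rightarrow> 'm \<Rightarrow> bool" where
  "split_epic C X Y f \<longleftrightarrow> f \<in> Arr C X Y \<and> (\<exists>s\<in>Arr C Y X. Comp C Y X Y f s = Ident C Y)"

definition is_kernel :: "('o, 'm) precat \<Rightarrow> 'o \<Rightarrow> 'o \<Rightarrow> 'm \<Rightarrow> 'o \<Rightarrow> 'm \<Rightarrow> bool" where
  "is_kernel C X Y f K k \<longleftrightarrow> K \<in> Ob C \<and> k \<in> Arr C K X \<and> Comp C K X Y f k = zero_arr C K Y \<and>
     (\<forall>W\<in>Ob C. \<forall>h\<in>Arr C W X. Comp C W X Y f h = zero_arr C W Y \<longrightarrow>
        (\<exists>!u. u \<in> Arr C W K \<and> Comp C W K X k u = h))"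

definition is_cokernel :: "('o, 'm) precat \<Rightarrow> 'o \<Rightarrow> 'o \<Rightarrow> 'm \<Rightarrow> 'o \<Rightarrow> 'm \<Rightarrow> bool" where
  "is_cokernel C X Y f Q q \<longleftrightarrow> Q \<in> Ob C \<and> q \<in> Arr C Y Q \<and> Comp C X Y Q q f = zero_arr C X Q \<and>
     (\<forall>W\<in>Ob C. \<forall>h\<in>Arr C Y W. Comp C X Y W h f = zero_arr C X W \<longrightarrow>
        (\<exists>!u. u \<in> Arr C Q W \<and> Comp C Y Q W u q = h))"

definition is_biproduct ::
    "('o, 'm) precat \<Rightarrow> 'o \<Rightarrow> 'o \<Rightarrow> 'o \<Rightarrow> 'm \<Rightarrow> 'm \<Rightarrow> 'm \<Rightarrow> 'm \<Rightarrow> bool" where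
  "is_biproduct C X Y S i j p q \<longleftrightarrow> S \<in> Ob C \<and>
     i \<in> Arr C X S \<and> j \<in> Arr C Y S \<and> p \<in> Arr C S X \<and> q \<in> Arr C S Y \<and>
     Comp C X S X p i = Ident C X \<and> Comp C Y S Y q j = Ident C Y \<and>
     Comp C Y S X p j = zero_arr C Y X \<and> Comp C X S Y q i = zero_arr C X Y \<and>
     Comp C S X S i p \<otimes>\<^bsub>Hom C S S\<^esub> Comp C S Y S j q = Ident C S"

locale abelian_category = preadditive_category C for C :: "('o, 'm) precat" +
  assumes ex_zero_object: "\<exists>Z. is_zero_object C Z"
    and ex_biproduct: "\<lbrakk>X \<in> Ob C; Y \<in> Ob C\<rbrakk> \<Longrightarrow> \<exists>S i j p q. is_biproduct C X Y S i j p q"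
    and ex_kernel: "\<lbrakk>X \<in> Ob C; Y \<in> Ob C; f \<in> Arr C X Y\<rbrakk> \<Longrightarrow> \<exists>K k. is_kernel C X Y f K k"
    and ex_cokernel: "\<lbrakk>X \<in> Ob C; Y \<in> Ob C; f \<in> Arr C X Y\<rbrakk> \<Longrightarrow> \<exists>Q q. is_cokernel C X Y f Q q"
    and monic_normal: "\<lbrakk>X \<in> Ob C; Y \<in> Ob C; monic C X Y f\<rbrakk>
        \<Longrightarrow> \<exists>Z\<in>Ob C. \<exists>g\<in>Arr C Y Z. is_kernel C Y Z g X f"
    and epic_normal: "\<lbrakk>X \<in> Ob C; Y \<in> Ob C; epic C X Y f\<rbrakk>
        \<Longrightarrow> \<exists>W\<in>Ob C. \<exists>g\<in>Arr C W X. is_cokernel C W X g Y f"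

text \<open>\<open>X \<rightarrow> Y \<rightarrow> Z\<close> is exact when the image of \<open>f\<close>, i.e. the kernel of its cokernel, is the
  kernel of \<open>g\<close>.\<close>

definition exact_at :: "('o, 'm) precat \<Rightarrow> 'o \<Rightarrow> 'o \<Rightarrow> 'o \<Rightarrow> 'm \<Rightarrow> 'm \<Rightarrow> bool" where
  "exact_at C X Y Z f g \<longleftrightarrow> f \<in> Arr C X Y \<and> g \<in> Arr C Y Z \<and>
     (\<exists>Q q K k. is_cokernel C X Y f Q q \<and> is_kernel C Y Q q K k \<and> is_kernel C Y Z g K k)"

text \<open>Exactness of \<open>0 \<rightarrow> X \<rightarrow> Y \<rightarrow> Z\<close>.\<close>

definition left_exact_seq :: "('o, 'm) precat \<Rightarrow> 'o \<Rightarrow> 'o \<Rightarrow> 'o \<Rightarrow> 'm \<Rightarrow> 'm \<Rightarrow> bool" where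
  "left_exact_seq C X Y Z f g \<longleftrightarrow> monic C X Y f \<and> exact_at C X Y Z f g"

text \<open>\<open>H\<close> is the homology at \<open>Y\<close> of \<open>X \<rightarrow> Y \<rightarrow> Z\<close>: the cokernel of the map from \<open>X\<close> to the
  kernel of \<open>g\<close>.\<close>

definition is_homology :: "('o, 'm) precat \<Rightarrow> 'o \<Rightarrow> 'o \<Rightarrow> 'o \<Rightarrow> 'm \<Rightarrow> 'm \<Rightarrow> 'o \<Rightarrow> bool" where
  "is_homology C X Y Z f g H \<longleftrightarrow>
     (\<exists>K k f' c. is_kernel C Y Z g K k \<and> f' \<in> Arr C X K \<and> Comp C X K Y k f' = f \<and>
        is_cokernel C X K f' H c)"

definition projective :: "('o, 'm) precat \<Rightarrow> 'o \<Rightarrow> bool" where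
  "projective C P \<longleftrightarrow> P \<in> Ob C \<and>
     (\<forall>X\<in>Ob C. \<forall>Y\<in>Ob C. \<forall>e. epic C X Y e \<longrightarrow>
        (\<forall>f\<in>Arr C P Y. \<exists>g\<in>Arr C P X. Comp C P X Y e g = f))"

definition enough_projectives :: "('o, 'm) precat \<Rightarrow> bool" where
  "enough_projectives C \<longleftrightarrow> (\<forall>X\<in>Ob C. \<exists>P e. projective C P \<and> epic C P X e)"

definition proj_resolution ::
    "('o, 'm) precat \<Rightarrow> 'o \<Rightarrow> (nat \<Rightarrow> 'o) \<Rightarrow> (nat \<Rightarrow> 'm) \<Rightarrow> 'm \<Rightarrow> bool" where
  "proj_resolution C X P d e \<longleftrightarrow>
     (\<forall>n. projective C (P n)) \<and> epic C (P 0) X e \<and>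
     exact_at C (P 1) (P 0) X (d 0) e \<and>
     (\<forall>n. exact_at C (P (Suc (Suc n))) (P (Suc n)) (P n) (d (Suc n)) (d n))"

section \<open>Cohomology of cochain complexes of abelian groups\<close>

definition cocycles :: "(nat \<Rightarrow> 'a monoid) \<Rightarrow> (nat \<Rightarrow> 'a \<Rightarrow> 'a) \<Rightarrow> nat \<Rightarrow> 'a monoid" where
  "cocycles K \<delta> n = (K n)\<lparr>carrier := kernel (K n) (K (Suc n)) (\<delta> n)\<rparr>"

definition coboundaries :: "(nat \<Rightarrow> 'a monoid) \<Rightarrow> (nat \<Rightarrow> 'a \<Rightarrow> 'a) \<Rightarrow> nat \<Rightarrow> 'a set" where
  "coboundaries K \<delta> n = (case n of 0 \<Rightarrow> {\<one>\<^bsub>K 0\<^esub>} | Suc m \<Rightarrow> \<delta> m ` carrier (K m))"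

definition cohomology :: "(nat \<Rightarrow> 'a monoid) \<Rightarrow> (nat \<Rightarrow> 'a \<Rightarrow> 'a) \<Rightarrow> nat \<Rightarrow> 'a set monoid" where
  "cohomology K \<delta> n = cocycles K \<delta> n Mod coboundaries K \<delta> n"

section \<open>Additive functors to abelian groups\<close>

text \<open>Data of a contravariant functor: for \<open>f : X \<rightarrow> Y\<close>, \<open>Fmap F X Y f\<close> maps \<open>Fob F Y\<close> to
  \<open>Fob F X\<close>.  The groups may live in a type \<open>'v\<close> other than \<open>'m\<close>, because Ext groups are
  quotients and hence have sets as elements.\<close>

record ('o, 'm, 'v) abfun =
  Fob :: "'o \<Rightarrow> 'v monoid"
  Fmap :: "'o \<Rightarrow> 'o \<Rightarrow> 'm \<Rightarrow> 'v \<Rightarrow> 'v"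

definition additive_functor :: "('o, 'm) precat \<Rightarrow> ('o, 'm, 'v) abfun \<Rightarrow> bool" where
  "additive_functor A F \<longleftrightarrow>
     (\<forall>X\<in>Ob A. comm_group (Fob F X)) \<and>
     (\<forall>X\<in>Ob A. \<forall>Y\<in>Ob A. \<forall>f\<in>Arr A X Y. Fmap F X Y f \<in> hom (Fob F Y) (Fob F X)) \<and>
     (\<forall>X\<in>Ob A. \<forall>x\<in>carrier (Fob F X). Fmap F X X (Ident A X) x = x) \<and>
     (\<forall>X\<in>Ob A. \<forall>Y\<in>Ob A. \<forall>Z\<in>Ob A. \<forall>f\<in>Arr A X Y. \<forall>g\<in>Arr A Y Z. \<forall>z\<in>carrier (Fob F Z).
        Fmap F X Z (Comp A X Y Z g f) z = Fmap F X Y f (Fmap F Y Z g z)) \<and>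
     (\<forall>X\<in>Ob A. \<forall>Y\<in>Ob A. \<forall>f\<in>Arr A X Y. \<forall>g\<in>Arr A X Y. \<forall>y\<in>carrier (Fob F Y).
        Fmap F X Y (f \<otimes>\<^bsub>Hom A X Y\<^esub> g) y = Fmap F X Y f y \<otimes>\<^bsub>Fob F X\<^esub> Fmap F X Y g y)"

definition vanishes_on_projectives :: "('o, 'm) precat \<Rightarrow> ('o, 'm, 'v) abfun \<Rightarrow> bool" where
  "vanishes_on_projectives A F \<longleftrightarrow> (\<forall>P. projective A P \<longrightarrow> trivial_group (Fob F P))"

text \<open>The group \<open>(F, G)\<close>.  Components are extensional, so that natural transformations agreeing
  on all objects and elements are equal.\<close>

definition NatTr ::
    "('o, 'm) precat \<Rightarrow> ('o, 'm, 'a) abfun \<Rightarrow> ('o, 'm, 'b) abfun \<Rightarrow> ('o \<Rightarrow> 'a \<Rightarrow> 'b) monoid" where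
  "NatTr A F G =
     \<lparr>carrier = {\<eta> \<in> (\<Pi>\<^sub>E X\<in>Ob A. hom (Fob F X) (Fob G X) \<inter> extensional (carrier (Fob F X))).
        \<forall>X\<in>Ob A. \<forall>Y\<in>Ob A. \<forall>f\<in>Arr A X Y. \<forall>y\<in>carrier (Fob F Y).
          \<eta> X (Fmap F X Y f y) = Fmap G X Y f (\<eta> Y y)},
      mult = (\<lambda>\<eta> \<theta>. \<lambda>X\<in>Ob A. \<lambda>x\<in>carrier (Fob F X). \<eta> X x \<otimes>\<^bsub>Fob G X\<^esub> \<theta> X x),
      one = (\<lambda>X\<in>Ob A. \<lambda>x\<in>carrier (Fob F X). \<one>\<^bsub>Fob G X\<^esub>)\<rparr>"

definition nat_comp ::
    "('o, 'm) precat \<Rightarrow> ('o, 'm, 'a) abfun \<Rightarrow> ('o \<Rightarrow> 'b \<Rightarrow> 'c) \<Rightarrow> ('o \<Rightarrow> 'a \<Rightarrow> 'b) \<Rightarrow> 'o \<Rightarrow> 'a \<Rightarrow> 'c"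
  where "nat_comp A F \<beta> \<alpha> = (\<lambda>X\<in>Ob A. \<lambda>x\<in>carrier (Fob F X). \<beta> X (\<alpha> X x))"

definition nat_ident :: "('o, 'm) precat \<Rightarrow> ('o, 'm, 'a) abfun \<Rightarrow> 'o \<Rightarrow> 'a \<Rightarrow> 'a" where
  "nat_ident A F = (\<lambda>X\<in>Ob A. \<lambda>x\<in>carrier (Fob F X). x)"

text \<open>Exactness of a sequence of functors is exactness at every object.\<close>

definition nat_exact ::
    "('o, 'm) precat \<Rightarrow> ('o, 'm, 'a) abfun \<Rightarrow> ('o, 'm, 'b) abfun \<Rightarrow> ('o, 'm, 'c) abfun
      \<Rightarrow> ('o \<Rightarrow> 'a \<Rightarrow> 'b) \<Rightarrow> ('o \<Rightarrow> 'b \<Rightarrow> 'c) \<Rightarrow> bool" where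
  "nat_exact A F G H \<alpha> \<beta> \<longleftrightarrow>
     (\<forall>X\<in>Ob A. \<alpha> X ` carrier (Fob F X) = kernel (Fob G X) (Fob H X) (\<beta> X))"

definition nat_inj :: "('o, 'm) precat \<Rightarrow> ('o, 'm, 'a) abfun \<Rightarrow> ('o \<Rightarrow> 'a \<Rightarrow> 'b) \<Rightarrow> bool" where
  "nat_inj A F \<alpha> \<longleftrightarrow> (\<forall>X\<in>Ob A. inj_on (\<alpha> X) (carrier (Fob F X)))"

definition nat_surj :: "('o, 'm) precat \<Rightarrow> ('o, 'm, 'a) abfun \<Rightarrow> ('o, 'm, 'b) abfun
    \<Rightarrow> ('o \<Rightarrow> 'a \<Rightarrow> 'b) \<Rightarrow> bool" where
  "nat_surj A F G \<alpha> \<longleftrightarrow> (\<forall>X\<in>Ob A. \<alpha> X ` carrier (Fob F X) = carrier (Fob G X))"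

definition Rep :: "('o, 'm) precat \<Rightarrow> 'o \<Rightarrow> ('o, 'm, 'm) abfun" where
  "Rep A B = \<lparr>Fob = (\<lambda>X. Hom A X B), Fmap = (\<lambda>X Y f h. Comp A X Y B h f)\<rparr>"

text \<open>The natural transformation \<open>f\<^sub>* : Hom(-, B) \<rightarrow> Hom(-, B')\<close> induced by \<open>f : B \<rightarrow> B'\<close>.\<close>

definition push :: "('o, 'm) precat \<Rightarrow> 'o \<Rightarrow> 'o \<Rightarrow> 'm \<Rightarrow> 'o \<Rightarrow> 'm \<Rightarrow> 'm" where
  "push A B B' f = (\<lambda>X\<in>Ob A. \<lambda>h\<in>Arr A X B. Comp A X B B' f h)"

definition finitely_presented :: "('o, 'm) precat \<Rightarrow> ('o, 'm, 'm) abfun \<Rightarrow> bool" where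
  "finitely_presented A F \<longleftrightarrow> additive_functor A F \<and>
     (\<exists>B\<in>Ob A. \<exists>C\<in>Ob A. \<exists>\<alpha>\<in>carrier (NatTr A (Rep A B) (Rep A C)). \<exists>\<pi>\<in>carrier (NatTr A (Rep A C) F).
        nat_exact A (Rep A B) (Rep A C) F \<alpha> \<pi> \<and> nat_surj A (Rep A C) F \<pi>)"

definition fp :: "('o, 'm) precat \<Rightarrow> (('o, 'm, 'm) abfun, 'o \<Rightarrow> 'm \<Rightarrow> 'm) precat" where
  "fp A = \<lparr>Ob = {F. finitely_presented A F}, Hom = NatTr A,
     Comp = (\<lambda>F G H \<beta> \<alpha>. nat_comp A F \<beta> \<alpha>), Ident = nat_ident A\<rparr>"

definition fp0 :: "('o, 'm) precat \<Rightarrow> (('o, 'm, 'm) abfun, 'o \<Rightarrow> 'm \<Rightarrow> 'm) precat" where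
  "fp0 A = (fp A)\<lparr>Ob := {F \<in> Ob (fp A). vanishes_on_projectives A F}\<rparr>"

text \<open>The maps \<open>f : X \<rightarrow> Y\<close>, \<open>g : Y \<rightarrow> Z\<close> give a projective presentation
  \<open>0 \<rightarrow> Hom(-, X) \<rightarrow> Hom(-, Y) \<rightarrow> Hom(-, Z) \<rightarrow> F \<rightarrow> 0\<close> of \<open>F\<close>.\<close>

definition gives_presentation ::
    "('o, 'm) precat \<Rightarrow> 'o \<Rightarrow> 'o \<Rightarrow> 'o \<Rightarrow> 'm \<Rightarrow> 'm \<Rightarrow> ('o, 'm, 'm) abfun \<Rightarrow> bool" where
  "gives_presentation A X Y Z f g F \<longleftrightarrow>
     (\<exists>\<pi>\<in>carrier (NatTr A (Rep A Z) F).
        nat_inj A (Rep A X) (push A X Y f) \<and>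
        nat_exact A (Rep A X) (Rep A Y) (Rep A Z) (push A X Y f) (push A Y Z g) \<and>
        nat_exact A (Rep A Y) (Rep A Z) F (push A Y Z g) \<pi> \<and>
        nat_surj A (Rep A Z) F \<pi>)"

section \<open>Left adjoints and left derived functors\<close>

record ('o1, 'm1, 'o2, 'm2) catfun =
  Tob :: "'o1 \<Rightarrow> 'o2"
  Tmap :: "'o1 \<Rightarrow> 'o1 \<Rightarrow> 'm1 \<Rightarrow> 'm2"

definition is_catfun ::
    "('o1, 'm1) precat \<Rightarrow> ('o2, 'm2) precat \<Rightarrow> ('o1, 'm1, 'o2, 'm2) catfun \<Rightarrow> bool" where
  "is_catfun C D T \<longleftrightarrow>
     (\<forall>X\<in>Ob C. Tob T X \<in> Ob D) \<and>
     (\<forall>X\<in>Ob C. \<forall>Y\<in>Ob C. \<forall>f\<in>Arr C X Y. Tmap T X Y f \<in> Arr D (Tob T X) (Tob T Y)) \<and>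
     (\<forall>X\<in>Ob C. Tmap T X X (Ident C X) = Ident D (Tob T X)) \<and>
     (\<forall>X\<in>Ob C. \<forall>Y\<in>Ob C. \<forall>Z\<in>Ob C. \<forall>f\<in>Arr C X Y. \<forall>g\<in>Arr C Y Z.
        Tmap T X Z (Comp C X Y Z g f) =
        Comp D (Tob T X) (Tob T Y) (Tob T Z) (Tmap T Y Z g) (Tmap T X Y f))"

text \<open>\<open>L\<close> is left adjoint to \<open>R\<close>, expressed by a unit \<open>\<eta> : 1 \<rightarrow> R L\<close> with universal components.\<close>

definition is_left_adjoint ::
    "('o1, 'm1) precat \<Rightarrow> ('o2, 'm2) precat \<Rightarrow> ('o1, 'm1, 'o2, 'm2) catfun
      \<Rightarrow> ('o2, 'm2, 'o1, 'm1) catfun \<Rightarrow> bool" where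
  "is_left_adjoint C D L R \<longleftrightarrow> is_catfun C D L \<and> is_catfun D C R \<and>
     (\<exists>\<eta>.
        (\<forall>X\<in>Ob C. \<eta> X \<in> Arr C X (Tob R (Tob L X))) \<and>
        (\<forall>X\<in>Ob C. \<forall>Y\<in>Ob C. \<forall>f\<in>Arr C X Y.
           Comp C X Y (Tob R (Tob L Y)) (\<eta> Y) f =
           Comp C X (Tob R (Tob L X)) (Tob R (Tob L Y))
             (Tmap R (Tob L X) (Tob L Y) (Tmap L X Y f)) (\<eta> X)) \<and>
        (\<forall>X\<in>Ob C. \<forall>Y\<in>Ob D. \<forall>f\<in>Arr C X (Tob R Y).
           \<exists>!g. g \<in> Arr D (Tob L X) Y \<and>
             Comp C X (Tob R (Tob L X)) (Tob R Y) (Tmap R (Tob L X) Y g) (\<eta> X) = f))"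

definition incl :: "('o, 'm, 'o, 'm) catfun" where
  "incl = \<lparr>Tob = (\<lambda>X. X), Tmap = (\<lambda>X Y f. f)\<rparr>"

text \<open>The functor \<open>(-)\<^sup>0\<close>; left adjoints are unique only up to natural isomorphism, so one is
  chosen.  Likewise for the first left derived functor below, the choice being that of a
  projective resolution and of a homology object.\<close>

definition sup0 :: "('o, 'm) precat
    \<Rightarrow> (('o, 'm, 'm) abfun, 'o \<Rightarrow> 'm \<Rightarrow> 'm, ('o, 'm, 'm) abfun, 'o \<Rightarrow> 'm \<Rightarrow> 'm) catfun" where
  "sup0 A = (SOME L. is_left_adjoint (fp A) (fp0 A) L incl)"

definition L1 :: "('o1, 'm1) precat \<Rightarrow> ('o2, 'm2) precat \<Rightarrow> ('o1, 'm1, 'o2, 'm2) catfun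
    \<Rightarrow> 'o1 \<Rightarrow> 'o2" where
  "L1 C D T X = (SOME H. \<exists>P d e. proj_resolution C X P d e \<and>
     is_homology D (Tob T (P 2)) (Tob T (P 1)) (Tob T (P 0))
       (Tmap T (P 2) (P 1) (d 1)) (Tmap T (P 1) (P 0) (d 0)) H)"

definition fp_shriek :: "('o, 'm) precat \<Rightarrow> ('o, 'm, 'm) abfun set" where
  "fp_shriek A = {F \<in> Ob (fp A). is_zero_object (fp0 A) (Tob (sup0 A) F) \<and>
     is_zero_object (fp0 A) (L1 (fp A) (fp0 A) (sup0 A) F)}"

section \<open>Ext groups\<close>

text \<open>Extensions of functors: cohomology of \<open>(P\<^sub>\<bullet>, G)\<close> for a resolution of \<open>F\<close> by the
  representable functors \<open>P\<^sub>n = Hom(-, R n)\<close>.\<close>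

definition rep_resolution ::
    "('o, 'm) precat \<Rightarrow> ('o, 'm, 'a) abfun \<Rightarrow> (nat \<Rightarrow> 'o) \<Rightarrow> (nat \<Rightarrow> 'o \<Rightarrow> 'm \<Rightarrow> 'm)
      \<Rightarrow> ('o \<Rightarrow> 'm \<Rightarrow> 'a) \<Rightarrow> bool" where
  "rep_resolution A F R d e \<longleftrightarrow>
     (\<forall>n. R n \<in> Ob A) \<and>
     (\<forall>n. d n \<in> carrier (NatTr A (Rep A (R (Suc n))) (Rep A (R n)))) \<and>
     e \<in> carrier (NatTr A (Rep A (R 0)) F) \<and>
     nat_surj A (Rep A (R 0)) F e \<and>
     nat_exact A (Rep A (R 1)) (Rep A (R 0)) F (d 0) e \<and>
     (\<forall>n. nat_exact A (Rep A (R (Suc (Suc n)))) (Rep A (R (Suc n))) (Rep A (R n))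
        (d (Suc n)) (d n))"

definition ExtFun :: "('o, 'm) precat \<Rightarrow> nat \<Rightarrow> ('o, 'm, 'a) abfun \<Rightarrow> ('o, 'm, 'b) abfun
    \<Rightarrow> ('o \<Rightarrow> 'm \<Rightarrow> 'b) set monoid" where
  "ExtFun A n F G = (case (SOME (R, d, e). rep_resolution A F R d e) of (R, d, e) \<Rightarrow>
     cohomology (\<lambda>k. NatTr A (Rep A (R k)) G)
       (\<lambda>k \<theta>. nat_comp A (Rep A (R (Suc k))) \<theta> (d k)) n)"

text \<open>Extensions in the category itself, as a functor of the first argument: a projective
  resolution \<open>res A Y\<close> of every object \<open>Y\<close> is chosen, and a morphism acts through a chain map
  lifting it.\<close>

definition res :: "('o, 'm) precat \<Rightarrow> 'o \<Rightarrow> (nat \<Rightarrow> 'o) \<times> (nat \<Rightarrow> 'm) \<times> 'm" where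
  "res A Y = (SOME (P, d, e). proj_resolution A Y P d e)"

definition res_ob :: "('o, 'm) precat \<Rightarrow> 'o \<Rightarrow> nat \<Rightarrow> 'o" where
  "res_ob A Y = fst (res A Y)"

definition res_diff :: "('o, 'm) precat \<Rightarrow> 'o \<Rightarrow> nat \<Rightarrow> 'm" where
  "res_diff A Y = fst (snd (res A Y))"

definition res_aug :: "('o, 'm) precat \<Rightarrow> 'o \<Rightarrow> 'm" where
  "res_aug A Y = snd (snd (res A Y))"

definition is_chain_lift ::
    "('o, 'm) precat \<Rightarrow> 'o \<Rightarrow> 'o \<Rightarrow> 'm \<Rightarrow> (nat \<Rightarrow> 'm) \<Rightarrow> bool" where
  "is_chain_lift A Y Z f \<phi> \<longleftrightarrow>
     (\<forall>n. \<phi> n \<in> Arr A (res_ob A Y n) (res_ob A Z n)) \<and>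
     Comp A (res_ob A Y 0) (res_ob A Z 0) Z (res_aug A Z) (\<phi> 0) =
       Comp A (res_ob A Y 0) Y Z f (res_aug A Y) \<and>
     (\<forall>n. Comp A (res_ob A Y (Suc n)) (res_ob A Y n) (res_ob A Z n) (\<phi> n) (res_diff A Y n) =
       Comp A (res_ob A Y (Suc n)) (res_ob A Z (Suc n)) (res_ob A Z n)
         (res_diff A Z n) (\<phi> (Suc n)))"

definition chain_lift :: "('o, 'm) precat \<Rightarrow> 'o \<Rightarrow> 'o \<Rightarrow> 'm \<Rightarrow> nat \<Rightarrow> 'm" where
  "chain_lift A Y Z f = (SOME \<phi>. is_chain_lift A Y Z f \<phi>)"

definition ext_cx :: "('o, 'm) precat \<Rightarrow> 'o \<Rightarrow> 'o \<Rightarrow> nat \<Rightarrow> 'm monoid" where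
  "ext_cx A X Y n = Hom A (res_ob A Y n) X"

definition ext_cx_diff :: "('o, 'm) precat \<Rightarrow> 'o \<Rightarrow> 'o \<Rightarrow> nat \<Rightarrow> 'm \<Rightarrow> 'm" where
  "ext_cx_diff A X Y n h = Comp A (res_ob A Y (Suc n)) (res_ob A Y n) X h (res_diff A Y n)"

text \<open>The functor \<open>Ext\<^sup>n(-, X)\<close>.  Elements of \<open>Ext\<^sup>n(Y, X)\<close> are cosets of the coboundaries; the
  union in \<^const>\<open>Fmap\<close> is over the representatives of a class, all of which give the same
  coset.\<close>

definition ExtA :: "('o, 'm) precat \<Rightarrow> nat \<Rightarrow> 'o \<Rightarrow> ('o, 'm, 'm set) abfun" where
  "ExtA A n X =
     \<lparr>Fob = (\<lambda>Y. cohomology (ext_cx A X Y) (ext_cx_diff A X Y) n),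
      Fmap = (\<lambda>Y Z f c. \<Union>h\<in>c.
        coboundaries (ext_cx A X Y) (ext_cx_diff A X Y) n #>\<^bsub>ext_cx A X Y n\<^esub>
          Comp A (res_ob A Y n) (res_ob A Z n) X h (chain_lift A Y Z f n))\<rparr>"

section \<open>The projective stabilisation\<close>

definition proj_arrs :: "('o, 'm) precat \<Rightarrow> 'o \<Rightarrow> 'o \<Rightarrow> 'm set" where
  "proj_arrs A X Y = {Comp A X P Y v u | P u v.
     projective A P \<and> u \<in> Arr A X P \<and> v \<in> Arr A P Y}"

definition stab_arr :: "('o, 'm) precat \<Rightarrow> 'o \<Rightarrow> 'o \<Rightarrow> 'm \<Rightarrow> 'm set" where
  "stab_arr A X Y f = proj_arrs A X Y #>\<^bsub>Hom A X Y\<^esub> f"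

text \<open>As above, the union defining composition is over representatives giving the same coset.\<close>

definition stab :: "('o, 'm) precat \<Rightarrow> ('o, 'm set) precat" where
  "stab A = \<lparr>Ob = Ob A, Hom = (\<lambda>X Y. Hom A X Y Mod proj_arrs A X Y),
     Comp = (\<lambda>X Y Z c b. \<Union>g\<in>c. \<Union>f\<in>b. stab_arr A X Z (Comp A X Y Z g f)),
     Ident = (\<lambda>X. stab_arr A X X (Ident A X))\<rparr>"

definition weak_kernel :: "('o, 'm) precat \<Rightarrow> 'o \<Rightarrow> 'o \<Rightarrow> 'o \<Rightarrow> 'm \<Rightarrow> 'm \<Rightarrow> bool" where
  "weak_kernel C X Y Z f g \<longleftrightarrow> f \<in> Arr C X Y \<and> g \<in> Arr C Y Z \<and>
     nat_exact C (Rep C X) (Rep C Y) (Rep C Z) (push C X Y f) (push C Y Z g)"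

end

theory Submission
  imports Defs
begin

text \<open>
  Fix maps \<open>f : X \<rightarrow> Y\<close> and \<open>g : Y \<rightarrow> Z\<close> for which
  \<open>Hom(-, X) \<rightarrow> Hom(-, Y) \<rightarrow> Hom(-, Z) \<rightarrow> F \<rightarrow> 0\<close> is exact.  All six conditions say that
  \<open>X \<rightarrow> Y \<rightarrow> Z \<rightarrow> 0\<close> is contractible in the stable category: modulo maps factoring through
  projectives, \<open>1 = g s\<close> on \<open>Z\<close> and \<open>1 = f t + s' g\<close> on \<open>Y\<close> (\<open>stably_split\<close>).

  A split epimorphism with a weak kernel is this contraction, read off at identities
  (\<open>stably_exact_iff_stably_split\<close>, \<open>stably_exact_iff_stab\<close>).

  By Yoneda, \<open>(F, G)\<close> and \<open>Ext\<^sup>1(F, G)\<close> vanish iff \<open>0 \<rightarrow> G Z \<rightarrow> G Y \<rightarrow> G X\<close> is exact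
  (\<open>trivial_Hom_Ext_iff_exact_on\<close>).  A functor \<open>G\<close> that vanishes on projectives factors through the
  stable category, so a contraction makes this sequence exact (\<open>stably_split_imp_exact_on\<close>).
  Conversely, add a projective cover of \<open>Z\<close> to \<open>g\<close>, and one of \<open>Y\<close> to \<open>f\<close>, to get epimorphisms \<open>p\<close>
  (\<open>stably_splitI\<close>).  The cokernel \<open>G\<close> of \<open>p\<^sub>*\<close> is finitely presented and vanishes on projectives, and
  exactness at the class of the identity in \<open>G Z\<close>, respectively \<open>G Y\<close>, yields \<open>s\<close>, respectively
  \<open>t\<close> and \<open>s'\<close> (\<open>stably_split_if_exact_on_cokers\<close>).  If \<open>K\<close> is the kernel of \<open>p : V \<rightarrow> W\<close>, the connecting
  map embeds \<open>G\<close> into \<open>Ext\<^sup>1(-, K)\<close> as the kernel of \<open>Ext\<^sup>1(-, K) \<rightarrow> Ext\<^sup>1(-, V)\<close>, so exactness on the functors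
  \<open>Ext\<^sup>1(-, K)\<close> and \<open>Ext\<^sup>1(-, V)\<close> suffices (\<open>stably_split_if_exact_on_ExtA\<close>).

  For \<open>fp\<^sub>!\<close>, call the trace of a functor the subfunctor of the elements that come from projective
  objects.  Then \<open>F\<^sup>0\<close> is the quotient of \<open>F\<close> by its trace, and \<open>F\<^sup>0 = 0 = L\<^sub>1((-)\<^sup>0)(F)\<close> says that a
  projective resolution of \<open>F\<close> stays exact in degrees 0 and 1 after dividing by traces
  (\<open>stably_exact\<close>, \<open>fp_shriek_iff_stably_exact\<close>).  Kernels, cokernels and epimorphisms of finitely
  presented functors are pointwise (locale \<open>functor_subcat\<close>), which identifies the categorical
  resolutions and homology objects with pointwise ones.  Comparing resolutions by chain maps and a
  homotopy shows that this exactness depends on \<open>F\<close> only (\<open>stably_exact_transfer\<close>).  The trace of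
  \<open>Hom(-, Z)\<close> consists of the maps factoring through projectives, so for the representables above one
  gets back the contraction.

  Most lifting statements have the form \<open>g u = g v \<Longrightarrow> u = f w + v\<close>, which keeps inverses out of the
  computations.
\<close>

section \<open>Commutative groups\<close>

lemma (in comm_group) rcos_eq_iff:
  assumes "subgroup N G" "x \<in> carrier G" "y \<in> carrier G"
  shows "N #> x = N #> y \<longleftrightarrow> (\<exists>n\<in>N. x = n \<otimes> y)"
proof
  assume "N #> x = N #> y"
  moreover have "x \<in> N #> x" by (simp add: assms rcos_self)
  ultimately show "\<exists>n\<in>N. x = n \<otimes> y" by (auto simp: r_coset_def)
next
  assume "\<exists>n\<in>N. x = n \<otimes> y"
  then have "x \<in> N #> y" by (auto simp: r_coset_def)
  then show "N #> x = N #> y" by (metis assms repr_independence)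
qed

lemma (in comm_group) rcos_eq_subgroup_iff:
  assumes "subgroup N G" "x \<in> carrier G"
  shows "N #> x = N \<longleftrightarrow> x \<in> N"
  using assms coset_join1 coset_join2 subgroup.subset subgroup.mem_carrier by metis

lemma (in comm_group) trivial_quotient_iff:
  assumes "subgroup N G"
  shows "trivial_group (G Mod N) \<longleftrightarrow> carrier G \<subseteq> N"
proof -
  have "group (G Mod N)"
    by (simp add: assms normal.factorgroup_is_group subgroup_imp_normal)
  then have "trivial_group (G Mod N) \<longleftrightarrow> carrier (G Mod N) \<subseteq> {N}"
    by (simp add: group.trivial_group_subset)
  also have "\<dots> \<longleftrightarrow> carrier G \<subseteq> N"
    using rcos_eq_subgroup_iff[OF assms] by (auto simp: carrier_FactGroup image_subset_iff)
  finally show ?thesis .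
qed

lemma (in comm_group) rcos_mult:
  assumes "subgroup N G" "x \<in> carrier G" "y \<in> carrier G"
  shows "(N #> x) <#> (N #> y) = N #> (x \<otimes> y)"
  using assms by (simp add: normal.rcos_sum subgroup_imp_normal)

lemma comm_subgroup:
  assumes "comm_group G" "subgroup H G" shows "comm_group (G\<lparr>carrier := H\<rparr>)"
proof -
  interpret comm_group G by fact
  interpret H: group "G\<lparr>carrier := H\<rparr>" by (rule subgroup.subgroup_is_group[OF assms(2)]) (rule is_group)
  show ?thesis
    by (rule H.group_comm_groupI) (use subgroup.mem_carrier[OF assms(2)] m_comm in auto)
qed

text \<open>Fibres of a homomorphism are cosets of its kernel.\<close>

lemma hom_eqD:
  assumes "comm_group G" "comm_group H" "\<phi> \<in> hom G H" "x \<in> carrier G" "y \<in> carrier G"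
    and "\<phi> x = \<phi> y"
  shows "\<exists>k\<in>carrier G. \<phi> k = \<one>\<^bsub>H\<^esub> \<and> x = k \<otimes>\<^bsub>G\<^esub> y"
proof -
  interpret G: comm_group G by fact
  interpret H: comm_group H by fact
  interpret h: group_hom G H \<phi>
    using assms by (simp add: group_hom_def group_hom_axioms_def G.is_group H.is_group)
  show ?thesis
    using assms by (intro bexI[of _ "x \<otimes>\<^bsub>G\<^esub> inv\<^bsub>G\<^esub> y"]) (auto simp: G.m_assoc)
qed

lemma kernel_image_subgroup:
  assumes "comm_group G" "comm_group H" "\<phi> \<in> hom G H"
  shows "subgroup (\<phi> ` carrier G) H" "subgroup (kernel G H \<phi>) G"
proof -
  interpret h: group_hom G H \<phi>
    using assms by (simp add: group_hom_def group_hom_axioms_def comm_group_def)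
  show "subgroup (\<phi> ` carrier G) H" "subgroup (kernel G H \<phi>) G"
    by (rule h.img_is_subgroup h.subgroup_kernel)+
qed

section \<open>Preadditive categories\<close>

context preadditive_category
begin

lemma comp_closed [simp]:
  "\<lbrakk>f \<in> Arr C X Y; g \<in> Arr C Y Z; X \<in> Ob C; Y \<in> Ob C; Z \<in> Ob C\<rbrakk> \<Longrightarrow> Comp C X Y Z g f \<in> Arr C X Z"
  using Comp_hom_left[of X Y Z f] by (auto simp: hom_def)

lemma ident_closed [simp]: "X \<in> Ob C \<Longrightarrow> Ident C X \<in> Arr C X X"
  by (rule Ident_closed)

lemma group_Hom [simp]: "\<lbrakk>X \<in> Ob C; Y \<in> Ob C\<rbrakk> \<Longrightarrow> group (Hom C X Y)"
  using Hom_comm_group[of X Y] by (simp add: comm_group_def)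

lemma monoid_Hom [simp]: "\<lbrakk>X \<in> Ob C; Y \<in> Ob C\<rbrakk> \<Longrightarrow> monoid (Hom C X Y)"
  using group_Hom by (simp add: group.is_monoid)

lemma zero_closed [simp]: "\<lbrakk>X \<in> Ob C; Y \<in> Ob C\<rbrakk> \<Longrightarrow> zero_arr C X Y \<in> Arr C X Y"
  by (simp add: monoid.one_closed)

lemma add_closed [simp]:
  "\<lbrakk>f \<in> Arr C X Y; g \<in> Arr C X Y; X \<in> Ob C; Y \<in> Ob C\<rbrakk> \<Longrightarrow> f \<otimes>\<^bsub>Hom C X Y\<^esub> g \<in> Arr C X Y"
  by (simp add: monoid.m_closed)

lemma neg_closed [simp]:
  "\<lbrakk>f \<in> Arr C X Y; X \<in> Ob C; Y \<in> Ob C\<rbrakk> \<Longrightarrow> inv\<^bsub>Hom C X Y\<^esub> f \<in> Arr C X Y"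
  by (simp add: group.inv_closed)

lemma add_assoc:
  "\<lbrakk>X \<in> Ob C; Y \<in> Ob C; f \<in> Arr C X Y; g \<in> Arr C X Y; h \<in> Arr C X Y\<rbrakk>
    \<Longrightarrow> f \<otimes>\<^bsub>Hom C X Y\<^esub> g \<otimes>\<^bsub>Hom C X Y\<^esub> h = f \<otimes>\<^bsub>Hom C X Y\<^esub> (g \<otimes>\<^bsub>Hom C X Y\<^esub> h)"
  by (simp add: monoid.m_assoc)

lemma add_commute:
  "\<lbrakk>X \<in> Ob C; Y \<in> Ob C; f \<in> Arr C X Y; g \<in> Arr C X Y\<rbrakk>
    \<Longrightarrow> f \<otimes>\<^bsub>Hom C X Y\<^esub> g = g \<otimes>\<^bsub>Hom C X Y\<^esub> f"
  using Hom_comm_group[of X Y] by (simp add: comm_group_def comm_monoid.m_comm)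

lemma add_left_commute:
  "\<lbrakk>X \<in> Ob C; Y \<in> Ob C; f \<in> Arr C X Y; g \<in> Arr C X Y; h \<in> Arr C X Y\<rbrakk>
    \<Longrightarrow> f \<otimes>\<^bsub>Hom C X Y\<^esub> (g \<otimes>\<^bsub>Hom C X Y\<^esub> h) = g \<otimes>\<^bsub>Hom C X Y\<^esub> (f \<otimes>\<^bsub>Hom C X Y\<^esub> h)"
  using Hom_comm_group[of X Y] by (simp add: comm_group_def comm_monoid.m_lcomm)

lemmas add_ac = add_assoc add_commute add_left_commute

lemma add_zero [simp]:
  "\<lbrakk>f \<in> Arr C X Y; X \<in> Ob C; Y \<in> Ob C\<rbrakk> \<Longrightarrow> f \<otimes>\<^bsub>Hom C X Y\<^esub> zero_arr C X Y = f"
  "\<lbrakk>f \<in> Arr C X Y; X \<in> Ob C; Y \<in> Ob C\<rbrakk> \<Longrightarrow> zero_arr C X Y \<otimes>\<^bsub>Hom C X Y\<^esub> f = f"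
  by (simp_all add: monoid.r_one monoid.l_one)

lemma add_neg [simp]:
  "\<lbrakk>f \<in> Arr C X Y; X \<in> Ob C; Y \<in> Ob C\<rbrakk> \<Longrightarrow> f \<otimes>\<^bsub>Hom C X Y\<^esub> inv\<^bsub>Hom C X Y\<^esub> f = zero_arr C X Y"
  "\<lbrakk>f \<in> Arr C X Y; X \<in> Ob C; Y \<in> Ob C\<rbrakk> \<Longrightarrow> inv\<^bsub>Hom C X Y\<^esub> f \<otimes>\<^bsub>Hom C X Y\<^esub> f = zero_arr C X Y"
  by (simp_all add: group.r_inv group.l_inv)

lemma comp_add_left:
  "\<lbrakk>f \<in> Arr C X Y; g \<in> Arr C Y Z; g' \<in> Arr C Y Z; X \<in> Ob C; Y \<in> Ob C; Z \<in> Ob C\<rbrakk>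
    \<Longrightarrow> Comp C X Y Z (g \<otimes>\<^bsub>Hom C Y Z\<^esub> g') f = Comp C X Y Z g f \<otimes>\<^bsub>Hom C X Z\<^esub> Comp C X Y Z g' f"
  using Comp_hom_left[of X Y Z f] by (simp add: hom_def)

lemma comp_add_right:
  "\<lbrakk>g \<in> Arr C Y Z; f \<in> Arr C X Y; f' \<in> Arr C X Y; X \<in> Ob C; Y \<in> Ob C; Z \<in> Ob C\<rbrakk>
    \<Longrightarrow> Comp C X Y Z g (f \<otimes>\<^bsub>Hom C X Y\<^esub> f') = Comp C X Y Z g f \<otimes>\<^bsub>Hom C X Z\<^esub> Comp C X Y Z g f'"
  using Comp_hom_right[of X Y Z g] by (simp add: hom_def)

lemma comp_zero [simp]:
  "\<lbrakk>f \<in> Arr C X Y; X \<in> Ob C; Y \<in> Ob C; Z \<in> Ob C\<rbrakk> \<Longrightarrow> Comp C X Y Z (zero_arr C Y Z) f = zero_arr C X Z"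
  "\<lbrakk>g \<in> Arr C Y Z; X \<in> Ob C; Y \<in> Ob C; Z \<in> Ob C\<rbrakk> \<Longrightarrow> Comp C X Y Z g (zero_arr C X Y) = zero_arr C X Z"
  using hom_one[OF Comp_hom_left] hom_one[OF Comp_hom_right] by simp_all

lemma comp_neg_left:
  "\<lbrakk>f \<in> Arr C X Y; g \<in> Arr C Y Z; X \<in> Ob C; Y \<in> Ob C; Z \<in> Ob C\<rbrakk>
    \<Longrightarrow> Comp C X Y Z (inv\<^bsub>Hom C Y Z\<^esub> g) f = inv\<^bsub>Hom C X Z\<^esub> Comp C X Y Z g f"
  using group_hom.hom_inv[of "Hom C Y Z" "Hom C X Z" "\<lambda>g. Comp C X Y Z g f" g] Comp_hom_left[of X Y Z f]
  by (simp add: group_hom_def group_hom_axioms_def)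

lemma comp_neg_right:
  "\<lbrakk>f \<in> Arr C X Y; g \<in> Arr C Y Z; X \<in> Ob C; Y \<in> Ob C; Z \<in> Ob C\<rbrakk>
    \<Longrightarrow> Comp C X Y Z g (inv\<^bsub>Hom C X Y\<^esub> f) = inv\<^bsub>Hom C X Z\<^esub> Comp C X Y Z g f"
  using group_hom.hom_inv[of "Hom C X Y" "Hom C X Z" "\<lambda>f. Comp C X Y Z g f" f] Comp_hom_right[of X Y Z g]
  by (simp add: group_hom_def group_hom_axioms_def)

lemma comp_ident [simp]:
  "\<lbrakk>f \<in> Arr C X Y; X \<in> Ob C; Y \<in> Ob C\<rbrakk> \<Longrightarrow> Comp C X Y Y (Ident C Y) f = f"
  "\<lbrakk>f \<in> Arr C X Y; X \<in> Ob C; Y \<in> Ob C\<rbrakk> \<Longrightarrow> Comp C X X Y f (Ident C X) = f"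
  by (simp_all add: Comp_Ident_left Comp_Ident_right)

section \<open>Additive functors\<close>

lemma comm_group_Fob:
  "\<lbrakk>additive_functor C F; X \<in> Ob C\<rbrakk> \<Longrightarrow> comm_group (Fob F X)"
  by (simp add: additive_functor_def)

lemma group_Fob [simp]: "\<lbrakk>additive_functor C F; X \<in> Ob C\<rbrakk> \<Longrightarrow> group (Fob F X)"
  using comm_group_Fob[of F X] by (simp add: comm_group_def)

lemma monoid_Fob [simp]: "\<lbrakk>additive_functor C F; X \<in> Ob C\<rbrakk> \<Longrightarrow> monoid (Fob F X)"
  by (simp add: group.is_monoid)

lemma Fob_closed [simp]:
  "\<lbrakk>additive_functor C F; X \<in> Ob C\<rbrakk> \<Longrightarrow> \<one>\<^bsub>Fob F X\<^esub> \<in> carrier (Fob F X)"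
  "\<lbrakk>x \<in> carrier (Fob F X); y \<in> carrier (Fob F X); additive_functor C F; X \<in> Ob C\<rbrakk>
    \<Longrightarrow> x \<otimes>\<^bsub>Fob F X\<^esub> y \<in> carrier (Fob F X)"
  "\<lbrakk>x \<in> carrier (Fob F X); additive_functor C F; X \<in> Ob C\<rbrakk> \<Longrightarrow> inv\<^bsub>Fob F X\<^esub> x \<in> carrier (Fob F X)"
  by (simp_all add: monoid.one_closed monoid.m_closed group.inv_closed)

lemma Fob_simps [simp]:
  "\<lbrakk>x \<in> carrier (Fob F X); additive_functor C F; X \<in> Ob C\<rbrakk> \<Longrightarrow> x \<otimes>\<^bsub>Fob F X\<^esub> \<one>\<^bsub>Fob F X\<^esub> = x"
  "\<lbrakk>x \<in> carrier (Fob F X); additive_functor C F; X \<in> Ob C\<rbrakk> \<Longrightarrow> \<one>\<^bsub>Fob F X\<^esub> \<otimes>\<^bsub>Fob F X\<^esub> x = x"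
  "\<lbrakk>x \<in> carrier (Fob F X); additive_functor C F; X \<in> Ob C\<rbrakk>
    \<Longrightarrow> x \<otimes>\<^bsub>Fob F X\<^esub> inv\<^bsub>Fob F X\<^esub> x = \<one>\<^bsub>Fob F X\<^esub>"
  "\<lbrakk>x \<in> carrier (Fob F X); additive_functor C F; X \<in> Ob C\<rbrakk>
    \<Longrightarrow> inv\<^bsub>Fob F X\<^esub> x \<otimes>\<^bsub>Fob F X\<^esub> x = \<one>\<^bsub>Fob F X\<^esub>"
  by (simp_all add: monoid.r_one monoid.l_one group.r_inv group.l_inv)

lemma Fob_ac:
  "\<lbrakk>additive_functor C F; X \<in> Ob C; x \<in> carrier (Fob F X); y \<in> carrier (Fob F X); z \<in> carrier (Fob F X)\<rbrakk>
    \<Longrightarrow> x \<otimes>\<^bsub>Fob F X\<^esub> y \<otimes>\<^bsub>Fob F X\<^esub> z = x \<otimes>\<^bsub>Fob F X\<^esub> (y \<otimes>\<^bsub>Fob F X\<^esub> z)"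
  "\<lbrakk>additive_functor C F; X \<in> Ob C; x \<in> carrier (Fob F X); y \<in> carrier (Fob F X)\<rbrakk>
    \<Longrightarrow> x \<otimes>\<^bsub>Fob F X\<^esub> y = y \<otimes>\<^bsub>Fob F X\<^esub> x"
  "\<lbrakk>additive_functor C F; X \<in> Ob C; x \<in> carrier (Fob F X); y \<in> carrier (Fob F X); z \<in> carrier (Fob F X)\<rbrakk>
    \<Longrightarrow> x \<otimes>\<^bsub>Fob F X\<^esub> (y \<otimes>\<^bsub>Fob F X\<^esub> z) = y \<otimes>\<^bsub>Fob F X\<^esub> (x \<otimes>\<^bsub>Fob F X\<^esub> z)"
  using comm_group_Fob[of F X]
  by (simp_all add: comm_group_def comm_monoid.m_comm comm_monoid.m_lcomm monoid.m_assoc)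

lemma Fmap_hom:
  "\<lbrakk>additive_functor C F; f \<in> Arr C X Y; X \<in> Ob C; Y \<in> Ob C\<rbrakk> \<Longrightarrow> Fmap F X Y f \<in> hom (Fob F Y) (Fob F X)"
  by (simp add: additive_functor_def)

lemma Fmap_closed [simp]:
  "\<lbrakk>f \<in> Arr C X Y; y \<in> carrier (Fob F Y); additive_functor C F; X \<in> Ob C; Y \<in> Ob C\<rbrakk>
    \<Longrightarrow> Fmap F X Y f y \<in> carrier (Fob F X)"
  using Fmap_hom[of F f X Y] by (auto simp: hom_def)

lemma Fmap_mult:
  "\<lbrakk>f \<in> Arr C X Y; y \<in> carrier (Fob F Y); z \<in> carrier (Fob F Y); additive_functor C F; X \<in> Ob C; Y \<in> Ob C\<rbrakk>
    \<Longrightarrow> Fmap F X Y f (y \<otimes>\<^bsub>Fob F Y\<^esub> z) = Fmap F X Y f y \<otimes>\<^bsub>Fob F X\<^esub> Fmap F X Y f z"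
  using Fmap_hom[of F f X Y] by (auto simp: hom_def)

lemma Fmap_one [simp]:
  "\<lbrakk>f \<in> Arr C X Y; additive_functor C F; X \<in> Ob C; Y \<in> Ob C\<rbrakk>
    \<Longrightarrow> Fmap F X Y f \<one>\<^bsub>Fob F Y\<^esub> = \<one>\<^bsub>Fob F X\<^esub>"
  by (rule hom_one[OF Fmap_hom]) auto

lemma Fmap_ident [simp]:
  "\<lbrakk>x \<in> carrier (Fob F X); additive_functor C F; X \<in> Ob C\<rbrakk> \<Longrightarrow> Fmap F X X (Ident C X) x = x"
  by (simp add: additive_functor_def)

lemma Fmap_comp:
  "\<lbrakk>additive_functor C F; X \<in> Ob C; Y \<in> Ob C; Z \<in> Ob C; f \<in> Arr C X Y; g \<in> Arr C Y Z; z \<in> carrier (Fob F Z)\<rbrakk>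
    \<Longrightarrow> Fmap F X Z (Comp C X Y Z g f) z = Fmap F X Y f (Fmap F Y Z g z)"
  by (simp add: additive_functor_def)

lemma Fmap_add:
  "\<lbrakk>additive_functor C F; X \<in> Ob C; Y \<in> Ob C; f \<in> Arr C X Y; g \<in> Arr C X Y; y \<in> carrier (Fob F Y)\<rbrakk>
    \<Longrightarrow> Fmap F X Y (f \<otimes>\<^bsub>Hom C X Y\<^esub> g) y = Fmap F X Y f y \<otimes>\<^bsub>Fob F X\<^esub> Fmap F X Y g y"
  by (simp add: additive_functor_def)

lemma Fmap_zero [simp]:
  assumes "additive_functor C F" "X \<in> Ob C" "Y \<in> Ob C" "y \<in> carrier (Fob F Y)"
  shows "Fmap F X Y (zero_arr C X Y) y = \<one>\<^bsub>Fob F X\<^esub>"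
proof -
  let ?z = "Fmap F X Y (zero_arr C X Y) y"
  have "?z \<otimes>\<^bsub>Fob F X\<^esub> ?z = ?z"
    using Fmap_add[of F X Y "zero_arr C X Y" "zero_arr C X Y" y] assms by simp
  then show ?thesis
    using assms group.l_cancel_one[of "Fob F X" ?z ?z] by simp
qed

lemma additive_Rep [simp]:
  assumes "Z \<in> Ob C" shows "additive_functor C (Rep C Z)"
  using assms Hom_comm_group Comp_hom_left
  by (auto simp: additive_functor_def Rep_def Comp_assoc comp_add_right)

lemma Rep_simps [simp]:
  "Fob (Rep C Z) X = Hom C X Z" "Fmap (Rep C Z) X Y f h = Comp C X Y Z h f"
  by (simp_all add: Rep_def)

end

section \<open>Natural transformations\<close>

text \<open>The condition on the elements of \<^const>\<open>NatTr\<close> without extensionality, so that natural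
  transformations can be written down pointwise.\<close>

definition natural ::
    "('o, 'm) precat \<Rightarrow> ('o, 'm, 'a) abfun \<Rightarrow> ('o, 'm, 'b) abfun \<Rightarrow> ('o \<Rightarrow> 'a \<Rightarrow> 'b) \<Rightarrow> bool" where
  "natural A F G \<alpha> \<longleftrightarrow> (\<forall>X\<in>Ob A. \<alpha> X \<in> hom (Fob F X) (Fob G X)) \<and>
     (\<forall>X\<in>Ob A. \<forall>Y\<in>Ob A. \<forall>f\<in>Arr A X Y. \<forall>y\<in>carrier (Fob F Y).
        \<alpha> X (Fmap F X Y f y) = Fmap G X Y f (\<alpha> Y y))"

definition restrict_nat :: "('o, 'm) precat \<Rightarrow> ('o, 'm, 'a) abfun \<Rightarrow> ('o \<Rightarrow> 'a \<Rightarrow> 'b) \<Rightarrow> 'o \<Rightarrow> 'a \<Rightarrow> 'b" where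
  "restrict_nat A F \<alpha> = (\<lambda>X\<in>Ob A. \<lambda>x\<in>carrier (Fob F X). \<alpha> X x)"

lemma restrict_nat_apply [simp]: "\<lbrakk>X \<in> Ob A; x \<in> carrier (Fob F X)\<rbrakk> \<Longrightarrow> restrict_nat A F \<alpha> X x = \<alpha> X x"
  by (simp add: restrict_nat_def)

context preadditive_category
begin

lemma natural_closed [simp]:
  "\<lbrakk>natural C F G \<alpha>; x \<in> carrier (Fob F X); X \<in> Ob C\<rbrakk> \<Longrightarrow> \<alpha> X x \<in> carrier (Fob G X)"
  by (auto simp: natural_def hom_def)

lemma natural_hom: "\<lbrakk>natural C F G \<alpha>; X \<in> Ob C\<rbrakk> \<Longrightarrow> \<alpha> X \<in> hom (Fob F X) (Fob G X)"
  by (auto simp: natural_def)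

lemma natural_mult:
  "\<lbrakk>natural C F G \<alpha>; x \<in> carrier (Fob F X); y \<in> carrier (Fob F X); X \<in> Ob C\<rbrakk>
    \<Longrightarrow> \<alpha> X (x \<otimes>\<^bsub>Fob F X\<^esub> y) = \<alpha> X x \<otimes>\<^bsub>Fob G X\<^esub> \<alpha> X y"
  by (auto simp: natural_def hom_def)

lemma natural_Fmap:
  "\<lbrakk>natural C F G \<alpha>; f \<in> Arr C X Y; y \<in> carrier (Fob F Y); X \<in> Ob C; Y \<in> Ob C\<rbrakk>
    \<Longrightarrow> \<alpha> X (Fmap F X Y f y) = Fmap G X Y f (\<alpha> Y y)"
  by (auto simp: natural_def)

lemma natural_one:
  "\<lbrakk>natural C F G \<alpha>; additive_functor C F; additive_functor C G; X \<in> Ob C\<rbrakk>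
    \<Longrightarrow> \<alpha> X \<one>\<^bsub>Fob F X\<^esub> = \<one>\<^bsub>Fob G X\<^esub>"
  by (rule hom_one[OF natural_hom]) auto

lemma natural_inv:
  "\<lbrakk>natural C F G \<alpha>; x \<in> carrier (Fob F X); additive_functor C F; additive_functor C G; X \<in> Ob C\<rbrakk>
    \<Longrightarrow> \<alpha> X (inv\<^bsub>Fob F X\<^esub> x) = inv\<^bsub>Fob G X\<^esub> \<alpha> X x"
  using group_hom.hom_inv[of "Fob F X" "Fob G X" "\<alpha> X" x] natural_hom[of F G \<alpha> X]
  by (simp add: group_hom_def group_hom_axioms_def)

lemma natural_compose:
  "\<lbrakk>natural C F G \<alpha>; natural C G H \<beta>\<rbrakk> \<Longrightarrow> natural C F H (\<lambda>X x. \<beta> X (\<alpha> X x))"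
  by (auto simp: natural_def hom_def Pi_iff)

lemma natural_id: "additive_functor C F \<Longrightarrow> natural C F F (\<lambda>X x. x)"
  by (auto simp: natural_def hom_def)

lemma natural_zero:
  "\<lbrakk>additive_functor C F; additive_functor C G\<rbrakk> \<Longrightarrow> natural C F G (\<lambda>X x. \<one>\<^bsub>Fob G X\<^esub>)"
  by (auto simp: natural_def hom_def)

lemma natural_div:
  assumes "natural C F G \<alpha>" "natural C F G \<beta>" "additive_functor C F" "additive_functor C G"
  shows "natural C F G (\<lambda>X x. \<alpha> X x \<otimes>\<^bsub>Fob G X\<^esub> inv\<^bsub>Fob G X\<^esub> \<beta> X x)"
proof -
  have eq: "inv\<^bsub>Fob G X\<^esub> (x \<otimes>\<^bsub>Fob G X\<^esub> y) = inv\<^bsub>Fob G X\<^esub> x \<otimes>\<^bsub>Fob G X\<^esub> inv\<^bsub>Fob G X\<^esub> y"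
    if "X \<in> Ob C" "x \<in> carrier (Fob G X)" "y \<in> carrier (Fob G X)" for X x y
    using comm_group.inv_mult[OF comm_group_Fob[OF assms(4)]] that by simp
  have Finv: "Fmap G X Y f (inv\<^bsub>Fob G Y\<^esub> y) = inv\<^bsub>Fob G X\<^esub> Fmap G X Y f y"
    if "X \<in> Ob C" "Y \<in> Ob C" "f \<in> Arr C X Y" "y \<in> carrier (Fob G Y)" for X Y f y
    using group_hom.hom_inv[of "Fob G Y" "Fob G X" "Fmap G X Y f" y] Fmap_hom[of G f X Y] that assms
    by (simp add: group_hom_def group_hom_axioms_def)
  show ?thesis
    unfolding natural_def[of _ _ _ "\<lambda>X x. \<alpha> X x \<otimes>\<^bsub>Fob G X\<^esub> inv\<^bsub>Fob G X\<^esub> \<beta> X x"] hom_def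
    using assms by (auto simp: natural_mult eq Fob_ac Finv Fmap_mult natural_Fmap)
qed

lemma NatTr_carrier_iff:
  "\<theta> \<in> carrier (NatTr C F G) \<longleftrightarrow> natural C F G \<theta> \<and> \<theta> = restrict_nat C F \<theta>"
proof
  assume "\<theta> \<in> carrier (NatTr C F G)"
  then show "natural C F G \<theta> \<and> \<theta> = restrict_nat C F \<theta>"
    by (auto simp: NatTr_def natural_def restrict_nat_def PiE_iff extensional_def fun_eq_iff)
next
  assume *: "natural C F G \<theta> \<and> \<theta> = restrict_nat C F \<theta>"
  have "restrict_nat C F \<theta> \<in> extensional (Ob C)" "\<And>X. X \<in> Ob C \<Longrightarrow> restrict_nat C F \<theta> X \<in> extensional (carrier (Fob F X))"
    by (auto simp: restrict_nat_def)
  then have "\<theta> \<in> extensional (Ob C)" "\<And>X. X \<in> Ob C \<Longrightarrow> \<theta> X \<in> extensional (carrier (Fob F X))"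
    by (simp_all flip: conjunct2[OF *])
  then show "\<theta> \<in> carrier (NatTr C F G)"
    using conjunct1[OF *] by (auto simp: NatTr_def natural_def PiE_iff)
qed

lemma natural_NatTr: "\<theta> \<in> carrier (NatTr C F G) \<Longrightarrow> natural C F G \<theta>"
  by (simp add: NatTr_carrier_iff)

lemma natural_cong:
  assumes "natural C F G \<alpha>" "additive_functor C F"
    "\<And>X x. \<lbrakk>X \<in> Ob C; x \<in> carrier (Fob F X)\<rbrakk> \<Longrightarrow> \<beta> X x = \<alpha> X x"
  shows "natural C F G \<beta>"
proof -
  have "\<beta> X \<in> hom (Fob F X) (Fob G X)" if "X \<in> Ob C" for X
    using assms that by (auto simp: hom_def natural_mult)
  moreover have "\<beta> X (Fmap F X Y f y) = Fmap G X Y f (\<beta> Y y)"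
    if "X \<in> Ob C" "Y \<in> Ob C" "f \<in> Arr C X Y" "y \<in> carrier (Fob F Y)" for X Y f y
    using assms that by (simp add: natural_Fmap)
  ultimately show ?thesis by (simp add: natural_def)
qed

lemma ext_in_NatTr [simp]:
  assumes "natural C F G \<alpha>" "additive_functor C F"
  shows "restrict_nat C F \<alpha> \<in> carrier (NatTr C F G)"
  unfolding NatTr_carrier_iff
  using natural_cong[OF assms, of "restrict_nat C F \<alpha>"] by (auto simp: restrict_nat_def fun_eq_iff)

lemma NatTr_eqI:
  assumes "\<theta> \<in> carrier (NatTr C F G)" "\<theta>' \<in> carrier (NatTr C F H)"
    "\<And>X x. \<lbrakk>X \<in> Ob C; x \<in> carrier (Fob F X)\<rbrakk> \<Longrightarrow> \<theta> X x = \<theta>' X x"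
  shows "\<theta> = \<theta>'"
proof -
  have "\<theta> = restrict_nat C F \<theta>" "\<theta>' = restrict_nat C F \<theta>'" using assms by (auto simp: NatTr_carrier_iff)
  moreover have "restrict_nat C F \<theta> = restrict_nat C F \<theta>'" using assms(3) by (auto simp: restrict_nat_def fun_eq_iff)
  ultimately show ?thesis by simp
qed

lemma NatTr_simps:
  "\<one>\<^bsub>NatTr C F G\<^esub> = restrict_nat C F (\<lambda>X x. \<one>\<^bsub>Fob G X\<^esub>)"
  "\<alpha> \<otimes>\<^bsub>NatTr C F G\<^esub> \<beta> = restrict_nat C F (\<lambda>X x. \<alpha> X x \<otimes>\<^bsub>Fob G X\<^esub> \<beta> X x)"
  "nat_comp C F \<gamma> \<alpha> = restrict_nat C F (\<lambda>X x. \<gamma> X (\<alpha> X x))"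
  "nat_ident C F = restrict_nat C F (\<lambda>X x. x)"
  by (simp_all add: NatTr_def restrict_nat_def nat_comp_def nat_ident_def)

lemma natural_times:
  assumes "natural C F G \<alpha>" "natural C F G \<beta>" "additive_functor C G"
  shows "natural C F G (\<lambda>X x. \<alpha> X x \<otimes>\<^bsub>Fob G X\<^esub> \<beta> X x)"
  unfolding natural_def hom_def using assms
  by (auto simp: natural_mult Fob_ac Fmap_mult natural_Fmap)

lemma comm_group_NatTr:
  assumes "additive_functor C F" "additive_functor C G"
  shows "comm_group (NatTr C F G)"
proof (rule comm_groupI)
  fix \<alpha> \<beta> \<gamma> assume \<alpha>: "\<alpha> \<in> carrier (NatTr C F G)" and \<beta>: "\<beta> \<in> carrier (NatTr C F G)"
    and \<gamma>: "\<gamma> \<in> carrier (NatTr C F G)"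
  note nat = \<alpha>[THEN natural_NatTr] \<beta>[THEN natural_NatTr] \<gamma>[THEN natural_NatTr]
  show "\<alpha> \<otimes>\<^bsub>NatTr C F G\<^esub> \<beta> \<in> carrier (NatTr C F G)"
    using nat assms by (simp add: NatTr_simps natural_times)
  show "\<alpha> \<otimes>\<^bsub>NatTr C F G\<^esub> \<beta> \<otimes>\<^bsub>NatTr C F G\<^esub> \<gamma> = \<alpha> \<otimes>\<^bsub>NatTr C F G\<^esub> (\<beta> \<otimes>\<^bsub>NatTr C F G\<^esub> \<gamma>)"
    using nat assms by (auto simp: NatTr_simps restrict_nat_def Fob_ac fun_eq_iff)
  show "\<alpha> \<otimes>\<^bsub>NatTr C F G\<^esub> \<beta> = \<beta> \<otimes>\<^bsub>NatTr C F G\<^esub> \<alpha>"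
    using nat assms by (auto simp: NatTr_simps restrict_nat_def Fob_ac fun_eq_iff)
next
  show one: "\<one>\<^bsub>NatTr C F G\<^esub> \<in> carrier (NatTr C F G)"
    using assms by (simp add: NatTr_simps natural_zero)
  fix \<alpha> assume \<alpha>: "\<alpha> \<in> carrier (NatTr C F G)"
  note nat = \<alpha>[THEN natural_NatTr]
  have "natural C F G (\<lambda>X x. \<one>\<^bsub>Fob G X\<^esub> \<otimes>\<^bsub>Fob G X\<^esub> \<alpha> X x)"
    by (rule natural_cong[OF nat]) (use assms nat in auto)
  then show "\<one>\<^bsub>NatTr C F G\<^esub> \<otimes>\<^bsub>NatTr C F G\<^esub> \<alpha> = \<alpha>"
    using \<alpha> nat assms
    by (intro NatTr_eqI[of _ F G _ G]) (auto simp: NatTr_simps intro!: ext_in_NatTr natural_times natural_cong[OF natural_zero])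
  let ?i = "restrict_nat C F (\<lambda>X x. inv\<^bsub>Fob G X\<^esub> \<alpha> X x)"
  have "natural C F G (\<lambda>X x. inv\<^bsub>Fob G X\<^esub> \<alpha> X x)"
    by (rule natural_cong[OF natural_div[OF natural_zero nat]]) (use assms nat in auto)
  then have "?i \<in> carrier (NatTr C F G)" using assms by simp
  moreover have "?i \<otimes>\<^bsub>NatTr C F G\<^esub> \<alpha> = \<one>\<^bsub>NatTr C F G\<^esub>"
    using nat assms by (auto simp: NatTr_simps restrict_nat_def fun_eq_iff)
  ultimately show "\<exists>y\<in>carrier (NatTr C F G). y \<otimes>\<^bsub>NatTr C F G\<^esub> \<alpha> = \<one>\<^bsub>NatTr C F G\<^esub>" by blast
qed

section \<open>Yoneda\<close>

definition yon :: "('o, 'm, 'v) abfun \<Rightarrow> 'o \<Rightarrow> 'v \<Rightarrow> 'o \<Rightarrow> 'm \<Rightarrow> 'v" where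
  "yon G Z x = (\<lambda>X h. Fmap G X Z h x)"

lemma natural_yon:
  "\<lbrakk>additive_functor C G; Z \<in> Ob C; x \<in> carrier (Fob G Z)\<rbrakk> \<Longrightarrow> natural C (Rep C Z) G (yon G Z x)"
  by (auto simp: natural_def yon_def hom_def Fmap_add Fmap_comp)

lemma yoneda:
  assumes "natural C (Rep C Z) G \<alpha>" "X \<in> Ob C" "Z \<in> Ob C" "h \<in> Arr C X Z"
  shows "\<alpha> X h = Fmap G X Z h (\<alpha> Z (Ident C Z))"
  using natural_Fmap[OF assms(1,4), of "Ident C Z"] assms by simp

lemma natural_comp_left:
  "\<lbrakk>Y \<in> Ob C; Z \<in> Ob C; f \<in> Arr C Y Z\<rbrakk> \<Longrightarrow> natural C (Rep C Y) (Rep C Z) (\<lambda>X h. Comp C X Y Z f h)"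
  using natural_yon[of "Rep C Z" Y f] by (simp add: yon_def)

lemma push_ext: "push C Y Z f = restrict_nat C (Rep C Y) (\<lambda>X h. Comp C X Y Z f h)"
  by (simp add: push_def restrict_nat_def)

lemma push_apply [simp]: "\<lbrakk>X \<in> Ob C; h \<in> Arr C X Y\<rbrakk> \<Longrightarrow> push C Y Z f X h = Comp C X Y Z f h"
  by (simp add: push_def)

lemma push_in_NatTr [simp]:
  "\<lbrakk>Y \<in> Ob C; Z \<in> Ob C; f \<in> Arr C Y Z\<rbrakk> \<Longrightarrow> push C Y Z f \<in> carrier (NatTr C (Rep C Y) (Rep C Z))"
  by (simp add: push_ext natural_comp_left)

lemma NatTr_Rep_eq_push:
  assumes "\<alpha> \<in> carrier (NatTr C (Rep C Y) (Rep C Z))" "Y \<in> Ob C" "Z \<in> Ob C"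
  obtains f where "f \<in> Arr C Y Z" "\<alpha> = push C Y Z f"
proof
  have nat: "natural C (Rep C Y) (Rep C Z) \<alpha>" using assms by (simp add: natural_NatTr)
  show *: "\<alpha> Y (Ident C Y) \<in> Arr C Y Z"
    using natural_closed[OF nat, of "Ident C Y" Y] assms by simp
  show "\<alpha> = push C Y Z (\<alpha> Y (Ident C Y))"
  proof (rule NatTr_eqI[OF assms(1) push_in_NatTr])
    fix X h assume "X \<in> Ob C" "h \<in> carrier (Fob (Rep C Y) X)"
    then show "\<alpha> X h = push C Y Z (\<alpha> Y (Ident C Y)) X h"
      using yoneda[OF nat, of X h] assms by simp
  qed (use assms * in simp_all)
qed

section \<open>Pointwise exactness\<close>

lemma nat_exactI:
  assumes "\<And>X z. \<lbrakk>X \<in> Ob C; z \<in> carrier (Fob F X)\<rbrakk> \<Longrightarrow> \<beta> X (\<alpha> X z) = \<one>\<^bsub>Fob H X\<^esub>"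
    "\<And>X x. \<lbrakk>X \<in> Ob C; x \<in> carrier (Fob G X); \<beta> X x = \<one>\<^bsub>Fob H X\<^esub>\<rbrakk> \<Longrightarrow> \<exists>z\<in>carrier (Fob F X). x = \<alpha> X z"
    "natural C F G \<alpha>"
  shows "nat_exact C F G H \<alpha> \<beta>"
  unfolding nat_exact_def kernel_def using assms by (fastforce simp: image_iff)

lemma nat_exact_zero:
  "\<lbrakk>nat_exact C F G H \<alpha> \<beta>; X \<in> Ob C; z \<in> carrier (Fob F X)\<rbrakk> \<Longrightarrow> \<beta> X (\<alpha> X z) = \<one>\<^bsub>Fob H X\<^esub>"
  by (auto simp: nat_exact_def kernel_def)

lemma nat_exactD:
  "\<lbrakk>nat_exact C F G H \<alpha> \<beta>; X \<in> Ob C; x \<in> carrier (Fob G X); \<beta> X x = \<one>\<^bsub>Fob H X\<^esub>\<rbrakk>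
    \<Longrightarrow> \<exists>z\<in>carrier (Fob F X). x = \<alpha> X z"
  by (force simp: nat_exact_def kernel_def)

lemma nat_exact_eqD:
  assumes "nat_exact C F G H \<alpha> \<beta>" "additive_functor C G" "additive_functor C H" "natural C G H \<beta>"
    "X \<in> Ob C" "x \<in> carrier (Fob G X)" "y \<in> carrier (Fob G X)" "\<beta> X x = \<beta> X y"
  shows "\<exists>z\<in>carrier (Fob F X). x = \<alpha> X z \<otimes>\<^bsub>Fob G X\<^esub> y"
proof -
  obtain k where "k \<in> carrier (Fob G X)" "\<beta> X k = \<one>\<^bsub>Fob H X\<^esub>" "x = k \<otimes>\<^bsub>Fob G X\<^esub> y"
    using hom_eqD[OF comm_group_Fob comm_group_Fob natural_hom, of G X H \<beta> x y] assms by auto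
  then show ?thesis using nat_exactD[OF assms(1,5), of k] by auto
qed

text \<open>A retract of a representable functor.  By Yoneda such functors lift against pointwise
  surjections, without any choice at the level of objects.\<close>

definition summand_of_Rep :: "('o, 'm, 'a) abfun \<Rightarrow> bool" where
  "summand_of_Rep P \<longleftrightarrow> (\<exists>Z\<in>Ob C. \<exists>\<pi> \<sigma>. natural C (Rep C Z) P \<pi> \<and> natural C P (Rep C Z) \<sigma> \<and>
     (\<forall>X\<in>Ob C. \<forall>x\<in>carrier (Fob P X). \<pi> X (\<sigma> X x) = x))"

lemma summand_of_Rep_Rep: "Z \<in> Ob C \<Longrightarrow> summand_of_Rep (Rep C Z)"
  unfolding summand_of_Rep_def
  by (intro bexI[of _ Z] exI[of _ "\<lambda>X x. x"]) (simp_all add: natural_id)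

lemma lift_summand:
  assumes "summand_of_Rep P" "additive_functor C M" "additive_functor C N"
    "natural C P N \<alpha>" "natural C M N \<beta>"
    "\<And>X x. \<lbrakk>X \<in> Ob C; x \<in> carrier (Fob P X)\<rbrakk> \<Longrightarrow> \<exists>y\<in>carrier (Fob M X). \<alpha> X x = \<beta> X y"
  obtains \<gamma> where "natural C P M \<gamma>" "\<And>X x. \<lbrakk>X \<in> Ob C; x \<in> carrier (Fob P X)\<rbrakk> \<Longrightarrow> \<beta> X (\<gamma> X x) = \<alpha> X x"
proof -
  obtain Z \<pi> \<sigma> where Z: "Z \<in> Ob C" and \<pi>: "natural C (Rep C Z) P \<pi>" and \<sigma>: "natural C P (Rep C Z) \<sigma>"
    and id: "\<And>X x. \<lbrakk>X \<in> Ob C; x \<in> carrier (Fob P X)\<rbrakk> \<Longrightarrow> \<pi> X (\<sigma> X x) = x"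
    using assms(1) by (auto simp: summand_of_Rep_def)
  let ?u = "\<pi> Z (Ident C Z)"
  have u: "?u \<in> carrier (Fob P Z)" using natural_closed[OF \<pi>, of "Ident C Z" Z] Z by simp
  obtain y where y: "y \<in> carrier (Fob M Z)" "\<alpha> Z ?u = \<beta> Z y" using assms(6)[OF Z u] by auto
  let ?\<gamma> = "\<lambda>X x. yon M Z y X (\<sigma> X x)"
  show ?thesis
  proof
    show "natural C P M ?\<gamma>" by (rule natural_compose[OF \<sigma> natural_yon]) (use assms Z y in auto)
    fix X x assume X: "X \<in> Ob C" and x: "x \<in> carrier (Fob P X)"
    have s: "\<sigma> X x \<in> Arr C X Z" using natural_closed[OF \<sigma> x X] by simp
    have "\<beta> X (?\<gamma> X x) = Fmap N X Z (\<sigma> X x) (\<beta> Z y)"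
      using natural_Fmap[OF assms(5) s y(1)] X Z by (simp add: yon_def)
    also have "\<dots> = \<alpha> X (Fmap P X Z (\<sigma> X x) ?u)"
      using natural_Fmap[OF assms(4) s u] X Z y by simp
    also have "\<dots> = \<alpha> X x" using yoneda[OF \<pi> X Z s] id[OF X x] by simp
    finally show "\<beta> X (?\<gamma> X x) = \<alpha> X x" .
  qed
qed

text \<open>With \<open>\<alpha>\<close> a composite of comparison maps and \<open>\<alpha>'\<close> the identity, \<open>\<gamma>\<close> is a homotopy between them.\<close>

lemma lift_summand_diff:
  assumes "summand_of_Rep P" "additive_functor C P" "additive_functor C M" "additive_functor C N" "additive_functor C H"
    "natural C P N \<alpha>" "natural C P N \<alpha>'" "natural C M N \<beta>" "natural C N H \<delta>" "nat_exact C M N H \<beta> \<delta>"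
    "\<And>X x. \<lbrakk>X \<in> Ob C; x \<in> carrier (Fob P X)\<rbrakk> \<Longrightarrow> \<delta> X (\<alpha> X x) = \<delta> X (\<alpha>' X x)"
  obtains \<gamma> where "natural C P M \<gamma>"
    "\<And>X x. \<lbrakk>X \<in> Ob C; x \<in> carrier (Fob P X)\<rbrakk> \<Longrightarrow> \<alpha> X x = \<beta> X (\<gamma> X x) \<otimes>\<^bsub>Fob N X\<^esub> \<alpha>' X x"
proof -
  let ?d = "\<lambda>X x. \<alpha> X x \<otimes>\<^bsub>Fob N X\<^esub> inv\<^bsub>Fob N X\<^esub> \<alpha>' X x"
  have nd: "natural C P N ?d" using assms by (intro natural_div) auto
  have "\<exists>y\<in>carrier (Fob M X). ?d X x = \<beta> X y" if "X \<in> Ob C" "x \<in> carrier (Fob P X)" for X x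
    using that assms by (intro nat_exactD[OF assms(10)]) (auto simp: natural_mult natural_inv)
  then obtain \<gamma> where \<gamma>: "natural C P M \<gamma>"
    "\<And>X x. \<lbrakk>X \<in> Ob C; x \<in> carrier (Fob P X)\<rbrakk> \<Longrightarrow> \<beta> X (\<gamma> X x) = ?d X x"
    using lift_summand[OF assms(1,3,4) nd assms(8)] by blast
  show ?thesis
    by (rule that[OF \<gamma>(1)]) (use assms \<gamma>(2) in \<open>auto simp: Fob_ac\<close>)
qed

end

section \<open>Subfunctors and quotient functors\<close>

lemma comm_group_image:
  assumes "comm_group G" "\<kappa> ` carrier G = carrier H" "\<kappa> \<one>\<^bsub>G\<^esub> = \<one>\<^bsub>H\<^esub>"
    and mult: "\<And>x y. \<lbrakk>x \<in> carrier G; y \<in> carrier G\<rbrakk> \<Longrightarrow> \<kappa> (x \<otimes>\<^bsub>G\<^esub> y) = \<kappa> x \<otimes>\<^bsub>H\<^esub> \<kappa> y"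
  shows "comm_group H"
proof -
  interpret G: comm_group G by fact
  have im: "\<exists>x\<in>carrier G. a = \<kappa> x" if "a \<in> carrier H" for a using that assms(2) by auto
  have cl: "\<kappa> x \<in> carrier H" if "x \<in> carrier G" for x using that assms(2) by auto
  show ?thesis
  proof (rule comm_groupI)
    fix a b c assume abc: "a \<in> carrier H" "b \<in> carrier H" "c \<in> carrier H"
    obtain x y z where xyz: "x \<in> carrier G" "y \<in> carrier G" "z \<in> carrier G"
      and eq: "a = \<kappa> x" "b = \<kappa> y" "c = \<kappa> z"
      using im[OF abc(1)] im[OF abc(2)] im[OF abc(3)] by auto
    show "a \<otimes>\<^bsub>H\<^esub> b \<in> carrier H"
      unfolding eq mult[OF xyz(1,2), symmetric] by (rule cl) (simp add: xyz)
    show "a \<otimes>\<^bsub>H\<^esub> b \<otimes>\<^bsub>H\<^esub> c = a \<otimes>\<^bsub>H\<^esub> (b \<otimes>\<^bsub>H\<^esub> c)"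
      using xyz mult[of "x \<otimes>\<^bsub>G\<^esub> y" z] mult[of x "y \<otimes>\<^bsub>G\<^esub> z"] by (simp add: eq G.m_assoc mult)
    show "a \<otimes>\<^bsub>H\<^esub> b = b \<otimes>\<^bsub>H\<^esub> a"
      using xyz mult[of x y] mult[of y x] by (simp add: eq G.m_comm)
  next
    show "\<one>\<^bsub>H\<^esub> \<in> carrier H" using cl[of "\<one>\<^bsub>G\<^esub>"] assms(3) by simp
  next
    fix a assume "a \<in> carrier H"
    then obtain x where x: "x \<in> carrier G" "a = \<kappa> x" using im[of a] by auto
    then show "\<one>\<^bsub>H\<^esub> \<otimes>\<^bsub>H\<^esub> a = a" using mult[of "\<one>\<^bsub>G\<^esub>" x] assms(3) by simp
    show "\<exists>b\<in>carrier H. b \<otimes>\<^bsub>H\<^esub> a = \<one>\<^bsub>H\<^esub>"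
      using x mult[of "inv\<^bsub>G\<^esub> x" x] assms(3) by (intro bexI[of _ "\<kappa> (inv\<^bsub>G\<^esub> x)"]) (simp_all add: cl)
  qed
qed

definition subfunctor :: "('o, 'm, 'v) abfun \<Rightarrow> ('o \<Rightarrow> 'v set) \<Rightarrow> ('o, 'm, 'v) abfun" where
  "subfunctor F N = \<lparr>Fob = (\<lambda>X. (Fob F X)\<lparr>carrier := N X\<rparr>), Fmap = Fmap F\<rparr>"

lemma subfunctor_simps [simp]:
  "carrier (Fob (subfunctor F N) X) = N X"
  "x \<otimes>\<^bsub>Fob (subfunctor F N) X\<^esub> y = x \<otimes>\<^bsub>Fob F X\<^esub> y"
  "\<one>\<^bsub>Fob (subfunctor F N) X\<^esub> = \<one>\<^bsub>Fob F X\<^esub>"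
  "Fmap (subfunctor F N) = Fmap F"
  by (simp_all add: subfunctor_def)

context preadditive_category
begin

definition subfunctorial :: "('o, 'm, 'v) abfun \<Rightarrow> ('o \<Rightarrow> 'v set) \<Rightarrow> bool" where
  "subfunctorial F N \<longleftrightarrow> (\<forall>X\<in>Ob C. subgroup (N X) (Fob F X)) \<and>
     (\<forall>X\<in>Ob C. \<forall>Y\<in>Ob C. \<forall>f\<in>Arr C X Y. \<forall>y\<in>N Y. Fmap F X Y f y \<in> N X)"

lemma subfunctorialD:
  assumes "subfunctorial F N" "X \<in> Ob C"
  shows "subgroup (N X) (Fob F X)" "\<And>x. x \<in> N X \<Longrightarrow> x \<in> carrier (Fob F X)"
    "\<And>x y. \<lbrakk>x \<in> N X; y \<in> N X\<rbrakk> \<Longrightarrow> x \<otimes>\<^bsub>Fob F X\<^esub> y \<in> N X"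
    "\<And>x. x \<in> N X \<Longrightarrow> inv\<^bsub>Fob F X\<^esub> x \<in> N X"
    "\<one>\<^bsub>Fob F X\<^esub> \<in> N X"
    "\<And>f Y y. \<lbrakk>f \<in> Arr C X Y; Y \<in> Ob C; y \<in> N Y\<rbrakk> \<Longrightarrow> Fmap F X Y f y \<in> N X"
  using assms by (auto simp: subfunctorial_def subgroup_def)

lemma additive_subfunctor:
  assumes "additive_functor C F" "subfunctorial F N"
  shows "additive_functor C (subfunctor F N)"
proof -
  have cg: "comm_group (Fob (subfunctor F N) X)" if "X \<in> Ob C" for X
    using comm_subgroup[OF comm_group_Fob[OF assms(1) that] subfunctorialD(1)[OF assms(2) that]]
    by (simp add: subfunctor_def)
  show ?thesis
    unfolding additive_functor_def
    using assms(1) cg subfunctorialD[OF assms(2)]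
    by (auto simp: hom_def Fmap_mult Fmap_comp Fmap_add)
qed

lemma natural_subfunctor_incl:
  "\<lbrakk>additive_functor C F; subfunctorial F N\<rbrakk> \<Longrightarrow> natural C (subfunctor F N) F (\<lambda>X x. x)"
  using subfunctorialD(2)[of F N] by (auto simp: natural_def hom_def)

lemma natural_into_subfunctor:
  "\<lbrakk>natural C G F \<alpha>; \<And>X x. \<lbrakk>X \<in> Ob C; x \<in> carrier (Fob G X)\<rbrakk> \<Longrightarrow> \<alpha> X x \<in> N X\<rbrakk>
    \<Longrightarrow> natural C G (subfunctor F N) \<alpha>"
  by (auto simp: natural_def hom_def)

lemma subfunctorial_image:
  assumes "additive_functor C F" "additive_functor C G" "natural C F G \<alpha>"
  shows "subfunctorial G (\<lambda>X. \<alpha> X ` carrier (Fob F X))"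
  unfolding subfunctorial_def
  using kernel_image_subgroup(1)[OF comm_group_Fob comm_group_Fob natural_hom] assms
  by (auto simp flip: natural_Fmap)

lemma subfunctorial_kernel:
  assumes "additive_functor C F" "additive_functor C G" "natural C F G \<alpha>"
  shows "subfunctorial F (\<lambda>X. kernel (Fob F X) (Fob G X) (\<alpha> X))"
  unfolding subfunctorial_def
  using kernel_image_subgroup(2)[OF comm_group_Fob comm_group_Fob natural_hom] assms
  by (auto simp: kernel_def natural_Fmap)

text \<open>The quotient of a functor can be realised in every universe into which its values inject:
  a class is represented by the image of one of its elements.\<close>

lemma quotient_functor:
  fixes j :: "'o \<Rightarrow> 'b \<Rightarrow> 'v" and H :: "('o, 'm, 'b) abfun"
  assumes H: "additive_functor C H" and N: "subfunctorial H N"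
    and j: "\<And>X. X \<in> Ob C \<Longrightarrow> inj_on (j X) (carrier (Fob H X))"
  obtains Q :: "('o, 'm, 'v) abfun" and \<pi>
  where "additive_functor C Q" "natural C H Q \<pi>" "nat_surj C H Q \<pi>"
    "\<And>X x. \<lbrakk>X \<in> Ob C; x \<in> carrier (Fob H X)\<rbrakk> \<Longrightarrow> \<pi> X x = \<one>\<^bsub>Fob Q X\<^esub> \<longleftrightarrow> x \<in> N X"
proof -
  define rep where "rep X x = (SOME y. y \<in> N X #>\<^bsub>Fob H X\<^esub> x)" for X x
  define \<pi> where "\<pi> X x = j X (rep X x)" for X x
  have rep: "rep X x \<in> carrier (Fob H X) \<and> N X #>\<^bsub>Fob H X\<^esub> rep X x = N X #>\<^bsub>Fob H X\<^esub> x"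
    if "X \<in> Ob C" "x \<in> carrier (Fob H X)" for X x
  proof -
    interpret G: comm_group "Fob H X" by (rule comm_group_Fob[OF H that(1)])
    have sub: "subgroup (N X) (Fob H X)" using N that by (simp add: subfunctorial_def)
    have "x \<in> N X #>\<^bsub>Fob H X\<^esub> x" using sub that by (simp add: G.rcos_self)
    then have in_coset: "rep X x \<in> N X #>\<^bsub>Fob H X\<^esub> x" unfolding rep_def by (rule someI)
    then show ?thesis
      using sub that G.r_coset_subset_G[OF subgroup.subset[OF sub], of x] G.repr_independence[OF in_coset] by auto
  qed
  have \<pi>_eq: "\<pi> X x = \<pi> X y \<longleftrightarrow> (\<exists>n\<in>N X. x = n \<otimes>\<^bsub>Fob H X\<^esub> y)"
    if "X \<in> Ob C" "x \<in> carrier (Fob H X)" "y \<in> carrier (Fob H X)" for X x y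
  proof -
    interpret G: comm_group "Fob H X" by (rule comm_group_Fob[OF H that(1)])
    have "\<pi> X x = \<pi> X y \<longleftrightarrow> rep X x = rep X y"
      unfolding \<pi>_def using inj_on_eq_iff[OF j] rep that by blast
    also have "\<dots> \<longleftrightarrow> N X #>\<^bsub>Fob H X\<^esub> x = N X #>\<^bsub>Fob H X\<^esub> y"
      using rep that by (metis rep_def)
    also have "\<dots> \<longleftrightarrow> (\<exists>n\<in>N X. x = n \<otimes>\<^bsub>Fob H X\<^esub> y)"
      using N that by (intro G.rcos_eq_iff) (auto simp: subfunctorial_def)
    finally show ?thesis .
  qed
  \<comment> \<open>operations on classes are defined on chosen elements \<open>r\<close> of the classes\<close>
  define r where "r X = inv_into (carrier (Fob H X)) (\<pi> X)" for X
  have r: "\<exists>n\<in>N X. r X (\<pi> X x) = n \<otimes>\<^bsub>Fob H X\<^esub> x" and r_closed: "r X (\<pi> X x) \<in> carrier (Fob H X)"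
    if "X \<in> Ob C" "x \<in> carrier (Fob H X)" for X x
  proof -
    show *: "r X (\<pi> X x) \<in> carrier (Fob H X)"
      using that unfolding r_def by (simp add: inv_into_into)
    have "\<pi> X (r X (\<pi> X x)) = \<pi> X x"
      using that unfolding r_def by (simp add: f_inv_into_f)
    then show "\<exists>n\<in>N X. r X (\<pi> X x) = n \<otimes>\<^bsub>Fob H X\<^esub> x" using \<pi>_eq * that by simp
  qed
  define Q where "Q = \<lparr>Fob = (\<lambda>X. \<lparr>carrier = \<pi> X ` carrier (Fob H X),
      mult = (\<lambda>a b. \<pi> X (r X a \<otimes>\<^bsub>Fob H X\<^esub> r X b)), one = \<pi> X \<one>\<^bsub>Fob H X\<^esub>\<rparr>),
      Fmap = (\<lambda>X Y f a. \<pi> X (Fmap H X Y f (r Y a)))\<rparr>"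
  have car: "carrier (Fob Q X) = \<pi> X ` carrier (Fob H X)" and one: "\<one>\<^bsub>Fob Q X\<^esub> = \<pi> X \<one>\<^bsub>Fob H X\<^esub>" for X
    by (simp_all add: Q_def)
  have mult: "\<pi> X (x \<otimes>\<^bsub>Fob H X\<^esub> y) = \<pi> X x \<otimes>\<^bsub>Fob Q X\<^esub> \<pi> X y"
    if X: "X \<in> Ob C" and x: "x \<in> carrier (Fob H X)" and y: "y \<in> carrier (Fob H X)" for X x y
  proof -
    obtain n m where n: "n \<in> N X" "r X (\<pi> X x) = n \<otimes>\<^bsub>Fob H X\<^esub> x" and m: "m \<in> N X" "r X (\<pi> X y) = m \<otimes>\<^bsub>Fob H X\<^esub> y"
      using r X x y by meson
    have "r X (\<pi> X x) \<otimes>\<^bsub>Fob H X\<^esub> r X (\<pi> X y) = (n \<otimes>\<^bsub>Fob H X\<^esub> m) \<otimes>\<^bsub>Fob H X\<^esub> (x \<otimes>\<^bsub>Fob H X\<^esub> y)"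
      using X x y n m subfunctorialD[OF N X] H by (simp add: Fob_ac)
    then have "\<pi> X (r X (\<pi> X x) \<otimes>\<^bsub>Fob H X\<^esub> r X (\<pi> X y)) = \<pi> X (x \<otimes>\<^bsub>Fob H X\<^esub> y)"
      using X x y n m subfunctorialD[OF N X] H r_closed by (subst \<pi>_eq) auto
    then show ?thesis by (simp add: Q_def)
  qed
  have nat: "Fmap Q X Y f (\<pi> Y y) = \<pi> X (Fmap H X Y f y)"
    if X: "X \<in> Ob C" and Y: "Y \<in> Ob C" and f: "f \<in> Arr C X Y" and y: "y \<in> carrier (Fob H Y)" for X Y f y
  proof -
    obtain n where n: "n \<in> N Y" "r Y (\<pi> Y y) = n \<otimes>\<^bsub>Fob H Y\<^esub> y" using r Y y by meson
    have "Fmap H X Y f (r Y (\<pi> Y y)) = Fmap H X Y f n \<otimes>\<^bsub>Fob H X\<^esub> Fmap H X Y f y"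
      using X Y f y n subfunctorialD[OF N Y] H by (simp add: Fmap_mult)
    then have "\<pi> X (Fmap H X Y f (r Y (\<pi> Y y))) = \<pi> X (Fmap H X Y f y)"
      using X Y f y n subfunctorialD(6)[OF N X f Y] subfunctorialD(2)[OF N Y] H r_closed by (subst \<pi>_eq) auto
    then show ?thesis by (simp add: Q_def)
  qed
  have cg: "comm_group (Fob Q X)" if "X \<in> Ob C" for X
    by (rule comm_group_image[OF comm_group_Fob[OF H that], of "\<pi> X"]) (use that in \<open>simp_all add: car one mult\<close>)
  show ?thesis
  proof
    show "additive_functor C Q"
      unfolding additive_functor_def hom_def
      using H cg by (auto simp: car nat Fmap_mult Fmap_comp Fmap_add simp flip: mult)
    show "natural C H Q \<pi>" by (auto simp: natural_def hom_def car nat mult)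
    show "nat_surj C H Q \<pi>" by (simp add: nat_surj_def car)
    show "\<pi> X x = \<one>\<^bsub>Fob Q X\<^esub> \<longleftrightarrow> x \<in> N X" if "X \<in> Ob C" "x \<in> carrier (Fob H X)" for X x
      using that H subfunctorialD(2)[OF N that(1)] by (auto simp: one \<pi>_eq)
  qed
qed

lemma nat_surjD:
  "\<lbrakk>nat_surj C F G \<pi>; X \<in> Ob C; y \<in> carrier (Fob G X)\<rbrakk> \<Longrightarrow> \<exists>x\<in>carrier (Fob F X). y = \<pi> X x"
  by (auto simp: nat_surj_def)

lemma nat_surjI:
  "\<lbrakk>natural C F G \<pi>; \<And>X y. \<lbrakk>X \<in> Ob C; y \<in> carrier (Fob G X)\<rbrakk> \<Longrightarrow> \<exists>x\<in>carrier (Fob F X). y = \<pi> X x\<rbrakk>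
    \<Longrightarrow> nat_surj C F G \<pi>"
  by (auto simp: nat_surj_def)

text \<open>A value of \<open>\<beta>\<close> is computed from any preimage; two preimages differ by an element that \<open>\<alpha>\<close>
  kills.\<close>

lemma descend_along_surj:
  assumes "natural C F Q \<pi>" "nat_surj C F Q \<pi>" "natural C F G \<alpha>" 
    "additive_functor C F" "additive_functor C G" "additive_functor C Q"
    "\<And>X x. \<lbrakk>X \<in> Ob C; x \<in> carrier (Fob F X); \<pi> X x = \<one>\<^bsub>Fob Q X\<^esub>\<rbrakk> \<Longrightarrow> \<alpha> X x = \<one>\<^bsub>Fob G X\<^esub>"
  obtains \<beta> where "natural C Q G \<beta>" "\<And>X x. \<lbrakk>X \<in> Ob C; x \<in> carrier (Fob F X)\<rbrakk> \<Longrightarrow> \<beta> X (\<pi> X x) = \<alpha> X x"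
proof -
  define \<beta> where "\<beta> X a = \<alpha> X (inv_into (carrier (Fob F X)) (\<pi> X) a)" for X a
  have eq: "\<beta> X (\<pi> X x) = \<alpha> X x" if Xx: "X \<in> Ob C" "x \<in> carrier (Fob F X)" for X x
  proof -
    let ?y = "inv_into (carrier (Fob F X)) (\<pi> X) (\<pi> X x)"
    have y: "?y \<in> carrier (Fob F X)" "\<pi> X ?y = \<pi> X x"
      using that by (simp_all add: inv_into_into f_inv_into_f)
    then obtain k where "k \<in> carrier (Fob F X)" "\<pi> X k = \<one>\<^bsub>Fob Q X\<^esub>" "?y = k \<otimes>\<^bsub>Fob F X\<^esub> x"
      using hom_eqD[OF comm_group_Fob[OF assms(4)] comm_group_Fob[OF assms(6)] natural_hom[OF assms(1)], of X ?y x]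
        Xx by auto
    then show ?thesis unfolding \<beta>_def using that assms by (simp add: natural_mult)
  qed
  have car: "carrier (Fob Q X) = \<pi> X ` carrier (Fob F X)" if "X \<in> Ob C" for X
    using assms(2) that by (simp add: nat_surj_def)
  have "natural C Q G \<beta>"
    unfolding natural_def hom_def
    using assms(3,4)
    by (auto simp: car eq natural_mult[OF assms(3)] natural_Fmap[OF assms(3)]
        simp flip: natural_mult[OF assms(1)] natural_Fmap[OF assms(1)])
  then show ?thesis using eq that by blast
qed

section \<open>Finitely presented functors\<close>

text \<open>The map between the representables is given by an arrow \<open>g\<close>, as Yoneda allows.\<close>

definition presentation ::
    "'o \<Rightarrow> 'o \<Rightarrow> 'm \<Rightarrow> ('o \<Rightarrow> 'm \<Rightarrow> 'v) \<Rightarrow> ('o, 'm, 'v) abfun \<Rightarrow> bool" where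
  "presentation Y Z g \<pi> F \<longleftrightarrow> Y \<in> Ob C \<and> Z \<in> Ob C \<and> g \<in> Arr C Y Z \<and> natural C (Rep C Z) F \<pi> \<and>
     nat_surj C (Rep C Z) F \<pi> \<and>
     (\<forall>X\<in>Ob C. \<forall>h\<in>Arr C X Z. \<pi> X h = \<one>\<^bsub>Fob F X\<^esub> \<longleftrightarrow> (\<exists>u\<in>Arr C X Y. h = Comp C X Y Z g u))"

lemma presentation_iff_nat_exact:
  assumes "Y \<in> Ob C" "Z \<in> Ob C" "g \<in> Arr C Y Z" "natural C (Rep C Z) F \<pi>"
  shows "presentation Y Z g \<pi> F \<longleftrightarrow> nat_surj C (Rep C Z) F \<pi> \<and> nat_exact C (Rep C Y) (Rep C Z) F (push C Y Z g) \<pi>"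
proof -
  have "(\<forall>X\<in>Ob C. \<forall>h\<in>Arr C X Z. \<pi> X h = \<one>\<^bsub>Fob F X\<^esub> \<longleftrightarrow> (\<exists>u\<in>Arr C X Y. h = Comp C X Y Z g u)) \<longleftrightarrow>
     nat_exact C (Rep C Y) (Rep C Z) F (push C Y Z g) \<pi>"
    unfolding nat_exact_def
  proof (intro ball_cong[OF refl])
    fix X assume X: "X \<in> Ob C"
    show "(\<forall>h\<in>Arr C X Z. \<pi> X h = \<one>\<^bsub>Fob F X\<^esub> \<longleftrightarrow> (\<exists>u\<in>Arr C X Y. h = Comp C X Y Z g u)) \<longleftrightarrow>
      push C Y Z g X ` carrier (Fob (Rep C Y) X) = kernel (Fob (Rep C Z) X) (Fob F X) (\<pi> X)"
      using X assms by (auto simp: kernel_def set_eq_iff image_iff)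
  qed
  then show ?thesis using assms by (auto simp: presentation_def)
qed

lemma finitely_presented_iff:
  fixes F :: "('o, 'm, 'm) abfun"
  shows "finitely_presented C F \<longleftrightarrow> additive_functor C F \<and> (\<exists>Y Z g \<pi>. presentation Y Z g \<pi> F)"
proof
  assume F: "finitely_presented C F"
  then obtain Y Z \<alpha> \<pi> where *: "Y \<in> Ob C" "Z \<in> Ob C" "\<alpha> \<in> carrier (NatTr C (Rep C Y) (Rep C Z))"
    "\<pi> \<in> carrier (NatTr C (Rep C Z) F)" "nat_exact C (Rep C Y) (Rep C Z) F \<alpha> \<pi>" "nat_surj C (Rep C Z) F \<pi>"
    by (auto simp: finitely_presented_def)
  obtain g where "g \<in> Arr C Y Z" "\<alpha> = push C Y Z g" using NatTr_Rep_eq_push[OF *(3,1,2)] by auto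
  then have "presentation Y Z g \<pi> F" using * by (simp add: presentation_iff_nat_exact natural_NatTr)
  then show "additive_functor C F \<and> (\<exists>Y Z g \<pi>. presentation Y Z g \<pi> F)"
    using F by (auto simp: finitely_presented_def)
next
  assume F: "additive_functor C F \<and> (\<exists>Y Z g \<pi>. presentation Y Z g \<pi> F)"
  then obtain Y Z g \<pi> where *: "presentation Y Z g \<pi> F" by auto
  let ?\<pi> = "restrict_nat C (Rep C Z) \<pi>"
  have "presentation Y Z g ?\<pi> F"
    using * natural_NatTr[OF ext_in_NatTr, of "Rep C Z" F \<pi>]
    by (simp add: presentation_def nat_surj_def)
  then have "nat_surj C (Rep C Z) F ?\<pi> \<and> nat_exact C (Rep C Y) (Rep C Z) F (push C Y Z g) ?\<pi>"
    and "?\<pi> \<in> carrier (NatTr C (Rep C Z) F)" and "push C Y Z g \<in> carrier (NatTr C (Rep C Y) (Rep C Z))"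
    and "Y \<in> Ob C" "Z \<in> Ob C"
    using presentation_iff_nat_exact[of Y Z g F ?\<pi>] * by (auto simp: presentation_def)
  then show "finitely_presented C F"
    using F unfolding finitely_presented_def by blast
qed

lemma presentationD:
  assumes "presentation Y Z g \<pi> F"
  shows "Y \<in> Ob C" "Z \<in> Ob C" "g \<in> Arr C Y Z" "natural C (Rep C Z) F \<pi>"
    "\<And>X x. \<lbrakk>X \<in> Ob C; x \<in> carrier (Fob F X)\<rbrakk> \<Longrightarrow> \<exists>h\<in>Arr C X Z. x = \<pi> X h"
    "\<And>X h. \<lbrakk>X \<in> Ob C; h \<in> Arr C X Z\<rbrakk> \<Longrightarrow> \<pi> X h = \<one>\<^bsub>Fob F X\<^esub> \<longleftrightarrow> (\<exists>u\<in>Arr C X Y. h = Comp C X Y Z g u)"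
    "\<And>X h h'. \<lbrakk>X \<in> Ob C; h \<in> Arr C X Z; h' \<in> Arr C X Z; \<pi> X h = \<pi> X h'; additive_functor C F\<rbrakk>
      \<Longrightarrow> \<exists>u\<in>Arr C X Y. h = Comp C X Y Z g u \<otimes>\<^bsub>Hom C X Z\<^esub> h'"
proof -
  show basic: "Y \<in> Ob C" "Z \<in> Ob C" "g \<in> Arr C Y Z" "natural C (Rep C Z) F \<pi>"
    "\<And>X x. \<lbrakk>X \<in> Ob C; x \<in> carrier (Fob F X)\<rbrakk> \<Longrightarrow> \<exists>h\<in>Arr C X Z. x = \<pi> X h"
    "\<And>X h. \<lbrakk>X \<in> Ob C; h \<in> Arr C X Z\<rbrakk> \<Longrightarrow> \<pi> X h = \<one>\<^bsub>Fob F X\<^esub> \<longleftrightarrow> (\<exists>u\<in>Arr C X Y. h = Comp C X Y Z g u)"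
    using assms nat_surjD[of "Rep C Z" F \<pi>] by (auto simp: presentation_def)
  fix X h h' assume *: "X \<in> Ob C" "h \<in> Arr C X Z" "h' \<in> Arr C X Z" "\<pi> X h = \<pi> X h'" "additive_functor C F"
  obtain k where "k \<in> Arr C X Z" "\<pi> X k = \<one>\<^bsub>Fob F X\<^esub>" "h = k \<otimes>\<^bsub>Hom C X Z\<^esub> h'"
    using hom_eqD[OF comm_group_Fob comm_group_Fob natural_hom[OF basic(4)], of X h h'] * basic by auto
  then show "\<exists>u\<in>Arr C X Y. h = Comp C X Y Z g u \<otimes>\<^bsub>Hom C X Z\<^esub> h'" using basic(6) * by auto
qed

end

section \<open>Abelian categories with enough projectives\<close>

locale proj_abelian = abelian_category A for A :: "('o, 'm) precat" +
  assumes enough: "enough_projectives A"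
begin

lemma projective_Ob: "projective A P \<Longrightarrow> P \<in> Ob A"
  by (simp add: projective_def)

lemma projective_lift:
  "\<lbrakk>projective A P; epic A X Y e; f \<in> Arr A P Y; X \<in> Ob A; Y \<in> Ob A\<rbrakk> \<Longrightarrow> \<exists>g\<in>Arr A P X. Comp A P X Y e g = f"
  by (simp add: projective_def)

lemma proj_cover:
  assumes "X \<in> Ob A" obtains P e where "projective A P" "P \<in> Ob A" "epic A P X e" "e \<in> Arr A P X"
  using assms enough by (auto simp: enough_projectives_def projective_def epic_def)

text \<open>The map \<open>[g, h] : X \<oplus> Y \<rightarrow> Z\<close>, described by what it hits on generalised elements.\<close>

lemma cotuple:
  assumes "X \<in> Ob A" "Y \<in> Ob A" "Z \<in> Ob A" "g \<in> Arr A X Z" "h \<in> Arr A Y Z"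
  obtains S k where "S \<in> Ob A" "k \<in> Arr A S Z"
    "\<And>W u. \<lbrakk>W \<in> Ob A; u \<in> Arr A W S\<rbrakk> \<Longrightarrow> \<exists>a\<in>Arr A W X. \<exists>b\<in>Arr A W Y.
        Comp A W S Z k u = Comp A W X Z g a \<otimes>\<^bsub>Hom A W Z\<^esub> Comp A W Y Z h b"
    "\<And>W a b. \<lbrakk>W \<in> Ob A; a \<in> Arr A W X; b \<in> Arr A W Y\<rbrakk> \<Longrightarrow> \<exists>u\<in>Arr A W S.
        Comp A W S Z k u = Comp A W X Z g a \<otimes>\<^bsub>Hom A W Z\<^esub> Comp A W Y Z h b"
proof -
  obtain S i j p q where S: "S \<in> Ob A" and mem: "i \<in> Arr A X S" "j \<in> Arr A Y S" "p \<in> Arr A S X" "q \<in> Arr A S Y"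
    and eqs: "Comp A X S X p i = Ident A X" "Comp A Y S Y q j = Ident A Y"
     "Comp A Y S X p j = zero_arr A Y X" "Comp A X S Y q i = zero_arr A X Y"
    using ex_biproduct[OF assms(1,2)] by (auto simp: is_biproduct_def)
  let ?k = "Comp A S X Z g p \<otimes>\<^bsub>Hom A S Z\<^esub> Comp A S Y Z h q"
  have 1: "Comp A W S Z ?k u = Comp A W X Z g (Comp A W S X p u) \<otimes>\<^bsub>Hom A W Z\<^esub> Comp A W Y Z h (Comp A W S Y q u)"
    if "W \<in> Ob A" "u \<in> Arr A W S" for W u
    using that S mem assms by (simp add: comp_add_left Comp_assoc)
  show ?thesis
  proof
    show "S \<in> Ob A" "?k \<in> Arr A S Z" using S mem assms by simp_all
    show "\<exists>a\<in>Arr A W X. \<exists>b\<in>Arr A W Y.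
        Comp A W S Z ?k u = Comp A W X Z g a \<otimes>\<^bsub>Hom A W Z\<^esub> Comp A W Y Z h b"
      if "W \<in> Ob A" "u \<in> Arr A W S" for W u
      using that S mem assms
      by (intro bexI[of _ "Comp A W S X p u"] bexI[of _ "Comp A W S Y q u"]) (simp_all add: 1)
    fix W a b assume W: "W \<in> Ob A" and ab: "a \<in> Arr A W X" "b \<in> Arr A W Y"
    let ?u = "Comp A W X S i a \<otimes>\<^bsub>Hom A W S\<^esub> Comp A W Y S j b"
    have "Comp A W S X p ?u = a" "Comp A W S Y q ?u = b"
      using W ab S mem assms(1,2) by (simp_all add: comp_add_right Comp_assoc eqs)
    then show "\<exists>u\<in>Arr A W S. Comp A W S Z ?k u = Comp A W X Z g a \<otimes>\<^bsub>Hom A W Z\<^esub> Comp A W Y Z h b"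
      using 1[OF W, of ?u] W ab S mem assms(1,2) by (intro bexI[of _ ?u]) simp_all
  qed
qed

text \<open>\<open>L\<close> is the kernel of \<open>[g, -h]\<close> on \<open>X \<oplus> Y\<close>, projected to \<open>X\<close>.  What is recorded is the image of
  \<open>Hom(-, L) \<rightarrow> Hom(-, X)\<close>, because this is the form in which pullbacks give presentations of kernels.\<close>

lemma weak_pullback:
  assumes "X \<in> Ob A" "Y \<in> Ob A" "Z \<in> Ob A" "g \<in> Arr A X Z" "h \<in> Arr A Y Z"
  obtains L l where "L \<in> Ob A" "l \<in> Arr A L X"
    "\<And>W a. \<lbrakk>W \<in> Ob A; a \<in> Arr A W X\<rbrakk> \<Longrightarrow>
      (\<exists>b\<in>Arr A W Y. Comp A W X Z g a = Comp A W Y Z h b) \<longleftrightarrow> (\<exists>u\<in>Arr A W L. a = Comp A W L X l u)"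
proof -
  obtain S i j p q where S: "S \<in> Ob A" and mem: "i \<in> Arr A X S" "j \<in> Arr A Y S" "p \<in> Arr A S X" "q \<in> Arr A S Y"
    and eqs: "Comp A X S X p i = Ident A X" "Comp A Y S Y q j = Ident A Y"
     "Comp A Y S X p j = zero_arr A Y X" "Comp A X S Y q i = zero_arr A X Y"
    using ex_biproduct[OF assms(1,2)] by (auto simp: is_biproduct_def)
  let ?d = "Comp A S X Z g p \<otimes>\<^bsub>Hom A S Z\<^esub> inv\<^bsub>Hom A S Z\<^esub> Comp A S Y Z h q"
  have d: "?d \<in> Arr A S Z" using S mem assms by simp
  obtain L k where L: "L \<in> Ob A" "k \<in> Arr A L S" "Comp A L S Z ?d k = zero_arr A L Z"
    and univ: "\<And>W w. \<lbrakk>W \<in> Ob A; w \<in> Arr A W S; Comp A W S Z ?d w = zero_arr A W Z\<rbrakk>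
        \<Longrightarrow> \<exists>u\<in>Arr A W L. Comp A W L S k u = w"
    using ex_kernel[OF S assms(3) d] unfolding is_kernel_def by blast
  have dk: "Comp A W S Z ?d w = Comp A W X Z g (Comp A W S X p w) \<otimes>\<^bsub>Hom A W Z\<^esub>
      inv\<^bsub>Hom A W Z\<^esub> Comp A W Y Z h (Comp A W S Y q w)" if "W \<in> Ob A" "w \<in> Arr A W S" for W w
    using that S mem assms by (simp add: comp_add_left comp_neg_left Comp_assoc)
  have dz: "Comp A W S Z ?d w = zero_arr A W Z \<longleftrightarrow>
      Comp A W X Z g (Comp A W S X p w) = Comp A W Y Z h (Comp A W S Y q w)" if "W \<in> Ob A" "w \<in> Arr A W S" for W w
    using that S mem assms by (simp add: dk group.inv_solve_right')
  show ?thesis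
  proof
    show "L \<in> Ob A" "Comp A L S X p k \<in> Arr A L X" using L S mem assms by simp_all
    fix W a assume W: "W \<in> Ob A" and a: "a \<in> Arr A W X"
    show "(\<exists>b\<in>Arr A W Y. Comp A W X Z g a = Comp A W Y Z h b) \<longleftrightarrow>
      (\<exists>u\<in>Arr A W L. a = Comp A W L X (Comp A L S X p k) u)"
    proof
      assume "\<exists>b\<in>Arr A W Y. Comp A W X Z g a = Comp A W Y Z h b"
      then obtain b where b: "b \<in> Arr A W Y" "Comp A W X Z g a = Comp A W Y Z h b" by auto
      let ?w = "Comp A W X S i a \<otimes>\<^bsub>Hom A W S\<^esub> Comp A W Y S j b"
      have w: "?w \<in> Arr A W S" using W a b S mem assms(1,2) by simp
      have pq: "Comp A W S X p ?w = a" "Comp A W S Y q ?w = b"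
        using W a b S mem assms(1,2) by (simp_all add: comp_add_right Comp_assoc eqs)
      then have "Comp A W S Z ?d ?w = zero_arr A W Z" using dz[OF W w] b by simp
      then obtain u where "u \<in> Arr A W L" "Comp A W L S k u = ?w" using univ[OF W w] by auto
      then show "\<exists>u\<in>Arr A W L. a = Comp A W L X (Comp A L S X p k) u"
        using pq W L S mem assms(1) by (intro bexI[of _ u]) (simp_all flip: Comp_assoc)
    next
      assume "\<exists>u\<in>Arr A W L. a = Comp A W L X (Comp A L S X p k) u"
      then obtain u where u: "u \<in> Arr A W L" "a = Comp A W L X (Comp A L S X p k) u" by auto
      have "Comp A W S Z ?d (Comp A W L S k u) = zero_arr A W Z"
        using u(1) W L S d assms(3) by (simp add: Comp_assoc)
      then have "Comp A W X Z g (Comp A W S X p (Comp A W L S k u)) = Comp A W Y Z h (Comp A W S Y q (Comp A W L S k u))"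
        using dz[OF W] u(1) W L S by simp
      then show "\<exists>b\<in>Arr A W Y. Comp A W X Z g a = Comp A W Y Z h b"
        using u W L S mem assms by (intro bexI[of _ "Comp A W S Y q (Comp A W L S k u)"]) (simp_all flip: Comp_assoc)
    qed
  qed
qed

subsection \<open>Kernels, images and quotients of finitely presented functors\<close>

lemma finitely_presented_additive: "finitely_presented A F \<Longrightarrow> additive_functor A F"
  by (simp add: finitely_presented_def)

lemma finitely_presented_Rep:
  assumes "Z \<in> Ob A" shows "finitely_presented A (Rep A Z)"
proof -
  have "presentation Z Z (zero_arr A Z Z) (\<lambda>X x. x) (Rep A Z)"
    using assms by (auto simp: presentation_def natural_id nat_surj_def)
  then show ?thesis using assms unfolding finitely_presented_iff by auto
qed

text \<open>Lift \<open>Hom(-, L) \<rightarrow> G\<close> to \<open>l : L \<rightarrow> Z\<close>.  An element \<open>h\<close> is killed iff \<open>l h\<close> factors through \<open>g\<close>, so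
  the kernel is covered by the pullback of \<open>l\<close> and \<open>g\<close>.\<close>

lemma Rep_kernel_covered:
  assumes "additive_functor A G" "presentation Y Z g \<pi> G" "L \<in> Ob A" "natural A (Rep A L) G \<tau>"
  obtains K k where "K \<in> Ob A" "k \<in> Arr A K L"
    "\<And>X h. \<lbrakk>X \<in> Ob A; h \<in> Arr A X L\<rbrakk> \<Longrightarrow> \<tau> X h = \<one>\<^bsub>Fob G X\<^esub> \<longleftrightarrow> (\<exists>u\<in>Arr A X K. h = Comp A X K L k u)"
proof -
  note p = presentationD[OF assms(2)]
  have "\<tau> L (Ident A L) \<in> carrier (Fob G L)"
    using natural_closed[OF assms(4), of "Ident A L" L] assms(3) by simp
  then obtain l where l: "l \<in> Arr A L Z" "\<tau> L (Ident A L) = \<pi> L l" using p(5)[OF assms(3)] by blast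
  have eq: "\<tau> X h = \<pi> X (Comp A X L Z l h)" if "X \<in> Ob A" "h \<in> Arr A X L" for X h
    using yoneda[OF assms(4) that(1) assms(3) that(2)] natural_Fmap[OF p(4) that(2), of l] that l p(1-3) assms(3)
    by simp
  obtain K k where K: "K \<in> Ob A" "k \<in> Arr A K L" and
    k: "\<And>W a. \<lbrakk>W \<in> Ob A; a \<in> Arr A W L\<rbrakk> \<Longrightarrow>
      (\<exists>b\<in>Arr A W Y. Comp A W L Z l a = Comp A W Y Z g b) \<longleftrightarrow> (\<exists>u\<in>Arr A W K. a = Comp A W K L k u)"
    using weak_pullback[OF assms(3) p(1,2) l(1) p(3)] by blast
  show ?thesis
    by (rule that[OF K]) (use assms(3) l p(1-3) in \<open>simp add: eq p(6) flip: k\<close>)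
qed

lemma finitely_presented_image:
  assumes "finitely_presented A G" "L \<in> Ob A" "natural A (Rep A L) G \<tau>"
  shows "finitely_presented A (subfunctor G (\<lambda>X. \<tau> X ` Arr A X L))"
    "subfunctorial G (\<lambda>X. \<tau> X ` Arr A X L)"
proof -
  have G: "additive_functor A G" using assms(1) by (rule finitely_presented_additive)
  show sub: "subfunctorial G (\<lambda>X. \<tau> X ` Arr A X L)"
    using subfunctorial_image[of "Rep A L" G \<tau>] assms G by simp
  obtain Y Z g \<pi> where p: "presentation Y Z g \<pi> G" using assms(1) by (auto simp: finitely_presented_iff)
  obtain K k where K: "K \<in> Ob A" "k \<in> Arr A K L" and
    k: "\<And>X h. \<lbrakk>X \<in> Ob A; h \<in> Arr A X L\<rbrakk> \<Longrightarrow> \<tau> X h = \<one>\<^bsub>Fob G X\<^esub> \<longleftrightarrow> (\<exists>u\<in>Arr A X K. h = Comp A X K L k u)"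
    using Rep_kernel_covered[OF G p assms(2,3)] by blast
  have "presentation K L k \<tau> (subfunctor G (\<lambda>X. \<tau> X ` Arr A X L))"
    using K assms(2,3) natural_into_subfunctor[OF assms(3), of "\<lambda>X. \<tau> X ` Arr A X L"]
    by (auto simp: presentation_def nat_surj_def k)
  then show "finitely_presented A (subfunctor G (\<lambda>X. \<tau> X ` Arr A X L))"
    using additive_subfunctor[OF G sub] unfolding finitely_presented_iff by blast
qed

text \<open>Cover \<open>F\<close> by a representable; the kernel of the composite to \<open>G\<close> is covered by a representable,
  whose image in \<open>F\<close> is the kernel of \<open>\<alpha>\<close>.\<close>

lemma kernel_covered:
  assumes "finitely_presented A F" "finitely_presented A G" "natural A F G \<alpha>"
  obtains L \<tau> where "L \<in> Ob A" "natural A (Rep A L) F \<tau>"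
    "\<And>X. X \<in> Ob A \<Longrightarrow> \<tau> X ` Arr A X L = kernel (Fob F X) (Fob G X) (\<alpha> X)"
proof -
  have F: "additive_functor A F" and G: "additive_functor A G" using assms by (simp_all add: finitely_presented_additive)
  obtain Y Z g \<pi> where pG: "presentation Y Z g \<pi> G" using assms(2) by (auto simp: finitely_presented_iff)
  obtain B D f \<rho> where pF: "presentation B D f \<rho> F" using assms(1) by (auto simp: finitely_presented_iff)
  note pD = presentationD[OF pF]
  obtain K k where K: "K \<in> Ob A" "k \<in> Arr A K D" and
    k: "\<And>X h. \<lbrakk>X \<in> Ob A; h \<in> Arr A X D\<rbrakk> \<Longrightarrow> \<alpha> X (\<rho> X h) = \<one>\<^bsub>Fob G X\<^esub> \<longleftrightarrow> (\<exists>u\<in>Arr A X K. h = Comp A X K D k u)"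
    using Rep_kernel_covered[OF G pG pD(2) natural_compose[OF pD(4) assms(3)]] by blast
  have clos: "\<rho> X h \<in> carrier (Fob F X)" if "X \<in> Ob A" "h \<in> Arr A X D" for X h
    using natural_closed[OF pD(4)] that by simp
  show ?thesis
  proof
    show "K \<in> Ob A" by fact
    show "natural A (Rep A K) F (\<lambda>X h. \<rho> X (Comp A X K D k h))"
      using natural_compose[OF natural_comp_left pD(4)] K pD(2) by blast
    fix X assume X: "X \<in> Ob A"
    show "(\<lambda>h. \<rho> X (Comp A X K D k h)) ` Arr A X K = kernel (Fob F X) (Fob G X) (\<alpha> X)"
    proof (intro equalityI subsetI)
      fix x assume "x \<in> (\<lambda>h. \<rho> X (Comp A X K D k h)) ` Arr A X K"
      then show "x \<in> kernel (Fob F X) (Fob G X) (\<alpha> X)"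
        using X K pD(2) k[OF X] clos[OF X] by (auto simp: kernel_def)
    next
      fix x assume x: "x \<in> kernel (Fob F X) (Fob G X) (\<alpha> X)"
      then obtain h where "h \<in> Arr A X D" "x = \<rho> X h" using pD(5)[OF X] by (auto simp: kernel_def)
      then show "x \<in> (\<lambda>h. \<rho> X (Comp A X K D k h)) ` Arr A X K"
        using k[OF X, of h] x by (auto simp: kernel_def)
    qed
  qed
qed

text \<open>Outside the objects the values of \<open>\<alpha>\<close> are arbitrary; taking the empty set there keeps the
  subfunctor independent of them.\<close>

lemma finitely_presented_kernel:
  assumes "finitely_presented A F" "finitely_presented A G" "natural A F G \<alpha>"
  shows "finitely_presented A (subfunctor F (\<lambda>X. if X \<in> Ob A then kernel (Fob F X) (Fob G X) (\<alpha> X) else {}))"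
proof -
  obtain L \<tau> where L: "L \<in> Ob A" "natural A (Rep A L) F \<tau>"
    "\<And>X. X \<in> Ob A \<Longrightarrow> \<tau> X ` Arr A X L = kernel (Fob F X) (Fob G X) (\<alpha> X)"
    using kernel_covered[OF assms] by blast
  have F: "additive_functor A F" and G: "additive_functor A G" using assms by (simp_all add: finitely_presented_additive)
  let ?K = "\<lambda>X. if X \<in> Ob A then kernel (Fob F X) (Fob G X) (\<alpha> X) else {}"
  obtain Y Z g \<pi> where p: "presentation Y Z g \<pi> (subfunctor F (\<lambda>X. \<tau> X ` Arr A X L))"
    using finitely_presented_image(1)[OF assms(1) L(1,2)] unfolding finitely_presented_iff by auto
  have "presentation Y Z g \<pi> (subfunctor F ?K)"
    using p L(3) by (auto simp: presentation_def natural_def nat_surj_def hom_def)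
  moreover have "additive_functor A (subfunctor F ?K)"
    using subfunctorial_kernel[OF F G assms(3)]
    by (intro additive_subfunctor[OF F]) (auto simp: subfunctorial_def)
  ultimately show ?thesis unfolding finitely_presented_iff by blast
qed

text \<open>If \<open>g : Y \<rightarrow> Z\<close> presents \<open>G\<close> and \<open>l : L \<rightarrow> Z\<close> lifts \<open>Hom(-, L) \<rightarrow> G\<close>, then \<open>[g, l]\<close> presents
  the quotient.\<close>

lemma finitely_presented_quotient:
  assumes "finitely_presented A G" "L \<in> Ob A" "natural A (Rep A L) G \<tau>"
    "additive_functor A Q" "natural A G Q \<kappa>" "nat_surj A G Q \<kappa>"
    "\<And>X x. \<lbrakk>X \<in> Ob A; x \<in> carrier (Fob G X)\<rbrakk> \<Longrightarrow> \<kappa> X x = \<one>\<^bsub>Fob Q X\<^esub> \<longleftrightarrow> x \<in> \<tau> X ` Arr A X L"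
  shows "finitely_presented A Q"
proof -
  have G: "additive_functor A G" using assms(1) by (rule finitely_presented_additive)
  obtain Y Z g \<pi> where p: "presentation Y Z g \<pi> G" using assms(1) by (auto simp: finitely_presented_iff)
  note pD = presentationD[OF p]
  have "\<tau> L (Ident A L) \<in> carrier (Fob G L)"
    using natural_closed[OF assms(3), of "Ident A L" L] assms(2) by simp
  then obtain l where l: "l \<in> Arr A L Z" "\<tau> L (Ident A L) = \<pi> L l" using pD(5)[OF assms(2)] by blast
  have eq: "\<tau> X h = \<pi> X (Comp A X L Z l h)" if "X \<in> Ob A" "h \<in> Arr A X L" for X h
    using yoneda[OF assms(3) that(1) assms(2) that(2)] natural_Fmap[OF pD(4) that(2), of l] that l pD(1-3) assms(2)
    by simp
  obtain S k where S: "S \<in> Ob A" "k \<in> Arr A S Z" and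
    k: "\<And>W u. \<lbrakk>W \<in> Ob A; u \<in> Arr A W S\<rbrakk> \<Longrightarrow> \<exists>a\<in>Arr A W Y. \<exists>b\<in>Arr A W L.
        Comp A W S Z k u = Comp A W Y Z g a \<otimes>\<^bsub>Hom A W Z\<^esub> Comp A W L Z l b"
    "\<And>W a b. \<lbrakk>W \<in> Ob A; a \<in> Arr A W Y; b \<in> Arr A W L\<rbrakk> \<Longrightarrow> \<exists>u\<in>Arr A W S.
        Comp A W S Z k u = Comp A W Y Z g a \<otimes>\<^bsub>Hom A W Z\<^esub> Comp A W L Z l b"
    using cotuple[OF pD(1) assms(2) pD(2,3) l(1)] by blast
  have "presentation S Z k (\<lambda>X h. \<kappa> X (\<pi> X h)) Q"
    unfolding presentation_def
  proof (intro conjI ballI)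
    show "S \<in> Ob A" "k \<in> Arr A S Z" "Z \<in> Ob A" by fact+
    show "natural A (Rep A Z) Q (\<lambda>X h. \<kappa> X (\<pi> X h))" by (rule natural_compose[OF pD(4) assms(5)])
    then show "nat_surj A (Rep A Z) Q (\<lambda>X h. \<kappa> X (\<pi> X h))"
      by (rule nat_surjI) (use nat_surjD[OF assms(6)] pD(5) in fastforce)
    fix X h assume X: "X \<in> Ob A" and h: "h \<in> Arr A X Z"
    have \<pi>h: "\<pi> X h \<in> carrier (Fob G X)" using natural_closed[OF pD(4)] X h by simp
    have "\<kappa> X (\<pi> X h) = \<one>\<^bsub>Fob Q X\<^esub> \<longleftrightarrow> (\<exists>b\<in>Arr A X L. \<pi> X h = \<pi> X (Comp A X L Z l b))"
      using assms(7)[OF X \<pi>h] eq[OF X] by auto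
    also have "\<dots> \<longleftrightarrow> (\<exists>u\<in>Arr A X S. h = Comp A X S Z k u)"
    proof
      assume "\<exists>b\<in>Arr A X L. \<pi> X h = \<pi> X (Comp A X L Z l b)"
      then obtain b where b: "b \<in> Arr A X L" "\<pi> X h = \<pi> X (Comp A X L Z l b)" by auto
      then obtain a where "a \<in> Arr A X Y" "h = Comp A X Y Z g a \<otimes>\<^bsub>Hom A X Z\<^esub> Comp A X L Z l b"
        using pD(7)[OF X h _ b(2) G] X b l pD(2) assms(2) by auto
      then show "\<exists>u\<in>Arr A X S. h = Comp A X S Z k u" using k(2)[OF X _ b(1)] by metis
    next
      assume "\<exists>u\<in>Arr A X S. h = Comp A X S Z k u"
      then obtain a b where ab: "a \<in> Arr A X Y" "b \<in> Arr A X L" "h = Comp A X Y Z g a \<otimes>\<^bsub>Hom A X Z\<^esub> Comp A X L Z l b"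
        using k(1)[OF X] by metis
      have z: "\<pi> X (Comp A X Y Z g a) = \<one>\<^bsub>Fob G X\<^esub>" using pD(6)[OF X, of "Comp A X Y Z g a"] X ab pD(1-3) by auto
      have "\<pi> X h = \<pi> X (Comp A X Y Z g a) \<otimes>\<^bsub>Fob G X\<^esub> \<pi> X (Comp A X L Z l b)"
        using natural_mult[OF pD(4), of "Comp A X Y Z g a" X "Comp A X L Z l b"] X ab pD(1-3) l assms(2) by simp
      also have "\<dots> = \<pi> X (Comp A X L Z l b)"
        using z natural_closed[OF pD(4), of "Comp A X L Z l b" X] X ab pD(1-3) l assms(2) G by simp
      finally show "\<exists>b\<in>Arr A X L. \<pi> X h = \<pi> X (Comp A X L Z l b)" using ab by blast
    qed
    finally show "\<kappa> X (\<pi> X h) = \<one>\<^bsub>Fob Q X\<^esub> \<longleftrightarrow> (\<exists>u\<in>Arr A X S. h = Comp A X S Z k u)" .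
  qed
  then show ?thesis using assms(4) unfolding finitely_presented_iff by blast
qed

lemma finitely_presented_coker:
  fixes G :: "('o, 'm, 'm) abfun"
  assumes "finitely_presented A F" "finitely_presented A G" "natural A F G \<alpha>"
  obtains Q :: "('o, 'm, 'm) abfun" and \<kappa> where "finitely_presented A Q" "natural A G Q \<kappa>" "nat_surj A G Q \<kappa>"
    "\<And>X x. \<lbrakk>X \<in> Ob A; x \<in> carrier (Fob G X)\<rbrakk> \<Longrightarrow> \<kappa> X x = \<one>\<^bsub>Fob Q X\<^esub> \<longleftrightarrow> x \<in> \<alpha> X ` carrier (Fob F X)"
proof -
  have F: "additive_functor A F" and G: "additive_functor A G" using assms by (simp_all add: finitely_presented_additive)
  obtain B D f \<rho> where pF: "presentation B D f \<rho> F" using assms(1) by (auto simp: finitely_presented_iff)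
  note pD = presentationD[OF pF]
  obtain Q :: "('o, 'm, 'm) abfun" and \<kappa> where Q: "additive_functor A Q" "natural A G Q \<kappa>" "nat_surj A G Q \<kappa>"
    "\<And>X x. \<lbrakk>X \<in> Ob A; x \<in> carrier (Fob G X)\<rbrakk> \<Longrightarrow> \<kappa> X x = \<one>\<^bsub>Fob Q X\<^esub> \<longleftrightarrow> x \<in> \<alpha> X ` carrier (Fob F X)"
    using quotient_functor[OF G subfunctorial_image[OF F G assms(3)], of "\<lambda>X x. x"] by (auto simp: inj_on_def)
  have im: "(\<lambda>h. \<alpha> X (\<rho> X h)) ` Arr A X D = \<alpha> X ` carrier (Fob F X)" if X: "X \<in> Ob A" for X
  proof -
    have "\<rho> X ` Arr A X D = carrier (Fob F X)" using pF X by (simp add: presentation_def nat_surj_def)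
    then show ?thesis by (metis image_image)
  qed
  have "finitely_presented A Q"
    by (rule finitely_presented_quotient[OF assms(2) pD(2) natural_compose[OF pD(4) assms(3)] Q(1-3)])
      (simp add: Q(4) im)
  then show ?thesis using Q that by blast
qed

section \<open>The trace of the projectives\<close>

text \<open>The elements of \<open>F\<close> that come from projective objects.  They form the kernel of
  \<open>F \<rightarrow> F\<^sup>0\<close>.\<close>

definition trace :: "('o, 'm, 'v) abfun \<Rightarrow> 'o \<Rightarrow> 'v set" where
  "trace F X = {Fmap F X P u x | P u x. projective A P \<and> u \<in> Arr A X P \<and> x \<in> carrier (Fob F P)}"

lemma ex_projective: "\<exists>P. projective A P"
proof -
  obtain Z where "Z \<in> Ob A" using ex_zero_object by (auto simp: is_zero_object_def)
  then show ?thesis by (metis proj_cover)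
qed

lemma projective_biproduct:
  assumes "projective A P" "projective A Q" "is_biproduct A P Q S i j p q"
  shows "projective A S"
  unfolding projective_def
proof (intro conjI ballI allI impI)
  have Ob: "P \<in> Ob A" "Q \<in> Ob A" using assms by (simp_all add: projective_def)
  have S: "S \<in> Ob A" and mem: "i \<in> Arr A P S" "j \<in> Arr A Q S" "p \<in> Arr A S P" "q \<in> Arr A S Q"
    and sum: "Comp A S P S i p \<otimes>\<^bsub>Hom A S S\<^esub> Comp A S Q S j q = Ident A S"
    using assms(3) by (auto simp: is_biproduct_def)
  show "S \<in> Ob A" by fact
  fix X Y e f assume XY: "X \<in> Ob A" "Y \<in> Ob A" and e: "epic A X Y e" and f: "f \<in> Arr A S Y"
  have e': "e \<in> Arr A X Y" using e by (simp add: epic_def)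
  obtain a b where a: "a \<in> Arr A P X" "Comp A P X Y e a = Comp A P S Y f i"
    and b: "b \<in> Arr A Q X" "Comp A Q X Y e b = Comp A Q S Y f j"
    using projective_lift[OF assms(1) e _ XY, of "Comp A P S Y f i"] projective_lift[OF assms(2) e _ XY, of "Comp A Q S Y f j"]
      Ob S mem XY f by auto
  let ?g = "Comp A S P X a p \<otimes>\<^bsub>Hom A S X\<^esub> Comp A S Q X b q"
  have "Comp A S X Y e ?g = Comp A S P Y (Comp A P S Y f i) p \<otimes>\<^bsub>Hom A S Y\<^esub> Comp A S Q Y (Comp A Q S Y f j) q"
    using a b Ob S mem XY e' by (simp add: comp_add_right Comp_assoc)
  also have "\<dots> = Comp A S S Y f (Ident A S)"
    using Ob S mem XY f unfolding sum[symmetric] by (simp add: comp_add_right Comp_assoc)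
  finally have "Comp A S X Y e ?g = f" using S XY f by simp
  then show "\<exists>g\<in>Arr A S X. Comp A S X Y e g = f"
    using a b Ob S mem XY by (intro bexI[of _ ?g]) simp_all
qed

text \<open>Closed under sums because two maps to projectives combine into one map to their biproduct.\<close>

lemma subfunctorial_trace:
  assumes F: "additive_functor A F"
  shows "subfunctorial F (trace F)"
  unfolding subfunctorial_def
proof (intro conjI ballI)
  fix X assume X: "X \<in> Ob A"
  show "subgroup (trace F X) (Fob F X)"
  proof
    show "trace F X \<subseteq> carrier (Fob F X)" using F X by (auto simp: trace_def projective_Ob)
    obtain P where P: "projective A P" using ex_projective by auto
    then have "\<one>\<^bsub>Fob F X\<^esub> = Fmap F X P (zero_arr A X P) \<one>\<^bsub>Fob F P\<^esub>"
      using F X by (simp add: projective_Ob)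
    then show "\<one>\<^bsub>Fob F X\<^esub> \<in> trace F X" using F X P unfolding trace_def
      by (auto intro!: exI[of _ P] exI[of _ "zero_arr A X P"] exI[of _ "\<one>\<^bsub>Fob F P\<^esub>"] simp: projective_Ob)
  next
    fix a assume "a \<in> trace F X"
    then obtain P u x where *: "projective A P" "u \<in> Arr A X P" "x \<in> carrier (Fob F P)" "a = Fmap F X P u x"
      by (auto simp: trace_def)
    then have "inv\<^bsub>Fob F X\<^esub> a = Fmap F X P u (inv\<^bsub>Fob F P\<^esub> x)"
      using group_hom.hom_inv[of "Fob F P" "Fob F X" "Fmap F X P u" x] Fmap_hom[OF F *(2) X projective_Ob] F X
      by (simp add: group_hom_def group_hom_axioms_def projective_Ob)
    then show "inv\<^bsub>Fob F X\<^esub> a \<in> trace F X"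
      using *(1-3) F projective_Ob[OF *(1)] Fob_closed(3)[of x F P] unfolding trace_def by blast
  next
    fix a b assume "a \<in> trace F X" "b \<in> trace F X"
    then obtain P u x Q v y where a: "projective A P" "u \<in> Arr A X P" "x \<in> carrier (Fob F P)" "a = Fmap F X P u x"
      and b: "projective A Q" "v \<in> Arr A X Q" "y \<in> carrier (Fob F Q)" "b = Fmap F X Q v y"
      by (auto simp: trace_def)
    have Ob: "P \<in> Ob A" "Q \<in> Ob A" using a b by (simp_all add: projective_def)
    obtain S i j p q where bi: "is_biproduct A P Q S i j p q" using ex_biproduct[OF Ob] by blast
    have S: "S \<in> Ob A" and mem: "i \<in> Arr A P S" "j \<in> Arr A Q S" "p \<in> Arr A S P" "q \<in> Arr A S Q"
      and eqs: "Comp A P S P p i = Ident A P" "Comp A Q S Q q j = Ident A Q"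
        "Comp A Q S P p j = zero_arr A Q P" "Comp A P S Q q i = zero_arr A P Q"
      using bi by (auto simp: is_biproduct_def)
    let ?w = "Comp A X P S i u \<otimes>\<^bsub>Hom A X S\<^esub> Comp A X Q S j v"
    let ?z = "Fmap F S P p x \<otimes>\<^bsub>Fob F S\<^esub> Fmap F S Q q y"
    have i: "Fmap F P S i ?z = x"
      using F Ob S mem a b by (simp add: Fmap_mult eqs flip: Fmap_comp)
    have j: "Fmap F Q S j ?z = y"
      using F Ob S mem a b by (simp add: Fmap_mult eqs flip: Fmap_comp)
    have "Fmap F X S ?w ?z = a \<otimes>\<^bsub>Fob F X\<^esub> b"
      using F X Ob S mem a b by (simp add: Fmap_add Fmap_comp i j)
    then show "a \<otimes>\<^bsub>Fob F X\<^esub> b \<in> trace F X"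
      using projective_biproduct[OF a(1) b(1) bi] F X Ob S mem a b
      unfolding trace_def by (auto intro!: exI[of _ S] exI[of _ ?w] exI[of _ ?z])
  qed
next
  fix X Y f y assume *: "X \<in> Ob A" "Y \<in> Ob A" "f \<in> Arr A X Y" "y \<in> trace F Y"
  then obtain P u x where P: "projective A P" "u \<in> Arr A Y P" "x \<in> carrier (Fob F P)" "y = Fmap F Y P u x"
    by (auto simp: trace_def)
  then have "Fmap F X Y f y = Fmap F X P (Comp A X Y P u f) x" using F * by (simp add: Fmap_comp projective_Ob)
  then show "Fmap F X Y f y \<in> trace F X"
    using F * P unfolding trace_def
    by (auto intro!: exI[of _ P] exI[of _ "Comp A X Y P u f"] exI[of _ x] simp: projective_Ob)
qed

lemmas traceD = subfunctorialD[OF subfunctorial_trace]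

lemma trace_natural:
  "\<lbrakk>natural A F G \<alpha>; x \<in> trace F X; X \<in> Ob A\<rbrakk> \<Longrightarrow> \<alpha> X x \<in> trace G X"
  by (fastforce simp: trace_def natural_Fmap projective_Ob)

lemma vanishesD:
  "\<lbrakk>vanishes_on_projectives A G; projective A P; x \<in> carrier (Fob G P)\<rbrakk> \<Longrightarrow> x = \<one>\<^bsub>Fob G P\<^esub>"
  by (auto simp: vanishes_on_projectives_def trivial_group_def)

lemma trace_vanishes:
  "\<lbrakk>vanishes_on_projectives A G; additive_functor A G; x \<in> trace G X; X \<in> Ob A\<rbrakk> \<Longrightarrow> x = \<one>\<^bsub>Fob G X\<^esub>"
  by (auto simp: trace_def projective_Ob dest!: vanishesD)

text \<open>Every map from a projective object to \<open>Z\<close> lifts to a projective cover \<open>P\<close> of \<open>Z\<close>, so the trace is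
  the image of \<open>Hom(-, P)\<close>.\<close>

lemma trace_covered:
  assumes "finitely_presented A F"
  obtains L \<tau> where "L \<in> Ob A" "natural A (Rep A L) F \<tau>" "\<And>X. X \<in> Ob A \<Longrightarrow> \<tau> X ` Arr A X L = trace F X"
proof -
  have F: "additive_functor A F" using assms by (rule finitely_presented_additive)
  obtain Y Z g \<pi> where p: "presentation Y Z g \<pi> F" using assms by (auto simp: finitely_presented_iff)
  note pD = presentationD[OF p]
  obtain P e where P: "projective A P" "P \<in> Ob A" "epic A P Z e" "e \<in> Arr A P Z" using proj_cover[OF pD(2)] .
  show ?thesis
  proof
    show "P \<in> Ob A" by fact
    show "natural A (Rep A P) F (\<lambda>X h. \<pi> X (Comp A X P Z e h))"
      using natural_compose[OF natural_comp_left pD(4)] P pD(2) by blast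
    fix X assume X: "X \<in> Ob A"
    show "(\<lambda>h. \<pi> X (Comp A X P Z e h)) ` Arr A X P = trace F X"
    proof (intro equalityI subsetI)
      fix x assume "x \<in> (\<lambda>h. \<pi> X (Comp A X P Z e h)) ` Arr A X P"
      then obtain h where h: "h \<in> Arr A X P" "x = Fmap F X P h (\<pi> P e)"
        using natural_Fmap[OF pD(4), of _ X P e] X P pD(2) by auto
      moreover have "\<pi> P e \<in> carrier (Fob F P)" using natural_closed[OF pD(4)] P by simp
      ultimately show "x \<in> trace F X" using P by (auto simp: trace_def)
    next
      fix x assume "x \<in> trace F X"
      then obtain Q u y where Q: "projective A Q" "u \<in> Arr A X Q" "y \<in> carrier (Fob F Q)" "x = Fmap F X Q u y"
        by (auto simp: trace_def)
      obtain v where v: "v \<in> Arr A Q Z" "y = \<pi> Q v" using pD(5)[OF projective_Ob[OF Q(1)] Q(3)] by auto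
      obtain w where w: "w \<in> Arr A Q P" "Comp A Q P Z e w = v" using projective_lift[OF Q(1) P(3) v(1) P(2) pD(2)] by auto
      have "x = \<pi> X (Comp A X Q Z v u)" using natural_Fmap[OF pD(4) Q(2), of v] X Q v projective_Ob by simp
      also have "Comp A X Q Z v u = Comp A X P Z e (Comp A X Q P w u)"
        using X Q w P pD(2) projective_Ob by (simp add: Comp_assoc)
      finally show "x \<in> (\<lambda>h. \<pi> X (Comp A X P Z e h)) ` Arr A X P"
        using X Q w P projective_Ob by auto
    qed
  qed
qed

lemma trace_Rep: "trace (Rep A Z) X = proj_arrs A X Z"
  by (auto simp: trace_def proj_arrs_def)

lemma proj_arrs_subgroup: "\<lbrakk>X \<in> Ob A; Y \<in> Ob A\<rbrakk> \<Longrightarrow> subgroup (proj_arrs A X Y) (Hom A X Y)"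
  using traceD(1)[of "Rep A Y" X] by (simp add: trace_Rep)

lemma proj_arrs_closed [simp]: "\<lbrakk>f \<in> proj_arrs A X Y; X \<in> Ob A; Y \<in> Ob A\<rbrakk> \<Longrightarrow> f \<in> Arr A X Y"
  using traceD(2)[of "Rep A Y" X] by (simp add: trace_Rep)

lemma proj_arrs_add: "\<lbrakk>f \<in> proj_arrs A X Y; g \<in> proj_arrs A X Y; X \<in> Ob A; Y \<in> Ob A\<rbrakk>
    \<Longrightarrow> f \<otimes>\<^bsub>Hom A X Y\<^esub> g \<in> proj_arrs A X Y"
  using traceD(3)[of "Rep A Y" X] by (simp add: trace_Rep)

lemma proj_arrs_zero: "\<lbrakk>X \<in> Ob A; Y \<in> Ob A\<rbrakk> \<Longrightarrow> zero_arr A X Y \<in> proj_arrs A X Y"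
  using traceD(5)[of "Rep A Y" X] by (simp add: trace_Rep)

lemma proj_arrs_comp_right:
  "\<lbrakk>f \<in> Arr A X Y; g \<in> proj_arrs A Y Z; X \<in> Ob A; Y \<in> Ob A; Z \<in> Ob A\<rbrakk> \<Longrightarrow> Comp A X Y Z g f \<in> proj_arrs A X Z"
  using traceD(6)[of "Rep A Z" X f Y g] by (simp add: trace_Rep)

lemma proj_arrs_comp_left:
  "\<lbrakk>f \<in> proj_arrs A X Y; g \<in> Arr A Y Z; X \<in> Ob A; Y \<in> Ob A; Z \<in> Ob A\<rbrakk> \<Longrightarrow> Comp A X Y Z g f \<in> proj_arrs A X Z"
  using trace_natural[OF natural_comp_left, of Y Z g f X] by (simp add: trace_Rep)

section \<open>Stable exactness of a resolution\<close>

text \<open>The beginning of a projective resolution of \<open>F\<close>, with exactness taken pointwise and values in arbitrary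
  universes: \<open>P\<^sub>0\<close> and \<open>P\<^sub>1\<close> are projective, and \<open>P\<^sub>2\<close> covers the kernel of \<open>d\<^sub>0\<close>.\<close>

definition resolution where
  "resolution P2 P1 P0 F d1 d0 e \<longleftrightarrow>
     additive_functor A P2 \<and> additive_functor A P1 \<and> additive_functor A P0 \<and> additive_functor A F \<and>
     summand_of_Rep P1 \<and> summand_of_Rep P0 \<and>
     natural A P2 P1 d1 \<and> natural A P1 P0 d0 \<and> natural A P0 F e \<and>
     nat_exact A P2 P1 P0 d1 d0 \<and> nat_exact A P1 P0 F d0 e \<and> nat_surj A P0 F e"

text \<open>Exactness of \<open>P\<^sub>2/tr \<rightarrow> P\<^sub>1/tr \<rightarrow> P\<^sub>0/tr \<rightarrow> 0\<close>, where \<open>tr\<close> is the trace: the first part says that the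
  cokernel \<open>F/tr\<close> of the last differential is zero.\<close>

definition stably_exact where
  "stably_exact P2 P1 P0 F d1 d0 \<longleftrightarrow>
     (\<forall>X\<in>Ob A. carrier (Fob F X) \<subseteq> trace F X) \<and>
     (\<forall>X\<in>Ob A. \<forall>x\<in>carrier (Fob P1 X). d0 X x \<in> trace P0 X \<longrightarrow>
        (\<exists>z\<in>carrier (Fob P2 X). \<exists>i\<in>trace P1 X. x = d1 X z \<otimes>\<^bsub>Fob P1 X\<^esub> i))"

text \<open>Choose chain maps \<open>c, b\<close> from \<open>P\<close> to \<open>Q\<close> and \<open>c', b'\<close> back, over the identity of \<open>F\<close>, and a homotopy
  \<open>h\<close> with \<open>c' c = d\<^sub>0 h + 1\<close>.  Natural transformations preserve traces, so an element \<open>x\<close> of \<open>P\<^sub>1\<close> with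
  \<open>d\<^sub>0 x\<close> in the trace is sent by \<open>b\<close> to an element of \<open>Q\<^sub>1\<close> of the same kind, which is a boundary
  modulo the trace; going back by \<open>b'\<close> gives \<open>x + h d\<^sub>0 x\<close> up to a boundary, and \<open>h d\<^sub>0 x\<close> is in the trace.\<close>

lemma stably_exact_transfer:
  assumes P: "resolution P2 P1 P0 F d1 d0 e" and Q: "resolution Q2 Q1 Q0 F d1' d0' e'"
    and ex: "stably_exact Q2 Q1 Q0 F d1' d0'"
  shows "stably_exact P2 P1 P0 F d1 d0"
proof -
  have add: "additive_functor A P2" "additive_functor A P1" "additive_functor A P0" "additive_functor A F"
      "additive_functor A Q2" "additive_functor A Q1" "additive_functor A Q0"
    and sum: "summand_of_Rep P1" "summand_of_Rep P0" "summand_of_Rep Q1" "summand_of_Rep Q0"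
    and nat: "natural A P2 P1 d1" "natural A P1 P0 d0" "natural A P0 F e"
      "natural A Q2 Q1 d1'" "natural A Q1 Q0 d0'" "natural A Q0 F e'"
    and pex: "nat_exact A P2 P1 P0 d1 d0" "nat_exact A P1 P0 F d0 e" "nat_surj A P0 F e"
    and qex: "nat_exact A Q2 Q1 Q0 d1' d0'" "nat_exact A Q1 Q0 F d0' e'" "nat_surj A Q0 F e'"
    using P Q by (simp_all add: resolution_def)
  note cl = nat[THEN natural_closed]
  obtain c where c: "natural A P0 Q0 c" "\<And>X x. \<lbrakk>X \<in> Ob A; x \<in> carrier (Fob P0 X)\<rbrakk> \<Longrightarrow> e' X (c X x) = e X x"
    using lift_summand[OF sum(2) add(7,4) nat(3,6)] nat_surjD[OF qex(3)] cl(3) by blast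
  obtain c' where c': "natural A Q0 P0 c'" "\<And>X x. \<lbrakk>X \<in> Ob A; x \<in> carrier (Fob Q0 X)\<rbrakk> \<Longrightarrow> e X (c' X x) = e' X x"
    using lift_summand[OF sum(4) add(3,4) nat(6,3)] nat_surjD[OF pex(3)] cl(6) by blast
  have "\<exists>y\<in>carrier (Fob Q1 X). c X (d0 X x) = d0' X y" if "X \<in> Ob A" "x \<in> carrier (Fob P1 X)" for X x
    using that nat_exactD[OF qex(2), of X "c X (d0 X x)"] nat_exact_zero[OF pex(2)] c cl by simp
  then obtain b where b: "natural A P1 Q1 b" "\<And>X x. \<lbrakk>X \<in> Ob A; x \<in> carrier (Fob P1 X)\<rbrakk> \<Longrightarrow> d0' X (b X x) = c X (d0 X x)"
    using lift_summand[OF sum(1) add(6,7) natural_compose[OF nat(2) c(1)] nat(5)] by blast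
  have "\<exists>y\<in>carrier (Fob P1 X). c' X (d0' X x) = d0 X y" if "X \<in> Ob A" "x \<in> carrier (Fob Q1 X)" for X x
    using that nat_exactD[OF pex(2), of X "c' X (d0' X x)"] nat_exact_zero[OF qex(2)] c' cl by simp
  then obtain b' where b': "natural A Q1 P1 b'" "\<And>X x. \<lbrakk>X \<in> Ob A; x \<in> carrier (Fob Q1 X)\<rbrakk> \<Longrightarrow> d0 X (b' X x) = c' X (d0' X x)"
    using lift_summand[OF sum(3) add(2,3) natural_compose[OF nat(5) c'(1)] nat(2)] by blast
  \<comment> \<open>a homotopy from the identity to \<open>c' c\<close> in degree 0\<close>
  obtain h where h: "natural A P0 P1 h" "\<And>X x. \<lbrakk>X \<in> Ob A; x \<in> carrier (Fob P0 X)\<rbrakk>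
      \<Longrightarrow> c' X (c X x) = d0 X (h X x) \<otimes>\<^bsub>Fob P0 X\<^esub> x"
    using lift_summand_diff[OF sum(2) add(3,2,3,4) natural_compose[OF c(1) c'(1)] natural_id[OF add(3)] nat(2,3) pex(2)]
      c c' by (metis natural_closed)
  note cl = cl c(1)[THEN natural_closed] c'(1)[THEN natural_closed] b(1)[THEN natural_closed]
    b'(1)[THEN natural_closed] h(1)[THEN natural_closed]
  show ?thesis
    unfolding stably_exact_def
  proof (intro conjI ballI impI)
    show "carrier (Fob F X) \<subseteq> trace F X" if "X \<in> Ob A" for X using ex that by (simp add: stably_exact_def)
    fix X x assume X: "X \<in> Ob A" and x: "x \<in> carrier (Fob P1 X)" and tr: "d0 X x \<in> trace P0 X"
    have "d0' X (b X x) \<in> trace Q0 X" using trace_natural[OF c(1) tr X] b(2)[OF X x] by simp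
    then obtain z i where z: "z \<in> carrier (Fob Q2 X)" and i: "i \<in> trace Q1 X" and bx: "b X x = d1' X z \<otimes>\<^bsub>Fob Q1 X\<^esub> i"
      using ex X x cl unfolding stably_exact_def by meson
    have ic: "i \<in> carrier (Fob Q1 X)" using traceD(2)[OF add(6) X i] .
    have b'bx: "b' X (b X x) = b' X (d1' X z) \<otimes>\<^bsub>Fob P1 X\<^esub> b' X i"
      using X z ic cl by (simp add: bx natural_mult[OF b'(1)])
    have "d0 X (b' X (d1' X z)) = \<one>\<^bsub>Fob P0 X\<^esub>"
      using X z cl nat_exact_zero[OF qex(1) X z] natural_one[OF c'(1) add(7,3) X] by (simp add: b'(2))
    then obtain w where w: "w \<in> carrier (Fob P2 X)" "b' X (d1' X z) = d1 X w"
      using nat_exactD[OF pex(1) X] X z cl by metis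
    let ?k = "h X (d0 X x)"
    have "d0 X (b' X (b X x)) = d0 X (?k \<otimes>\<^bsub>Fob P1 X\<^esub> x)"
      using X x cl by (simp add: b' b h(2) natural_mult[OF nat(2)])
    then obtain v where v: "v \<in> carrier (Fob P2 X)" "b' X (b X x) = d1 X v \<otimes>\<^bsub>Fob P1 X\<^esub> (?k \<otimes>\<^bsub>Fob P1 X\<^esub> x)"
      using nat_exact_eqD[OF pex(1) add(2,3) nat(2) X, of "b' X (b X x)" "?k \<otimes>\<^bsub>Fob P1 X\<^esub> x"] X x cl add by auto
    have kt: "?k \<in> trace P1 X" using trace_natural[OF h(1) tr X] .
    have it: "b' X i \<in> trace P1 X" using trace_natural[OF b'(1) i X] .
    let ?m = "inv\<^bsub>Fob P1 X\<^esub> (d1 X v) \<otimes>\<^bsub>Fob P1 X\<^esub> inv\<^bsub>Fob P1 X\<^esub> ?k"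
    have kc: "?k \<in> carrier (Fob P1 X)" and vc: "d1 X v \<in> carrier (Fob P1 X)" and wc: "d1 X w \<in> carrier (Fob P1 X)"
      and bic: "b' X i \<in> carrier (Fob P1 X)"
      using X x v w ic cl by simp_all
    have "x = ?m \<otimes>\<^bsub>Fob P1 X\<^esub> (d1 X v \<otimes>\<^bsub>Fob P1 X\<^esub> (?k \<otimes>\<^bsub>Fob P1 X\<^esub> x))"
    proof -
      interpret G: comm_group "Fob P1 X" by (rule comm_group_Fob[OF add(2) X])
      have "?m \<otimes>\<^bsub>Fob P1 X\<^esub> (d1 X v \<otimes>\<^bsub>Fob P1 X\<^esub> (?k \<otimes>\<^bsub>Fob P1 X\<^esub> x))
        = (inv\<^bsub>Fob P1 X\<^esub> (d1 X v) \<otimes>\<^bsub>Fob P1 X\<^esub> d1 X v) \<otimes>\<^bsub>Fob P1 X\<^esub> ((inv\<^bsub>Fob P1 X\<^esub> ?k \<otimes>\<^bsub>Fob P1 X\<^esub> ?k) \<otimes>\<^bsub>Fob P1 X\<^esub> x)"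
        using kc vc x by (simp only: G.m_ac G.inv_closed G.m_closed)
      then show ?thesis using kc vc x by simp
    qed
    also have "\<dots> = ?m \<otimes>\<^bsub>Fob P1 X\<^esub> (d1 X w \<otimes>\<^bsub>Fob P1 X\<^esub> b' X i)" using v(2) b'bx w(2) by simp
    also have "\<dots> = d1 X (inv\<^bsub>Fob P2 X\<^esub> v \<otimes>\<^bsub>Fob P2 X\<^esub> w) \<otimes>\<^bsub>Fob P1 X\<^esub> (inv\<^bsub>Fob P1 X\<^esub> ?k \<otimes>\<^bsub>Fob P1 X\<^esub> b' X i)"
      using kc vc wc bic v(1) w(1) X add
      by (simp add: natural_mult[OF nat(1)] natural_inv[OF nat(1)] Fob_ac)
    finally show "\<exists>z\<in>carrier (Fob P2 X). \<exists>i\<in>trace P1 X. x = d1 X z \<otimes>\<^bsub>Fob P1 X\<^esub> i"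
      using v(1) w(1) kt it add X traceD(3,4)[OF add(2) X]
      by (intro bexI[of _ "inv\<^bsub>Fob P2 X\<^esub> v \<otimes>\<^bsub>Fob P2 X\<^esub> w"] bexI[of _ "inv\<^bsub>Fob P1 X\<^esub> ?k \<otimes>\<^bsub>Fob P1 X\<^esub> b' X i"]) simp_all
  qed
qed

section \<open>The stable category\<close>

lemma Union_constant_family:
  "\<lbrakk>\<And>x y. \<lbrakk>x \<in> S; y \<in> T\<rbrakk> \<Longrightarrow> H x y = U; s \<in> S; t \<in> T\<rbrakk> \<Longrightarrow> (\<Union>x\<in>S. \<Union>y\<in>T. H x y) = U"
  by blast

lemma Collect_image_eq:
  "\<lbrakk>S = k ` T; \<And>x. x \<in> T \<Longrightarrow> P (k x) \<longleftrightarrow> Q x\<rbrakk> \<Longrightarrow> {c \<in> S. P c} = k ` {x \<in> T. Q x}"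
  by auto

lemma image_eq_image_iff:
  "(\<And>z. z \<in> T \<Longrightarrow> c z \<in> V \<and> P (c z)) \<Longrightarrow>
    (\<lambda>z. k (c z)) ` T = k ` {x \<in> V. P x} \<longleftrightarrow> (\<forall>x\<in>V. P x \<longrightarrow> (\<exists>z\<in>T. k x = k (c z)))"
  by (auto simp: image_def)

lemma stab_simps:
  "Ob (stab A) = Ob A" "Hom (stab A) X Y = Hom A X Y Mod proj_arrs A X Y"
  "carrier (Hom A X Y Mod proj_arrs A X Y) = stab_arr A X Y ` Arr A X Y"
  by (auto simp: stab_def carrier_FactGroup stab_arr_def)

lemma stab_arr_eq_iff:
  "\<lbrakk>X \<in> Ob A; Y \<in> Ob A; f \<in> Arr A X Y; g \<in> Arr A X Y\<rbrakk>
    \<Longrightarrow> stab_arr A X Y f = stab_arr A X Y g \<longleftrightarrow> (\<exists>n\<in>proj_arrs A X Y. f = n \<otimes>\<^bsub>Hom A X Y\<^esub> g)"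
  unfolding stab_arr_def by (intro comm_group.rcos_eq_iff Hom_comm_group proj_arrs_subgroup)

lemma stab_arr_eq_zero_iff:
  "\<lbrakk>X \<in> Ob A; Y \<in> Ob A; f \<in> Arr A X Y\<rbrakk>
    \<Longrightarrow> stab_arr A X Y f = \<one>\<^bsub>Hom A X Y Mod proj_arrs A X Y\<^esub> \<longleftrightarrow> f \<in> proj_arrs A X Y"
  unfolding stab_arr_def one_FactGroup
  by (intro comm_group.rcos_eq_subgroup_iff Hom_comm_group proj_arrs_subgroup)

lemma stab_comp:
  assumes "X \<in> Ob A" "Y \<in> Ob A" "Z \<in> Ob A" "f \<in> Arr A X Y" "g \<in> Arr A Y Z"
  shows "Comp (stab A) X Y Z (stab_arr A Y Z g) (stab_arr A X Y f) = stab_arr A X Z (Comp A X Y Z g f)"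
proof -
  have mem: "h' \<in> stab_arr A U V h \<longleftrightarrow> (\<exists>n\<in>proj_arrs A U V. h' = n \<otimes>\<^bsub>Hom A U V\<^esub> h)" for U V h h'
    by (auto simp: stab_arr_def r_coset_def)
  have "stab_arr A X Z (Comp A X Y Z g' f') = stab_arr A X Z (Comp A X Y Z g f)"
    if "g' \<in> stab_arr A Y Z g" "f' \<in> stab_arr A X Y f" for g' f'
  proof -
    obtain n m where n: "n \<in> proj_arrs A Y Z" "g' = n \<otimes>\<^bsub>Hom A Y Z\<^esub> g" and m: "m \<in> proj_arrs A X Y" "f' = m \<otimes>\<^bsub>Hom A X Y\<^esub> f"
      using \<open>g' \<in> _\<close> \<open>f' \<in> _\<close> by (auto simp: mem)
    have "Comp A X Y Z g' f' = (Comp A X Y Z n m \<otimes>\<^bsub>Hom A X Z\<^esub> Comp A X Y Z g m \<otimes>\<^bsub>Hom A X Z\<^esub> Comp A X Y Z n f) \<otimes>\<^bsub>Hom A X Z\<^esub> Comp A X Y Z g f"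
      using assms n m by (simp add: comp_add_left comp_add_right add_ac)
    moreover have "Comp A X Y Z n m \<otimes>\<^bsub>Hom A X Z\<^esub> Comp A X Y Z g m \<otimes>\<^bsub>Hom A X Z\<^esub> Comp A X Y Z n f \<in> proj_arrs A X Z"
      using assms n m by (intro proj_arrs_add proj_arrs_comp_left proj_arrs_comp_right) auto
    ultimately show ?thesis using assms n m by (subst stab_arr_eq_iff) auto
  qed
  moreover have "g \<in> stab_arr A Y Z g" "f \<in> stab_arr A X Y f"
    using assms proj_arrs_zero by (auto simp: mem intro!: bexI[of _ "zero_arr A _ _"])
  ultimately have "(\<Union>g'\<in>stab_arr A Y Z g. \<Union>f'\<in>stab_arr A X Y f. stab_arr A X Z (Comp A X Y Z g' f')) =
      stab_arr A X Z (Comp A X Y Z g f)" by (rule Union_constant_family)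
  then show ?thesis by (simp add: stab_def)
qed

lemma resolution_Rep:
  assumes "gives_presentation A X Y Z f g F" "f \<in> Arr A X Y" "g \<in> Arr A Y Z" "X \<in> Ob A" "Y \<in> Ob A" "Z \<in> Ob A"
    "additive_functor A F"
  obtains \<pi> where "resolution (Rep A X) (Rep A Y) (Rep A Z) F (push A X Y f) (push A Y Z g) \<pi>"
  using assms natural_NatTr
  by (auto simp: gives_presentation_def resolution_def summand_of_Rep_Rep natural_NatTr[OF push_in_NatTr])

text \<open>For a resolution by representables, stable exactness is a contraction of
  \<open>X \<rightarrow> Y \<rightarrow> Z \<rightarrow> 0\<close> modulo projectives.\<close>

definition stably_split where
  "stably_split X Y Z f g \<longleftrightarrow>
     (\<exists>s\<in>Arr A Z Y. \<exists>p\<in>proj_arrs A Z Z. Ident A Z = Comp A Z Y Z g s \<otimes>\<^bsub>Hom A Z Z\<^esub> p) \<and>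
     (\<exists>s\<in>Arr A Z Y. \<exists>t\<in>Arr A Y X. \<exists>q\<in>proj_arrs A Y Y.
        Ident A Y = Comp A Y X Y f t \<otimes>\<^bsub>Hom A Y Y\<^esub> q \<otimes>\<^bsub>Hom A Y Y\<^esub> Comp A Y Z Y s g)"

text \<open>The identity of \<open>Z\<close> represents a generator of \<open>F\<close>; that its class lies in the trace means that the
  identity factors through a projective object modulo \<open>g\<close>.\<close>

lemma trace_full_iff_split:
  assumes "presentation Y Z g \<pi> F" "additive_functor A F"
  shows "(\<forall>X\<in>Ob A. carrier (Fob F X) \<subseteq> trace F X) \<longleftrightarrow>
    (\<exists>s\<in>Arr A Z Y. \<exists>p\<in>proj_arrs A Z Z. Ident A Z = Comp A Z Y Z g s \<otimes>\<^bsub>Hom A Z Z\<^esub> p)"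
proof
  note pD = presentationD[OF assms(1)]
  assume "\<forall>X\<in>Ob A. carrier (Fob F X) \<subseteq> trace F X"
  moreover have "\<pi> Z (Ident A Z) \<in> carrier (Fob F Z)" using natural_closed[OF pD(4)] pD(2) by simp
  ultimately have "\<pi> Z (Ident A Z) \<in> trace F Z" using pD(2) by auto
  then obtain P u x where P: "projective A P" "u \<in> Arr A Z P" "x \<in> carrier (Fob F P)" "\<pi> Z (Ident A Z) = Fmap F Z P u x"
    by (auto simp: trace_def)
  obtain v where v: "v \<in> Arr A P Z" "x = \<pi> P v" using pD(5)[OF projective_Ob[OF P(1)] P(3)] by auto
  have eq: "\<pi> Z (Ident A Z) = \<pi> Z (Comp A Z P Z v u)"
    using natural_Fmap[OF pD(4) P(2), of v] P v pD(2) projective_Ob by simp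
  have "\<exists>s\<in>Arr A Z Y. Ident A Z = Comp A Z Y Z g s \<otimes>\<^bsub>Hom A Z Z\<^esub> Comp A Z P Z v u"
    by (rule pD(7)[OF pD(2)]) (simp_all add: eq assms(2) P(1,2) v(1) pD(2) projective_Ob)
  moreover have "Comp A Z P Z v u \<in> proj_arrs A Z Z" using P(1,2) v(1) unfolding proj_arrs_def by blast
  ultimately show "\<exists>s\<in>Arr A Z Y. \<exists>p\<in>proj_arrs A Z Z. Ident A Z = Comp A Z Y Z g s \<otimes>\<^bsub>Hom A Z Z\<^esub> p" by blast
next
  note pD = presentationD[OF assms(1)]
  assume "\<exists>s\<in>Arr A Z Y. \<exists>p\<in>proj_arrs A Z Z. Ident A Z = Comp A Z Y Z g s \<otimes>\<^bsub>Hom A Z Z\<^esub> p"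
  then obtain s p where s: "s \<in> Arr A Z Y" and p: "p \<in> proj_arrs A Z Z"
    and eq: "Ident A Z = Comp A Z Y Z g s \<otimes>\<^bsub>Hom A Z Z\<^esub> p" by auto
  show "\<forall>X\<in>Ob A. carrier (Fob F X) \<subseteq> trace F X"
  proof (intro ballI subsetI)
    fix X x assume X: "X \<in> Ob A" and x: "x \<in> carrier (Fob F X)"
    obtain h where h: "h \<in> Arr A X Z" "x = \<pi> X h" using pD(5)[OF X x] by auto
    let ?a = "Comp A X Y Z g (Comp A X Z Y s h)" and ?b = "Comp A X Z Z p h"
    have ab: "?a \<in> Arr A X Z" "?b \<in> Arr A X Z" using X h s p pD(1-3) by simp_all
    have "h = Comp A X Z Z (Ident A Z) h" using X h pD by simp
    also have "\<dots> = ?a \<otimes>\<^bsub>Hom A X Z\<^esub> ?b"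
      unfolding eq using X h s p pD(1-3) by (simp add: comp_add_left Comp_assoc)
    finally have "\<pi> X h = \<pi> X ?a \<otimes>\<^bsub>Fob F X\<^esub> \<pi> X ?b" using natural_mult[OF pD(4), of ?a X ?b] X ab by simp
    moreover have "\<pi> X ?a = \<one>\<^bsub>Fob F X\<^esub>"
      using pD(6)[OF X ab(1)] X h s pD(1,2) by auto
    ultimately have "x = \<pi> X ?b" using natural_closed[OF pD(4), of ?b X] ab X h assms(2) by simp
    then show "x \<in> trace F X"
      using trace_natural[OF pD(4) _ X, of ?b] X h p pD(2) by (simp add: trace_Rep proj_arrs_comp_right)
  qed
qed

lemma resolution_RepD:
  assumes "resolution (Rep A X) (Rep A Y) (Rep A Z) F (push A X Y f) (push A Y Z g) \<pi>"
    "f \<in> Arr A X Y" "g \<in> Arr A Y Z" "X \<in> Ob A" "Y \<in> Ob A" "Z \<in> Ob A"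
  shows "presentation Y Z g \<pi> F" "Comp A X Y Z g f = zero_arr A X Z"
proof -
  show "presentation Y Z g \<pi> F" using assms by (simp add: presentation_iff_nat_exact resolution_def)
  have "nat_exact A (Rep A X) (Rep A Y) (Rep A Z) (push A X Y f) (push A Y Z g)" using assms by (simp add: resolution_def)
  from nat_exact_zero[OF this, of X "Ident A X"] show "Comp A X Y Z g f = zero_arr A X Z" using assms by simp
qed

text \<open>The contraction on \<open>Y\<close> comes from the element \<open>1 - s g\<close> of \<open>Hom(Y, Y)\<close>, which \<open>g\<close> sends to the map
  \<open>p g\<close> in the trace.  Conversely, composing the contraction with \<open>x\<close> writes \<open>x\<close> as \<open>f t x\<close> plus an
  element of the trace.\<close>

lemma stably_exact_iff_stably_split:
  assumes R: "resolution (Rep A X) (Rep A Y) (Rep A Z) F (push A X Y f) (push A Y Z g) \<pi>"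
    and [simp]: "f \<in> Arr A X Y" "g \<in> Arr A Y Z" "X \<in> Ob A" "Y \<in> Ob A" "Z \<in> Ob A"
  shows "stably_exact (Rep A X) (Rep A Y) (Rep A Z) F (push A X Y f) (push A Y Z g) \<longleftrightarrow> stably_split X Y Z f g"
proof -
  have p: "presentation Y Z g \<pi> F" and F: "additive_functor A F"
    using resolution_RepD[OF R] R by (simp_all add: resolution_def)
  note split = trace_full_iff_split[OF p F]
  show ?thesis
  proof
    assume E: "stably_exact (Rep A X) (Rep A Y) (Rep A Z) F (push A X Y f) (push A Y Z g)"
    then obtain s p where s[simp]: "s \<in> Arr A Z Y" and p: "p \<in> proj_arrs A Z Z"
      and eq: "Ident A Z = Comp A Z Y Z g s \<otimes>\<^bsub>Hom A Z Z\<^esub> p"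
      using split by (auto simp: stably_exact_def)
    have p': "p \<in> Arr A Z Z" using p by simp
    let ?x = "Ident A Y \<otimes>\<^bsub>Hom A Y Y\<^esub> inv\<^bsub>Hom A Y Y\<^esub> Comp A Y Z Y s g"
    have "g = Comp A Y Z Z (Ident A Z) g" by simp
    also have "\<dots> = Comp A Y Z Z p g \<otimes>\<^bsub>Hom A Y Z\<^esub> Comp A Y Y Z g (Comp A Y Z Y s g)"
      unfolding eq using p' by (simp add: comp_add_left Comp_assoc add_commute)
    finally have "g \<otimes>\<^bsub>Hom A Y Z\<^esub> inv\<^bsub>Hom A Y Z\<^esub> Comp A Y Y Z g (Comp A Y Z Y s g) = Comp A Y Z Z p g"
      using p' group.inv_solve_right'[of "Hom A Y Z" "Comp A Y Z Z p g" g "Comp A Y Y Z g (Comp A Y Z Y s g)"]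
      by (metis \<open>g \<in> Arr A Y Z\<close> \<open>Y \<in> Ob A\<close> \<open>Z \<in> Ob A\<close> comp_closed group_Hom s)
    then have "Comp A Y Y Z g ?x = Comp A Y Z Z p g"
      by (simp add: comp_add_right comp_neg_right)
    then have "push A Y Z g Y ?x \<in> trace (Rep A Z) Y"
      using p by (simp add: trace_Rep proj_arrs_comp_right)
    then obtain t q where t: "t \<in> Arr A Y X" and q: "q \<in> proj_arrs A Y Y" and x: "?x = Comp A Y X Y f t \<otimes>\<^bsub>Hom A Y Y\<^esub> q"
      using E[unfolded stably_exact_def, THEN conjunct2, THEN bspec, of Y, THEN bspec, of ?x] by (auto simp: trace_Rep)
    have "Ident A Y = ?x \<otimes>\<^bsub>Hom A Y Y\<^esub> Comp A Y Z Y s g"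
      by (simp add: add_assoc)
    then show "stably_split X Y Z f g"
      using s p eq t q unfolding x stably_split_def by blast
  next
    assume "stably_split X Y Z f g"
    then obtain s t q where s[simp]: "s \<in> Arr A Z Y" and t[simp]: "t \<in> Arr A Y X" and q: "q \<in> proj_arrs A Y Y"
      and eq: "Ident A Y = Comp A Y X Y f t \<otimes>\<^bsub>Hom A Y Y\<^esub> q \<otimes>\<^bsub>Hom A Y Y\<^esub> Comp A Y Z Y s g"
      and split': "\<exists>s\<in>Arr A Z Y. \<exists>p\<in>proj_arrs A Z Z. Ident A Z = Comp A Z Y Z g s \<otimes>\<^bsub>Hom A Z Z\<^esub> p"
      unfolding stably_split_def by blast
    have q': "q \<in> Arr A Y Y" using q by simp
    show "stably_exact (Rep A X) (Rep A Y) (Rep A Z) F (push A X Y f) (push A Y Z g)"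
      unfolding stably_exact_def
    proof (intro conjI[OF split[THEN iffD2]] ballI impI)
      show "\<exists>s\<in>Arr A Z Y. \<exists>p\<in>proj_arrs A Z Z. Ident A Z = Comp A Z Y Z g s \<otimes>\<^bsub>Hom A Z Z\<^esub> p"
        by (rule split')
      fix W x assume W[simp]: "W \<in> Ob A" and "x \<in> carrier (Fob (Rep A Y) W)" and "push A Y Z g W x \<in> trace (Rep A Z) W"
      then have x[simp]: "x \<in> Arr A W Y" and gx: "Comp A W Y Z g x \<in> proj_arrs A W Z" by (simp_all add: trace_Rep)
      let ?i = "Comp A W Y Y q x \<otimes>\<^bsub>Hom A W Y\<^esub> Comp A W Z Y s (Comp A W Y Z g x)"
      have "x = Comp A W Y Y (Ident A Y) x" by simp
      also have "\<dots> = Comp A W X Y f (Comp A W Y X t x) \<otimes>\<^bsub>Hom A W Y\<^esub> ?i"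
        unfolding eq using q' by (simp add: comp_add_left Comp_assoc add_assoc)
      finally have "x = push A X Y f W (Comp A W Y X t x) \<otimes>\<^bsub>Fob (Rep A Y) W\<^esub> ?i" by simp
      moreover have "?i \<in> trace (Rep A Y) W"
        using gx q by (simp add: trace_Rep proj_arrs_add proj_arrs_comp_left proj_arrs_comp_right)
      ultimately show "\<exists>z\<in>carrier (Fob (Rep A X) W). \<exists>i\<in>trace (Rep A Y) W. x = push A X Y f W z \<otimes>\<^bsub>Fob (Rep A Y) W\<^esub> i"
        by (intro bexI[of _ "Comp A W Y X t x"] bexI[of _ ?i]) simp_all
    qed
  qed
qed

text \<open>Hom groups of the stable category are quotients by the traces of representables, so this is
  stable exactness in terms of classes: the splitting of \<open>g\<close> says that \<open>F\<close> is its own trace, the weak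
  kernel property is exactness at \<open>Y\<close>.\<close>

lemma stably_exact_iff_stab:
  assumes R: "resolution (Rep A X) (Rep A Y) (Rep A Z) F (push A X Y f) (push A Y Z g) \<pi>"
    and [simp]: "f \<in> Arr A X Y" "g \<in> Arr A Y Z" "X \<in> Ob A" "Y \<in> Ob A" "Z \<in> Ob A"
  shows "stably_exact (Rep A X) (Rep A Y) (Rep A Z) F (push A X Y f) (push A Y Z g) \<longleftrightarrow>
    split_epic (stab A) Y Z (stab_arr A Y Z g) \<and> weak_kernel (stab A) X Y Z (stab_arr A X Y f) (stab_arr A Y Z g)"
proof -
  have p: "presentation Y Z g \<pi> F" and F: "additive_functor A F" and gf: "Comp A X Y Z g f = zero_arr A X Z"
    using resolution_RepD[OF R] R by (simp_all add: resolution_def)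
  have arr: "stab_arr A X Y f \<in> Arr (stab A) X Y" "stab_arr A Y Z g \<in> Arr (stab A) Y Z" by (simp_all add: stab_simps)
  have split: "split_epic (stab A) Y Z (stab_arr A Y Z g) \<longleftrightarrow> (\<forall>X\<in>Ob A. carrier (Fob F X) \<subseteq> trace F X)"
  proof -
    have "split_epic (stab A) Y Z (stab_arr A Y Z g) \<longleftrightarrow>
        (\<exists>s\<in>Arr A Z Y. stab_arr A Z Z (Ident A Z) = stab_arr A Z Z (Comp A Z Y Z g s))"
      using arr by (auto simp: split_epic_def stab_simps stab_comp) (auto simp: stab_def)
    also have "\<dots> \<longleftrightarrow> (\<exists>s\<in>Arr A Z Y. \<exists>p\<in>proj_arrs A Z Z. Ident A Z = Comp A Z Y Z g s \<otimes>\<^bsub>Hom A Z Z\<^esub> p)"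
      by (simp add: stab_arr_eq_iff add_commute cong: bex_cong)
    finally show ?thesis using trace_full_iff_split[OF p F] by simp
  qed
  have push: "push (stab A) V U (stab_arr A V U a) W (stab_arr A W V b) = stab_arr A W U (Comp A W V U a b)"
    if "U \<in> Ob A" "V \<in> Ob A" "W \<in> Ob A" "a \<in> Arr A V U" "b \<in> Arr A W V" for U V W a b
    using that by (simp add: push_def stab_simps stab_comp)
  have "weak_kernel (stab A) X Y Z (stab_arr A X Y f) (stab_arr A Y Z g) \<longleftrightarrow>
     (\<forall>W\<in>Ob A. \<forall>x\<in>Arr A W Y. Comp A W Y Z g x \<in> proj_arrs A W Z \<longrightarrow>
        (\<exists>z\<in>Arr A W X. stab_arr A W Y x = stab_arr A W Y (Comp A W X Y f z)))" (is "_ \<longleftrightarrow> ?R")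
  proof -
    have *: "push (stab A) X Y (stab_arr A X Y f) W ` carrier (Fob (Rep (stab A) X) W) =
        (\<lambda>z. stab_arr A W Y (Comp A W X Y f z)) ` Arr A W X"
      and **: "kernel (Fob (Rep (stab A) Y) W) (Fob (Rep (stab A) Z) W) (push (stab A) Y Z (stab_arr A Y Z g) W) =
        stab_arr A W Y ` {x \<in> Arr A W Y. Comp A W Y Z g x \<in> proj_arrs A W Z}" if W[simp]: "W \<in> Ob A" for W
    proof -
      show "push (stab A) X Y (stab_arr A X Y f) W ` carrier (Fob (Rep (stab A) X) W) =
        (\<lambda>z. stab_arr A W Y (Comp A W X Y f z)) ` Arr A W X"
        by (simp add: Rep_def stab_simps image_image push cong: image_cong)
      have "push (stab A) Y Z (stab_arr A Y Z g) W (stab_arr A W Y x) = \<one>\<^bsub>Fob (Rep (stab A) Z) W\<^esub> \<longleftrightarrow>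
          Comp A W Y Z g x \<in> proj_arrs A W Z" if "x \<in> Arr A W Y" for x
        using that by (simp add: Rep_def stab_simps push stab_arr_eq_zero_iff del: one_FactGroup)
      moreover have "carrier (Fob (Rep (stab A) Y) W) = stab_arr A W Y ` Arr A W Y" by (simp add: Rep_def stab_simps)
      ultimately show "kernel (Fob (Rep (stab A) Y) W) (Fob (Rep (stab A) Z) W) (push (stab A) Y Z (stab_arr A Y Z g) W) =
        stab_arr A W Y ` {x \<in> Arr A W Y. Comp A W Y Z g x \<in> proj_arrs A W Z}"
        unfolding kernel_def by (rule Collect_image_eq[rotated])
    qed
    have "Comp A W X Y f z \<in> Arr A W Y \<and> Comp A W Y Z g (Comp A W X Y f z) \<in> proj_arrs A W Z"
      if "W \<in> Ob A" "z \<in> Arr A W X" for W z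
      using that by (simp add: Comp_assoc gf proj_arrs_zero)
    then have "(\<lambda>z. stab_arr A W Y (Comp A W X Y f z)) ` Arr A W X =
        stab_arr A W Y ` {x \<in> Arr A W Y. Comp A W Y Z g x \<in> proj_arrs A W Z} \<longleftrightarrow>
      (\<forall>x\<in>Arr A W Y. Comp A W Y Z g x \<in> proj_arrs A W Z \<longrightarrow>
        (\<exists>z\<in>Arr A W X. stab_arr A W Y x = stab_arr A W Y (Comp A W X Y f z)))" if "W \<in> Ob A" for W
      using that by (intro image_eq_image_iff) blast
    then show ?thesis
      using arr by (simp add: weak_kernel_def nat_exact_def * ** stab_simps(1) cong: ball_cong)
  qed
  also have "\<dots> \<longleftrightarrow> (\<forall>W\<in>Ob A. \<forall>x\<in>carrier (Fob (Rep A Y) W). push A Y Z g W x \<in> trace (Rep A Z) W \<longrightarrow>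
        (\<exists>z\<in>carrier (Fob (Rep A X) W). \<exists>i\<in>trace (Rep A Y) W. x = push A X Y f W z \<otimes>\<^bsub>Fob (Rep A Y) W\<^esub> i))"
    by (simp add: trace_Rep stab_arr_eq_iff add_commute cong: ball_cong bex_cong)
  finally show ?thesis unfolding stably_exact_def split by simp
qed

end

section \<open>Cohomology in degree one\<close>

locale cochain3 =
  fixes K :: "nat \<Rightarrow> 'a monoid" and \<delta> :: "nat \<Rightarrow> 'a \<Rightarrow> 'a"
  assumes comm: "comm_group (K 0)" "comm_group (K 1)" "comm_group (K 2)"
    and hom: "\<delta> 0 \<in> hom (K 0) (K 1)" "\<delta> 1 \<in> hom (K 1) (K 2)"
    and zero: "x \<in> carrier (K 0) \<Longrightarrow> \<delta> 1 (\<delta> 0 x) = \<one>\<^bsub>K 2\<^esub>"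
begin

lemma cocycles_1: "cocycles K \<delta> 1 = (K 1)\<lparr>carrier := {y \<in> carrier (K 1). \<delta> 1 y = \<one>\<^bsub>K 2\<^esub>}\<rparr>"
  by (simp add: cocycles_def kernel_def numeral_2_eq_2)

lemma coboundaries_1: "coboundaries K \<delta> 1 = \<delta> 0 ` carrier (K 0)"
  by (simp add: coboundaries_def)

lemma comm_group_cocycles: "comm_group (cocycles K \<delta> 1)"
  unfolding cocycles_1
  using comm_subgroup[OF comm(2)] kernel_image_subgroup(2)[OF comm(2,3) hom(2)] by (simp add: kernel_def)

lemma subgroup_coboundaries: "subgroup (coboundaries K \<delta> 1) (K 1)"
  unfolding coboundaries_1 by (rule kernel_image_subgroup(1)[OF comm(1,2) hom(1)])

lemma coboundaries_subset: "coboundaries K \<delta> 1 \<subseteq> carrier (cocycles K \<delta> 1)"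
  unfolding cocycles_1 coboundaries_1 using hom(1) zero by (auto simp: hom_def)

lemma subgroup_coboundaries_cocycles: "subgroup (coboundaries K \<delta> 1) (cocycles K \<delta> 1)"
proof -
  interpret K1: comm_group "K 1" by (rule comm)
  have "subgroup {y \<in> carrier (K 1). \<delta> 1 y = \<one>\<^bsub>K 2\<^esub>} (K 1)"
    using kernel_image_subgroup(2)[OF comm(2,3) hom(2)] by (simp add: kernel_def)
  then show ?thesis
    using K1.subgroup_incl[OF subgroup_coboundaries] coboundaries_subset unfolding cocycles_1 by simp
qed

lemma trivial_cohomology_iff:
  "trivial_group (cohomology K \<delta> 1) \<longleftrightarrow>
    (\<forall>y\<in>carrier (K 1). \<delta> 1 y = \<one>\<^bsub>K 2\<^esub> \<longrightarrow> (\<exists>x\<in>carrier (K 0). y = \<delta> 0 x))"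
  unfolding cohomology_def comm_group.trivial_quotient_iff[OF comm_group_cocycles subgroup_coboundaries_cocycles]
  unfolding cocycles_1 coboundaries_1 by auto

end

section \<open>Morphisms and extensions out of a finitely presented functor\<close>

text \<open>\<open>0 \<rightarrow> G Z \<rightarrow> G Y \<rightarrow> G X\<close> is exact.  If \<open>X \<rightarrow> Y \<rightarrow> Z\<close> presents \<open>F\<close>, then by Yoneda this
  says that \<open>(F, G)\<close> and \<open>Ext\<^sup>1(F, G)\<close> vanish.\<close>

definition exact_on :: "('o, 'm, 'v) abfun \<Rightarrow> 'o \<Rightarrow> 'o \<Rightarrow> 'o \<Rightarrow> 'm \<Rightarrow> 'm \<Rightarrow> bool" where
  "exact_on G X Y Z f g \<longleftrightarrow>
     (\<forall>x\<in>carrier (Fob G Z). Fmap G Y Z g x = \<one>\<^bsub>Fob G Y\<^esub> \<longrightarrow> x = \<one>\<^bsub>Fob G Z\<^esub>) \<and>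
     (\<forall>y\<in>carrier (Fob G Y). Fmap G X Y f y = \<one>\<^bsub>Fob G X\<^esub> \<longrightarrow> (\<exists>x\<in>carrier (Fob G Z). y = Fmap G Y Z g x))"

context preadditive_category
begin

text \<open>By Yoneda, \<open>(F, G)\<close> is the group of the \<open>x\<close> in \<open>G Z\<close> whose transformation \<open>Hom(-, Z) \<rightarrow> G\<close> kills the image
  of \<open>g\<^sub>*\<close>, that is, the kernel of \<open>G g\<close>.\<close>

lemma trivial_NatTr_iff:
  assumes p: "presentation Y Z g \<pi> F" and F: "additive_functor C F" and G: "additive_functor C G"
  shows "trivial_group (NatTr C F G) \<longleftrightarrow>
    (\<forall>x\<in>carrier (Fob G Z). Fmap G Y Z g x = \<one>\<^bsub>Fob G Y\<^esub> \<longrightarrow> x = \<one>\<^bsub>Fob G Z\<^esub>)"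
proof -
  note pD = presentationD[OF p]
  have "group (NatTr C F G)" using comm_group_NatTr[OF F G] by (simp add: comm_group_def)
  then have triv: "trivial_group (NatTr C F G) \<longleftrightarrow> carrier (NatTr C F G) \<subseteq> {\<one>\<^bsub>NatTr C F G\<^esub>}"
    by (rule group.trivial_group_subset)
  have id: "\<pi> Z (Ident C Z) \<in> carrier (Fob F Z)" using natural_closed[OF pD(4)] pD(2) by simp
  show ?thesis
    unfolding triv
  proof (intro iffI ballI impI subsetI)
    fix x assume sub: "carrier (NatTr C F G) \<subseteq> {\<one>\<^bsub>NatTr C F G\<^esub>}"
      and x: "x \<in> carrier (Fob G Z)" and gx: "Fmap G Y Z g x = \<one>\<^bsub>Fob G Y\<^esub>"
    have "yon G Z x X h = \<one>\<^bsub>Fob G X\<^esub>" if X: "X \<in> Ob C" "h \<in> carrier (Fob (Rep C Z) X)" "\<pi> X h = \<one>\<^bsub>Fob F X\<^esub>" for X h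
    proof -
      obtain u where "u \<in> Arr C X Y" "h = Comp C X Y Z g u" using pD(6)[OF X(1), of h] X by auto
      then show ?thesis using X pD(1-3) x G gx by (simp add: yon_def Fmap_comp)
    qed
    moreover have "nat_surj C (Rep C Z) F \<pi>" using p by (simp add: presentation_def)
    ultimately obtain \<beta> where \<beta>: "natural C F G \<beta>" "\<And>X h. \<lbrakk>X \<in> Ob C; h \<in> Arr C X Z\<rbrakk> \<Longrightarrow> \<beta> X (\<pi> X h) = yon G Z x X h"
      using descend_along_surj[OF pD(4) _ natural_yon[OF G pD(2) x] additive_Rep[OF pD(2)] G F] by auto
    have "restrict_nat C F \<beta> = restrict_nat C F (\<lambda>X x. \<one>\<^bsub>Fob G X\<^esub>)"
      using subsetD[OF sub ext_in_NatTr[OF \<beta>(1) F]] by (simp add: NatTr_simps)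
    then have "restrict_nat C F \<beta> Z (\<pi> Z (Ident C Z)) = restrict_nat C F (\<lambda>X x. \<one>\<^bsub>Fob G X\<^esub>) Z (\<pi> Z (Ident C Z))" by simp
    then show "x = \<one>\<^bsub>Fob G Z\<^esub>" using \<beta>(2)[OF pD(2), of "Ident C Z"] pD(2) id x G by (simp add: yon_def)
  next
    fix \<eta> assume *: "\<forall>x\<in>carrier (Fob G Z). Fmap G Y Z g x = \<one>\<^bsub>Fob G Y\<^esub> \<longrightarrow> x = \<one>\<^bsub>Fob G Z\<^esub>"
      and \<eta>: "\<eta> \<in> carrier (NatTr C F G)"
    have nat: "natural C F G \<eta>" using \<eta> by (rule natural_NatTr)
    let ?x = "\<eta> Z (\<pi> Z (Ident C Z))"
    have comp: "\<eta> X (\<pi> X h) = Fmap G X Z h ?x" if "X \<in> Ob C" "h \<in> Arr C X Z" for X h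
      using yoneda[OF natural_compose[OF pD(4) nat] that(1) pD(2) that(2)] .
    have "\<pi> Y g = \<one>\<^bsub>Fob F Y\<^esub>" using pD(6)[OF pD(1,3)] pD(1-3) by (auto intro!: bexI[of _ "Ident C Y"])
    then have "Fmap G Y Z g ?x = \<one>\<^bsub>Fob G Y\<^esub>"
      using comp[OF pD(1,3)] natural_one[OF nat F G pD(1)] by simp
    then have x: "?x = \<one>\<^bsub>Fob G Z\<^esub>" using * natural_closed[OF nat id pD(2)] by blast
    have "\<eta> X y = \<one>\<^bsub>Fob G X\<^esub>" if X: "X \<in> Ob C" "y \<in> carrier (Fob F X)" for X y
    proof -
      obtain h where "h \<in> Arr C X Z" "y = \<pi> X h" using pD(5)[OF X] by auto
      then show ?thesis using comp[OF X(1)] x X(1) pD(2) G by simp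
    qed
    then have "\<eta> = restrict_nat C F (\<lambda>X x. \<one>\<^bsub>Fob G X\<^esub>)"
      by (intro NatTr_eqI[OF \<eta> ext_in_NatTr[OF natural_zero[OF F G] F]]) simp
    then show "\<eta> \<in> {\<one>\<^bsub>NatTr C F G\<^esub>}" by (simp add: NatTr_simps)
  qed
qed

lemma cochain3_Rep:
  assumes G: "additive_functor C G" and Ob: "\<And>n. R n \<in> Ob C"
    and d: "\<And>n. d n \<in> carrier (NatTr C (Rep C (R (Suc n))) (Rep C (R n)))"
    and "d 0 = push C (R 1) (R 0) g" "d 1 = push C (R 2) (R 1) f" "g \<in> Arr C (R 1) (R 0)" "f \<in> Arr C (R 2) (R 1)"
    and zero: "Comp C (R 2) (R 1) (R 0) g f = zero_arr C (R 2) (R 0)"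
  shows "cochain3 (\<lambda>k. NatTr C (Rep C (R k)) G) (\<lambda>k \<theta>. nat_comp C (Rep C (R (Suc k))) \<theta> (d k))"
proof -
  have nd: "natural C (Rep C (R (Suc n))) (Rep C (R n)) (d n)" for n using d by (rule natural_NatTr)
  have comm: "comm_group (NatTr C (Rep C (R n)) G)" for n by (rule comm_group_NatTr[OF additive_Rep[OF Ob] G])
  have clos: "nat_comp C (Rep C (R (Suc n))) \<theta> (d n) \<in> carrier (NatTr C (Rep C (R (Suc n))) G)"
    if "\<theta> \<in> carrier (NatTr C (Rep C (R n)) G)" for n \<theta>
    using natural_compose[OF nd natural_NatTr[OF that]] Ob by (simp add: NatTr_simps)
  have hom: "(\<lambda>\<theta>. nat_comp C (Rep C (R (Suc n))) \<theta> (d n)) \<in> hom (NatTr C (Rep C (R n)) G) (NatTr C (Rep C (R (Suc n))) G)" for n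
  proof (rule homI)
    fix \<theta> \<theta>' assume "\<theta> \<in> carrier (NatTr C (Rep C (R n)) G)" "\<theta>' \<in> carrier (NatTr C (Rep C (R n)) G)"
    show "nat_comp C (Rep C (R (Suc n))) (\<theta> \<otimes>\<^bsub>NatTr C (Rep C (R n)) G\<^esub> \<theta>') (d n) =
      nat_comp C (Rep C (R (Suc n))) \<theta> (d n) \<otimes>\<^bsub>NatTr C (Rep C (R (Suc n))) G\<^esub> nat_comp C (Rep C (R (Suc n))) \<theta>' (d n)"
      using natural_closed[OF nd[of n]] by (auto simp: NatTr_simps restrict_nat_def fun_eq_iff)
  qed (rule clos)
  have homs: "(\<lambda>\<theta>. nat_comp C (Rep C (R (Suc 0))) \<theta> (d 0)) \<in> hom (NatTr C (Rep C (R 0)) G) (NatTr C (Rep C (R 1)) G)"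
    "(\<lambda>\<theta>. nat_comp C (Rep C (R (Suc 1))) \<theta> (d 1)) \<in> hom (NatTr C (Rep C (R 1)) G) (NatTr C (Rep C (R 2)) G)"
    using hom[of 0] hom[of 1] by (simp_all add: numeral_2_eq_2)
  have zero': "nat_comp C (Rep C (R (Suc 1))) (nat_comp C (Rep C (R (Suc 0))) x (d 0)) (d 1) = \<one>\<^bsub>NatTr C (Rep C (R 2)) G\<^esub>"
    if x: "x \<in> carrier (NatTr C (Rep C (R 0)) G)" for x
  proof -
  have "x X (Comp C X (R 1) (R 0) g (Comp C X (R 2) (R 1) f h)) = \<one>\<^bsub>Fob G X\<^esub>" if "X \<in> Ob C" "h \<in> Arr C X (R 2)" for X h
    using that Ob assms(6,7) zero natural_one[OF natural_NatTr[OF x] additive_Rep[OF Ob] G that(1)] by (simp add: Comp_assoc)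
  then show ?thesis
    using Ob assms(4-7) by (auto simp: NatTr_simps restrict_nat_def fun_eq_iff numeral_2_eq_2)
  qed
  show ?thesis unfolding cochain3_def using comm homs zero' by blast
qed

text \<open>By Yoneda, the complex \<open>(P\<^sub>\<bullet>, G)\<close> is \<open>G(R 0) \<rightarrow> G(R 1) \<rightarrow> G(R 2) \<rightarrow> \<dots>\<close>.\<close>

lemma trivial_ExtFun_iff:
  assumes G: "additive_functor C G"
    and res: "(SOME (R, d, e). rep_resolution C F R d e) = (R, d, e)" "rep_resolution C F R d e"
    and d: "d 0 = push C (R 1) (R 0) g" "d 1 = push C (R 2) (R 1) f" "g \<in> Arr C (R 1) (R 0)" "f \<in> Arr C (R 2) (R 1)"
  shows "trivial_group (ExtFun C 1 F G) \<longleftrightarrow>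
    (\<forall>y\<in>carrier (Fob G (R 1)). Fmap G (R 2) (R 1) f y = \<one>\<^bsub>Fob G (R 2)\<^esub> \<longrightarrow>
      (\<exists>x\<in>carrier (Fob G (R 0)). y = Fmap G (R 1) (R 0) g x))"
proof -
  have Ob[simp]: "\<And>n. R n \<in> Ob C" and dn: "\<And>n. d n \<in> carrier (NatTr C (Rep C (R (Suc n))) (Rep C (R n)))"
    and ex: "nat_exact C (Rep C (R 2)) (Rep C (R 1)) (Rep C (R 0)) (d 1) (d 0)"
    using res(2) unfolding rep_resolution_def numeral_2_eq_2 by auto
  have zero: "Comp C (R 2) (R 1) (R 0) g f = zero_arr C (R 2) (R 0)"
    using nat_exact_zero[OF ex, of "R 2" "Ident C (R 2)"] d by simp
  interpret cochain3 "\<lambda>k. NatTr C (Rep C (R k)) G" "\<lambda>k \<theta>. nat_comp C (Rep C (R (Suc k))) \<theta> (d k)"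
    by (rule cochain3_Rep[OF G Ob dn d zero])
  have "trivial_group (ExtFun C 1 F G) \<longleftrightarrow>
     (\<forall>\<theta>\<in>carrier (NatTr C (Rep C (R 1)) G). nat_comp C (Rep C (R (Suc 1))) \<theta> (d 1) = \<one>\<^bsub>NatTr C (Rep C (R 2)) G\<^esub> \<longrightarrow>
        (\<exists>\<xi>\<in>carrier (NatTr C (Rep C (R 0)) G). \<theta> = nat_comp C (Rep C (R (Suc 0))) \<xi> (d 0)))"
    unfolding ExtFun_def res(1) prod.case by (rule trivial_cohomology_iff)
  also have "\<dots> \<longleftrightarrow> (\<forall>y\<in>carrier (Fob G (R 1)). Fmap G (R 2) (R 1) f y = \<one>\<^bsub>Fob G (R 2)\<^esub> \<longrightarrow>
      (\<exists>x\<in>carrier (Fob G (R 0)). y = Fmap G (R 1) (R 0) g x))"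
  proof (intro iffI ballI impI)
    fix y assume *: "\<forall>\<theta>\<in>carrier (NatTr C (Rep C (R 1)) G). nat_comp C (Rep C (R (Suc 1))) \<theta> (d 1) = \<one>\<^bsub>NatTr C (Rep C (R 2)) G\<^esub> \<longrightarrow>
        (\<exists>\<xi>\<in>carrier (NatTr C (Rep C (R 0)) G). \<theta> = nat_comp C (Rep C (R (Suc 0))) \<xi> (d 0))"
      and y: "y \<in> carrier (Fob G (R 1))" and fy: "Fmap G (R 2) (R 1) f y = \<one>\<^bsub>Fob G (R 2)\<^esub>"
    let ?\<theta> = "restrict_nat C (Rep C (R 1)) (yon G (R 1) y)"
    have "?\<theta> \<in> carrier (NatTr C (Rep C (R 1)) G)" using natural_yon[OF G Ob y] by simp
    moreover have "nat_comp C (Rep C (R (Suc 1))) ?\<theta> (d 1) = \<one>\<^bsub>NatTr C (Rep C (R 2)) G\<^esub>"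
      using d y G fy by (auto simp: NatTr_simps restrict_nat_def fun_eq_iff numeral_2_eq_2 yon_def Fmap_comp)
    ultimately obtain \<xi> where \<xi>: "\<xi> \<in> carrier (NatTr C (Rep C (R 0)) G)" "?\<theta> = nat_comp C (Rep C (R (Suc 0))) \<xi> (d 0)"
      using * by blast
    have nat: "natural C (Rep C (R 0)) G \<xi>" using \<xi>(1) by (rule natural_NatTr)
    have "?\<theta> (R 1) (Ident C (R 1)) = \<xi> (R 1) g" using \<xi>(2) d by (simp add: NatTr_simps)
    then have "y = Fmap G (R 1) (R 0) g (\<xi> (R 0) (Ident C (R 0)))"
      using yoneda[OF nat Ob Ob d(3)] y G by (simp add: yon_def)
    then show "\<exists>x\<in>carrier (Fob G (R 0)). y = Fmap G (R 1) (R 0) g x"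
      using natural_closed[OF nat, of "Ident C (R 0)" "R 0"] by auto
  next
    fix \<theta> assume *: "\<forall>y\<in>carrier (Fob G (R 1)). Fmap G (R 2) (R 1) f y = \<one>\<^bsub>Fob G (R 2)\<^esub> \<longrightarrow>
      (\<exists>x\<in>carrier (Fob G (R 0)). y = Fmap G (R 1) (R 0) g x)"
      and \<theta>: "\<theta> \<in> carrier (NatTr C (Rep C (R 1)) G)"
      and z: "nat_comp C (Rep C (R (Suc 1))) \<theta> (d 1) = \<one>\<^bsub>NatTr C (Rep C (R 2)) G\<^esub>"
    have nat: "natural C (Rep C (R 1)) G \<theta>" using \<theta> by (rule natural_NatTr)
    let ?y = "\<theta> (R 1) (Ident C (R 1))"
    have y: "?y \<in> carrier (Fob G (R 1))" using natural_closed[OF nat, of "Ident C (R 1)" "R 1"] by simp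
    have "nat_comp C (Rep C (R (Suc 1))) \<theta> (d 1) (R 2) (Ident C (R 2)) = \<theta> (R 2) f"
      using d by (simp add: NatTr_simps numeral_2_eq_2)
    then have "Fmap G (R 2) (R 1) f ?y = \<one>\<^bsub>Fob G (R 2)\<^esub>"
      using yoneda[OF nat Ob Ob d(4)] z by (simp add: NatTr_simps)
    then obtain x where x: "x \<in> carrier (Fob G (R 0))" "?y = Fmap G (R 1) (R 0) g x" using * y by blast
    let ?\<xi> = "restrict_nat C (Rep C (R 0)) (yon G (R 0) x)"
    have \<xi>: "?\<xi> \<in> carrier (NatTr C (Rep C (R 0)) G)" using natural_yon[OF G Ob x(1)] by simp
    moreover have "\<theta> = nat_comp C (Rep C (R (Suc 0))) ?\<xi> (d 0)"
    proof (rule NatTr_eqI[OF \<theta>, of _ G])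
      show "nat_comp C (Rep C (R (Suc 0))) ?\<xi> (d 0) \<in> carrier (NatTr C (Rep C (R 1)) G)"
        using natural_compose[OF natural_NatTr[OF dn[of 0]] natural_NatTr[OF \<xi>]] Ob by (simp add: NatTr_simps)
      fix X h assume X: "X \<in> Ob C" "h \<in> carrier (Fob (Rep C (R 1)) X)"
      then show "\<theta> X h = nat_comp C (Rep C (R (Suc 0))) ?\<xi> (d 0) X h"
        using yoneda[OF nat X(1) Ob, of h] x d G by (simp add: NatTr_simps yon_def Fmap_comp)
    qed
    ultimately show "\<exists>\<xi>\<in>carrier (NatTr C (Rep C (R 0)) G). \<theta> = nat_comp C (Rep C (R (Suc 0))) \<xi> (d 0)" by blast
  qed
  finally show ?thesis .
qed

end

context proj_abelian
begin

text \<open>As \<open>p\<close> is an epimorphism, \<open>k\<close> and \<open>k p\<close> have the same cokernel \<open>q\<close>; as \<open>g\<close> factors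
  through \<open>q\<close>, the kernel \<open>k\<close> of \<open>g\<close> is also a kernel of \<open>q\<close>.\<close>

lemma exact_at_kernel:
  assumes k: "is_kernel A Y Z g K k" and p: "epic A P K p" and Ob: "Y \<in> Ob A" "Z \<in> Ob A" "P \<in> Ob A" and g: "g \<in> Arr A Y Z"
  shows "exact_at A P Y Z (Comp A P K Y k p) g"
proof -
  have K: "K \<in> Ob A" "k \<in> Arr A K Y" "Comp A K Y Z g k = zero_arr A K Z"
    and univ: "\<And>W h. \<lbrakk>W \<in> Ob A; h \<in> Arr A W Y; Comp A W Y Z g h = zero_arr A W Z\<rbrakk>
        \<Longrightarrow> \<exists>!u. u \<in> Arr A W K \<and> Comp A W K Y k u = h"
    using k by (auto simp: is_kernel_def)
  have p': "p \<in> Arr A P K" and pe: "\<And>W u v. \<lbrakk>W \<in> Ob A; u \<in> Arr A K W; v \<in> Arr A K W; Comp A P K W u p = Comp A P K W v p\<rbrakk> \<Longrightarrow> u = v"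
    using p by (auto simp: epic_def)
  let ?f = "Comp A P K Y k p"
  have f: "?f \<in> Arr A P Y" using K p' Ob by simp
  obtain Q q where q: "is_cokernel A P Y ?f Q q" using ex_cokernel[OF Ob(3,1) f] by blast
  then have Q: "Q \<in> Ob A" "q \<in> Arr A Y Q" "Comp A P Y Q q ?f = zero_arr A P Q"
    and couniv: "\<And>W h. \<lbrakk>W \<in> Ob A; h \<in> Arr A Y W; Comp A P Y W h ?f = zero_arr A P W\<rbrakk>
        \<Longrightarrow> \<exists>u\<in>Arr A Q W. Comp A Y Q W u q = h"
    unfolding is_cokernel_def by blast+
  have "Comp A P Y Z g ?f = zero_arr A P Z" using K p' Ob g by (simp add: Comp_assoc)
  then obtain e where e: "e \<in> Arr A Q Z" "Comp A Y Q Z e q = g" using couniv[OF Ob(2) g] by blast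
  have "Comp A K Y Q q k = zero_arr A K Q"
    by (rule pe[OF Q(1)]) (use Q K p' Ob in \<open>simp_all flip: Comp_assoc\<close>)
  moreover have "Comp A W Y Z g h = zero_arr A W Z" if "W \<in> Ob A" "h \<in> Arr A W Y" "Comp A W Y Q q h = zero_arr A W Q" for W h
    using that e Q Ob by (simp flip: e(2) Comp_assoc)
  ultimately have "is_kernel A Y Q q K k"
    unfolding is_kernel_def using K univ by blast
  then show ?thesis unfolding exact_at_def using f g k q by blast
qed

lemma epic_ident: "X \<in> Ob A \<Longrightarrow> epic A X X (Ident A X)"
  by (simp add: epic_def)

lemma ex_presentation:
  assumes "finitely_presented A F"
  obtains X Y Z f g where "X \<in> Ob A" "Y \<in> Ob A" "Z \<in> Ob A" "f \<in> Arr A X Y" "g \<in> Arr A Y Z"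
    "left_exact_seq A X Y Z f g" "gives_presentation A X Y Z f g F"
proof -
  obtain Y Z g \<pi> where p: "presentation Y Z g \<pi> F" using assms by (auto simp: finitely_presented_iff)
  note pD = presentationD[OF p]
  obtain X f where k: "is_kernel A Y Z g X f" using ex_kernel[OF pD(1-3)] by blast
  then have X: "X \<in> Ob A" "f \<in> Arr A X Y" "Comp A X Y Z g f = zero_arr A X Z"
    and univ: "\<And>W h. \<lbrakk>W \<in> Ob A; h \<in> Arr A W Y; Comp A W Y Z g h = zero_arr A W Z\<rbrakk>
        \<Longrightarrow> \<exists>!u. u \<in> Arr A W X \<and> Comp A W X Y f u = h"
    by (auto simp: is_kernel_def)
  have mono: "u = v" if "W \<in> Ob A" "u \<in> Arr A W X" "v \<in> Arr A W X" "Comp A W X Y f u = Comp A W X Y f v" for W u v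
  proof -
    have "Comp A W Y Z g (Comp A W X Y f u) = zero_arr A W Z"
      using that X pD by (simp add: Comp_assoc)
    then show ?thesis using univ[of W "Comp A W X Y f u"] that X pD by (metis comp_closed)
  qed
  have lex: "left_exact_seq A X Y Z f g"
    using mono exact_at_kernel[OF k epic_ident[OF X(1)] pD(1,2) X(1) pD(3)] X pD(1)
    by (auto simp: left_exact_seq_def monic_def)
  have "nat_inj A (Rep A X) (push A X Y f)"
    using mono X pD(1) by (auto simp: nat_inj_def inj_on_def)
  moreover have "nat_exact A (Rep A X) (Rep A Y) (Rep A Z) (push A X Y f) (push A Y Z g)"
  proof (rule nat_exactI)
    show "natural A (Rep A X) (Rep A Y) (push A X Y f)"
      using natural_NatTr[OF push_in_NatTr] X pD(1) by blast
  qed (use univ X pD(1-3) in \<open>auto simp: Comp_assoc\<close>, metis push_apply)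
  moreover have "nat_exact A (Rep A Y) (Rep A Z) F (push A Y Z g) (restrict_nat A (Rep A Z) \<pi>) \<and> nat_surj A (Rep A Z) F (restrict_nat A (Rep A Z) \<pi>)"
  proof -
    have "presentation Y Z g (restrict_nat A (Rep A Z) \<pi>) F"
      using p natural_NatTr[OF ext_in_NatTr[OF pD(4)]] pD(2) by (simp add: presentation_def nat_surj_def)
    then show ?thesis using presentation_iff_nat_exact[OF pD(1-3) natural_NatTr[OF ext_in_NatTr[OF pD(4) additive_Rep[OF pD(2)]]]] by blast
  qed
  moreover have "restrict_nat A (Rep A Z) \<pi> \<in> carrier (NatTr A (Rep A Z) F)" using pD by simp
  ultimately have "gives_presentation A X Y Z f g F" unfolding gives_presentation_def by blast
  then show ?thesis using that X pD(1-3) lex by blast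
qed

text \<open>A presentation that starts with a kernel is already a resolution; it is continued by zero objects.\<close>

lemma ex_rep_resolution:
  assumes "finitely_presented A F"
  shows "\<exists>R d e. rep_resolution A F R d e"
proof -
  obtain X Y Z f g where Ob: "X \<in> Ob A" "Y \<in> Ob A" "Z \<in> Ob A" and fg: "f \<in> Arr A X Y" "g \<in> Arr A Y Z"
    and pres: "gives_presentation A X Y Z f g F" using ex_presentation[OF assms] .
  obtain N where N: "is_zero_object A N" using ex_zero_object by auto
  then have N': "N \<in> Ob A" by (simp add: is_zero_object_def)
  have to_O: "u = zero_arr A W N" if "W \<in> Ob A" "u \<in> Arr A W N" for W u
    using N that by (metis is_zero_object_def N' zero_closed)
  obtain \<pi> where \<pi>: "\<pi> \<in> carrier (NatTr A (Rep A Z) F)" "nat_inj A (Rep A X) (push A X Y f)"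
    "nat_exact A (Rep A X) (Rep A Y) (Rep A Z) (push A X Y f) (push A Y Z g)"
    "nat_exact A (Rep A Y) (Rep A Z) F (push A Y Z g) \<pi>" "nat_surj A (Rep A Z) F \<pi>"
    using pres by (auto simp: gives_presentation_def)
  define R where "R n = (if n = 0 then Z else if n = 1 then Y else if n = 2 then X else N)" for n :: nat
  define d where "d n = (if n = 0 then push A Y Z g else if n = 1 then push A X Y f else push A N (R n) (zero_arr A N (R n)))" for n :: nat
  have R: "R n \<in> Ob A" for n using Ob N' by (simp add: R_def)
  have d: "d n \<in> carrier (NatTr A (Rep A (R (Suc n))) (Rep A (R n)))" for n
    using Ob N' fg by (auto simp: d_def R_def)
  have z: "nat_exact A (Rep A N) (Rep A W) (Rep A V) (push A N W (zero_arr A N W)) \<beta>"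
    if "W \<in> Ob A" "V \<in> Ob A" "natural A (Rep A W) (Rep A V) \<beta>" "nat_inj A (Rep A W) \<beta>" for W V \<beta>
  proof (rule nat_exactI)
    have b1: "\<beta> U (zero_arr A U W) = zero_arr A U V" if "U \<in> Ob A" for U
      using natural_one[OF \<open>natural A (Rep A W) (Rep A V) \<beta>\<close>] \<open>W \<in> Ob A\<close> \<open>V \<in> Ob A\<close> that by simp
    show "natural A (Rep A N) (Rep A W) (push A N W (zero_arr A N W))"
      by (rule natural_NatTr, rule push_in_NatTr) (use N' \<open>W \<in> Ob A\<close> in simp_all)
    show "\<beta> U (push A N W (zero_arr A N W) U x) = \<one>\<^bsub>Fob (Rep A V) U\<^esub>" if "U \<in> Ob A" "x \<in> carrier (Fob (Rep A N) U)" for U x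
      using that N' \<open>W \<in> Ob A\<close> b1 by simp
    show "\<exists>x\<in>carrier (Fob (Rep A N) U). y = push A N W (zero_arr A N W) U x"
      if U: "U \<in> Ob A" and y: "y \<in> carrier (Fob (Rep A W) U)" and by1: "\<beta> U y = \<one>\<^bsub>Fob (Rep A V) U\<^esub>" for U y
    proof -
      have "y = zero_arr A U W"
        using \<open>nat_inj A (Rep A W) \<beta>\<close> U y by1 b1[OF U] \<open>W \<in> Ob A\<close> by (auto simp: nat_inj_def inj_on_def)
      then show ?thesis using U N' \<open>W \<in> Ob A\<close> by (intro bexI[of _ "zero_arr A U N"]) simp_all
    qed
  qed
  have inj_O: "nat_inj A (Rep A N) \<beta>" for \<beta> :: "'o \<Rightarrow> 'm \<Rightarrow> 'm"
    using to_O by (auto simp: nat_inj_def inj_on_def)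
  have "nat_exact A (Rep A (R (Suc (Suc n)))) (Rep A (R (Suc n))) (Rep A (R n)) (d (Suc n)) (d n)" for n
  proof (cases "n = 0")
    case True then show ?thesis using \<pi>(3) by (simp add: d_def R_def numeral_2_eq_2)
  next
    case False
    have "nat_inj A (Rep A (R (Suc n))) (d n)"
      using False \<pi>(2) inj_O by (auto simp: R_def d_def numeral_2_eq_2)
    then have "nat_exact A (Rep A N) (Rep A (R (Suc n))) (Rep A (R n)) (push A N (R (Suc n)) (zero_arr A N (R (Suc n)))) (d n)"
      by (intro z R natural_NatTr[OF d])
    moreover have "R (Suc (Suc n)) = N" using False by (simp add: R_def)
    moreover have "d (Suc n) = push A N (R (Suc n)) (zero_arr A N (R (Suc n)))"
      using False unfolding d_def by simp
    ultimately show ?thesis by simp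
  qed
  then have "rep_resolution A F R d \<pi>"
    unfolding rep_resolution_def using R d \<pi> by (simp add: R_def d_def)
  then show ?thesis by blast
qed

text \<open>One resolution by representables computes both groups for all coefficients.  Three types of
  coefficients are stated at once, because the same \<open>f\<close> and \<open>g\<close> have to serve all of them.\<close>

lemma trivial_Hom_Ext_iff_exact_on:
  assumes F: "finitely_presented A F"
  obtains X Y Z f g \<pi> where "X \<in> Ob A" "Y \<in> Ob A" "Z \<in> Ob A" "f \<in> Arr A X Y" "g \<in> Arr A Y Z"
    "resolution (Rep A X) (Rep A Y) (Rep A Z) F (push A X Y f) (push A Y Z g) \<pi>"
    "\<And>G :: ('o, 'm, 'a) abfun. additive_functor A G \<Longrightarrow>
      trivial_group (NatTr A F G) \<and> trivial_group (ExtFun A 1 F G) \<longleftrightarrow> exact_on G X Y Z f g"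
    "\<And>G :: ('o, 'm, 'b) abfun. additive_functor A G \<Longrightarrow>
      trivial_group (NatTr A F G) \<and> trivial_group (ExtFun A 1 F G) \<longleftrightarrow> exact_on G X Y Z f g"
    "\<And>G :: ('o, 'm, 'c) abfun. additive_functor A G \<Longrightarrow>
      trivial_group (NatTr A F G) \<and> trivial_group (ExtFun A 1 F G) \<longleftrightarrow> exact_on G X Y Z f g"
proof -
  obtain R d e where sel: "(SOME (R, d, e). rep_resolution A F R d e) = (R, d, e)" by (metis prod_cases3)
  have "case (SOME (R, d, e). rep_resolution A F R d e) of (R, d, e) \<Rightarrow> rep_resolution A F R d e"
    using ex_rep_resolution[OF F] by (intro someI_ex[of "\<lambda>(R, d, e). rep_resolution A F R d e"]) auto
  then have res: "rep_resolution A F R d e" by (simp add: sel)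
  have R: "\<And>n. R n \<in> Ob A" and dn: "\<And>n. d n \<in> carrier (NatTr A (Rep A (R (Suc n))) (Rep A (R n)))"
    and e: "e \<in> carrier (NatTr A (Rep A (R 0)) F)"
    and ex: "nat_exact A (Rep A (R 2)) (Rep A (R 1)) (Rep A (R 0)) (d 1) (d 0)"
      "nat_exact A (Rep A (R 1)) (Rep A (R 0)) F (d 0) e" "nat_surj A (Rep A (R 0)) F e"
    using res unfolding rep_resolution_def numeral_2_eq_2 by auto
  obtain g where g: "g \<in> Arr A (R 1) (R 0)" "d 0 = push A (R 1) (R 0) g"
    using NatTr_Rep_eq_push[of "d 0" "R 1" "R 0"] dn[of 0] R by auto
  obtain f where f: "f \<in> Arr A (R 2) (R 1)" "d 1 = push A (R 2) (R 1) f"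
    using NatTr_Rep_eq_push[of "d 1" "R 2" "R 1"] dn[of 1] R by (auto simp: numeral_2_eq_2)
  have add: "additive_functor A F" using F by (rule finitely_presented_additive)
  have reso: "resolution (Rep A (R 2)) (Rep A (R 1)) (Rep A (R 0)) F (push A (R 2) (R 1) f) (push A (R 1) (R 0) g) e"
    using ex g f R add natural_NatTr[OF push_in_NatTr] natural_NatTr[OF e]
    by (simp add: resolution_def summand_of_Rep_Rep)
  have p: "presentation (R 1) (R 0) g e F" using resolution_RepD(1)[OF reso f(1) g(1)] R by simp
  show ?thesis
    by (rule that[OF R R R f(1) g(1) reso])
      (simp_all only: trivial_NatTr_iff[OF p add] trivial_ExtFun_iff[OF _ sel res g(2) f(2) g(1) f(1)] exact_on_def)
qed

section \<open>Exactness on all coefficients forces stable splitting\<close>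

lemma Fmap_proj_arrs:
  assumes "additive_functor A G" "vanishes_on_projectives A G" "p \<in> proj_arrs A X Y" "X \<in> Ob A" "Y \<in> Ob A" "y \<in> carrier (Fob G Y)"
  shows "Fmap G X Y p y = \<one>\<^bsub>Fob G X\<^esub>"
proof -
  obtain P u v where P: "projective A P" "u \<in> Arr A X P" "v \<in> Arr A P Y" "p = Comp A X P Y v u"
    using assms(3) unfolding proj_arrs_def by blast
  then have "Fmap G X Y p y = Fmap G X P u (Fmap G P Y v y)" using assms by (simp add: Fmap_comp projective_Ob)
  also have "Fmap G P Y v y = \<one>\<^bsub>Fob G P\<^esub>" using vanishesD[OF assms(2) P(1)] P assms by (simp add: projective_Ob)
  finally show ?thesis using assms P by (simp add: projective_Ob)
qed

text \<open>\<open>G\<close> kills maps that factor through projectives, so the contraction of \<open>X \<rightarrow> Y \<rightarrow> Z\<close> becomes one of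
  \<open>G Z \<rightarrow> G Y \<rightarrow> G X\<close>.\<close>

lemma stably_split_imp_exact_on:
  assumes split: "stably_split X Y Z f g" and G: "additive_functor A G" "vanishes_on_projectives A G"
    and [simp]: "f \<in> Arr A X Y" "g \<in> Arr A Y Z" "X \<in> Ob A" "Y \<in> Ob A" "Z \<in> Ob A"
  shows "exact_on G X Y Z f g"
proof -
  obtain s s' t p q where s[simp]: "s \<in> Arr A Z Y" and s'[simp]: "s' \<in> Arr A Z Y" and t[simp]: "t \<in> Arr A Y X"
    and p: "p \<in> proj_arrs A Z Z" and q: "q \<in> proj_arrs A Y Y"
    and eq: "Ident A Z = Comp A Z Y Z g s \<otimes>\<^bsub>Hom A Z Z\<^esub> p"
      "Ident A Y = Comp A Y X Y f t \<otimes>\<^bsub>Hom A Y Y\<^esub> q \<otimes>\<^bsub>Hom A Y Y\<^esub> Comp A Y Z Y s' g"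
    using split unfolding stably_split_def by blast
  have pq: "p \<in> Arr A Z Z" "q \<in> Arr A Y Y" using p q by simp_all
  note G' = G(1) Fmap_proj_arrs[OF G p] Fmap_proj_arrs[OF G q]
  have 1: "x = Fmap G Z Y s (Fmap G Y Z g x)" if "x \<in> carrier (Fob G Z)" for x
  proof -
    have "x = Fmap G Z Z (Ident A Z) x" using that G by simp
    also have "\<dots> = Fmap G Z Y s (Fmap G Y Z g x)" unfolding eq(1) using that pq G' by (simp add: Fmap_add Fmap_comp)
    finally show ?thesis .
  qed
  have 2: "y = Fmap G Y X t (Fmap G X Y f y) \<otimes>\<^bsub>Fob G Y\<^esub> Fmap G Y Z g (Fmap G Z Y s' y)" if "y \<in> carrier (Fob G Y)" for y
  proof -
    have "y = Fmap G Y Y (Ident A Y) y" using that G by simp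
    also have "\<dots> = Fmap G Y X t (Fmap G X Y f y) \<otimes>\<^bsub>Fob G Y\<^esub> Fmap G Y Z g (Fmap G Z Y s' y)"
      unfolding eq(2) using that pq G' by (simp add: Fmap_add Fmap_comp)
    finally show ?thesis .
  qed
  show ?thesis
    unfolding exact_on_def
  proof (intro conjI ballI impI)
    fix x assume "x \<in> carrier (Fob G Z)" "Fmap G Y Z g x = \<one>\<^bsub>Fob G Y\<^esub>"
    then show "x = \<one>\<^bsub>Fob G Z\<^esub>" using 1[of x] G by simp
  next
    fix y assume y: "y \<in> carrier (Fob G Y)" "Fmap G X Y f y = \<one>\<^bsub>Fob G X\<^esub>"
    have "y = Fmap G Y Z g (Fmap G Z Y s' y)" using 2[of y] y G by simp
    then show "\<exists>x\<in>carrier (Fob G Z). y = Fmap G Y Z g x" using y(1) G by (intro bexI[of _ "Fmap G Z Y s' y"]) simp_all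
  qed
qed

text \<open>Adding a projective cover turns \<open>g\<close> and \<open>f\<close> into epimorphisms without changing them modulo
  projectives, so it suffices to test against epimorphisms \<open>p\<close>.\<close>

lemma stably_splitI:
  assumes [simp]: "f \<in> Arr A X Y" "g \<in> Arr A Y Z" "X \<in> Ob A" "Y \<in> Ob A" "Z \<in> Ob A"
    and 1: "\<And>V p. \<lbrakk>V \<in> Ob A; epic A V Z p; \<exists>v\<in>Arr A Y V. g = Comp A Y V Z p v\<rbrakk> \<Longrightarrow> \<exists>v\<in>Arr A Z V. Ident A Z = Comp A Z V Z p v"
    and 2: "\<And>V p. \<lbrakk>V \<in> Ob A; epic A V Y p; \<exists>v\<in>Arr A X V. f = Comp A X V Y p v\<rbrakk> \<Longrightarrow>
        \<exists>v\<in>Arr A Y V. \<exists>k\<in>Arr A Z Y. Ident A Y = Comp A Y V Y p v \<otimes>\<^bsub>Hom A Y Y\<^esub> Comp A Y Z Y k g"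
  shows "stably_split X Y Z f g"
proof -
  have cover: "\<exists>S k. S \<in> Ob A \<and> epic A S W k \<and> (\<exists>v\<in>Arr A U S. h = Comp A U S W k v) \<and>
      (\<forall>T\<in>Ob A. \<forall>v\<in>Arr A T S. \<exists>a\<in>Arr A T U. \<exists>b\<in>proj_arrs A T W. Comp A T S W k v = Comp A T U W h a \<otimes>\<^bsub>Hom A T W\<^esub> b)"
    if U[simp]: "U \<in> Ob A" and W[simp]: "W \<in> Ob A" and h[simp]: "h \<in> Arr A U W" for U W h
  proof -
    obtain P e where P: "projective A P" and [simp]: "P \<in> Ob A" and e: "epic A P W e" and [simp]: "e \<in> Arr A P W" using proj_cover[OF W] .
    obtain S k where [simp]: "S \<in> Ob A" "k \<in> Arr A S W" and
      k: "\<And>T u. \<lbrakk>T \<in> Ob A; u \<in> Arr A T S\<rbrakk> \<Longrightarrow> \<exists>a\<in>Arr A T U. \<exists>b\<in>Arr A T P.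
          Comp A T S W k u = Comp A T U W h a \<otimes>\<^bsub>Hom A T W\<^esub> Comp A T P W e b"
        "\<And>T a b. \<lbrakk>T \<in> Ob A; a \<in> Arr A T U; b \<in> Arr A T P\<rbrakk> \<Longrightarrow> \<exists>u\<in>Arr A T S.
          Comp A T S W k u = Comp A T U W h a \<otimes>\<^bsub>Hom A T W\<^esub> Comp A T P W e b"
      by (rule cotuple[of U P W h e]) auto
    obtain w where w: "w \<in> Arr A P S" "Comp A P S W k w = e"
      using k(2)[of P "zero_arr A P U" "Ident A P"] by auto
    obtain v where v: "v \<in> Arr A U S" "Comp A U S W k v = h"
      using k(2)[of U "Ident A U" "zero_arr A U P"] by auto
    have "epic A S W k"
      unfolding epic_def
    proof (intro conjI ballI impI)
      fix V x y assume *: "V \<in> Ob A" "x \<in> Arr A W V" "y \<in> Arr A W V" "Comp A S W V x k = Comp A S W V y k"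
      have "Comp A P W V x e = Comp A P S V (Comp A S W V x k) w" unfolding w(2)[symmetric] using * w(1) by (simp add: Comp_assoc)
      also have "\<dots> = Comp A P W V y e" unfolding *(4) w(2)[symmetric] using * w(1) by (simp add: Comp_assoc)
      finally show "x = y" using e * by (auto simp: epic_def)
    qed simp
    moreover have "\<exists>a\<in>Arr A T U. \<exists>b\<in>proj_arrs A T W. Comp A T S W k v = Comp A T U W h a \<otimes>\<^bsub>Hom A T W\<^esub> b"
      if "T \<in> Ob A" "v \<in> Arr A T S" for T v
    proof -
      obtain a b where ab: "a \<in> Arr A T U" "b \<in> Arr A T P" "Comp A T S W k v = Comp A T U W h a \<otimes>\<^bsub>Hom A T W\<^esub> Comp A T P W e b"
        using k(1)[OF \<open>T \<in> Ob A\<close> \<open>v \<in> Arr A T S\<close>] by blast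
      moreover have "Comp A T P W e b \<in> proj_arrs A T W"
        unfolding proj_arrs_def using P ab(2) \<open>e \<in> Arr A P W\<close> by blast
      ultimately show ?thesis by blast
    qed
    ultimately show ?thesis using v \<open>S \<in> Ob A\<close> by blast
  qed
  obtain S k where S: "S \<in> Ob A" "epic A S Z k" "\<exists>v\<in>Arr A Y S. g = Comp A Y S Z k v"
    and k: "\<And>T v. \<lbrakk>T \<in> Ob A; v \<in> Arr A T S\<rbrakk> \<Longrightarrow> \<exists>a\<in>Arr A T Y. \<exists>b\<in>proj_arrs A T Z. Comp A T S Z k v = Comp A T Y Z g a \<otimes>\<^bsub>Hom A T Z\<^esub> b"
    using cover[of Y Z g] assms(2,4,5) by blast
  obtain v where v: "v \<in> Arr A Z S" "Ident A Z = Comp A Z S Z k v" using 1[OF S] by blast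
  obtain s p where s: "s \<in> Arr A Z Y" "p \<in> proj_arrs A Z Z" "Comp A Z S Z k v = Comp A Z Y Z g s \<otimes>\<^bsub>Hom A Z Z\<^esub> p"
    using k[OF assms(5) v(1)] by blast
  obtain S' k' where S': "S' \<in> Ob A" "epic A S' Y k'" "\<exists>v\<in>Arr A X S'. f = Comp A X S' Y k' v"
    and k': "\<And>T v. \<lbrakk>T \<in> Ob A; v \<in> Arr A T S'\<rbrakk> \<Longrightarrow> \<exists>a\<in>Arr A T X. \<exists>b\<in>proj_arrs A T Y. Comp A T S' Y k' v = Comp A T X Y f a \<otimes>\<^bsub>Hom A T Y\<^esub> b"
    using cover[of X Y f] assms(1,3,4) by blast
  obtain v' s' where v': "v' \<in> Arr A Y S'" "s' \<in> Arr A Z Y" "Ident A Y = Comp A Y S' Y k' v' \<otimes>\<^bsub>Hom A Y Y\<^esub> Comp A Y Z Y s' g"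
    using 2[OF S'] by blast
  obtain t q where t: "t \<in> Arr A Y X" "q \<in> proj_arrs A Y Y" "Comp A Y S' Y k' v' = Comp A Y X Y f t \<otimes>\<^bsub>Hom A Y Y\<^esub> q"
    using k'[OF assms(4) v'(1)] by blast
  show ?thesis
    unfolding stably_split_def using s(1,2) v(2)[unfolded s(3)] t(1,2) v'(2) v'(3)[unfolded t(3)] by blast
qed

text \<open>The cokernel of \<open>p\<^sub>*\<close> vanishes on projectives because \<open>p\<close> is an epimorphism.  Its values are
  quotients of hom-groups, so they fit into any universe into which the hom-groups inject.\<close>

lemma coker_functor:
  assumes p: "epic A V W p" and Ob: "V \<in> Ob A" "W \<in> Ob A"
    and inj: "\<And>U. U \<in> Ob A \<Longrightarrow> \<exists>i :: 'm \<Rightarrow> 'v. inj_on i (Arr A U W)"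
  obtains Q :: "('o, 'm, 'v) abfun" and \<pi>
  where "additive_functor A Q" "vanishes_on_projectives A Q" "presentation V W p \<pi> Q"
proof -
  have p': "p \<in> Arr A V W" using p by (simp add: epic_def)
  define j :: "'o \<Rightarrow> 'm \<Rightarrow> 'v" where "j U = (SOME i. inj_on i (Arr A U W))" for U
  have j: "inj_on (j U) (carrier (Fob (Rep A W) U))" if "U \<in> Ob A" for U
    using someI_ex[OF inj[OF that]] by (simp add: j_def)
  have nat: "natural A (Rep A V) (Rep A W) (\<lambda>U h. Comp A U V W p h)" by (rule natural_comp_left[OF Ob p'])
  obtain Q :: "('o, 'm, 'v) abfun" and \<pi> where Q: "additive_functor A Q" "natural A (Rep A W) Q \<pi>" "nat_surj A (Rep A W) Q \<pi>"
    and ker: "\<And>U h. \<lbrakk>U \<in> Ob A; h \<in> carrier (Fob (Rep A W) U)\<rbrakk> \<Longrightarrow> \<pi> U h = \<one>\<^bsub>Fob Q U\<^esub> \<longleftrightarrow>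
        h \<in> (\<lambda>h. Comp A U V W p h) ` carrier (Fob (Rep A V) U)"
    using quotient_functor[OF additive_Rep[OF Ob(2)] subfunctorial_image[OF additive_Rep[OF Ob(1)] additive_Rep[OF Ob(2)] nat] j]
    by metis
  have pres: "presentation V W p \<pi> Q"
    using Q Ob p' ker by (auto simp: presentation_def)
  note pD = presentationD[OF pres]
  have "trivial_group (Fob Q P)" if P: "projective A P" for P
  proof -
    have "x = \<one>\<^bsub>Fob Q P\<^esub>" if x: "x \<in> carrier (Fob Q P)" for x
    proof -
      obtain h where h: "h \<in> Arr A P W" "x = \<pi> P h" using pD(5)[OF projective_Ob[OF P] x] by auto
      obtain v where "v \<in> Arr A P V" "Comp A P V W p v = h" using projective_lift[OF P p h(1) Ob] by auto
      then show ?thesis using pD(6)[OF projective_Ob[OF P] h(1)] h(2) by auto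
    qed
    then show ?thesis using Q(1) projective_Ob[OF P] by (auto simp: trivial_group_def)
  qed
  then show ?thesis using that Q(1) pres by (simp add: vanishes_on_projectives_def)
qed

text \<open>Let \<open>Q\<close> be the cokernel of \<open>p\<^sub>*\<close>.  If \<open>g\<close> factors through \<open>p\<close>, the class of the identity in \<open>Q Z\<close> is
  killed by \<open>Q g\<close>, hence zero, and \<open>p\<close> splits.  If \<open>f\<close> factors through \<open>p\<close>, the class of the identity in
  \<open>Q Y\<close> is killed by \<open>Q f\<close>, hence comes from the class of some \<open>k : Z \<rightarrow> Y\<close>, and \<open>1 - k g\<close> factors through \<open>p\<close>.\<close>

lemma stably_split_if_exact_on_cokers:
  fixes f :: 'm
  assumes [simp]: "f \<in> Arr A X Y" "g \<in> Arr A Y Z" "X \<in> Ob A" "Y \<in> Ob A" "Z \<in> Ob A"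
    and inj: "\<And>U W. \<lbrakk>U \<in> Ob A; W \<in> Ob A\<rbrakk> \<Longrightarrow> \<exists>i :: 'm \<Rightarrow> 'v. inj_on i (Arr A U W)"
    and ex: "\<And>V W p (Q :: ('o, 'm, 'v) abfun) \<pi>. \<lbrakk>additive_functor A Q; vanishes_on_projectives A Q; presentation V W p \<pi> Q\<rbrakk>
      \<Longrightarrow> exact_on Q X Y Z f g"
  shows "stably_split X Y Z f g"
proof (rule stably_splitI)
  fix V p assume V: "V \<in> Ob A" and p: "epic A V Z p" and v: "\<exists>v\<in>Arr A Y V. g = Comp A Y V Z p v"
  obtain Q :: "('o, 'm, 'v) abfun" and \<pi> where Q: "additive_functor A Q" "vanishes_on_projectives A Q" "presentation V Z p \<pi> Q"
    using coker_functor[OF p V \<open>Z \<in> Ob A\<close> inj[OF _ \<open>Z \<in> Ob A\<close>]] by blast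
  note pD = presentationD[OF Q(3)]
  let ?x = "\<pi> Z (Ident A Z)"
  have x: "?x \<in> carrier (Fob Q Z)" using natural_closed[OF pD(4), of "Ident A Z" Z] by simp
  have "Fmap Q Y Z g ?x = \<pi> Y g" using yoneda[OF pD(4), of Y g] by simp
  also have "\<dots> = \<one>\<^bsub>Fob Q Y\<^esub>" using pD(6)[of Y g] v by simp
  finally have "?x = \<one>\<^bsub>Fob Q Z\<^esub>" using ex[OF Q] x by (simp add: exact_on_def)
  then show "\<exists>v\<in>Arr A Z V. Ident A Z = Comp A Z V Z p v" using pD(6)[of Z "Ident A Z"] by simp
next
  fix V p assume V: "V \<in> Ob A" and p: "epic A V Y p" and v: "\<exists>v\<in>Arr A X V. f = Comp A X V Y p v"
  obtain Q :: "('o, 'm, 'v) abfun" and \<pi> where Q: "additive_functor A Q" "vanishes_on_projectives A Q" "presentation V Y p \<pi> Q"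
    using coker_functor[OF p V \<open>Y \<in> Ob A\<close> inj[OF _ \<open>Y \<in> Ob A\<close>]] by blast
  note pD = presentationD[OF Q(3)]
  let ?y = "\<pi> Y (Ident A Y)"
  have y: "?y \<in> carrier (Fob Q Y)" using natural_closed[OF pD(4), of "Ident A Y" Y] by simp
  have "Fmap Q X Y f ?y = \<pi> X f" using yoneda[OF pD(4), of X f] by simp
  also have "\<dots> = \<one>\<^bsub>Fob Q X\<^esub>" using pD(6)[of X f] v by simp
  finally obtain x where x: "x \<in> carrier (Fob Q Z)" "?y = Fmap Q Y Z g x" using ex[OF Q] y unfolding exact_on_def by blast
  obtain k where k: "k \<in> Arr A Z Y" "x = \<pi> Z k" using pD(5)[OF _ x(1)] by auto
  have "?y = \<pi> Y (Comp A Y Z Y k g)" unfolding x(2) k(2) using natural_Fmap[OF pD(4), of g Y Z k] k(1) by simp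
  then show "\<exists>v\<in>Arr A Y V. \<exists>k\<in>Arr A Z Y. Ident A Y = Comp A Y V Y p v \<otimes>\<^bsub>Hom A Y Y\<^esub> Comp A Y Z Y k g"
    using pD(7)[of Y "Ident A Y" "Comp A Y Z Y k g"] k(1) Q(1) by auto
qed simp_all

section \<open>Exact sequences and projective resolutions\<close>

lemma kernel_cancel:
  assumes "is_kernel A X Y f K k" "W \<in> Ob A" "X \<in> Ob A" "Y \<in> Ob A" "f \<in> Arr A X Y" "u \<in> Arr A W K" "v \<in> Arr A W K"
    "Comp A W K X k u = Comp A W K X k v"
  shows "u = v"
proof -
  have k: "K \<in> Ob A" "k \<in> Arr A K X" "Comp A K X Y f k = zero_arr A K Y" using assms(1) by (auto simp: is_kernel_def)
  have "Comp A W X Y f (Comp A W K X k u) = zero_arr A W Y" using k assms(2-7) by (simp add: Comp_assoc)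
  then have "\<exists>!w. w \<in> Arr A W K \<and> Comp A W K X k w = Comp A W K X k u"
    using assms k unfolding is_kernel_def by (metis comp_closed)
  then show ?thesis using assms(6-8) by metis
qed

lemma kernel_lift:
  "\<lbrakk>is_kernel A X Y f K k; W \<in> Ob A; h \<in> Arr A W X; Comp A W X Y f h = zero_arr A W Y\<rbrakk>
    \<Longrightarrow> \<exists>u\<in>Arr A W K. Comp A W K X k u = h"
  unfolding is_kernel_def by blast

lemma cokernel_factor:
  "\<lbrakk>is_cokernel A X Y f Q q; W \<in> Ob A; h \<in> Arr A Y W; Comp A X Y W h f = zero_arr A X W\<rbrakk>
    \<Longrightarrow> \<exists>u\<in>Arr A Q W. Comp A Y Q W u q = h"
  unfolding is_cokernel_def by blast

lemma epicI_zero: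
  assumes "f \<in> Arr A X Y" "X \<in> Ob A" "Y \<in> Ob A"
    "\<And>W u. \<lbrakk>W \<in> Ob A; u \<in> Arr A Y W; Comp A X Y W u f = zero_arr A X W\<rbrakk> \<Longrightarrow> u = zero_arr A Y W"
  shows "epic A X Y f"
  unfolding epic_def
proof (intro conjI ballI impI)
  fix W u v assume W: "W \<in> Ob A" and u: "u \<in> Arr A Y W" and v: "v \<in> Arr A Y W" and eq: "Comp A X Y W u f = Comp A X Y W v f"
  have "u \<otimes>\<^bsub>Hom A Y W\<^esub> inv\<^bsub>Hom A Y W\<^esub> v = zero_arr A Y W"
    by (rule assms(4)[OF W]) (use assms(1-3) W u v eq in \<open>simp_all add: comp_add_left comp_neg_left\<close>)
  then show "u = v" using group.inv_solve_right'[of "Hom A Y W" "zero_arr A Y W" u v] W u v assms(3) by simp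
qed fact

lemma epic_cancel:
  "\<lbrakk>epic A X Y f; W \<in> Ob A; u \<in> Arr A Y W; v \<in> Arr A Y W; Comp A X Y W u f = Comp A X Y W v f\<rbrakk> \<Longrightarrow> u = v"
  by (auto simp: epic_def)

text \<open>In an exact sequence, the first map is an epimorphism onto the kernel of the second.  If
  \<open>d f' = 0\<close>, then the kernel of \<open>d\<close> gives a subobject of \<open>Y\<close> that contains the image of \<open>f\<close>,
  and it is normal, hence contains the kernel of the cokernel of \<open>f\<close>.\<close>

lemma exact_at_factor:
  assumes ex: "exact_at A X Y Z f g" and Ob: "X \<in> Ob A" "Y \<in> Ob A" "Z \<in> Ob A"
  obtains K k f' where "K \<in> Ob A" "is_kernel A Y Z g K k" "k \<in> Arr A K Y" "f' \<in> Arr A X K" "Comp A X K Y k f' = f" "epic A X K f'"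
proof -
  obtain Q q K k where f: "f \<in> Arr A X Y" and g: "g \<in> Arr A Y Z" and c: "is_cokernel A X Y f Q q" and kq: "is_kernel A Y Q q K k"
    and kg: "is_kernel A Y Z g K k" using ex by (auto simp: exact_at_def)
  have Q: "Q \<in> Ob A" "q \<in> Arr A Y Q" "Comp A X Y Q q f = zero_arr A X Q" using c by (auto simp: is_cokernel_def)
  have K: "K \<in> Ob A" "k \<in> Arr A K Y" "Comp A K Y Q q k = zero_arr A K Q" using kq by (auto simp: is_kernel_def)
  obtain f' where f': "f' \<in> Arr A X K" "Comp A X K Y k f' = f" using kernel_lift[OF kq Ob(1) f Q(3)] by auto
  have "epic A X K f'"
  proof (rule epicI_zero[OF f'(1) Ob(1) K(1)])
    fix W d assume W: "W \<in> Ob A" and d: "d \<in> Arr A K W" and df: "Comp A X K W d f' = zero_arr A X W"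
    obtain M m where m: "is_kernel A K W d M m" using ex_kernel[OF K(1) W d] by blast
    then have M: "M \<in> Ob A" "m \<in> Arr A M K" "Comp A M K W d m = zero_arr A M W" by (auto simp: is_kernel_def)
    obtain f'' where f'': "f'' \<in> Arr A X M" "Comp A X M K m f'' = f'" using kernel_lift[OF m Ob(1) f'(1) df] by auto
    have "monic A M Y (Comp A M K Y k m)"
      unfolding monic_def
    proof (intro conjI ballI impI)
      show "Comp A M K Y k m \<in> Arr A M Y" using M K Ob by simp
      fix V u v assume V: "V \<in> Ob A" and u: "u \<in> Arr A V M" and v: "v \<in> Arr A V M"
        and eq: "Comp A V M Y (Comp A M K Y k m) u = Comp A V M Y (Comp A M K Y k m) v"
      have "Comp A V M K m u = Comp A V M K m v"
        by (rule kernel_cancel[OF kq V Ob(2) Q(1,2)]) (use M K Ob V u v eq in \<open>simp_all add: Comp_assoc\<close>)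
      then show "u = v" by (rule kernel_cancel[OF m V K(1) W d u v])
    qed
    then obtain T z where T: "T \<in> Ob A" "z \<in> Arr A Y T" and kz: "is_kernel A Y T z M (Comp A M K Y k m)"
      using monic_normal[OF M(1) Ob(2)] by blast
    then have z0: "Comp A M Y T z (Comp A M K Y k m) = zero_arr A M T" by (simp add: is_kernel_def)
    have "f = Comp A X M Y (Comp A M K Y k m) f''" using f' f'' M K Ob by (simp flip: Comp_assoc)
    then have "Comp A X Y T z f = Comp A X M T (Comp A M Y T z (Comp A M K Y k m)) f''"
      using M K Ob T f'' by (simp add: Comp_assoc)
    then have "Comp A X Y T z f = zero_arr A X T" using z0 f'' M Ob T by simp
    then obtain z' where z': "z' \<in> Arr A Q T" "Comp A Y Q T z' q = z" using cokernel_factor[OF c T] by auto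
    have "Comp A K Y T z k = zero_arr A K T" unfolding z'(2)[symmetric] using z'(1) Q K Ob T by (simp flip: Comp_assoc)
    then obtain r where r: "r \<in> Arr A K M" "Comp A K M Y (Comp A M K Y k m) r = k" using kernel_lift[OF kz K(1,2)] by auto
    have "Comp A K M K m r = Ident A K"
      by (rule kernel_cancel[OF kq K(1) Ob(2) Q(1,2)]) (use M K Ob r in \<open>simp_all add: Comp_assoc\<close>)
    then have "d = Comp A K K W d (Comp A K M K m r)" using d K W by simp
    also have "\<dots> = zero_arr A K W" using M K W d r by (simp add: Comp_assoc)
    finally show "d = zero_arr A K W" .
  qed
  then show ?thesis using that K kg f' by blast
qed

lemma exact_at_zero:
  assumes ex: "exact_at A X Y Z f g" and Ob: "X \<in> Ob A" "Y \<in> Ob A" "Z \<in> Ob A"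
  shows "Comp A X Y Z g f = zero_arr A X Z"
proof -
  obtain K k f' where *: "K \<in> Ob A" "is_kernel A Y Z g K k" "k \<in> Arr A K Y" "f' \<in> Arr A X K" "Comp A X K Y k f' = f"
    using exact_at_factor[OF assms] by metis
  have "Comp A K Y Z g k = zero_arr A K Z" "g \<in> Arr A Y Z" using * ex by (auto simp: is_kernel_def exact_at_def)
  then show ?thesis unfolding *(5)[symmetric] using *(1,3,4) Ob by (simp add: Comp_assoc)
qed

text \<open>The difference \<open>u - v\<close> factors through the kernel of \<open>g\<close>, onto which \<open>f\<close> is an epimorphism.\<close>

lemma exact_at_lift:
  assumes ex: "exact_at A X Y Z f g" and Ob: "X \<in> Ob A" "Y \<in> Ob A" "Z \<in> Ob A"
    and P: "projective A P" and u: "u \<in> Arr A P Y" and v: "v \<in> Arr A P Y" and eq: "Comp A P Y Z g u = Comp A P Y Z g v"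
  shows "\<exists>w\<in>Arr A P X. u = Comp A P X Y f w \<otimes>\<^bsub>Hom A P Y\<^esub> v"
proof -
  have P': "P \<in> Ob A" using P by (rule projective_Ob)
  have g: "g \<in> Arr A Y Z" using ex by (simp add: exact_at_def)
  obtain K k f' where *: "K \<in> Ob A" "is_kernel A Y Z g K k" "k \<in> Arr A K Y" "f' \<in> Arr A X K" "Comp A X K Y k f' = f" "epic A X K f'"
    using exact_at_factor[OF ex Ob] by metis
  let ?d = "u \<otimes>\<^bsub>Hom A P Y\<^esub> inv\<^bsub>Hom A P Y\<^esub> v"
  have d: "?d \<in> Arr A P Y" using u v P' Ob by simp
  have "Comp A P Y Z g ?d = zero_arr A P Z" using u v P' Ob g eq by (simp add: comp_add_right comp_neg_right)
  then obtain c where c: "c \<in> Arr A P K" "Comp A P K Y k c = ?d" using kernel_lift[OF *(2) P' d] by auto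
  obtain w where w: "w \<in> Arr A P X" "Comp A P X K f' w = c" using projective_lift[OF P *(6) c(1) Ob(1) *(1)] by auto
  have "Comp A P X Y f w = ?d" unfolding *(5)[symmetric] c(2)[symmetric] w(2)[symmetric] using w(1) *(1,3,4) P' Ob by (simp add: Comp_assoc)
  then have "Comp A P X Y f w \<otimes>\<^bsub>Hom A P Y\<^esub> v = u" using u v P' Ob by (simp add: add_assoc)
  then show ?thesis using w(1) by metis
qed

text \<open>The epimorphism \<open>e\<close> is a cokernel of some \<open>w\<close>, which factors through the kernel of \<open>e\<close>; on this kernel
  \<open>h\<close> vanishes, because it does so after composition with the epimorphism \<open>f'\<close>.\<close>

lemma exact_at_epic_factor:
  assumes ex: "exact_at A X Y Z f e" and Ob: "X \<in> Ob A" "Y \<in> Ob A" "Z \<in> Ob A" and e: "epic A Y Z e"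
    and h: "h \<in> Arr A Y W" "W \<in> Ob A" "Comp A X Y W h f = zero_arr A X W"
  shows "\<exists>y\<in>Arr A Z W. h = Comp A Y Z W y e"
proof -
  obtain K k f' where *: "K \<in> Ob A" "is_kernel A Y Z e K k" "k \<in> Arr A K Y" "f' \<in> Arr A X K" "Comp A X K Y k f' = f" "epic A X K f'"
    using exact_at_factor[OF ex Ob] by metis
  have hkf: "Comp A X K W (Comp A K Y W h k) f' = zero_arr A X W"
    using h(3) unfolding *(5)[symmetric] using *(1,3,4) h(1,2) Ob by (simp add: Comp_assoc)
  have hk: "Comp A K Y W h k = zero_arr A K W"
  proof (rule epic_cancel[OF *(6) h(2)])
    show "Comp A X K W (Comp A K Y W h k) f' = Comp A X K W (zero_arr A K W) f'"
      using hkf *(1,4) h(2) Ob by simp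
  qed (use *(1,3) h(1,2) Ob in simp_all)
  obtain V w where w: "V \<in> Ob A" "w \<in> Arr A V Y" and c: "is_cokernel A V Y w Z e" using epic_normal[OF Ob(2,3) e] by blast
  have "Comp A V Y Z e w = zero_arr A V Z" using c by (simp add: is_cokernel_def)
  then obtain w' where w': "w' \<in> Arr A V K" "Comp A V K Y k w' = w" using kernel_lift[OF *(2) w] by auto
  have "Comp A V Y W h w = zero_arr A V W" unfolding w'(2)[symmetric] using w'(1) w *(1,3) h(1,2) Ob hk by (simp add: Comp_assoc)
  then show ?thesis using cokernel_factor[OF c h(2,1)] by metis
qed

text \<open>Dependent choice along triples \<open>(Y, Z, g)\<close>, the last differential \<open>g : Y \<rightarrow> Z\<close> found so far; the next
  one covers its kernel.\<close>

lemma ex_proj_resolution: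
  assumes X: "X \<in> Ob A"
  shows "\<exists>P d e. proj_resolution A X P d e"
proof -
  obtain P0 e where P0: "projective A P0" "epic A P0 X e" "e \<in> Arr A P0 X" using proj_cover[OF X] by metis
  define ok where "ok n s \<longleftrightarrow> (case s of (Y, Z, g) \<Rightarrow> projective A Y \<and> Z \<in> Ob A \<and> g \<in> Arr A Y Z \<and>
      (n = 0 \<longrightarrow> (Y, Z, g) = (P0, X, e)))" for n :: nat and s
  define step where "step s s' \<longleftrightarrow> (case s of (Y, Z, g) \<Rightarrow> case s' of (Y', Z', g') \<Rightarrow> Z' = Y \<and> exact_at A Y' Y Z g' g)" for s s'
  have "\<exists>s. \<forall>n. ok n (s n) \<and> step (s n) (s (Suc n))"
  proof (rule dependent_nat_choice[of ok "\<lambda>n. step"])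
    show "\<exists>x. ok 0 x" using P0 X by (auto simp: ok_def)
    fix x and n :: nat assume "ok n x"
    moreover obtain Y Z g where x: "x = (Y, Z, g)" by (cases x)
    ultimately have Y: "projective A Y" "Y \<in> Ob A" "Z \<in> Ob A" "g \<in> Arr A Y Z" by (auto simp: ok_def projective_Ob)
    obtain K k where k: "is_kernel A Y Z g K k" using ex_kernel[OF Y(2-4)] by blast
    then have K: "K \<in> Ob A" "k \<in> Arr A K Y" by (auto simp: is_kernel_def)
    obtain P p where P: "projective A P" "P \<in> Ob A" "epic A P K p" "p \<in> Arr A P K" using proj_cover[OF K(1)] .
    have "exact_at A P Y Z (Comp A P K Y k p) g" by (rule exact_at_kernel[OF k P(3) Y(2,3) P(2) Y(4)])
    then show "\<exists>y. ok (Suc n) y \<and> step x y"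
      using P K Y x by (intro exI[of _ "(P, Y, Comp A P K Y k p)"]) (simp add: ok_def step_def)
  qed
  then obtain s where s: "\<And>n. ok n (s n)" "\<And>n. step (s n) (s (Suc n))" by blast
  define P where "P n = fst (s n)" for n
  define d where "d n = snd (snd (s (Suc n)))" for n
  have s0: "s 0 = (P0, X, e)" using s(1)[of 0] by (auto simp: ok_def split: prod.splits)
  have sS: "s (Suc n) = (P (Suc n), P n, d n)" for n
    using s(2)[of n] by (auto simp: step_def P_def d_def split: prod.splits)
  have "proj_resolution A X P d e"
    unfolding proj_resolution_def
  proof (intro conjI allI)
    show "projective A (P n)" for n using s(1)[of n] by (auto simp: ok_def P_def split: prod.splits)
    show "epic A (P 0) X e" using P0 s0 by (simp add: P_def)
    show "exact_at A (P 1) (P 0) X (d 0) e" using s(2)[of 0] unfolding sS s0 by (simp add: step_def)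
    show "exact_at A (P (Suc (Suc n))) (P (Suc n)) (P n) (d (Suc n)) (d n)" for n
      using s(2)[of "Suc n"] unfolding sS by (simp add: step_def)
  qed
  then show ?thesis by blast
qed

section \<open>The functor of first extensions in an abelian category\<close>

lemma res_resolution:
  assumes "Y \<in> Ob A"
  shows "proj_resolution A Y (res_ob A Y) (res_diff A Y) (res_aug A Y)"
proof -
  have "case res A Y of (P, d, e) \<Rightarrow> proj_resolution A Y P d e"
    using ex_proj_resolution[OF assms] unfolding res_def
    by (intro someI_ex[of "\<lambda>(P, d, e). proj_resolution A Y P d e"]) auto
  then show ?thesis by (simp add: res_ob_def res_diff_def res_aug_def split: prod.splits)
qed

lemma res_simps [simp]:
  assumes "Y \<in> Ob A"
  shows "res_ob A Y n \<in> Ob A" "projective A (res_ob A Y n)"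
    "res_diff A Y n \<in> Arr A (res_ob A Y (Suc n)) (res_ob A Y n)"
    "res_aug A Y \<in> Arr A (res_ob A Y 0) Y"
    "Comp A (res_ob A Y (Suc 0)) (res_ob A Y 0) Y (res_aug A Y) (res_diff A Y 0) = zero_arr A (res_ob A Y (Suc 0)) Y"
    "Comp A (res_ob A Y (Suc (Suc n))) (res_ob A Y (Suc n)) (res_ob A Y n) (res_diff A Y n) (res_diff A Y (Suc n)) =
      zero_arr A (res_ob A Y (Suc (Suc n))) (res_ob A Y n)"
proof -
  note r = res_resolution[OF assms]
  show p: "projective A (res_ob A Y n)" for n using r by (simp add: proj_resolution_def)
  then show o: "res_ob A Y n \<in> Ob A" for n by (rule projective_Ob)
  show d: "res_diff A Y n \<in> Arr A (res_ob A Y (Suc n)) (res_ob A Y n)" for n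
    using r unfolding proj_resolution_def by (cases n) (auto simp: exact_at_def)
  show e: "res_aug A Y \<in> Arr A (res_ob A Y 0) Y" using r by (simp add: proj_resolution_def epic_def)
  show "Comp A (res_ob A Y (Suc 0)) (res_ob A Y 0) Y (res_aug A Y) (res_diff A Y 0) = zero_arr A (res_ob A Y (Suc 0)) Y"
    using r o assms by (intro exact_at_zero) (simp_all add: proj_resolution_def)
  show "Comp A (res_ob A Y (Suc (Suc n))) (res_ob A Y (Suc n)) (res_ob A Y n) (res_diff A Y n) (res_diff A Y (Suc n)) =
      zero_arr A (res_ob A Y (Suc (Suc n))) (res_ob A Y n)"
    using r o assms by (intro exact_at_zero) (simp_all add: proj_resolution_def)
qed

lemma res_exact:
  assumes "Y \<in> Ob A"
  shows "epic A (res_ob A Y 0) Y (res_aug A Y)"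
    "exact_at A (res_ob A Y (Suc 0)) (res_ob A Y 0) Y (res_diff A Y 0) (res_aug A Y)"
    "exact_at A (res_ob A Y (Suc (Suc n))) (res_ob A Y (Suc n)) (res_ob A Y n) (res_diff A Y (Suc n)) (res_diff A Y n)"
  using res_resolution[OF assms] by (simp_all add: proj_resolution_def)

lemma ex_chain_lift:
  assumes [simp]: "Y \<in> Ob A" "Z \<in> Ob A" "f \<in> Arr A Y Z"
  shows "\<exists>\<phi>. is_chain_lift A Y Z f \<phi>"
proof -
  \<comment> \<open>the condition on a lift in degree \<open>n\<close> that allows it to be continued\<close>
  define cyc where "cyc n u = (case n of
      0 \<Rightarrow> Comp A (res_ob A Y 0) (res_ob A Z 0) Z (res_aug A Z) u = Comp A (res_ob A Y 0) Y Z f (res_aug A Y)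
    | Suc m \<Rightarrow> Comp A (res_ob A Y (Suc (Suc m))) (res_ob A Z (Suc m)) (res_ob A Z m) (res_diff A Z m)
        (Comp A (res_ob A Y (Suc (Suc m))) (res_ob A Y (Suc m)) (res_ob A Z (Suc m)) u (res_diff A Y (Suc m))) =
        zero_arr A (res_ob A Y (Suc (Suc m))) (res_ob A Z m))" for n u
  define ok where "ok n u \<longleftrightarrow> u \<in> Arr A (res_ob A Y n) (res_ob A Z n) \<and> cyc n u" for n u
  define step where "step n u v \<longleftrightarrow> Comp A (res_ob A Y (Suc n)) (res_ob A Y n) (res_ob A Z n) u (res_diff A Y n) =
       Comp A (res_ob A Y (Suc n)) (res_ob A Z (Suc n)) (res_ob A Z n) (res_diff A Z n) v" for n u v
  have "\<exists>\<phi>. \<forall>n. ok n (\<phi> n) \<and> step n (\<phi> n) (\<phi> (Suc n))"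
  proof (rule dependent_nat_choice)
    show "\<exists>u. ok 0 u"
      using projective_lift[OF res_simps(2) res_exact(1), of Y Z "Comp A (res_ob A Y 0) Y Z f (res_aug A Y)" 0]
      by (auto simp: ok_def cyc_def)
    fix u n assume ok: "ok n u"
    then have u[simp]: "u \<in> Arr A (res_ob A Y n) (res_ob A Z n)" by (simp add: ok_def)
    let ?w = "Comp A (res_ob A Y (Suc n)) (res_ob A Y n) (res_ob A Z n) u (res_diff A Y n)"
    have w: "?w \<in> Arr A (res_ob A Y (Suc n)) (res_ob A Z n)" by simp
    have "\<exists>v\<in>Arr A (res_ob A Y (Suc n)) (res_ob A Z (Suc n)). ?w =
        Comp A (res_ob A Y (Suc n)) (res_ob A Z (Suc n)) (res_ob A Z n) (res_diff A Z n) v \<otimes>\<^bsub>Hom A (res_ob A Y (Suc n)) (res_ob A Z n)\<^esub>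
        zero_arr A (res_ob A Y (Suc n)) (res_ob A Z n)"
    proof (cases n)
      case 0
      have "Comp A (res_ob A Y (Suc 0)) (res_ob A Z 0) Z (res_aug A Z) ?w =
          Comp A (res_ob A Y (Suc 0)) (res_ob A Y 0) Z (Comp A (res_ob A Y 0) (res_ob A Z 0) Z (res_aug A Z) u) (res_diff A Y 0)"
        using u unfolding 0 by (simp add: Comp_assoc)
      also have "\<dots> = zero_arr A (res_ob A Y (Suc 0)) Z"
        using ok unfolding 0 by (simp add: ok_def cyc_def flip: Comp_assoc)
      finally show ?thesis
        using w unfolding 0 by (intro exact_at_lift[OF res_exact(2)]) simp_all
    next
      case (Suc m)
      show ?thesis
        using w ok unfolding Suc by (intro exact_at_lift[OF res_exact(3)]) (simp_all add: ok_def cyc_def)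
    qed
    then obtain v where v: "v \<in> Arr A (res_ob A Y (Suc n)) (res_ob A Z (Suc n))"
      "?w = Comp A (res_ob A Y (Suc n)) (res_ob A Z (Suc n)) (res_ob A Z n) (res_diff A Z n) v"
      by auto
    have "Comp A (res_ob A Y (Suc (Suc n))) (res_ob A Y (Suc n)) (res_ob A Z n) ?w (res_diff A Y (Suc n)) =
        zero_arr A (res_ob A Y (Suc (Suc n))) (res_ob A Z n)"
      by (simp flip: Comp_assoc)
    then have "ok (Suc n) v" using v(1) unfolding v(2) by (simp add: ok_def cyc_def Comp_assoc)
    then show "\<exists>v. ok (Suc n) v \<and> step n u v" using v(2) by (auto simp: step_def)
  qed
  then obtain \<phi> where \<phi>: "\<And>n. ok n (\<phi> n)" "\<And>n. step n (\<phi> n) (\<phi> (Suc n))" by blast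
  have "is_chain_lift A Y Z f \<phi>"
    using \<phi>(1)[of 0] \<phi> unfolding is_chain_lift_def ok_def step_def cyc_def by simp
  then show ?thesis by blast
qed

text \<open>The part of a chain map over \<open>f\<close> that acts on \<open>Ext\<^sup>1\<close>.\<close>

definition lift1 :: "'o \<Rightarrow> 'o \<Rightarrow> 'm \<Rightarrow> 'm \<Rightarrow> 'm \<Rightarrow> bool" where
  "lift1 Y Z f a b \<longleftrightarrow> a \<in> Arr A (res_ob A Y 0) (res_ob A Z 0) \<and> b \<in> Arr A (res_ob A Y (Suc 0)) (res_ob A Z (Suc 0)) \<and>
     Comp A (res_ob A Y 0) (res_ob A Z 0) Z (res_aug A Z) a = Comp A (res_ob A Y 0) Y Z f (res_aug A Y) \<and>
     Comp A (res_ob A Y (Suc 0)) (res_ob A Y 0) (res_ob A Z 0) a (res_diff A Y 0) =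
       Comp A (res_ob A Y (Suc 0)) (res_ob A Z (Suc 0)) (res_ob A Z 0) (res_diff A Z 0) b"

lemma lift1_chain_lift:
  "\<lbrakk>Y \<in> Ob A; Z \<in> Ob A; f \<in> Arr A Y Z\<rbrakk> \<Longrightarrow> lift1 Y Z f (chain_lift A Y Z f 0) (chain_lift A Y Z f (Suc 0))"
  using someI_ex[OF ex_chain_lift[of Y Z f]] unfolding chain_lift_def[symmetric]
  by (simp add: is_chain_lift_def lift1_def)

definition cocyc :: "'o \<Rightarrow> 'o \<Rightarrow> 'm set" where
  "cocyc X Y = {h \<in> Arr A (res_ob A Y (Suc 0)) X.
     Comp A (res_ob A Y (Suc (Suc 0))) (res_ob A Y (Suc 0)) X h (res_diff A Y (Suc 0)) = zero_arr A (res_ob A Y (Suc (Suc 0))) X}"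

definition cobound :: "'o \<Rightarrow> 'o \<Rightarrow> 'm \<Rightarrow> 'm" where
  "cobound X Y k = Comp A (res_ob A Y (Suc 0)) (res_ob A Y 0) X k (res_diff A Y 0)"

definition cls :: "'o \<Rightarrow> 'o \<Rightarrow> 'm \<Rightarrow> 'm set" where
  "cls X Y h = coboundaries (ext_cx A X Y) (ext_cx_diff A X Y) (Suc 0) #>\<^bsub>Hom A (res_ob A Y (Suc 0)) X\<^esub> h"

lemma cochain3_Ext:
  "\<lbrakk>X \<in> Ob A; Y \<in> Ob A\<rbrakk> \<Longrightarrow> cochain3 (ext_cx A X Y) (ext_cx_diff A X Y)"
  unfolding cochain3_def ext_cx_def ext_cx_diff_def numeral_2_eq_2 One_nat_def
  by (simp add: Hom_comm_group Comp_hom_left flip: Comp_assoc)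

lemma coboundaries_Ext:
  "coboundaries (ext_cx A X Y) (ext_cx_diff A X Y) (Suc 0) = cobound X Y ` Arr A (res_ob A Y 0) X"
  by (simp add: coboundaries_def ext_cx_def ext_cx_diff_def cobound_def)

lemma cobound_closed [simp]:
  "\<lbrakk>k \<in> Arr A (res_ob A Y 0) X; X \<in> Ob A; Y \<in> Ob A\<rbrakk> \<Longrightarrow> cobound X Y k \<in> Arr A (res_ob A Y (Suc 0)) X"
  by (simp add: cobound_def)

lemma cocyc_closed: "h \<in> cocyc X Y \<Longrightarrow> h \<in> Arr A (res_ob A Y (Suc 0)) X"
  by (simp add: cocyc_def)

lemma cocyc_cobound [simp]:
  "\<lbrakk>k \<in> Arr A (res_ob A Y 0) X; X \<in> Ob A; Y \<in> Ob A\<rbrakk> \<Longrightarrow> cobound X Y k \<in> cocyc X Y"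
  by (simp add: cobound_def cocyc_def flip: Comp_assoc)

lemma cocyc_add [simp]:
  "\<lbrakk>h \<in> cocyc X Y; h' \<in> cocyc X Y; X \<in> Ob A; Y \<in> Ob A\<rbrakk> \<Longrightarrow> h \<otimes>\<^bsub>Hom A (res_ob A Y (Suc 0)) X\<^esub> h' \<in> cocyc X Y"
  by (simp add: cocyc_def comp_add_left)

lemma cls_eq_iff:
  assumes "X \<in> Ob A" "Y \<in> Ob A" "h \<in> Arr A (res_ob A Y (Suc 0)) X" "h' \<in> Arr A (res_ob A Y (Suc 0)) X"
  shows "cls X Y h = cls X Y h' \<longleftrightarrow>
    (\<exists>k\<in>Arr A (res_ob A Y 0) X. h = cobound X Y k \<otimes>\<^bsub>Hom A (res_ob A Y (Suc 0)) X\<^esub> h')"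
proof -
  have "subgroup (coboundaries (ext_cx A X Y) (ext_cx_diff A X Y) (Suc 0)) (Hom A (res_ob A Y (Suc 0)) X)"
    using cochain3.subgroup_coboundaries[OF cochain3_Ext[OF assms(1,2)]] by (simp add: ext_cx_def)
  then show ?thesis
    unfolding cls_def using comm_group.rcos_eq_iff[OF Hom_comm_group] assms by (simp add: coboundaries_Ext)
qed

lemma ExtA_carrier:
  assumes "X \<in> Ob A" "Y \<in> Ob A"
  shows "carrier (Fob (ExtA A (Suc 0) X) Y) = cls X Y ` cocyc X Y"
proof -
  interpret cochain3 "ext_cx A X Y" "ext_cx_diff A X Y" by (rule cochain3_Ext[OF assms])
  show ?thesis
    using cocycles_1 by (simp add: ExtA_def cohomology_def carrier_FactGroup cls_def cocyc_def ext_cx_def ext_cx_diff_def numeral_2_eq_2 r_coset_def)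
qed

lemma ExtA_mult:
  assumes "X \<in> Ob A" "Y \<in> Ob A" "h \<in> cocyc X Y" "h' \<in> cocyc X Y"
  shows "cls X Y h \<otimes>\<^bsub>Fob (ExtA A (Suc 0) X) Y\<^esub> cls X Y h' = cls X Y (h \<otimes>\<^bsub>Hom A (res_ob A Y (Suc 0)) X\<^esub> h')"
proof -
  interpret cochain3 "ext_cx A X Y" "ext_cx_diff A X Y" by (rule cochain3_Ext[OF assms(1,2)])
  have "cls X Y h <#>\<^bsub>Hom A (res_ob A Y (Suc 0)) X\<^esub> cls X Y h' = cls X Y (h \<otimes>\<^bsub>Hom A (res_ob A Y (Suc 0)) X\<^esub> h')"
    using comm_group.rcos_mult[OF Hom_comm_group] subgroup_coboundaries assms cocyc_closed by (simp add: cls_def ext_cx_def)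
  then show ?thesis
    using cocycles_1 by (simp add: ExtA_def cohomology_def set_mult_def ext_cx_def)
qed

lemma ExtA_one:
  assumes "X \<in> Ob A" "Y \<in> Ob A"
  shows "\<one>\<^bsub>Fob (ExtA A (Suc 0) X) Y\<^esub> = cls X Y (zero_arr A (res_ob A Y (Suc 0)) X)"
proof -
  have "subgroup (coboundaries (ext_cx A X Y) (ext_cx_diff A X Y) (Suc 0)) (Hom A (res_ob A Y (Suc 0)) X)"
    using cochain3.subgroup_coboundaries[OF cochain3_Ext[OF assms]] by (simp add: ext_cx_def)
  then show ?thesis
    using assms by (simp add: ExtA_def cohomology_def cls_def group.coset_join2 subgroup.one_closed)
qed

lemma cls_eq_one_iff:
  assumes "X \<in> Ob A" "Y \<in> Ob A" "h \<in> Arr A (res_ob A Y (Suc 0)) X"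
  shows "cls X Y h = \<one>\<^bsub>Fob (ExtA A (Suc 0) X) Y\<^esub> \<longleftrightarrow> (\<exists>k\<in>Arr A (res_ob A Y 0) X. h = cobound X Y k)"
  using assms by (simp add: ExtA_one cls_eq_iff)

lemma cocyc_comp:
  assumes "lift1 Y Z f a b" "h \<in> cocyc X Z" "X \<in> Ob A" "Y \<in> Ob A" "Z \<in> Ob A"
  shows "Comp A (res_ob A Y (Suc 0)) (res_ob A Z (Suc 0)) X h b \<in> cocyc X Y"
proof -
  \<comment> \<open>\<open>b d\<^sub>1\<close> is a cycle, hence lies in the image of \<open>d\<^sub>1\<close>, which \<open>h\<close> kills\<close>
  have b: "b \<in> Arr A (res_ob A Y (Suc 0)) (res_ob A Z (Suc 0))" and a: "a \<in> Arr A (res_ob A Y 0) (res_ob A Z 0)"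
    and ab: "Comp A (res_ob A Y (Suc 0)) (res_ob A Y 0) (res_ob A Z 0) a (res_diff A Y 0) =
       Comp A (res_ob A Y (Suc 0)) (res_ob A Z (Suc 0)) (res_ob A Z 0) (res_diff A Z 0) b"
    using assms(1) by (simp_all add: lift1_def)
  let ?P = "res_ob A Y (Suc (Suc 0))"
  let ?bd = "Comp A ?P (res_ob A Y (Suc 0)) (res_ob A Z (Suc 0)) b (res_diff A Y (Suc 0))"
  have "Comp A ?P (res_ob A Z (Suc 0)) (res_ob A Z 0) (res_diff A Z 0) ?bd =
      Comp A ?P (res_ob A Y (Suc 0)) (res_ob A Z 0)
        (Comp A (res_ob A Y (Suc 0)) (res_ob A Y 0) (res_ob A Z 0) a (res_diff A Y 0)) (res_diff A Y (Suc 0))"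
    unfolding ab using b assms(4,5) by (simp add: Comp_assoc)
  also have "\<dots> = zero_arr A ?P (res_ob A Z 0)" using a assms(4,5) by (simp flip: Comp_assoc)
  finally have "\<exists>w\<in>Arr A ?P (res_ob A Z (Suc (Suc 0))). ?bd =
      Comp A ?P (res_ob A Z (Suc (Suc 0))) (res_ob A Z (Suc 0)) (res_diff A Z (Suc 0)) w \<otimes>\<^bsub>Hom A ?P (res_ob A Z (Suc 0))\<^esub>
      zero_arr A ?P (res_ob A Z (Suc 0))"
    using b assms(4,5) by (intro exact_at_lift[OF res_exact(3)]) simp_all
  then obtain w where w: "w \<in> Arr A ?P (res_ob A Z (Suc (Suc 0)))" "?bd = Comp A ?P (res_ob A Z (Suc (Suc 0))) (res_ob A Z (Suc 0)) (res_diff A Z (Suc 0)) w"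
    using assms(4,5) by auto
  have h: "h \<in> Arr A (res_ob A Z (Suc 0)) X" using assms(2) by (rule cocyc_closed)
  have "Comp A ?P (res_ob A Y (Suc 0)) X (Comp A (res_ob A Y (Suc 0)) (res_ob A Z (Suc 0)) X h b) (res_diff A Y (Suc 0)) =
      Comp A ?P (res_ob A Z (Suc 0)) X h ?bd"
    using b h assms(3-5) by (simp flip: Comp_assoc)
  also have "\<dots> = zero_arr A ?P X"
    unfolding w(2) using w(1) h assms(2-5) by (simp add: Comp_assoc cocyc_def)
  finally show ?thesis using h b assms(3-5) by (simp add: cocyc_def)
qed

text \<open>Two lifts of the same morphism differ by a homotopy.\<close>

lemma lift1_unique:
  assumes "lift1 Y Z f a b" "lift1 Y Z f a' b'" "h \<in> cocyc X Z" "X \<in> Ob A" "Y \<in> Ob A" "Z \<in> Ob A"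
  shows "cls X Y (Comp A (res_ob A Y (Suc 0)) (res_ob A Z (Suc 0)) X h b) = cls X Y (Comp A (res_ob A Y (Suc 0)) (res_ob A Z (Suc 0)) X h b')"
proof -
  let ?P0 = "res_ob A Y 0" let ?P1 = "res_ob A Y (Suc 0)" let ?Q0 = "res_ob A Z 0" let ?Q1 = "res_ob A Z (Suc 0)"
  let ?Q2 = "res_ob A Z (Suc (Suc 0))" let ?d = "res_diff A Y 0" let ?d' = "res_diff A Z 0" let ?d1' = "res_diff A Z (Suc 0)"
  have b: "b \<in> Arr A ?P1 ?Q1" and a: "a \<in> Arr A ?P0 ?Q0" and b': "b' \<in> Arr A ?P1 ?Q1" and a': "a' \<in> Arr A ?P0 ?Q0"
    and ab: "Comp A ?P1 ?P0 ?Q0 a ?d = Comp A ?P1 ?Q1 ?Q0 ?d' b" and ab': "Comp A ?P1 ?P0 ?Q0 a' ?d = Comp A ?P1 ?Q1 ?Q0 ?d' b'"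
    and e: "Comp A ?P0 ?Q0 Z (res_aug A Z) a = Comp A ?P0 ?Q0 Z (res_aug A Z) a'"
    using assms(1,2) by (simp_all add: lift1_def)
  have h: "h \<in> Arr A ?Q1 X" using assms(3) by (rule cocyc_closed)
  obtain s where s: "s \<in> Arr A ?P0 ?Q1" "a = Comp A ?P0 ?Q1 ?Q0 ?d' s \<otimes>\<^bsub>Hom A ?P0 ?Q0\<^esub> a'"
    using exact_at_lift[OF res_exact(2) _ _ _ _ a a' e] assms(5,6) by auto
  let ?c = "Comp A ?P1 ?P0 ?Q1 s ?d \<otimes>\<^bsub>Hom A ?P1 ?Q1\<^esub> b'"
  have "Comp A ?P1 ?Q1 ?Q0 ?d' b = Comp A ?P1 ?Q1 ?Q0 ?d' ?c"
    unfolding ab[symmetric] s(2) using s(1) a' b' assms(5,6) by (simp add: comp_add_left comp_add_right Comp_assoc ab')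
  then have "\<exists>w\<in>Arr A ?P1 ?Q2. b = Comp A ?P1 ?Q2 ?Q1 ?d1' w \<otimes>\<^bsub>Hom A ?P1 ?Q1\<^esub> ?c"
    using exact_at_lift[OF res_exact(3)[OF assms(6), of 0] _ _ _ res_simps(2)[OF assms(5)] b, of ?c] s(1) b' assms(5,6) by simp
  then obtain w where w: "w \<in> Arr A ?P1 ?Q2" "b = Comp A ?P1 ?Q2 ?Q1 ?d1' w \<otimes>\<^bsub>Hom A ?P1 ?Q1\<^esub> ?c" by auto
  have "Comp A ?P1 ?Q1 X h (Comp A ?P1 ?Q2 ?Q1 ?d1' w) = zero_arr A ?P1 X"
    using w(1) h assms(3-6) by (simp add: Comp_assoc cocyc_def)
  then have "Comp A ?P1 ?Q1 X h b = cobound X Y (Comp A ?P0 ?Q1 X h s) \<otimes>\<^bsub>Hom A ?P1 X\<^esub> Comp A ?P1 ?Q1 X h b'"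
    unfolding w(2) using w(1) s(1) b' h assms(4-6) by (simp add: comp_add_right cobound_def flip: Comp_assoc)
  then show ?thesis
    using h b b' s(1) assms(4-6) by (subst cls_eq_iff) auto
qed

text \<open>By the preceding lemma the action of \<open>f\<close> can be computed with any lift of \<open>f\<close> in place of the chosen
  one.  Functoriality follows by composing and adding lifts.\<close>

lemma ExtA_Fmap:
  assumes l: "lift1 Y Z f a b" and h: "h \<in> cocyc X Z" and Ob: "X \<in> Ob A" "Y \<in> Ob A" "Z \<in> Ob A" and f: "f \<in> Arr A Y Z"
  shows "Fmap (ExtA A (Suc 0) X) Y Z f (cls X Z h) = cls X Y (Comp A (res_ob A Y (Suc 0)) (res_ob A Z (Suc 0)) X h b)"
proof -
  let ?a = "chain_lift A Y Z f 0" and ?b = "chain_lift A Y Z f (Suc 0)"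
  have l': "lift1 Y Z f ?a ?b" using lift1_chain_lift Ob f by simp
  then have a: "?a \<in> Arr A (res_ob A Y 0) (res_ob A Z 0)" and b: "?b \<in> Arr A (res_ob A Y (Suc 0)) (res_ob A Z (Suc 0))"
    and ab: "Comp A (res_ob A Y (Suc 0)) (res_ob A Y 0) (res_ob A Z 0) ?a (res_diff A Y 0) =
       Comp A (res_ob A Y (Suc 0)) (res_ob A Z (Suc 0)) (res_ob A Z 0) (res_diff A Z 0) ?b"
    by (simp_all add: lift1_def)
  have h': "h \<in> Arr A (res_ob A Z (Suc 0)) X" using h by (rule cocyc_closed)
  have rep: "cls X Y (Comp A (res_ob A Y (Suc 0)) (res_ob A Z (Suc 0)) X g ?b) = cls X Y (Comp A (res_ob A Y (Suc 0)) (res_ob A Z (Suc 0)) X h b)"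
    if g: "g \<in> cls X Z h" for g
  proof -
    obtain k where k: "k \<in> Arr A (res_ob A Z 0) X" "g = cobound X Z k \<otimes>\<^bsub>Hom A (res_ob A Z (Suc 0)) X\<^esub> h"
      using g by (auto simp: cls_def r_coset_def coboundaries_Ext)
    have "Comp A (res_ob A Y (Suc 0)) (res_ob A Z (Suc 0)) X (cobound X Z k) ?b = cobound X Y (Comp A (res_ob A Y 0) (res_ob A Z 0) X k ?a)"
      using k(1) a b Ob by (simp add: cobound_def ab flip: Comp_assoc)
    then have "Comp A (res_ob A Y (Suc 0)) (res_ob A Z (Suc 0)) X g ?b =
        cobound X Y (Comp A (res_ob A Y 0) (res_ob A Z 0) X k ?a) \<otimes>\<^bsub>Hom A (res_ob A Y (Suc 0)) X\<^esub>
        Comp A (res_ob A Y (Suc 0)) (res_ob A Z (Suc 0)) X h ?b"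
      unfolding k(2) using k(1) h' b Ob by (simp add: comp_add_left)
    then have "cls X Y (Comp A (res_ob A Y (Suc 0)) (res_ob A Z (Suc 0)) X g ?b) = cls X Y (Comp A (res_ob A Y (Suc 0)) (res_ob A Z (Suc 0)) X h ?b)"
      using k h' a b Ob by (subst cls_eq_iff) auto
    then show ?thesis using lift1_unique[OF l' l h Ob] by simp
  qed
  have "h \<in> cls X Z h"
    using cochain3.subgroup_coboundaries[OF cochain3_Ext[OF Ob(1,3)]] h' Ob
    by (simp add: cls_def ext_cx_def group.rcos_self)
  then show ?thesis using rep by (auto simp: ExtA_def ext_cx_def cls_def[symmetric])
qed

lemma lift1_ident: "Y \<in> Ob A \<Longrightarrow> lift1 Y Y (Ident A Y) (Ident A (res_ob A Y 0)) (Ident A (res_ob A Y (Suc 0)))"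
  by (simp add: lift1_def)

lemma lift1_comp:
  assumes "lift1 X Y f a b" "lift1 Y Z g a' b'" and [simp]: "X \<in> Ob A" "Y \<in> Ob A" "Z \<in> Ob A" "f \<in> Arr A X Y" "g \<in> Arr A Y Z"
  shows "lift1 X Z (Comp A X Y Z g f) (Comp A (res_ob A X 0) (res_ob A Y 0) (res_ob A Z 0) a' a)
    (Comp A (res_ob A X (Suc 0)) (res_ob A Y (Suc 0)) (res_ob A Z (Suc 0)) b' b)"
proof -
  have mem[simp]: "a \<in> Arr A (res_ob A X 0) (res_ob A Y 0)" "b \<in> Arr A (res_ob A X (Suc 0)) (res_ob A Y (Suc 0))"
    "a' \<in> Arr A (res_ob A Y 0) (res_ob A Z 0)" "b' \<in> Arr A (res_ob A Y (Suc 0)) (res_ob A Z (Suc 0))"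
    and e: "Comp A (res_ob A X 0) (res_ob A Y 0) Y (res_aug A Y) a = Comp A (res_ob A X 0) X Y f (res_aug A X)"
      "Comp A (res_ob A Y 0) (res_ob A Z 0) Z (res_aug A Z) a' = Comp A (res_ob A Y 0) Y Z g (res_aug A Y)"
    and d: "Comp A (res_ob A X (Suc 0)) (res_ob A X 0) (res_ob A Y 0) a (res_diff A X 0) =
        Comp A (res_ob A X (Suc 0)) (res_ob A Y (Suc 0)) (res_ob A Y 0) (res_diff A Y 0) b"
      "Comp A (res_ob A Y (Suc 0)) (res_ob A Y 0) (res_ob A Z 0) a' (res_diff A Y 0) =
        Comp A (res_ob A Y (Suc 0)) (res_ob A Z (Suc 0)) (res_ob A Z 0) (res_diff A Z 0) b'"
    using assms(1,2) by (simp_all add: lift1_def)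
  have "Comp A (res_ob A X 0) (res_ob A Z 0) Z (res_aug A Z) (Comp A (res_ob A X 0) (res_ob A Y 0) (res_ob A Z 0) a' a) =
      Comp A (res_ob A X 0) Y Z g (Comp A (res_ob A X 0) (res_ob A Y 0) Y (res_aug A Y) a)"
    by (simp add: Comp_assoc e(2))
  moreover have "Comp A (res_ob A X (Suc 0)) (res_ob A X 0) (res_ob A Z 0) (Comp A (res_ob A X 0) (res_ob A Y 0) (res_ob A Z 0) a' a) (res_diff A X 0) =
      Comp A (res_ob A X (Suc 0)) (res_ob A Y 0) (res_ob A Z 0) a' (Comp A (res_ob A X (Suc 0)) (res_ob A X 0) (res_ob A Y 0) a (res_diff A X 0))"
    by (simp add: Comp_assoc)
  ultimately show ?thesis by (simp add: lift1_def e(1) d(1)) (simp add: Comp_assoc d(2))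
qed

lemma lift1_add:
  assumes "lift1 Y Z f a b" "lift1 Y Z f' a' b'" and [simp]: "Y \<in> Ob A" "Z \<in> Ob A" "f \<in> Arr A Y Z" "f' \<in> Arr A Y Z"
  shows "lift1 Y Z (f \<otimes>\<^bsub>Hom A Y Z\<^esub> f') (a \<otimes>\<^bsub>Hom A (res_ob A Y 0) (res_ob A Z 0)\<^esub> a')
    (b \<otimes>\<^bsub>Hom A (res_ob A Y (Suc 0)) (res_ob A Z (Suc 0))\<^esub> b')"
  using assms(1,2) by (simp add: lift1_def comp_add_left comp_add_right)

lemma additive_ExtA:
  assumes X: "X \<in> Ob A"
  shows "additive_functor A (ExtA A (Suc 0) X)"
proof -
  have cg: "comm_group (Fob (ExtA A (Suc 0) X) Y)" if "Y \<in> Ob A" for Y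
  proof -
    interpret cochain3 "ext_cx A X Y" "ext_cx_diff A X Y" by (rule cochain3_Ext[OF X that])
    show ?thesis
      using comm_group.abelian_FactGroup[OF comm_group_cocycles subgroup_coboundaries_cocycles]
      by (simp add: ExtA_def cohomology_def)
  qed
  have lift: "\<exists>a b. lift1 Y Z f a b" if "Y \<in> Ob A" "Z \<in> Ob A" "f \<in> Arr A Y Z" for Y Z f
    using lift1_chain_lift[OF that] by blast
  have b_mem: "b \<in> Arr A (res_ob A Y (Suc 0)) (res_ob A Z (Suc 0))" if "lift1 Y Z f a b" for Y Z f a b
    using that by (simp add: lift1_def)
  have Fhom: "Fmap (ExtA A (Suc 0) X) Y Z f \<in> hom (Fob (ExtA A (Suc 0) X) Z) (Fob (ExtA A (Suc 0) X) Y)"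
    if Ob: "Y \<in> Ob A" "Z \<in> Ob A" and f: "f \<in> Arr A Y Z" for Y Z f
  proof -
    obtain a b where l: "lift1 Y Z f a b" using lift Ob f by blast
    show ?thesis
      using X Ob f cocyc_comp[OF l _ X Ob] b_mem[OF l] cocyc_closed
      by (intro homI) (auto simp: ExtA_carrier ExtA_mult ExtA_Fmap[OF l] comp_add_left)
  qed
  have Fid: "Fmap (ExtA A (Suc 0) X) Y Y (Ident A Y) x = x"
    if Y: "Y \<in> Ob A" and x: "x \<in> carrier (Fob (ExtA A (Suc 0) X) Y)" for Y x
    using x X Y cocyc_closed by (auto simp: ExtA_carrier ExtA_Fmap[OF lift1_ident[OF Y]])
  have Fcomp: "Fmap (ExtA A (Suc 0) X) U Z (Comp A U Y Z g f) x =
      Fmap (ExtA A (Suc 0) X) U Y f (Fmap (ExtA A (Suc 0) X) Y Z g x)"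
    if Ob: "U \<in> Ob A" "Y \<in> Ob A" "Z \<in> Ob A" and f: "f \<in> Arr A U Y" and g: "g \<in> Arr A Y Z"
      and x: "x \<in> carrier (Fob (ExtA A (Suc 0) X) Z)" for U Y Z f g x
  proof -
    obtain a b where l: "lift1 U Y f a b" using lift Ob f by blast
    obtain a' b' where l': "lift1 Y Z g a' b'" using lift Ob g by blast
    obtain h where h: "h \<in> cocyc X Z" "x = cls X Z h" using x X Ob by (auto simp: ExtA_carrier)
    show ?thesis
      using X Ob f g h cocyc_comp[OF l' h(1) X Ob(2,3)] b_mem[OF l] b_mem[OF l'] cocyc_closed[OF h(1)]
      by (simp add: ExtA_Fmap[OF l] ExtA_Fmap[OF l'] ExtA_Fmap[OF lift1_comp[OF l l']] Comp_assoc)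
  qed
  have Fadd: "Fmap (ExtA A (Suc 0) X) Y Z (f \<otimes>\<^bsub>Hom A Y Z\<^esub> f') x =
      Fmap (ExtA A (Suc 0) X) Y Z f x \<otimes>\<^bsub>Fob (ExtA A (Suc 0) X) Y\<^esub> Fmap (ExtA A (Suc 0) X) Y Z f' x"
    if Ob: "Y \<in> Ob A" "Z \<in> Ob A" and f: "f \<in> Arr A Y Z" and f': "f' \<in> Arr A Y Z"
      and x: "x \<in> carrier (Fob (ExtA A (Suc 0) X) Z)" for Y Z f f' x
  proof -
    obtain a b where l: "lift1 Y Z f a b" using lift Ob f by blast
    obtain a' b' where l': "lift1 Y Z f' a' b'" using lift Ob f' by blast
    obtain h where h: "h \<in> cocyc X Z" "x = cls X Z h" using x X Ob by (auto simp: ExtA_carrier)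
    show ?thesis
      using X Ob f f' h cocyc_comp[OF l h(1) X Ob] cocyc_comp[OF l' h(1) X Ob] b_mem[OF l] b_mem[OF l'] cocyc_closed[OF h(1)]
      by (simp add: ExtA_Fmap[OF l] ExtA_Fmap[OF l'] ExtA_Fmap[OF lift1_add[OF l l']] ExtA_mult comp_add_right)
  qed
  show ?thesis
    unfolding additive_functor_def by (intro conjI ballI cg Fhom Fid Fcomp Fadd)
qed

lemma vanishes_on_projectivesI:
  assumes "additive_functor A G" "\<And>P x. \<lbrakk>projective A P; x \<in> carrier (Fob G P)\<rbrakk> \<Longrightarrow> x = \<one>\<^bsub>Fob G P\<^esub>"
  shows "vanishes_on_projectives A G"
  unfolding vanishes_on_projectives_def trivial_group_def
proof (intro allI impI conjI equalityI subsetI)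
  fix P assume P: "projective A P"
  show "group (Fob G P)" by (rule group_Fob[OF assms(1) projective_Ob[OF P]])
  show "x \<in> {\<one>\<^bsub>Fob G P\<^esub>}" if "x \<in> carrier (Fob G P)" for x using assms(2)[OF P that] by simp
  show "x \<in> carrier (Fob G P)" if "x \<in> {\<one>\<^bsub>Fob G P\<^esub>}" for x
    using that Fob_closed(1)[OF assms(1) projective_Ob[OF P]] by simp
qed

text \<open>A section \<open>\<sigma>\<close> of the augmentation of a projective object starts a contraction of its resolution:
  \<open>1 = d\<^sub>0 s + \<sigma> e\<close> in degree 0 and \<open>1 = d\<^sub>1 w + s d\<^sub>0\<close> in degree 1.\<close>

lemma vanishes_ExtA:
  assumes X: "X \<in> Ob A"
  shows "vanishes_on_projectives A (ExtA A (Suc 0) X)"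
proof -
  have "x = \<one>\<^bsub>Fob (ExtA A (Suc 0) X) P\<^esub>" if P: "projective A P" and x: "x \<in> carrier (Fob (ExtA A (Suc 0) X) P)" for P x
  proof -
    have Ob: "P \<in> Ob A" using P by (rule projective_Ob)
    let ?P0 = "res_ob A P 0" let ?P1 = "res_ob A P (Suc 0)" let ?P2 = "res_ob A P (Suc (Suc 0))"
    let ?d = "res_diff A P 0" let ?d1 = "res_diff A P (Suc 0)" let ?e = "res_aug A P"
    obtain h where h: "h \<in> cocyc X P" "x = cls X P h" using x X Ob by (auto simp: ExtA_carrier)
    have h': "h \<in> Arr A ?P1 X" using h(1) by (rule cocyc_closed)
    obtain \<sigma> where \<sigma>: "\<sigma> \<in> Arr A P ?P0" "Comp A P ?P0 P ?e \<sigma> = Ident A P"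
      using projective_lift[OF P res_exact(1)[OF Ob], of "Ident A P"] Ob by auto
    have "Comp A ?P0 ?P0 P ?e (Ident A ?P0) = Comp A ?P0 ?P0 P ?e (Comp A ?P0 P ?P0 \<sigma> ?e)"
      using \<sigma> Ob by (simp add: Comp_assoc)
    then obtain s where s: "s \<in> Arr A ?P0 ?P1" "Ident A ?P0 = Comp A ?P0 ?P1 ?P0 ?d s \<otimes>\<^bsub>Hom A ?P0 ?P0\<^esub> Comp A ?P0 P ?P0 \<sigma> ?e"
      using exact_at_lift[OF res_exact(2)[OF Ob] _ _ Ob, of ?P0 "Ident A ?P0" "Comp A ?P0 P ?P0 \<sigma> ?e"] \<sigma>(1) Ob by auto
    have "?d = Comp A ?P1 ?P0 ?P0 (Ident A ?P0) ?d" using Ob by simp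
    also have "\<dots> = Comp A ?P1 ?P0 ?P0 (Comp A ?P0 ?P1 ?P0 ?d s) ?d \<otimes>\<^bsub>Hom A ?P1 ?P0\<^esub> Comp A ?P1 P ?P0 \<sigma> (Comp A ?P1 ?P0 P ?e ?d)"
      unfolding s(2) using s(1) \<sigma>(1) Ob by (simp add: comp_add_left flip: Comp_assoc)
    also have "\<dots> = Comp A ?P1 ?P1 ?P0 ?d (Comp A ?P1 ?P0 ?P1 s ?d)"
      using s(1) \<sigma>(1) Ob by (simp flip: Comp_assoc)
    finally have "Comp A ?P1 ?P1 ?P0 ?d (Ident A ?P1) = Comp A ?P1 ?P1 ?P0 ?d (Comp A ?P1 ?P0 ?P1 s ?d)"
      using Ob by simp
    then obtain w where w: "w \<in> Arr A ?P1 ?P2" "Ident A ?P1 = Comp A ?P1 ?P2 ?P1 ?d1 w \<otimes>\<^bsub>Hom A ?P1 ?P1\<^esub> Comp A ?P1 ?P0 ?P1 s ?d"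
      using exact_at_lift[OF res_exact(3)[OF Ob, of 0], of ?P1 "Ident A ?P1" "Comp A ?P1 ?P0 ?P1 s ?d"] s(1) Ob by auto
    have "h = Comp A ?P1 ?P1 X h (Ident A ?P1)" using h' X Ob by simp
    also have "\<dots> = Comp A ?P1 ?P2 X (Comp A ?P2 ?P1 X h ?d1) w \<otimes>\<^bsub>Hom A ?P1 X\<^esub> Comp A ?P1 ?P0 X (Comp A ?P0 ?P1 X h s) ?d"
      unfolding w(2) using w(1) s(1) h' X Ob by (simp add: comp_add_right Comp_assoc)
    also have "\<dots> = cobound X P (Comp A ?P0 ?P1 X h s)"
      using h(1) w(1) s(1) h' X Ob by (simp add: cocyc_def cobound_def)
    finally show ?thesis
      using h' s(1) X Ob by (simp add: h(2) cls_eq_one_iff) (metis comp_closed res_simps(1))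
  qed
  then show ?thesis by (rule vanishes_on_projectivesI[OF additive_ExtA[OF X]])
qed

section \<open>The connecting map of a short exact sequence\<close>

definition short_exact :: "'o \<Rightarrow> 'o \<Rightarrow> 'o \<Rightarrow> 'm \<Rightarrow> 'm \<Rightarrow> bool" where
  "short_exact X V W i p \<longleftrightarrow> X \<in> Ob A \<and> V \<in> Ob A \<and> W \<in> Ob A \<and> epic A V W p \<and> is_kernel A V W p X i"

text \<open>The graph of the connecting map \<open>Hom(U, W) \<rightarrow> Ext\<^sup>1(U, X)\<close> on representatives.\<close>

definition connects :: "'o \<Rightarrow> 'o \<Rightarrow> 'o \<Rightarrow> 'm \<Rightarrow> 'm \<Rightarrow> 'o \<Rightarrow> 'm \<Rightarrow> 'm \<Rightarrow> bool" where
  "connects X V W i p U h b \<longleftrightarrow> h \<in> Arr A U W \<and> b \<in> cocyc X U \<and>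
     (\<exists>a\<in>Arr A (res_ob A U 0) V. Comp A (res_ob A U 0) V W p a = Comp A (res_ob A U 0) U W h (res_aug A U) \<and>
        cobound V U a = Comp A (res_ob A U (Suc 0)) X V i b)"

lemma short_exactD:
  assumes "short_exact X V W i p"
  shows "X \<in> Ob A" "V \<in> Ob A" "W \<in> Ob A" "epic A V W p" "is_kernel A V W p X i" "p \<in> Arr A V W" "i \<in> Arr A X V"
    "Comp A X V W p i = zero_arr A X W"
  using assms by (auto simp: short_exact_def epic_def is_kernel_def)

lemma ex_short_exact:
  assumes "epic A V W p" "V \<in> Ob A" "W \<in> Ob A"
  obtains X i where "short_exact X V W i p"
proof -
  have "p \<in> Arr A V W" using assms(1) by (simp add: epic_def)
  then obtain X i where "is_kernel A V W p X i" using ex_kernel[OF assms(2,3)] by blast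
  then show ?thesis using that assms by (auto simp: short_exact_def is_kernel_def)
qed

lemma cobound_add:
  "\<lbrakk>k \<in> Arr A (res_ob A Y 0) X; k' \<in> Arr A (res_ob A Y 0) X; X \<in> Ob A; Y \<in> Ob A\<rbrakk>
    \<Longrightarrow> cobound X Y (k \<otimes>\<^bsub>Hom A (res_ob A Y 0) X\<^esub> k') = cobound X Y k \<otimes>\<^bsub>Hom A (res_ob A Y (Suc 0)) X\<^esub> cobound X Y k'"
  by (simp add: cobound_def comp_add_left)

lemma cobound_neg:
  "\<lbrakk>k \<in> Arr A (res_ob A Y 0) X; X \<in> Ob A; Y \<in> Ob A\<rbrakk>
    \<Longrightarrow> cobound X Y (inv\<^bsub>Hom A (res_ob A Y 0) X\<^esub> k) = inv\<^bsub>Hom A (res_ob A Y (Suc 0)) X\<^esub> cobound X Y k"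
  by (simp add: cobound_def comp_neg_left)

lemma cobound_comp:
  "\<lbrakk>k \<in> Arr A (res_ob A Y 0) X; f \<in> Arr A X V; X \<in> Ob A; V \<in> Ob A; Y \<in> Ob A\<rbrakk>
    \<Longrightarrow> cobound V Y (Comp A (res_ob A Y 0) X V f k) = Comp A (res_ob A Y (Suc 0)) X V f (cobound X Y k)"
  by (simp add: cobound_def Comp_assoc)

lemma cobound_aug:
  "\<lbrakk>y \<in> Arr A Y X; X \<in> Ob A; Y \<in> Ob A\<rbrakk>
    \<Longrightarrow> cobound X Y (Comp A (res_ob A Y 0) Y X y (res_aug A Y)) = zero_arr A (res_ob A Y (Suc 0)) X"
  by (simp add: cobound_def flip: Comp_assoc)

lemma cobound_eq_zero:
  assumes "k \<in> Arr A (res_ob A Y 0) X" "X \<in> Ob A" "Y \<in> Ob A" "cobound X Y k = zero_arr A (res_ob A Y (Suc 0)) X"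
  shows "\<exists>y\<in>Arr A Y X. k = Comp A (res_ob A Y 0) Y X y (res_aug A Y)"
  using exact_at_epic_factor[OF res_exact(2) _ _ _ res_exact(1), of Y k X] assms by (simp add: cobound_def)

text \<open>Lift \<open>h e\<close> along \<open>p\<close> to \<open>a\<close>; then \<open>p a d\<^sub>0 = h e d\<^sub>0 = 0\<close>, so \<open>a d\<^sub>0 = i b\<close>.\<close>

lemma ex_connects:
  assumes se: "short_exact X V W i p" and U: "U \<in> Ob A" and h: "h \<in> Arr A U W"
  shows "\<exists>b. connects X V W i p U h b"
proof -
  note D = short_exactD[OF se]
  let ?P0 = "res_ob A U 0" let ?P1 = "res_ob A U (Suc 0)" let ?P2 = "res_ob A U (Suc (Suc 0))"
  obtain a where a: "a \<in> Arr A ?P0 V" "Comp A ?P0 V W p a = Comp A ?P0 U W h (res_aug A U)"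
    using projective_lift[OF res_simps(2)[OF U] D(4), of "Comp A ?P0 U W h (res_aug A U)" 0] D U h by auto
  have "Comp A ?P1 V W p (cobound V U a) = zero_arr A ?P1 W"
    using a D U h cobound_aug[OF h D(3) U] by (simp flip: cobound_comp)
  then obtain b where b: "b \<in> Arr A ?P1 X" "Comp A ?P1 X V i b = cobound V U a"
    using kernel_lift[OF D(5), of ?P1 "cobound V U a"] a D U by auto
  have "Comp A ?P2 X V i (Comp A ?P2 ?P1 X b (res_diff A U (Suc 0))) = Comp A ?P2 ?P1 V (cobound V U a) (res_diff A U (Suc 0))"
    unfolding b(2)[symmetric] using b(1) D U by (simp add: Comp_assoc)
  also have "\<dots> = Comp A ?P2 X V i (zero_arr A ?P2 X)"
    using a D U cocyc_cobound[of a U V] by (simp add: cocyc_def)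
  finally have eq: "Comp A ?P2 X V i (Comp A ?P2 ?P1 X b (res_diff A U (Suc 0))) = Comp A ?P2 X V i (zero_arr A ?P2 X)" .
  have "Comp A ?P2 ?P1 X b (res_diff A U (Suc 0)) = zero_arr A ?P2 X"
    by (rule kernel_cancel[OF D(5) _ D(2,3,6) _ _ eq]) (use b(1) D(1) U in simp_all)
  then have "b \<in> cocyc X U" using b(1) by (simp add: cocyc_def)
  then show ?thesis using a b(2)[symmetric] h unfolding connects_def by blast
qed

lemma connects_natural:
  assumes c: "connects X V W i p U h b" and l: "lift1 U' U f \<alpha> \<beta>" and se: "short_exact X V W i p"
    and U: "U \<in> Ob A" "U' \<in> Ob A" and f: "f \<in> Arr A U' U"
  shows "connects X V W i p U' (Comp A U' U W h f) (Comp A (res_ob A U' (Suc 0)) (res_ob A U (Suc 0)) X b \<beta>)"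
proof -
  note D = short_exactD[OF se]
  let ?P0 = "res_ob A U 0" let ?P1 = "res_ob A U (Suc 0)"
  let ?Q0 = "res_ob A U' 0" let ?Q1 = "res_ob A U' (Suc 0)"
  obtain a where h: "h \<in> Arr A U W" and b: "b \<in> cocyc X U" and a: "a \<in> Arr A ?P0 V"
    and pa: "Comp A ?P0 V W p a = Comp A ?P0 U W h (res_aug A U)" and ad: "cobound V U a = Comp A ?P1 X V i b"
    using c unfolding connects_def by blast
  have b': "b \<in> Arr A ?P1 X" using b by (rule cocyc_closed)
  have mem: "\<alpha> \<in> Arr A ?Q0 ?P0" "\<beta> \<in> Arr A ?Q1 ?P1"
    and e: "Comp A ?Q0 ?P0 U (res_aug A U) \<alpha> = Comp A ?Q0 U' U f (res_aug A U')"
    and d: "Comp A ?Q1 ?Q0 ?P0 \<alpha> (res_diff A U' 0) = Comp A ?Q1 ?P1 ?P0 (res_diff A U 0) \<beta>"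
    using l by (simp_all add: lift1_def)
  have "Comp A ?Q0 V W p (Comp A ?Q0 ?P0 V a \<alpha>) = Comp A ?Q0 ?P0 W (Comp A ?P0 V W p a) \<alpha>"
    using a mem D U by (simp add: Comp_assoc)
  also have "\<dots> = Comp A ?Q0 U W h (Comp A ?Q0 ?P0 U (res_aug A U) \<alpha>)"
    unfolding pa using mem D U h by (simp add: Comp_assoc)
  also have "\<dots> = Comp A ?Q0 U' W (Comp A U' U W h f) (res_aug A U')" unfolding e using D U h f by (simp add: Comp_assoc)
  finally have 1: "Comp A ?Q0 V W p (Comp A ?Q0 ?P0 V a \<alpha>) = Comp A ?Q0 U' W (Comp A U' U W h f) (res_aug A U')" .
  have "cobound V U' (Comp A ?Q0 ?P0 V a \<alpha>) = Comp A ?Q1 ?P0 V a (Comp A ?Q1 ?Q0 ?P0 \<alpha> (res_diff A U' 0))"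
    using a mem D U by (simp add: cobound_def Comp_assoc)
  also have "\<dots> = Comp A ?Q1 ?P1 V (cobound V U a) \<beta>" unfolding d using a mem D U by (simp add: cobound_def Comp_assoc)
  also have "\<dots> = Comp A ?Q1 X V i (Comp A ?Q1 ?P1 X b \<beta>)" unfolding ad using b' mem D U by (simp add: Comp_assoc)
  finally have 2: "cobound V U' (Comp A ?Q0 ?P0 V a \<alpha>) = Comp A ?Q1 X V i (Comp A ?Q1 ?P1 X b \<beta>)" .
  have "Comp A ?Q0 ?P0 V a \<alpha> \<in> Arr A ?Q0 V" "Comp A U' U W h f \<in> Arr A U' W" using a mem D U h f by simp_all
  then show ?thesis
    using 1 2 cocyc_comp[OF l b D(1) U(2,1)] unfolding connects_def by blast
qed

text \<open>Exactness of \<open>Hom(U, V) \<rightarrow> Hom(U, W) \<rightarrow> Ext\<^sup>1(U, X)\<close>: if \<open>b = k d\<^sub>0 + b'\<close>, then \<open>a - (i k + a')\<close> kills \<open>d\<^sub>0\<close>,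
  so it is \<open>y e\<close> for some \<open>y : U \<rightarrow> V\<close>.\<close>

lemma connects_cohomologous:
  assumes c: "connects X V W i p U h b" and c': "connects X V W i p U h' b'" and se: "short_exact X V W i p" and U: "U \<in> Ob A"
    and k: "k \<in> Arr A (res_ob A U 0) X" "b = cobound X U k \<otimes>\<^bsub>Hom A (res_ob A U (Suc 0)) X\<^esub> b'"
  shows "\<exists>y\<in>Arr A U V. h = Comp A U V W p y \<otimes>\<^bsub>Hom A U W\<^esub> h'"
proof -
  note D = short_exactD[OF se]
  let ?P0 = "res_ob A U 0" let ?P1 = "res_ob A U (Suc 0)"
  obtain a where h: "h \<in> Arr A U W" and a: "a \<in> Arr A ?P0 V"
    and pa: "Comp A ?P0 V W p a = Comp A ?P0 U W h (res_aug A U)" and ad: "cobound V U a = Comp A ?P1 X V i b"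
    using c unfolding connects_def by blast
  obtain a' where h': "h' \<in> Arr A U W" and b': "b' \<in> cocyc X U" and a': "a' \<in> Arr A ?P0 V"
    and pa': "Comp A ?P0 V W p a' = Comp A ?P0 U W h' (res_aug A U)" and ad': "cobound V U a' = Comp A ?P1 X V i b'"
    using c' unfolding connects_def by blast
  let ?q = "Comp A ?P0 X V i k \<otimes>\<^bsub>Hom A ?P0 V\<^esub> a'"
  have q: "?q \<in> Arr A ?P0 V" using a' k D U by simp
  have cq: "cobound V U ?q = cobound V U a"
    unfolding ad k(2) using k(1) a' D U cocyc_closed[OF b'] by (simp add: cobound_add cobound_comp comp_add_right ad')
  let ?r = "a \<otimes>\<^bsub>Hom A ?P0 V\<^esub> inv\<^bsub>Hom A ?P0 V\<^esub> ?q"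
  have "cobound V U ?r = zero_arr A ?P1 V" using a q D U by (simp add: cobound_add cobound_neg cq)
  then obtain y where y: "y \<in> Arr A U V" "?r = Comp A ?P0 U V y (res_aug A U)"
    using cobound_eq_zero[of ?r U V] a q D U by auto
  have "a = Comp A ?P0 U V y (res_aug A U) \<otimes>\<^bsub>Hom A ?P0 V\<^esub> ?q"
    unfolding y(2)[symmetric] using a q D U by (simp only: add_assoc neg_closed add_neg add_zero res_simps)
  then have "Comp A ?P0 V W p a = Comp A ?P0 V W p (Comp A ?P0 U V y (res_aug A U)) \<otimes>\<^bsub>Hom A ?P0 W\<^esub>
      (Comp A ?P0 V W p (Comp A ?P0 X V i k) \<otimes>\<^bsub>Hom A ?P0 W\<^esub> Comp A ?P0 V W p a')"
    using y(1) a' k(1) D U by (metis (no_types) comp_add_right comp_closed q res_simps(1,4))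
  also have "Comp A ?P0 V W p (Comp A ?P0 X V i k) = zero_arr A ?P0 W" using k(1) D U by (simp add: Comp_assoc)
  finally have "Comp A ?P0 U W h (res_aug A U) = Comp A ?P0 U W (Comp A U V W p y \<otimes>\<^bsub>Hom A U W\<^esub> h') (res_aug A U)"
    unfolding pa pa' using y(1) h' D U by (simp add: comp_add_left Comp_assoc)
  then have "h = Comp A U V W p y \<otimes>\<^bsub>Hom A U W\<^esub> h'"
    by (rule epic_cancel[OF res_exact(1)[OF U] D(3) h, rotated]) (use y(1) h' D U in simp)
  then show ?thesis using y(1) by blast
qed

text \<open>If \<open>h = p y\<close> then \<open>a\<close> and \<open>y e\<close> are two lifts of \<open>h e\<close>, so they differ by some \<open>i k\<close>, and \<open>b = k d\<^sub>0\<close>.\<close>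

lemma connects_trivial:
  assumes c: "connects X V W i p U (Comp A U V W p y) b" and y: "y \<in> Arr A U V" and se: "short_exact X V W i p" and U: "U \<in> Ob A"
  shows "\<exists>k\<in>Arr A (res_ob A U 0) X. b = cobound X U k"
proof -
  note D = short_exactD[OF se]
  let ?P0 = "res_ob A U 0" let ?P1 = "res_ob A U (Suc 0)"
  obtain a where b: "b \<in> cocyc X U" and a: "a \<in> Arr A ?P0 V"
    and pa: "Comp A ?P0 V W p a = Comp A ?P0 U W (Comp A U V W p y) (res_aug A U)" and ad: "cobound V U a = Comp A ?P1 X V i b"
    using c unfolding connects_def by blast
  let ?q = "Comp A ?P0 U V y (res_aug A U)"
  have q: "?q \<in> Arr A ?P0 V" using y D U by simp
  let ?r = "a \<otimes>\<^bsub>Hom A ?P0 V\<^esub> inv\<^bsub>Hom A ?P0 V\<^esub> ?q"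
  have "Comp A ?P0 V W p ?r = zero_arr A ?P0 W"
    using a y D U by (simp add: comp_add_right comp_neg_right pa Comp_assoc)
  then obtain k where k: "k \<in> Arr A ?P0 X" "Comp A ?P0 X V i k = ?r"
    using kernel_lift[OF D(5), of ?P0 ?r] a q D U by auto
  have "Comp A ?P1 X V i (cobound X U k) = cobound V U ?r" using k D U by (simp flip: cobound_comp)
  also have "\<dots> = Comp A ?P1 X V i b"
    using a q y D U cocyc_closed[OF b] by (simp add: cobound_add cobound_neg cobound_aug ad monoid.inv_one)
  finally have eq: "Comp A ?P1 X V i (cobound X U k) = Comp A ?P1 X V i b" .
  have "cobound X U k = b"
    by (rule kernel_cancel[OF D(5) _ D(2,3,6) _ _ eq]) (use k(1) cocyc_closed[OF b] D(1) U in simp_all)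
  then show ?thesis using k(1) by metis
qed

text \<open>Exactness of \<open>Hom(U, W) \<rightarrow> Ext\<^sup>1(U, X) \<rightarrow> Ext\<^sup>1(U, V)\<close>: if \<open>i b = a d\<^sub>0\<close>, then \<open>p a\<close> kills \<open>d\<^sub>0\<close>, so it
  descends to \<open>U\<close>.\<close>

lemma connects_surj:
  assumes b: "b \<in> cocyc X U" and a: "a \<in> Arr A (res_ob A U 0) V" "Comp A (res_ob A U (Suc 0)) X V i b = cobound V U a"
    and se: "short_exact X V W i p" and U: "U \<in> Ob A"
  shows "\<exists>h. connects X V W i p U h b"
proof -
  note D = short_exactD[OF se]
  let ?P0 = "res_ob A U 0" let ?P1 = "res_ob A U (Suc 0)"
  have "cobound W U (Comp A ?P0 V W p a) = Comp A ?P1 V W p (Comp A ?P1 X V i b)"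
    using a D U by (simp add: cobound_comp)
  also have "\<dots> = zero_arr A ?P1 W" using cocyc_closed[OF b] D U by (simp add: Comp_assoc)
  finally obtain h where "h \<in> Arr A U W" "Comp A ?P0 V W p a = Comp A ?P0 U W h (res_aug A U)"
    using cobound_eq_zero[of "Comp A ?P0 V W p a" U W] a D U by auto
  then show ?thesis using a b unfolding connects_def by metis
qed

text \<open>The argument for cokernels of \<open>p\<^sub>*\<close>, with classes in the cokernel replaced by their images under the
  connecting map into \<open>Ext\<^sup>1(-, K)\<close>, where \<open>K\<close> is the kernel of \<open>p\<close>.  For an \<open>f\<close> that factors through \<open>p\<close>,
  exactness gives a class \<open>x\<close> in \<open>Ext\<^sup>1(Z, K)\<close> only; it comes from some \<open>h : Z \<rightarrow> Y\<close> because its image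
  in \<open>Ext\<^sup>1(Z, V)\<close> is zero.\<close>

lemma stably_split_if_exact_on_ExtA:
  assumes [simp]: "f \<in> Arr A X Y" "g \<in> Arr A Y Z" "X \<in> Ob A" "Y \<in> Ob A" "Z \<in> Ob A"
    and ex: "\<And>K. K \<in> Ob A \<Longrightarrow> exact_on (ExtA A (Suc 0) K) X Y Z f g"
  shows "stably_split X Y Z f g"
proof (rule stably_splitI)
  fix V p assume V: "V \<in> Ob A" and p: "epic A V Z p" and "\<exists>v\<in>Arr A Y V. g = Comp A Y V Z p v"
  then obtain v where v: "v \<in> Arr A Y V" "g = Comp A Y V Z p v" by blast
  obtain K i where se: "short_exact K V Z i p" using ex_short_exact[OF p V \<open>Z \<in> Ob A\<close>] .
  note D = short_exactD[OF se]
  obtain b where c: "connects K V Z i p Z (Ident A Z) b" using ex_connects[OF se, of Z "Ident A Z"] by auto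
  have b: "b \<in> cocyc K Z" using c by (simp add: connects_def)
  obtain \<alpha> \<beta> where l: "lift1 Y Z g \<alpha> \<beta>" using lift1_chain_lift[of Y Z g] by auto
  have "connects K V Z i p Y (Comp A Y V Z p v) (Comp A (res_ob A Y (Suc 0)) (res_ob A Z (Suc 0)) K b \<beta>)"
    using connects_natural[OF c l se] unfolding v(2)[symmetric] by simp
  from connects_trivial[OF this v(1) se]
  have "Fmap (ExtA A (Suc 0) K) Y Z g (cls K Z b) = \<one>\<^bsub>Fob (ExtA A (Suc 0) K) Y\<^esub>"
    using ExtA_Fmap[OF l b D(1)] cls_eq_one_iff[OF D(1)] cocyc_closed[OF cocyc_comp[OF l b D(1)]] by simp
  then have "cls K Z b = \<one>\<^bsub>Fob (ExtA A (Suc 0) K) Z\<^esub>"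
    using ex[OF D(1)] b D(1) by (simp add: exact_on_def ExtA_carrier)
  then obtain k where k: "k \<in> Arr A (res_ob A Z 0) K" "b = cobound K Z k"
    using cls_eq_one_iff[OF D(1) \<open>Z \<in> Ob A\<close> cocyc_closed[OF b]] by auto
  have "connects K V Z i p Z (zero_arr A Z Z) (zero_arr A (res_ob A Z (Suc 0)) K)"
    unfolding connects_def using D
    by (auto simp: cocyc_def cobound_def intro!: bexI[of _ "zero_arr A (res_ob A Z 0) V"])
  from connects_cohomologous[OF c this se _ k(1)]
  show "\<exists>v\<in>Arr A Z V. Ident A Z = Comp A Z V Z p v"
    using k D by auto
next
  fix V p assume V: "V \<in> Ob A" and p: "epic A V Y p" and "\<exists>v\<in>Arr A X V. f = Comp A X V Y p v"
  then obtain v where v: "v \<in> Arr A X V" "f = Comp A X V Y p v" by blast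
  obtain K i where se: "short_exact K V Y i p" using ex_short_exact[OF p V \<open>Y \<in> Ob A\<close>] .
  note D = short_exactD[OF se]
  let ?P1 = "res_ob A Y (Suc 0)" let ?Q1 = "res_ob A Z (Suc 0)"
  obtain b where c: "connects K V Y i p Y (Ident A Y) b" using ex_connects[OF se, of Y "Ident A Y"] by auto
  then obtain a where b: "b \<in> cocyc K Y" and a: "a \<in> Arr A (res_ob A Y 0) V" "cobound V Y a = Comp A ?P1 K V i b"
    unfolding connects_def by blast
  obtain \<alpha> \<beta> where l: "lift1 X Y f \<alpha> \<beta>" using lift1_chain_lift[of X Y f] by auto
  have "connects K V Y i p X (Comp A X V Y p v) (Comp A (res_ob A X (Suc 0)) ?P1 K b \<beta>)"
    using connects_natural[OF c l se] unfolding v(2)[symmetric] by simp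
  from connects_trivial[OF this v(1) se]
  have "Fmap (ExtA A (Suc 0) K) X Y f (cls K Y b) = \<one>\<^bsub>Fob (ExtA A (Suc 0) K) X\<^esub>"
    using ExtA_Fmap[OF l b D(1)] cls_eq_one_iff[OF D(1)] cocyc_closed[OF cocyc_comp[OF l b D(1)]] by simp
  moreover have "cls K Y b \<in> carrier (Fob (ExtA A (Suc 0) K) Y)" using b D(1) by (simp add: ExtA_carrier)
  ultimately obtain x where x: "x \<in> carrier (Fob (ExtA A (Suc 0) K) Z)" "cls K Y b = Fmap (ExtA A (Suc 0) K) Y Z g x"
    using ex[OF D(1)] unfolding exact_on_def by blast
  obtain c' where c': "c' \<in> cocyc K Z" "x = cls K Z c'" using x(1) D(1) by (auto simp: ExtA_carrier)
  obtain \<gamma> \<delta> where m: "lift1 Y Z g \<gamma> \<delta>" using lift1_chain_lift[of Y Z g] by auto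
  have \<delta>: "\<delta> \<in> Arr A ?P1 ?Q1" using m by (simp add: lift1_def)
  let ?cd = "Comp A ?P1 ?Q1 K c' \<delta>"
  have cd: "?cd \<in> Arr A ?P1 K" using cocyc_closed[OF c'(1)] \<delta> D(1) by simp
  have "cls K Y b = cls K Y ?cd" unfolding x(2) c'(2) using ExtA_Fmap[OF m c'(1) D(1)] by simp
  then obtain k where k: "k \<in> Arr A (res_ob A Y 0) K" "b = cobound K Y k \<otimes>\<^bsub>Hom A ?P1 K\<^esub> ?cd"
    using cls_eq_iff[OF D(1) _ cocyc_closed[OF b] cd] by auto
  \<comment> \<open>the image of \<open>x\<close> in \<open>Ext\<^sup>1(Z, V)\<close> vanishes, because it vanishes in \<open>Ext\<^sup>1(Y, V)\<close>\<close>
  have ic: "Comp A ?Q1 K V i c' \<in> cocyc V Z"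
    using c'(1) cocyc_closed[OF c'(1)] D by (simp add: cocyc_def flip: Comp_assoc)
  have "cobound V Y a = cobound V Y (Comp A (res_ob A Y 0) K V i k) \<otimes>\<^bsub>Hom A ?P1 V\<^esub> Comp A ?P1 K V i ?cd"
    unfolding a(2) k(2) using k(1) cd D by (simp add: comp_add_right cobound_comp)
  then have "Comp A ?P1 K V i ?cd = inv\<^bsub>Hom A ?P1 V\<^esub> (cobound V Y (Comp A (res_ob A Y 0) K V i k)) \<otimes>\<^bsub>Hom A ?P1 V\<^esub> cobound V Y a"
    using k(1) a(1) cd D by (simp flip: add_assoc)
  also have "\<dots> = cobound V Y (inv\<^bsub>Hom A (res_ob A Y 0) V\<^esub> (Comp A (res_ob A Y 0) K V i k) \<otimes>\<^bsub>Hom A (res_ob A Y 0) V\<^esub> a)"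
    using k(1) a(1) D by (simp add: cobound_add cobound_neg)
  finally have "\<exists>k\<in>Arr A (res_ob A Y 0) V. Comp A ?P1 ?Q1 V (Comp A ?Q1 K V i c') \<delta> = cobound V Y k"
    using k(1) a(1) D cocyc_closed[OF c'(1)] \<delta> by (auto simp: Comp_assoc)
  then have "Fmap (ExtA A (Suc 0) V) Y Z g (cls V Z (Comp A ?Q1 K V i c')) = \<one>\<^bsub>Fob (ExtA A (Suc 0) V) Y\<^esub>"
    using ExtA_Fmap[OF m ic D(2)] cls_eq_one_iff[OF D(2)] cocyc_closed[OF cocyc_comp[OF m ic D(2)]] by simp
  then have "cls V Z (Comp A ?Q1 K V i c') = \<one>\<^bsub>Fob (ExtA A (Suc 0) V) Z\<^esub>"
    using ex[OF D(2)] ic D(2) by (simp add: exact_on_def ExtA_carrier)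
  then obtain a' where a': "a' \<in> Arr A (res_ob A Z 0) V" "Comp A ?Q1 K V i c' = cobound V Z a'"
    using cls_eq_one_iff[OF D(2) \<open>Z \<in> Ob A\<close> cocyc_closed[OF ic]] by auto
  obtain h where h: "connects K V Y i p Z h c'" using connects_surj[OF c'(1) a' se] by auto
  then have hm: "h \<in> Arr A Z Y" by (simp add: connects_def)
  have "connects K V Y i p Y (Comp A Y Z Y h g) ?cd" using connects_natural[OF h m se] by simp
  from connects_cohomologous[OF c this se _ k]
  show "\<exists>v\<in>Arr A Y V. \<exists>k\<in>Arr A Z Y. Ident A Y = Comp A Y V Y p v \<otimes>\<^bsub>Hom A Y Y\<^esub> Comp A Y Z Y k g"
    using hm by auto
qed simp_all

section \<open>Categories of finitely presented functors\<close>

text \<open>The quotient by the trace, with values realised by representatives so that it lies in the same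
  universe as \<open>F\<close>.\<close>

lemma reflection:
  fixes F :: "('o, 'm, 'm) abfun"
  assumes F: "finitely_presented A F"
  obtains Q :: "('o, 'm, 'm) abfun" and \<kappa> where "finitely_presented A Q" "vanishes_on_projectives A Q" "natural A F Q \<kappa>" "nat_surj A F Q \<kappa>"
    "\<And>X x. \<lbrakk>X \<in> Ob A; x \<in> carrier (Fob F X)\<rbrakk> \<Longrightarrow> \<kappa> X x = \<one>\<^bsub>Fob Q X\<^esub> \<longleftrightarrow> x \<in> trace F X"
proof -
  have add: "additive_functor A F" using F by (rule finitely_presented_additive)
  obtain Q :: "('o, 'm, 'm) abfun" and \<kappa> where Q: "additive_functor A Q" "natural A F Q \<kappa>" "nat_surj A F Q \<kappa>"
    "\<And>X x. \<lbrakk>X \<in> Ob A; x \<in> carrier (Fob F X)\<rbrakk> \<Longrightarrow> \<kappa> X x = \<one>\<^bsub>Fob Q X\<^esub> \<longleftrightarrow> x \<in> trace F X"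
    using quotient_functor[OF add subfunctorial_trace[OF add], of "\<lambda>X x. x"] by (auto simp: inj_on_def)
  obtain L \<tau> where L: "L \<in> Ob A" "natural A (Rep A L) F \<tau>" "\<And>X. X \<in> Ob A \<Longrightarrow> \<tau> X ` Arr A X L = trace F X"
    using trace_covered[OF F] by blast
  have fp: "finitely_presented A Q"
    by (rule finitely_presented_quotient[OF F L(1,2) Q(1-3)]) (simp add: Q(4) L(3))
  have "y = \<one>\<^bsub>Fob Q P\<^esub>" if P: "projective A P" and y: "y \<in> carrier (Fob Q P)" for P y
  proof -
    have Ob: "P \<in> Ob A" using P by (rule projective_Ob)
    obtain x where x: "x \<in> carrier (Fob F P)" "y = \<kappa> P x" using nat_surjD[OF Q(3) Ob y] by auto
    have "Fmap F P P (Ident A P) x \<in> trace F P"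
      unfolding trace_def using P x(1) ident_closed[OF Ob] by blast
    then show ?thesis using x Q(4)[OF Ob x(1)] add Ob by simp
  qed
  then have "vanishes_on_projectives A Q" by (rule vanishes_on_projectivesI[OF Q(1)])
  then show ?thesis using that fp Q(2-4) by blast
qed

end

text \<open>Full subcategories of functors that are closed under quotients and kernels and in which
  every evaluation functor \<open>F \<mapsto> F X\<close> is represented by a functor with one generator in degree \<open>X\<close>.
  The last property makes kernels pointwise.\<close>

locale functor_subcat = proj_abelian A for A :: "('o, 'm) precat" +
  fixes D :: "(('o, 'm, 'm) abfun, 'o \<Rightarrow> 'm \<Rightarrow> 'm) precat"
  assumes Hom_D: "Hom D = NatTr A"
    and Comp_D: "Comp D = (\<lambda>F G H \<beta> \<alpha>. nat_comp A F \<beta> \<alpha>)"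
    and Ident_D: "Ident D = nat_ident A"
    and fp_D: "F \<in> Ob D \<Longrightarrow> finitely_presented A F"
    and quotient_D: "\<lbrakk>G \<in> Ob D; finitely_presented A Q; natural A G Q \<kappa>; nat_surj A G Q \<kappa>\<rbrakk> \<Longrightarrow> Q \<in> Ob D"
    and subfunctor_D: "\<lbrakk>F \<in> Ob D; finitely_presented A (subfunctor F N); subfunctorial F N\<rbrakk> \<Longrightarrow> subfunctor F N \<in> Ob D"
    and generator_D: "X \<in> Ob A \<Longrightarrow> \<exists>R\<in>Ob D. \<exists>u\<in>carrier (Fob R X).
        (\<forall>W\<in>Ob A. \<forall>r\<in>carrier (Fob R W). \<exists>w\<in>Arr A W X. r = Fmap R W X w u) \<and>
        (\<forall>M\<in>Ob D. \<forall>x\<in>carrier (Fob M X). \<exists>\<xi>. natural A R M \<xi> \<and> \<xi> X u = x)"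
begin

lemma additive_D: "F \<in> Ob D \<Longrightarrow> additive_functor A F"
  by (rule finitely_presented_additive[OF fp_D])

lemma nat_D: "\<alpha> \<in> Arr D F G \<Longrightarrow> natural A F G \<alpha>"
  by (simp add: Hom_D natural_NatTr)

lemma ext_D: "\<lbrakk>natural A F G \<alpha>; F \<in> Ob D\<rbrakk> \<Longrightarrow> restrict_nat A F \<alpha> \<in> Arr D F G"
  using additive_D by (simp add: Hom_D)

lemma eq_D:
  "\<lbrakk>\<alpha> \<in> Arr D F G; \<beta> \<in> Arr D F H; \<And>X x. \<lbrakk>X \<in> Ob A; x \<in> carrier (Fob F X)\<rbrakk> \<Longrightarrow> \<alpha> X x = \<beta> X x\<rbrakk> \<Longrightarrow> \<alpha> = \<beta>"
  unfolding Hom_D by (rule NatTr_eqI)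

lemma comp_D [simp]:
  "\<lbrakk>X \<in> Ob A; x \<in> carrier (Fob F X)\<rbrakk> \<Longrightarrow> Comp D F G H \<beta> \<alpha> X x = \<beta> X (\<alpha> X x)"
  by (simp add: Comp_D NatTr_simps)

lemma zero_D [simp]: "\<lbrakk>X \<in> Ob A; x \<in> carrier (Fob F X)\<rbrakk> \<Longrightarrow> zero_arr D F G X x = \<one>\<^bsub>Fob G X\<^esub>"
  by (simp add: Hom_D NatTr_simps)

lemma ident_D [simp]: "\<lbrakk>X \<in> Ob A; x \<in> carrier (Fob F X)\<rbrakk> \<Longrightarrow> Ident D F X x = x"
  by (simp add: Ident_D NatTr_simps)

lemma comp_closed_D: "\<lbrakk>\<alpha> \<in> Arr D F G; \<beta> \<in> Arr D G H; F \<in> Ob D\<rbrakk> \<Longrightarrow> Comp D F G H \<beta> \<alpha> \<in> Arr D F H"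
  using ext_D[OF natural_compose[OF nat_D nat_D]] by (simp add: Comp_D NatTr_simps)

lemma zero_closed_D: "\<lbrakk>F \<in> Ob D; G \<in> Ob D\<rbrakk> \<Longrightarrow> zero_arr D F G \<in> Arr D F G"
  using ext_D[OF natural_zero[OF additive_D additive_D]] by (simp add: Hom_D NatTr_simps)

lemma ident_closed_D: "F \<in> Ob D \<Longrightarrow> Ident D F \<in> Arr D F F"
  using ext_D[OF natural_id[OF additive_D]] by (simp add: Ident_D NatTr_simps)

lemma comp_eq_zero_iff:
  assumes "\<alpha> \<in> Arr D F G" "\<beta> \<in> Arr D G H" "F \<in> Ob D" "H \<in> Ob D"
  shows "Comp D F G H \<beta> \<alpha> = zero_arr D F H \<longleftrightarrow> (\<forall>X\<in>Ob A. \<forall>x\<in>carrier (Fob F X). \<beta> X (\<alpha> X x) = \<one>\<^bsub>Fob H X\<^esub>)"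
proof
  assume eq: "Comp D F G H \<beta> \<alpha> = zero_arr D F H"
  show "\<forall>X\<in>Ob A. \<forall>x\<in>carrier (Fob F X). \<beta> X (\<alpha> X x) = \<one>\<^bsub>Fob H X\<^esub>"
  proof (intro ballI)
    fix X x assume *: "X \<in> Ob A" "x \<in> carrier (Fob F X)"
    have "\<beta> X (\<alpha> X x) = Comp D F G H \<beta> \<alpha> X x" using * by simp
    also have "\<dots> = \<one>\<^bsub>Fob H X\<^esub>" unfolding eq using * by simp
    finally show "\<beta> X (\<alpha> X x) = \<one>\<^bsub>Fob H X\<^esub>" .
  qed
next
  assume "\<forall>X\<in>Ob A. \<forall>x\<in>carrier (Fob F X). \<beta> X (\<alpha> X x) = \<one>\<^bsub>Fob H X\<^esub>"
  then show "Comp D F G H \<beta> \<alpha> = zero_arr D F H"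
    by (intro eq_D[OF comp_closed_D[OF assms(1-3)] zero_closed_D[OF assms(3,4)]]) simp
qed

lemma zero_object_iff: "is_zero_object D F \<longleftrightarrow> F \<in> Ob D \<and> (\<forall>X\<in>Ob A. carrier (Fob F X) \<subseteq> {\<one>\<^bsub>Fob F X\<^esub>})"
proof
  assume z: "is_zero_object D F"
  then have F: "F \<in> Ob D" by (simp add: is_zero_object_def)
  have eq: "Ident D F = zero_arr D F F"
    using z F ident_closed_D[OF F] zero_closed_D[OF F F] unfolding is_zero_object_def by blast
  have "x = \<one>\<^bsub>Fob F X\<^esub>" if "X \<in> Ob A" "x \<in> carrier (Fob F X)" for X x
  proof -
    have "x = Ident D F X x" using that by simp
    then show ?thesis unfolding eq using that by simp
  qed
  then show "F \<in> Ob D \<and> (\<forall>X\<in>Ob A. carrier (Fob F X) \<subseteq> {\<one>\<^bsub>Fob F X\<^esub>})" using F by blast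
next
  assume *: "F \<in> Ob D \<and> (\<forall>X\<in>Ob A. carrier (Fob F X) \<subseteq> {\<one>\<^bsub>Fob F X\<^esub>})"
  then have F: "F \<in> Ob D" and tr: "\<And>X x. \<lbrakk>X \<in> Ob A; x \<in> carrier (Fob F X)\<rbrakk> \<Longrightarrow> x = \<one>\<^bsub>Fob F X\<^esub>" by blast+
  have 1: "f = zero_arr D G F" if "G \<in> Ob D" "f \<in> Arr D G F" for G f
    by (rule eq_D[OF that(2) zero_closed_D[OF that(1) F]])
      (use tr natural_closed[OF nat_D[OF that(2)]] in simp)
  have 2: "f = zero_arr D F G" if "G \<in> Ob D" "f \<in> Arr D F G" for G f
  proof (rule eq_D[OF that(2) zero_closed_D[OF F that(1)]])
    fix X x assume X: "X \<in> Ob A" "x \<in> carrier (Fob F X)"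
    then show "f X x = zero_arr D F G X x"
      using tr[OF X] natural_one[OF nat_D[OF that(2)] additive_D[OF F] additive_D[OF that(1)] X(1)] by simp
  qed
  show "is_zero_object D F"
    unfolding is_zero_object_def
    using F 1 2 zero_closed_D[OF _ F] zero_closed_D[OF F] by blast
qed

text \<open>Elements of \<open>G X\<close> are maps from the generator in degree \<open>X\<close> to \<open>G\<close>, so the universal property of \<open>k\<close>,
  applied to them, describes the elements of \<open>K X\<close>.\<close>

lemma kernel_pointwise:
  assumes k: "is_kernel D G H \<beta> K k" and G: "G \<in> Ob D" and H: "H \<in> Ob D" and \<beta>: "\<beta> \<in> Arr D G H" and X: "X \<in> Ob A"
  shows "inj_on (k X) (carrier (Fob K X))"
    "x \<in> carrier (Fob G X) \<Longrightarrow> \<beta> X x = \<one>\<^bsub>Fob H X\<^esub> \<longleftrightarrow> (\<exists>z\<in>carrier (Fob K X). x = k X z)"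
proof -
  have K: "K \<in> Ob D" and kK: "k \<in> Arr D K G" and zero: "Comp D K G H \<beta> k = zero_arr D K H"
    and univ: "\<And>W h. \<lbrakk>W \<in> Ob D; h \<in> Arr D W G; Comp D W G H \<beta> h = zero_arr D W H\<rbrakk>
        \<Longrightarrow> \<exists>!u. u \<in> Arr D W K \<and> Comp D W K G k u = h"
    using k by (auto simp: is_kernel_def)
  have zero': "\<beta> X (k X z) = \<one>\<^bsub>Fob H X\<^esub>" if "X \<in> Ob A" "z \<in> carrier (Fob K X)" for X z
    using zero comp_eq_zero_iff[OF kK \<beta> K H] that by simp
  obtain R u where R: "R \<in> Ob D" and u: "u \<in> carrier (Fob R X)"
    and gen: "\<And>W r. \<lbrakk>W \<in> Ob A; r \<in> carrier (Fob R W)\<rbrakk> \<Longrightarrow> \<exists>w\<in>Arr A W X. r = Fmap R W X w u"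
    and ev: "\<And>M x. \<lbrakk>M \<in> Ob D; x \<in> carrier (Fob M X)\<rbrakk> \<Longrightarrow> \<exists>\<xi>. natural A R M \<xi> \<and> \<xi> X u = x"
    using generator_D[OF X] by blast
  show "inj_on (k X) (carrier (Fob K X))"
  proof (rule inj_onI)
    fix z z' assume z: "z \<in> carrier (Fob K X)" and z': "z' \<in> carrier (Fob K X)" and eq: "k X z = k X z'"
    obtain \<xi> \<xi>' where \<xi>: "natural A R K \<xi>" "\<xi> X u = z" and \<xi>': "natural A R K \<xi>'" "\<xi>' X u = z'" using ev[OF K z] ev[OF K z'] by blast
    let ?a = "restrict_nat A R \<xi>" and ?b = "restrict_nat A R \<xi>'"
    have a: "?a \<in> Arr D R K" and b: "?b \<in> Arr D R K" using ext_D \<xi> \<xi>' R by blast+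
    have "Comp D R K G k ?a = Comp D R K G k ?b"
    proof (rule eq_D[OF comp_closed_D[OF a kK R] comp_closed_D[OF b kK R]])
      fix W r assume W: "W \<in> Ob A" and r: "r \<in> carrier (Fob R W)"
      obtain w where w: "w \<in> Arr A W X" "r = Fmap R W X w u" using gen[OF W r] by blast
      have "k W (\<xi> W r) = Fmap G W X w (k X z)" "k W (\<xi>' W r) = Fmap G W X w (k X z')"
        unfolding w(2) natural_Fmap[OF \<xi>(1) w(1) u W X] natural_Fmap[OF \<xi>'(1) w(1) u W X] \<xi>(2) \<xi>'(2)
        by (rule natural_Fmap[OF nat_D[OF kK] w(1) _ W X], fact)+
      then show "Comp D R K G k ?a W r = Comp D R K G k ?b W r" using eq W r by simp
    qed
    moreover have "Comp D R G H \<beta> (Comp D R K G k ?a) = zero_arr D R H"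
      unfolding comp_eq_zero_iff[OF comp_closed_D[OF a kK R] \<beta> R H]
      using zero' natural_closed[OF \<xi>(1)] by simp
    ultimately have "?a = ?b" using univ[OF R comp_closed_D[OF a kK R]] a b by metis
    then have "?a X u = ?b X u" by simp
    then show "z = z'" using X u \<xi>(2) \<xi>'(2) by simp
  qed
  assume x: "x \<in> carrier (Fob G X)"
  show "\<beta> X x = \<one>\<^bsub>Fob H X\<^esub> \<longleftrightarrow> (\<exists>z\<in>carrier (Fob K X). x = k X z)"
  proof
    assume \<beta>x: "\<beta> X x = \<one>\<^bsub>Fob H X\<^esub>"
    obtain \<xi> where \<xi>: "natural A R G \<xi>" "\<xi> X u = x" using ev[OF G x] by blast
    have a: "restrict_nat A R \<xi> \<in> Arr D R G" using ext_D \<xi> R by blast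
    have "Comp D R G H \<beta> (restrict_nat A R \<xi>) = zero_arr D R H"
      unfolding comp_eq_zero_iff[OF a \<beta> R H]
    proof (intro ballI)
      fix W r assume W: "W \<in> Ob A" and r: "r \<in> carrier (Fob R W)"
      obtain w where w: "w \<in> Arr A W X" "r = Fmap R W X w u" using gen[OF W r] by blast
      have "\<beta> W (\<xi> W r) = Fmap H W X w (\<beta> X x)"
        unfolding w(2) natural_Fmap[OF \<xi>(1) w(1) u W X] \<xi>(2)
        by (rule natural_Fmap[OF nat_D[OF \<beta>] w(1) x W X])
      then show "\<beta> W (restrict_nat A R \<xi> W r) = \<one>\<^bsub>Fob H W\<^esub>"
        using \<beta>x W r w(1) X additive_D[OF H] by simp
    qed
    then obtain v where v: "v \<in> Arr D R K" "Comp D R K G k v = restrict_nat A R \<xi>" using univ[OF R a] by blast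
    have "k X (v X u) = Comp D R K G k v X u" using X u by simp
    also have "\<dots> = x" unfolding v(2) using X u \<xi>(2) by simp
    finally show "\<exists>z\<in>carrier (Fob K X). x = k X z" using natural_closed[OF nat_D[OF v(1)] u X] by metis
  qed (use zero' X in auto)
qed

lemma is_kernelI:
  assumes K: "K \<in> Ob D" and kK: "k \<in> Arr D K G" and G: "G \<in> Ob D" and H: "H \<in> Ob D" and \<beta>: "\<beta> \<in> Arr D G H"
    and inj: "\<And>X. X \<in> Ob A \<Longrightarrow> inj_on (k X) (carrier (Fob K X))"
    and ker: "\<And>X x. \<lbrakk>X \<in> Ob A; x \<in> carrier (Fob G X)\<rbrakk> \<Longrightarrow> \<beta> X x = \<one>\<^bsub>Fob H X\<^esub> \<longleftrightarrow> (\<exists>z\<in>carrier (Fob K X). x = k X z)"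
  shows "is_kernel D G H \<beta> K k"
  unfolding is_kernel_def
proof (intro conjI ballI impI)
  note nk = nat_D[OF kK]
  show "Comp D K G H \<beta> k = zero_arr D K H"
    unfolding comp_eq_zero_iff[OF kK \<beta> K H] using ker natural_closed[OF nk] by blast
  fix W h assume W: "W \<in> Ob D" and h: "h \<in> Arr D W G" and z: "Comp D W G H \<beta> h = zero_arr D W H"
  note nh = nat_D[OF h]
  define v where "v X x = inv_into (carrier (Fob K X)) (k X) (h X x)" for X x
  have v: "v X x \<in> carrier (Fob K X) \<and> k X (v X x) = h X x" if X: "X \<in> Ob A" and x: "x \<in> carrier (Fob W X)" for X x
  proof -
    have "\<beta> X (h X x) = \<one>\<^bsub>Fob H X\<^esub>" using z comp_eq_zero_iff[OF h \<beta> W H] X x by simp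
    then have "h X x \<in> k X ` carrier (Fob K X)" using ker[OF X natural_closed[OF nh x X]] by blast
    then show ?thesis unfolding v_def by (simp add: inv_into_into f_inv_into_f)
  qed
  have v_eq: "v X x = c" if "X \<in> Ob A" "x \<in> carrier (Fob W X)" "c \<in> carrier (Fob K X)" "k X c = h X x" for X x c
    using inj_onD[OF inj[OF that(1)]] v[OF that(1,2)] that by metis
  have "natural A W K v"
    unfolding natural_def hom_def
  proof (intro conjI ballI CollectI funcsetI)
    fix X x assume "X \<in> Ob A" "x \<in> carrier (Fob W X)"
    then show "v X x \<in> carrier (Fob K X)" using v by blast
  next
    fix X x y assume X: "X \<in> Ob A" and x: "x \<in> carrier (Fob W X)" and y: "y \<in> carrier (Fob W X)"
    show "v X (x \<otimes>\<^bsub>Fob W X\<^esub> y) = v X x \<otimes>\<^bsub>Fob K X\<^esub> v X y"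
      using X x y v[OF X x] v[OF X y] additive_D[OF K] additive_D[OF W]
      by (intro v_eq) (simp_all add: natural_mult[OF nk] natural_mult[OF nh])
  next
    fix X Y f y assume X: "X \<in> Ob A" and Y: "Y \<in> Ob A" and f: "f \<in> Arr A X Y" and y: "y \<in> carrier (Fob W Y)"
    show "v X (Fmap W X Y f y) = Fmap K X Y f (v Y y)"
      using X Y f y v[OF Y y] additive_D[OF K] additive_D[OF W]
      by (intro v_eq) (simp_all add: natural_Fmap[OF nk] natural_Fmap[OF nh])
  qed
  then have v': "restrict_nat A W v \<in> Arr D W K" using ext_D W by blast
  show "\<exists>!u. u \<in> Arr D W K \<and> Comp D W K G k u = h"
  proof (intro ex1I conjI)
    show "restrict_nat A W v \<in> Arr D W K" by fact
    show "Comp D W K G k (restrict_nat A W v) = h"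
      by (rule eq_D[OF comp_closed_D[OF v' kK W] h]) (use v in simp)
    fix u assume u: "u \<in> Arr D W K \<and> Comp D W K G k u = h"
    show "u = restrict_nat A W v"
    proof (rule eq_D[OF conjunct1[OF u] v'])
      fix X x assume X: "X \<in> Ob A" and x: "x \<in> carrier (Fob W X)"
      have "h X x = k X (u X x)" using X x by (simp flip: conjunct2[OF u])
      then show "u X x = restrict_nat A W v X x"
        using v_eq[OF X x natural_closed[OF nat_D[OF conjunct1[OF u]] x X]] X x by simp
    qed
  qed
qed (use K kK in auto)

lemma ex_coker_pointwise:
  assumes F: "F \<in> Ob D" and G: "G \<in> Ob D" and \<alpha>: "\<alpha> \<in> Arr D F G"
  obtains Q \<kappa> where "Q \<in> Ob D" "\<kappa> \<in> Arr D G Q" "nat_surj A G Q \<kappa>"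
    "\<And>X x. \<lbrakk>X \<in> Ob A; x \<in> carrier (Fob G X)\<rbrakk> \<Longrightarrow> \<kappa> X x = \<one>\<^bsub>Fob Q X\<^esub> \<longleftrightarrow> x \<in> \<alpha> X ` carrier (Fob F X)"
proof -
  obtain Q :: "('o, 'm, 'm) abfun" and \<kappa> where Q: "finitely_presented A Q" "natural A G Q \<kappa>" "nat_surj A G Q \<kappa>"
    "\<And>X x. \<lbrakk>X \<in> Ob A; x \<in> carrier (Fob G X)\<rbrakk> \<Longrightarrow> \<kappa> X x = \<one>\<^bsub>Fob Q X\<^esub> \<longleftrightarrow> x \<in> \<alpha> X ` carrier (Fob F X)"
    using finitely_presented_coker[OF fp_D[OF F] fp_D[OF G] nat_D[OF \<alpha>]] by blast
  have "Q \<in> Ob D" by (rule quotient_D[OF G Q(1-3)])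
  moreover have "restrict_nat A G \<kappa> \<in> Arr D G Q" using ext_D[OF Q(2) G] .
  moreover have "nat_surj A G Q (restrict_nat A G \<kappa>)" using Q(3) by (auto simp: nat_surj_def image_def)
  ultimately show ?thesis using that[of Q "restrict_nat A G \<kappa>"] Q(4) by simp
qed

lemma is_cokernelI:
  assumes F: "F \<in> Ob D" and G: "G \<in> Ob D" and Q: "Q \<in> Ob D" and \<alpha>: "\<alpha> \<in> Arr D F G" and q: "q \<in> Arr D G Q" and surj: "nat_surj A G Q q"
    and ker: "\<And>X x. \<lbrakk>X \<in> Ob A; x \<in> carrier (Fob G X)\<rbrakk> \<Longrightarrow> q X x = \<one>\<^bsub>Fob Q X\<^esub> \<longleftrightarrow> x \<in> \<alpha> X ` carrier (Fob F X)"
  shows "is_cokernel D F G \<alpha> Q q"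
  unfolding is_cokernel_def
proof (intro conjI ballI impI)
  show "Comp D F G Q q \<alpha> = zero_arr D F Q"
    unfolding comp_eq_zero_iff[OF \<alpha> q F Q] using ker natural_closed[OF nat_D[OF \<alpha>]] by blast
  fix W h assume W: "W \<in> Ob D" and h: "h \<in> Arr D G W" and z: "Comp D F G W h \<alpha> = zero_arr D F W"
  have kill: "h X x = \<one>\<^bsub>Fob W X\<^esub>" if "X \<in> Ob A" "x \<in> carrier (Fob G X)" "q X x = \<one>\<^bsub>Fob Q X\<^esub>" for X x
    using z ker[OF that(1,2)] that comp_eq_zero_iff[OF \<alpha> h F W] by auto
  obtain v where v: "natural A Q W v" "\<And>X x. \<lbrakk>X \<in> Ob A; x \<in> carrier (Fob G X)\<rbrakk> \<Longrightarrow> v X (q X x) = h X x"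
    using descend_along_surj[OF nat_D[OF q] surj nat_D[OF h] additive_D[OF G] additive_D[OF W] additive_D[OF Q] kill] by blast
  have v': "restrict_nat A Q v \<in> Arr D Q W" using ext_D[OF v(1) Q] .
  have qc: "q X x \<in> carrier (Fob Q X)" if "X \<in> Ob A" "x \<in> carrier (Fob G X)" for X x
    using natural_closed[OF nat_D[OF q]] that by blast
  show "\<exists>!u. u \<in> Arr D Q W \<and> Comp D G Q W u q = h"
  proof (intro ex1I conjI)
    show "restrict_nat A Q v \<in> Arr D Q W" by fact
    show "Comp D G Q W (restrict_nat A Q v) q = h"
      by (rule eq_D[OF comp_closed_D[OF q v' G] h]) (use v qc in simp)
    fix u assume u: "u \<in> Arr D Q W \<and> Comp D G Q W u q = h"
    show "u = restrict_nat A Q v"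
    proof (rule eq_D[OF conjunct1[OF u] v'])
      fix X y assume X: "X \<in> Ob A" and y: "y \<in> carrier (Fob Q X)"
      obtain x where x: "x \<in> carrier (Fob G X)" "y = q X x" using nat_surjD[OF surj X y] by blast
      have "u X y = h X x" unfolding x(2) using X x(1) by (simp flip: conjunct2[OF u])
      then show "u X y = restrict_nat A Q v X y" using v(2)[OF X x(1)] X y x(2) by simp
    qed
  qed
qed (use Q q in auto)

text \<open>Compare with the pointwise cokernel: it factors through \<open>q\<close>, so \<open>q\<close> kills no more than the image.\<close>

lemma cokernel_pointwise:
  assumes c: "is_cokernel D F G \<alpha> Q q" and F: "F \<in> Ob D" and G: "G \<in> Ob D" and \<alpha>: "\<alpha> \<in> Arr D F G"
    and X: "X \<in> Ob A" and x: "x \<in> carrier (Fob G X)"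
  shows "q X x = \<one>\<^bsub>Fob Q X\<^esub> \<longleftrightarrow> x \<in> \<alpha> X ` carrier (Fob F X)"
proof -
  have Q: "Q \<in> Ob D" and q: "q \<in> Arr D G Q" and zero: "Comp D F G Q q \<alpha> = zero_arr D F Q"
    and univ: "\<And>W h. \<lbrakk>W \<in> Ob D; h \<in> Arr D G W; Comp D F G W h \<alpha> = zero_arr D F W\<rbrakk>
        \<Longrightarrow> \<exists>!u. u \<in> Arr D Q W \<and> Comp D G Q W u q = h"
    using c by (auto simp: is_cokernel_def)
  obtain Q' \<kappa> where Q': "Q' \<in> Ob D" "\<kappa> \<in> Arr D G Q'" "nat_surj A G Q' \<kappa>"
    and ker: "\<And>X x. \<lbrakk>X \<in> Ob A; x \<in> carrier (Fob G X)\<rbrakk> \<Longrightarrow> \<kappa> X x = \<one>\<^bsub>Fob Q' X\<^esub> \<longleftrightarrow> x \<in> \<alpha> X ` carrier (Fob F X)"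
    using ex_coker_pointwise[OF F G \<alpha>] by blast
  have "Comp D F G Q' \<kappa> \<alpha> = zero_arr D F Q'"
    unfolding comp_eq_zero_iff[OF \<alpha> Q'(2) F Q'(1)] using ker natural_closed[OF nat_D[OF \<alpha>]] by blast
  then obtain v where v: "v \<in> Arr D Q Q'" "Comp D G Q Q' v q = \<kappa>" using univ[OF Q'(1,2)] by blast
  show ?thesis
  proof
    assume "q X x = \<one>\<^bsub>Fob Q X\<^esub>"
    moreover have "\<kappa> X x = v X (q X x)" using X x by (simp flip: v(2))
    ultimately have "\<kappa> X x = \<one>\<^bsub>Fob Q' X\<^esub>"
      using natural_one[OF nat_D[OF v(1)] additive_D[OF Q] additive_D[OF Q'(1)] X] by simp
    then show "x \<in> \<alpha> X ` carrier (Fob F X)" using ker[OF X x] by simp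
  next
    assume "x \<in> \<alpha> X ` carrier (Fob F X)"
    then show "q X x = \<one>\<^bsub>Fob Q X\<^esub>" using zero X comp_eq_zero_iff[OF \<alpha> q F Q] by auto
  qed
qed

text \<open>The pointwise cokernel of an epimorphism is zero.\<close>

lemma epic_iff_surj:
  assumes F: "F \<in> Ob D" and G: "G \<in> Ob D" and \<alpha>: "\<alpha> \<in> Arr D F G"
  shows "epic D F G \<alpha> \<longleftrightarrow> nat_surj A F G \<alpha>"
proof
  assume e: "epic D F G \<alpha>"
  obtain Q \<kappa> where Q: "Q \<in> Ob D" "\<kappa> \<in> Arr D G Q" "nat_surj A G Q \<kappa>"
    and ker: "\<And>X x. \<lbrakk>X \<in> Ob A; x \<in> carrier (Fob G X)\<rbrakk> \<Longrightarrow> \<kappa> X x = \<one>\<^bsub>Fob Q X\<^esub> \<longleftrightarrow> x \<in> \<alpha> X ` carrier (Fob F X)"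
    using ex_coker_pointwise[OF F G \<alpha>] by blast
  note z = zero_closed_D[OF G Q(1)]
  have "Comp D F G Q \<kappa> \<alpha> = Comp D F G Q (zero_arr D G Q) \<alpha>"
  proof (rule eq_D[OF comp_closed_D[OF \<alpha> Q(2) F] comp_closed_D[OF \<alpha> z F]])
    fix X x assume "X \<in> Ob A" "x \<in> carrier (Fob F X)"
    then show "Comp D F G Q \<kappa> \<alpha> X x = Comp D F G Q (zero_arr D G Q) \<alpha> X x"
      using ker[of X "\<alpha> X x"] natural_closed[OF nat_D[OF \<alpha>]] by simp
  qed
  then have \<kappa>: "\<kappa> = zero_arr D G Q" using e Q(1,2) z unfolding epic_def by blast
  show "nat_surj A F G \<alpha>"
  proof (rule nat_surjI[OF nat_D[OF \<alpha>]])
    fix X y assume "X \<in> Ob A" "y \<in> carrier (Fob G X)"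
    then show "\<exists>x\<in>carrier (Fob F X). y = \<alpha> X x" using ker[of X y] by (auto simp: \<kappa>)
  qed
next
  assume s: "nat_surj A F G \<alpha>"
  show "epic D F G \<alpha>"
    unfolding epic_def
  proof (intro conjI ballI impI \<alpha>)
    fix W u v assume u: "u \<in> Arr D G W" and v: "v \<in> Arr D G W" and eq: "Comp D F G W u \<alpha> = Comp D F G W v \<alpha>"
    show "u = v"
    proof (rule eq_D[OF u v])
      fix X y assume X: "X \<in> Ob A" and y: "y \<in> carrier (Fob G X)"
      obtain x where x: "x \<in> carrier (Fob F X)" "y = \<alpha> X x" using nat_surjD[OF s X y] by blast
      have "u X y = Comp D F G W u \<alpha> X x" using X x by simp
      also have "\<dots> = v X y" unfolding eq using X x by simp
      finally show "u X y = v X y" .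
    qed
  qed
qed

lemma kernel_subfunctor:
  assumes G: "G \<in> Ob D" and H: "H \<in> Ob D" and \<beta>: "\<beta> \<in> Arr D G H"
  obtains K k where "K \<in> Ob D" "k \<in> Arr D K G" "\<And>X. X \<in> Ob A \<Longrightarrow> inj_on (k X) (carrier (Fob K X))"
    "\<And>X x. \<lbrakk>X \<in> Ob A; x \<in> carrier (Fob G X)\<rbrakk> \<Longrightarrow> \<beta> X x = \<one>\<^bsub>Fob H X\<^esub> \<longleftrightarrow> (\<exists>z\<in>carrier (Fob K X). x = k X z)"
proof -
  let ?N = "\<lambda>X. if X \<in> Ob A then kernel (Fob G X) (Fob H X) (\<beta> X) else {}"
  let ?K = "subfunctor G ?N"
  have sub: "subfunctorial G ?N"
    using subfunctorial_kernel[OF additive_D[OF G] additive_D[OF H] nat_D[OF \<beta>]] by (simp add: subfunctorial_def)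
  have K: "?K \<in> Ob D"
    by (rule subfunctor_D[OF G finitely_presented_kernel[OF fp_D[OF G] fp_D[OF H] nat_D[OF \<beta>]] sub])
  have k: "restrict_nat A ?K (\<lambda>X x. x) \<in> Arr D ?K G"
    by (rule ext_D[OF natural_subfunctor_incl[OF additive_D[OF G] sub] K])
  show ?thesis
    by (rule that[OF K k]) (auto simp: inj_on_def kernel_def restrict_nat_def)
qed

lemma exact_at_iff:
  assumes F: "F \<in> Ob D" and G: "G \<in> Ob D" and H: "H \<in> Ob D" and \<alpha>: "\<alpha> \<in> Arr D F G" and \<beta>: "\<beta> \<in> Arr D G H"
  shows "exact_at D F G H \<alpha> \<beta> \<longleftrightarrow> nat_exact A F G H \<alpha> \<beta>"
proof
  assume "exact_at D F G H \<alpha> \<beta>"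
  then obtain Q q K k where c: "is_cokernel D F G \<alpha> Q q" and k: "is_kernel D G Q q K k" and k': "is_kernel D G H \<beta> K k"
    by (auto simp: exact_at_def)
  have Q: "Q \<in> Ob D" "q \<in> Arr D G Q" using c by (auto simp: is_cokernel_def)
  have "\<beta> X x = \<one>\<^bsub>Fob H X\<^esub> \<longleftrightarrow> x \<in> \<alpha> X ` carrier (Fob F X)" if "X \<in> Ob A" "x \<in> carrier (Fob G X)" for X x
    using kernel_pointwise(2)[OF k G Q that] kernel_pointwise(2)[OF k' G H \<beta> that] cokernel_pointwise[OF c F G \<alpha> that] by simp
  then show "nat_exact A F G H \<alpha> \<beta>"
    using natural_closed[OF nat_D[OF \<alpha>]] by (auto simp: nat_exact_def kernel_def)
next
  assume ex: "nat_exact A F G H \<alpha> \<beta>"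
  obtain Q \<kappa> where Q: "Q \<in> Ob D" "\<kappa> \<in> Arr D G Q" "nat_surj A G Q \<kappa>"
    and ker: "\<And>X x. \<lbrakk>X \<in> Ob A; x \<in> carrier (Fob G X)\<rbrakk> \<Longrightarrow> \<kappa> X x = \<one>\<^bsub>Fob Q X\<^esub> \<longleftrightarrow> x \<in> \<alpha> X ` carrier (Fob F X)"
    using ex_coker_pointwise[OF F G \<alpha>] by blast
  obtain K k where K: "K \<in> Ob D" "k \<in> Arr D K G" "\<And>X. X \<in> Ob A \<Longrightarrow> inj_on (k X) (carrier (Fob K X))"
    and kk: "\<And>X x. \<lbrakk>X \<in> Ob A; x \<in> carrier (Fob G X)\<rbrakk> \<Longrightarrow> \<beta> X x = \<one>\<^bsub>Fob H X\<^esub> \<longleftrightarrow> (\<exists>z\<in>carrier (Fob K X). x = k X z)"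
    using kernel_subfunctor[OF G H \<beta>] by blast
  have "is_cokernel D F G \<alpha> Q \<kappa>" by (rule is_cokernelI[OF F G Q(1) \<alpha> Q(2,3) ker])
  moreover have "is_kernel D G H \<beta> K k" by (rule is_kernelI[OF K(1,2) G H \<beta> K(3) kk])
  moreover have "is_kernel D G Q \<kappa> K k"
  proof (rule is_kernelI[OF K(1,2) G Q(1,2) K(3)])
    fix X x assume *: "X \<in> Ob A" "x \<in> carrier (Fob G X)"
    have "\<beta> X x = \<one>\<^bsub>Fob H X\<^esub> \<longleftrightarrow> x \<in> \<alpha> X ` carrier (Fob F X)"
      using ex * by (auto simp: nat_exact_def kernel_def)
    then show "\<kappa> X x = \<one>\<^bsub>Fob Q X\<^esub> \<longleftrightarrow> (\<exists>z\<in>carrier (Fob K X). x = k X z)" using ker[OF *] kk[OF *] by simp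
  qed
  ultimately show "exact_at D F G H \<alpha> \<beta>" unfolding exact_at_def using \<alpha> \<beta> by blast
qed

text \<open>The homology is the cokernel of the map \<open>f'\<close> from \<open>F\<close> to the kernel of \<open>\<beta>\<close>, and it is zero iff \<open>f'\<close> is
  pointwise surjective.\<close>

lemma homology_zero_iff:
  assumes h: "is_homology D F G H \<alpha> \<beta> K'" and F: "F \<in> Ob D" and G: "G \<in> Ob D" and H: "H \<in> Ob D"
    and \<alpha>: "\<alpha> \<in> Arr D F G" and \<beta>: "\<beta> \<in> Arr D G H"
  shows "is_zero_object D K' \<longleftrightarrow> nat_exact A F G H \<alpha> \<beta>"
proof -
  obtain K k f' c where k: "is_kernel D G H \<beta> K k" and f': "f' \<in> Arr D F K" "Comp D F K G k f' = \<alpha>"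
    and c: "is_cokernel D F K f' K' c" using h by (auto simp: is_homology_def)
  have K: "K \<in> Ob D" "k \<in> Arr D K G" using k by (auto simp: is_kernel_def)
  have K': "K' \<in> Ob D" "c \<in> Arr D K K'" using c by (auto simp: is_cokernel_def)
  note kp = kernel_pointwise[OF k G H \<beta>] and cp = cokernel_pointwise[OF c F K(1) f'(1)]
  have \<alpha>_eq: "\<alpha> X x = k X (f' X x)" if "X \<in> Ob A" "x \<in> carrier (Fob F X)" for X x
    using that by (simp flip: f'(2))
  have f'c: "f' X x \<in> carrier (Fob K X)" if "X \<in> Ob A" "x \<in> carrier (Fob F X)" for X x
    using natural_closed[OF nat_D[OF f'(1)]] that by blast
  have zero: "is_zero_object D K' \<longleftrightarrow> (\<forall>X\<in>Ob A. \<forall>z\<in>carrier (Fob K X). c X z = \<one>\<^bsub>Fob K' X\<^esub>)"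
  proof
    assume "is_zero_object D K'"
    then show "\<forall>X\<in>Ob A. \<forall>z\<in>carrier (Fob K X). c X z = \<one>\<^bsub>Fob K' X\<^esub>"
      using natural_closed[OF nat_D[OF K'(2)]] unfolding zero_object_iff by blast
  next
    assume tr: "\<forall>X\<in>Ob A. \<forall>z\<in>carrier (Fob K X). c X z = \<one>\<^bsub>Fob K' X\<^esub>"
    note z = zero_closed_D[OF K'(1) K'(1)] and i = ident_closed_D[OF K'(1)]
    have "Comp D K K' K' (Ident D K') c = c"
      by (rule eq_D[OF comp_closed_D[OF K'(2) i K(1)] K'(2)]) (use natural_closed[OF nat_D[OF K'(2)]] in simp)
    moreover have "Comp D K K' K' (zero_arr D K' K') c = c"
      by (rule eq_D[OF comp_closed_D[OF K'(2) z K(1)] K'(2)]) (use natural_closed[OF nat_D[OF K'(2)]] tr in simp)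
    moreover have "\<exists>!u. u \<in> Arr D K' K' \<and> Comp D K K' K' u c = c"
      using c K' unfolding is_cokernel_def by blast
    ultimately have eq: "Ident D K' = zero_arr D K' K'" using i z by blast
    have "x = \<one>\<^bsub>Fob K' X\<^esub>" if "X \<in> Ob A" "x \<in> carrier (Fob K' X)" for X x
    proof -
      have "x = Ident D K' X x" using that by simp
      then show ?thesis unfolding eq using that by simp
    qed
    then show "is_zero_object D K'" unfolding zero_object_iff using K'(1) by blast
  qed
  also have "\<dots> \<longleftrightarrow> (\<forall>X\<in>Ob A. \<forall>z\<in>carrier (Fob K X). z \<in> f' X ` carrier (Fob F X))"
    using cp by simp
  also have "\<dots> \<longleftrightarrow> nat_exact A F G H \<alpha> \<beta>"
  proof
    assume s: "\<forall>X\<in>Ob A. \<forall>z\<in>carrier (Fob K X). z \<in> f' X ` carrier (Fob F X)"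
    show "nat_exact A F G H \<alpha> \<beta>"
    proof (rule nat_exactI[OF _ _ nat_D[OF \<alpha>]])
      fix X x assume *: "X \<in> Ob A" "x \<in> carrier (Fob F X)"
      show "\<beta> X (\<alpha> X x) = \<one>\<^bsub>Fob H X\<^esub>"
        using kp(2)[OF *(1) natural_closed[OF nat_D[OF \<alpha>] *(2,1)]] \<alpha>_eq[OF *] f'c[OF *] by blast
    next
      fix X x assume *: "X \<in> Ob A" "x \<in> carrier (Fob G X)" "\<beta> X x = \<one>\<^bsub>Fob H X\<^esub>"
      then obtain z where z: "z \<in> carrier (Fob K X)" "x = k X z" using kp(2)[OF *(1,2)] by blast
      then obtain y where "y \<in> carrier (Fob F X)" "z = f' X y" using s *(1) by blast
      then show "\<exists>z\<in>carrier (Fob F X). x = \<alpha> X z" using \<alpha>_eq[OF *(1)] z by auto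
    qed
  next
    assume ex: "nat_exact A F G H \<alpha> \<beta>"
    show "\<forall>X\<in>Ob A. \<forall>z\<in>carrier (Fob K X). z \<in> f' X ` carrier (Fob F X)"
    proof (intro ballI)
      fix X z assume X: "X \<in> Ob A" and z: "z \<in> carrier (Fob K X)"
      have kz: "k X z \<in> carrier (Fob G X)" by (rule natural_closed[OF nat_D[OF K(2)] z X])
      then have "\<beta> X (k X z) = \<one>\<^bsub>Fob H X\<^esub>" using kp(2)[OF X kz] z by blast
      then obtain y where y: "y \<in> carrier (Fob F X)" "k X z = \<alpha> X y" using nat_exactD[OF ex X kz] by blast
      then have "z = f' X y" using inj_onD[OF kp(1)[OF X] _ z f'c[OF X y(1)]] \<alpha>_eq[OF X y(1)] by simp
      then show "z \<in> f' X ` carrier (Fob F X)" using y by blast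
    qed
  qed
  finally show ?thesis .
qed

lemma ex_homology:
  assumes F: "F \<in> Ob D" and G: "G \<in> Ob D" and H: "H \<in> Ob D" and \<alpha>: "\<alpha> \<in> Arr D F G" and \<beta>: "\<beta> \<in> Arr D G H"
    and zero: "Comp D F G H \<beta> \<alpha> = zero_arr D F H"
  shows "\<exists>K'. is_homology D F G H \<alpha> \<beta> K'"
proof -
  obtain K k where K: "K \<in> Ob D" "k \<in> Arr D K G" "\<And>X. X \<in> Ob A \<Longrightarrow> inj_on (k X) (carrier (Fob K X))"
    and kk: "\<And>X x. \<lbrakk>X \<in> Ob A; x \<in> carrier (Fob G X)\<rbrakk> \<Longrightarrow> \<beta> X x = \<one>\<^bsub>Fob H X\<^esub> \<longleftrightarrow> (\<exists>z\<in>carrier (Fob K X). x = k X z)"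
    using kernel_subfunctor[OF G H \<beta>] by blast
  have k: "is_kernel D G H \<beta> K k" by (rule is_kernelI[OF K(1,2) G H \<beta> K(3) kk])
  then obtain f' where f': "f' \<in> Arr D F K" "Comp D F K G k f' = \<alpha>" using F \<alpha> zero unfolding is_kernel_def by blast
  obtain Q \<kappa> where Q: "Q \<in> Ob D" "\<kappa> \<in> Arr D K Q" "nat_surj A K Q \<kappa>"
    and ker: "\<And>X x. \<lbrakk>X \<in> Ob A; x \<in> carrier (Fob K X)\<rbrakk> \<Longrightarrow> \<kappa> X x = \<one>\<^bsub>Fob Q X\<^esub> \<longleftrightarrow> x \<in> f' X ` carrier (Fob F X)"
    using ex_coker_pointwise[OF F K(1) f'(1)] by blast
  have "is_cokernel D F K f' Q \<kappa>" by (rule is_cokernelI[OF F K(1) Q(1) f'(1) Q(2,3) ker])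
  then show ?thesis using k f' unfolding is_homology_def by blast
qed

end

section \<open>The left adjoint of the inclusion and its first derived functor\<close>

context proj_abelian
begin

lemma fp_simps [simp]:
  "Hom (fp A) = NatTr A" "Ident (fp A) = nat_ident A" "Comp (fp A) = (\<lambda>F G H \<beta> \<alpha>. nat_comp A F \<beta> \<alpha>)"
  "Hom (fp0 A) = NatTr A" "Ident (fp0 A) = nat_ident A" "Comp (fp0 A) = (\<lambda>F G H \<beta> \<alpha>. nat_comp A F \<beta> \<alpha>)"
  "F \<in> Ob (fp A) \<longleftrightarrow> finitely_presented A F"
  "F \<in> Ob (fp0 A) \<longleftrightarrow> finitely_presented A F \<and> vanishes_on_projectives A F"
  by (simp_all add: fp_def fp0_def)

lemma functor_subcat_fp: "functor_subcat A (fp A)"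
proof (unfold_locales, goal_cases)
  case (7 X)
  show ?case
  proof (rule bexI[of _ "Rep A X"], rule bexI[of _ "Ident A X"], intro conjI ballI)
    fix M x assume "M \<in> Ob (fp A)" "x \<in> carrier (Fob M X)"
    then have M: "additive_functor A M" and x: "x \<in> carrier (Fob M X)" by (simp_all add: finitely_presented_additive)
    have "natural A (Rep A X) M (yon M X x) \<and> yon M X x X (Ident A X) = x"
      using natural_yon[OF M 7 x] M 7 x by (simp add: yon_def)
    then show "\<exists>\<xi>. natural A (Rep A X) M \<xi> \<and> \<xi> X (Ident A X) = x" by blast
  next
    fix W r assume "W \<in> Ob A" "r \<in> carrier (Fob (Rep A X) W)"
    then show "\<exists>w\<in>Arr A W X. r = Fmap (Rep A X) W X w (Ident A X)" using 7 by auto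
  qed (use 7 in \<open>simp_all add: finitely_presented_Rep\<close>)
qed simp_all

lemma functor_subcat_fp0: "functor_subcat A (fp0 A)"
proof (unfold_locales, goal_cases)
  case (5 G Q \<kappa>)
  then have Q: "additive_functor A Q" by (simp add: finitely_presented_additive)
  have "y = \<one>\<^bsub>Fob Q P\<^esub>" if P: "projective A P" and y: "y \<in> carrier (Fob Q P)" for P y
  proof -
    obtain x where x: "x \<in> carrier (Fob G P)" "y = \<kappa> P x" using nat_surjD[OF 5(4) projective_Ob[OF P] y] by blast
    have "vanishes_on_projectives A G" using 5(1) by simp
    from vanishesD[OF this P x(1)] show ?thesis
      using natural_one[OF 5(3) _ Q projective_Ob[OF P]] 5(1) x(2) by (simp add: finitely_presented_additive)
  qed
  then show ?case using vanishes_on_projectivesI[OF Q] 5(2) by simp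
next
  case (6 F N)
  have "x = \<one>\<^bsub>Fob (subfunctor F N) P\<^esub>" if P: "projective A P" and x: "x \<in> carrier (Fob (subfunctor F N) P)" for P x
    using subfunctorialD(2)[OF 6(3) projective_Ob[OF P]] vanishesD[OF _ P, of F x] 6(1) x by simp
  then show ?case using vanishes_on_projectivesI[OF finitely_presented_additive[OF 6(2)]] 6(2) by simp
next
  case (7 X)
  obtain R :: "('o, 'm, 'm) abfun" and \<kappa> where R: "finitely_presented A R" "vanishes_on_projectives A R" "natural A (Rep A X) R \<kappa>" "nat_surj A (Rep A X) R \<kappa>"
    and ker: "\<And>W x. \<lbrakk>W \<in> Ob A; x \<in> carrier (Fob (Rep A X) W)\<rbrakk> \<Longrightarrow> \<kappa> W x = \<one>\<^bsub>Fob R W\<^esub> \<longleftrightarrow> x \<in> trace (Rep A X) W"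
    using reflection[OF finitely_presented_Rep[OF 7]] by blast
  show ?case
  proof (rule bexI[of _ R], rule bexI[of _ "\<kappa> X (Ident A X)"], intro conjI ballI)
    fix W r assume W: "W \<in> Ob A" and r: "r \<in> carrier (Fob R W)"
    obtain w where "w \<in> carrier (Fob (Rep A X) W)" "r = \<kappa> W w" using nat_surjD[OF R(4) W r] by blast
    then show "\<exists>w\<in>Arr A W X. r = Fmap R W X w (\<kappa> X (Ident A X))"
      using yoneda[OF R(3) W 7, of w] by auto
  next
    fix M x assume "M \<in> Ob (fp0 A)" and x: "x \<in> carrier (Fob M X)"
    then have M: "additive_functor A M" "vanishes_on_projectives A M" by (simp_all add: finitely_presented_additive)
    note n = natural_yon[OF M(1) 7 x]
    have kill: "yon M X x W h = \<one>\<^bsub>Fob M W\<^esub>"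
      if "W \<in> Ob A" "h \<in> carrier (Fob (Rep A X) W)" "\<kappa> W h = \<one>\<^bsub>Fob R W\<^esub>" for W h
      using trace_vanishes[OF M(2,1) trace_natural[OF n _ that(1)] that(1)] ker[OF that(1,2)] that(3) by simp
    obtain \<xi> where "natural A R M \<xi>" "\<And>W h. \<lbrakk>W \<in> Ob A; h \<in> carrier (Fob (Rep A X) W)\<rbrakk> \<Longrightarrow> \<xi> W (\<kappa> W h) = yon M X x W h"
      using descend_along_surj[OF R(3,4) n additive_Rep[OF 7] M(1) finitely_presented_additive[OF R(1)] kill] by blast
    then show "\<exists>\<xi>. natural A R M \<xi> \<and> \<xi> X (\<kappa> X (Ident A X)) = x"
      using 7 M(1) x by (intro exI[of _ \<xi>]) (simp add: yon_def)
  qed (use R 7 natural_closed[OF R(3), of "Ident A X" X] in simp_all)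
qed (simp_all add: fp_simps)

interpretation fp: functor_subcat A "fp A" by (rule functor_subcat_fp)
interpretation fp0: functor_subcat A "fp0 A" by (rule functor_subcat_fp0)

text \<open>A projective functor splits off a representable that covers it.\<close>

lemma projective_fp_summand:
  assumes P: "projective (fp A) P"
  shows "summand_of_Rep P"
proof -
  have fP: "finitely_presented A P" using P by (simp add: projective_def)
  obtain Y Z g \<pi> where p: "presentation Y Z g \<pi> P" using fP by (auto simp: finitely_presented_iff)
  note pD = presentationD[OF p]
  let ?\<pi> = "restrict_nat A (Rep A Z) \<pi>"
  have Z: "Rep A Z \<in> Ob (fp A)" and P': "P \<in> Ob (fp A)" using fP pD(2) by (simp_all add: finitely_presented_Rep)
  have \<pi>: "?\<pi> \<in> Arr (fp A) (Rep A Z) P" using fp.ext_D[OF pD(4) Z] .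
  have "nat_surj A (Rep A Z) P ?\<pi>" using p by (auto simp: presentation_def nat_surj_def)
  then have "epic (fp A) (Rep A Z) P ?\<pi>" using fp.epic_iff_surj[OF Z P' \<pi>] by simp
  then obtain \<sigma> where \<sigma>: "\<sigma> \<in> Arr (fp A) P (Rep A Z)" "Comp (fp A) P (Rep A Z) P ?\<pi> \<sigma> = Ident (fp A) P"
    using P Z P' fp.ident_closed_D[OF P'] unfolding projective_def by blast
  have "\<pi> X (\<sigma> X x) = x" if X: "X \<in> Ob A" and x: "x \<in> carrier (Fob P X)" for X x
  proof -
    have "\<sigma> X x \<in> carrier (Fob (Rep A Z) X)" using natural_closed[OF fp.nat_D[OF \<sigma>(1)] x X] .
    then have "\<pi> X (\<sigma> X x) = Comp (fp A) P (Rep A Z) P ?\<pi> \<sigma> X x" using fp.comp_D[OF X x] X by simp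
    also have "\<dots> = x" unfolding \<sigma>(2) by (rule fp.ident_D[OF X x])
    finally show ?thesis .
  qed
  then show ?thesis unfolding summand_of_Rep_def using pD(2,4) fp.nat_D[OF \<sigma>(1)] by blast
qed

lemma projective_fp_Rep:
  assumes Z: "Z \<in> Ob A"
  shows "projective (fp A) (Rep A Z)"
  unfolding projective_def
proof (intro conjI ballI allI impI)
  show R: "Rep A Z \<in> Ob (fp A)" using Z by (simp add: finitely_presented_Rep)
  fix F G e f assume F: "F \<in> Ob (fp A)" and G: "G \<in> Ob (fp A)" and e: "epic (fp A) F G e" and f: "f \<in> Arr (fp A) (Rep A Z) G"
  have e': "e \<in> Arr (fp A) F G" using e by (simp add: epic_def)
  have s: "nat_surj A F G e" using e fp.epic_iff_surj[OF F G e'] by simp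
  have "\<exists>y\<in>carrier (Fob F X). f X x = e X y" if "X \<in> Ob A" "x \<in> carrier (Fob (Rep A Z) X)" for X x
    using nat_surjD[OF s that(1) natural_closed[OF fp.nat_D[OF f] that(2,1)]] .
  then obtain \<gamma> where \<gamma>: "natural A (Rep A Z) F \<gamma>" "\<And>X x. \<lbrakk>X \<in> Ob A; x \<in> carrier (Fob (Rep A Z) X)\<rbrakk> \<Longrightarrow> e X (\<gamma> X x) = f X x"
    using lift_summand[OF summand_of_Rep_Rep[OF Z] fp.additive_D[OF F] fp.additive_D[OF G] fp.nat_D[OF f] fp.nat_D[OF e']] by blast
  note g = fp.ext_D[OF \<gamma>(1) R]
  have "Comp (fp A) (Rep A Z) F G e (restrict_nat A (Rep A Z) \<gamma>) = f"
  proof (rule fp.eq_D[OF fp.comp_closed_D[OF g e' R] f])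
    fix X x assume *: "X \<in> Ob A" "x \<in> carrier (Fob (Rep A Z) X)"
    show "Comp (fp A) (Rep A Z) F G e (restrict_nat A (Rep A Z) \<gamma>) X x = f X x"
      unfolding fp.comp_D[OF *] restrict_nat_apply[OF *] by (rule \<gamma>(2)[OF *])
  qed
  then show "\<exists>g\<in>Arr (fp A) (Rep A Z) F. Comp (fp A) (Rep A Z) F G e g = f" using g by blast
qed

lemma proj_resolution_fp_resolution:
  assumes F: "F \<in> Ob (fp A)" and r: "proj_resolution (fp A) F P d e"
  shows "resolution (P 2) (P 1) (P 0) F (d 1) (d 0) e"
    "\<And>n. P n \<in> Ob (fp A)" "\<And>n. d n \<in> Arr (fp A) (P (Suc n)) (P n)"
proof -
  have P: "projective (fp A) (P n)" for n using r by (simp add: proj_resolution_def)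
  show Ob: "P n \<in> Ob (fp A)" for n using P by (simp add: projective_def)
  show d: "d n \<in> Arr (fp A) (P (Suc n)) (P n)" for n
    using r unfolding proj_resolution_def by (cases n) (auto simp: exact_at_def)
  have e: "e \<in> Arr (fp A) (P 0) F" "epic (fp A) (P 0) F e" using r by (simp_all add: proj_resolution_def epic_def)
  have "exact_at (fp A) (P 2) (P 1) (P 0) (d 1) (d 0)" "exact_at (fp A) (P 1) (P 0) F (d 0) e"
    using r unfolding proj_resolution_def numeral_2_eq_2 One_nat_def by blast+
  then have "nat_exact A (P 2) (P 1) (P 0) (d 1) (d 0)" "nat_exact A (P 1) (P 0) F (d 0) e"
    using fp.exact_at_iff[OF Ob Ob Ob, of "d 1" 2 1 "d 0" 0] fp.exact_at_iff[OF Ob Ob F, of "d 0" 1 0 e] d[of 0] d[of 1] e(1)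
    by (simp_all only: numeral_2_eq_2 One_nat_def)
  moreover have "nat_surj A (P 0) F e" using fp.epic_iff_surj[OF Ob F e(1)] e(2) by simp
  moreover have "natural A (P 2) (P 1) (d 1)" "natural A (P 1) (P 0) (d 0)"
    using fp.nat_D[OF d[of 1]] fp.nat_D[OF d[of 0]] by (simp_all only: numeral_2_eq_2 One_nat_def)
  ultimately show "resolution (P 2) (P 1) (P 0) F (d 1) (d 0) e"
    unfolding resolution_def
    using fp.additive_D[OF Ob] fp.additive_D[OF F] projective_fp_summand[OF P] fp.nat_D[OF e(1)] by blast
qed

lemma ex_proj_resolution_fp:
  assumes F: "F \<in> Ob (fp A)"
  shows "\<exists>P d e. proj_resolution (fp A) F P d e"
proof -
  obtain R d e where r: "rep_resolution A F R d e" using ex_rep_resolution[OF fp.fp_D[OF F]] by blast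
  have R: "\<And>n. R n \<in> Ob A" and d: "\<And>n. d n \<in> Arr (fp A) (Rep A (R (Suc n))) (Rep A (R n))"
    and e: "e \<in> Arr (fp A) (Rep A (R 0)) F" and s: "nat_surj A (Rep A (R 0)) F e"
    and ex: "nat_exact A (Rep A (R (Suc 0))) (Rep A (R 0)) F (d 0) e"
      "\<And>n. nat_exact A (Rep A (R (Suc (Suc n)))) (Rep A (R (Suc n))) (Rep A (R n)) (d (Suc n)) (d n)"
    using r by (simp_all add: rep_resolution_def)
  have Ob: "Rep A (R n) \<in> Ob (fp A)" for n using R by (simp add: finitely_presented_Rep)
  have "proj_resolution (fp A) F (\<lambda>n. Rep A (R n)) d e"
    unfolding proj_resolution_def One_nat_def
    using projective_fp_Rep[OF R] fp.epic_iff_surj[OF Ob F e] s fp.exact_at_iff[OF Ob Ob F d e] ex(1)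
      fp.exact_at_iff[OF Ob Ob Ob d d] ex(2) by simp
  then show ?thesis by blast
qed

lemma ex_left_adjoint: "\<exists>L. is_left_adjoint (fp A) (fp0 A) L incl"
proof -
  define good where "good F Q \<kappa> \<longleftrightarrow> finitely_presented A Q \<and> vanishes_on_projectives A Q \<and> \<kappa> \<in> carrier (NatTr A F Q) \<and>
      nat_surj A F Q \<kappa> \<and> (\<forall>X\<in>Ob A. \<forall>x\<in>carrier (Fob F X). \<kappa> X x = \<one>\<^bsub>Fob Q X\<^esub> \<longleftrightarrow> x \<in> trace F X)"
    for F Q :: "('o, 'm, 'm) abfun" and \<kappa>
  have "\<exists>Q\<kappa>. good F (fst Q\<kappa>) (snd Q\<kappa>)" if F: "F \<in> Ob (fp A)" for F
  proof -
    obtain Q :: "('o, 'm, 'm) abfun" and \<kappa> where Q: "finitely_presented A Q" "vanishes_on_projectives A Q" "natural A F Q \<kappa>" "nat_surj A F Q \<kappa>"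
      "\<And>X x. \<lbrakk>X \<in> Ob A; x \<in> carrier (Fob F X)\<rbrakk> \<Longrightarrow> \<kappa> X x = \<one>\<^bsub>Fob Q X\<^esub> \<longleftrightarrow> x \<in> trace F X"
      using reflection F by auto
    have "good F Q (restrict_nat A F \<kappa>)"
      using Q fp.additive_D[OF F] by (simp add: good_def nat_surj_def)
    then show ?thesis by (intro exI[of _ "(Q, restrict_nat A F \<kappa>)"]) simp
  qed
  then obtain S where S: "\<And>F. F \<in> Ob (fp A) \<Longrightarrow> good F (fst (S F)) (snd (S F))" by metis
  define T where "T F = fst (S F)" for F
  define \<eta> where "\<eta> F = snd (S F)" for F
  have T: "T F \<in> Ob (fp0 A)" "T F \<in> Ob (fp A)" "additive_functor A (T F)" and \<eta>: "\<eta> F \<in> Arr (fp A) F (T F)" "natural A F (T F) (\<eta> F)" "nat_surj A F (T F) (\<eta> F)"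
    and ker: "\<And>X x. \<lbrakk>X \<in> Ob A; x \<in> carrier (Fob F X)\<rbrakk> \<Longrightarrow> \<eta> F X x = \<one>\<^bsub>Fob (T F) X\<^esub> \<longleftrightarrow> x \<in> trace F X"
    if "F \<in> Ob (fp A)" for F
    using S[OF that] by (simp_all add: good_def T_def \<eta>_def natural_NatTr finitely_presented_additive)
  \<comment> \<open>the universal property of \<open>\<eta>\<close>\<close>
  have univ: "\<exists>!g. g \<in> Arr (fp0 A) (T F) G \<and> Comp (fp A) F (T F) G g (\<eta> F) = f"
    if F: "F \<in> Ob (fp A)" and G: "G \<in> Ob (fp0 A)" and f: "f \<in> Arr (fp A) F G" for F G f
  proof -
    have G': "G \<in> Ob (fp A)" "vanishes_on_projectives A G" using G by simp_all
    have kill: "f X x = \<one>\<^bsub>Fob G X\<^esub>" if "X \<in> Ob A" "x \<in> carrier (Fob F X)" "\<eta> F X x = \<one>\<^bsub>Fob (T F) X\<^esub>" for X x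
      using trace_vanishes[OF G'(2) fp.additive_D[OF G'(1)] trace_natural[OF fp.nat_D[OF f] _ that(1)] that(1)]
        ker[OF F that(1,2)] that(3) by simp
    obtain \<beta> where \<beta>: "natural A (T F) G \<beta>" "\<And>X x. \<lbrakk>X \<in> Ob A; x \<in> carrier (Fob F X)\<rbrakk> \<Longrightarrow> \<beta> X (\<eta> F X x) = f X x"
      using descend_along_surj[OF \<eta>(2,3)[OF F] fp.nat_D[OF f] fp.additive_D[OF F] fp.additive_D[OF G'(1)] T(3)[OF F] kill] by blast
    note b = fp.ext_D[OF \<beta>(1) T(2)[OF F]]
    have comp: "Comp (fp A) F (T F) G (restrict_nat A (T F) \<beta>) (\<eta> F) = f"
    proof (rule fp.eq_D[OF fp.comp_closed_D[OF \<eta>(1)[OF F] b F] f])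
      fix X x assume *: "X \<in> Ob A" "x \<in> carrier (Fob F X)"
      show "Comp (fp A) F (T F) G (restrict_nat A (T F) \<beta>) (\<eta> F) X x = f X x"
        unfolding fp.comp_D[OF *] restrict_nat_apply[OF *(1) natural_closed[OF \<eta>(2)[OF F] *(2,1)]] by (rule \<beta>(2)[OF *])
    qed
    have uniq: "g = restrict_nat A (T F) \<beta>" if g: "g \<in> Arr (fp0 A) (T F) G" "Comp (fp A) F (T F) G g (\<eta> F) = f" for g
    proof (rule fp.eq_D[OF _ b])
      show "g \<in> Arr (fp A) (T F) G" using g(1) by simp
      fix X y assume X: "X \<in> Ob A" and y: "y \<in> carrier (Fob (T F) X)"
      obtain x where x: "x \<in> carrier (Fob F X)" "y = \<eta> F X x" using nat_surjD[OF \<eta>(3)[OF F] X y] by blast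
      have "g X y = f X x" unfolding x(2) g(2)[symmetric] fp.comp_D[OF X x(1)] ..
      also have "\<dots> = \<beta> X y" unfolding x(2) by (rule \<beta>(2)[OF X x(1), symmetric])
      also have "\<dots> = restrict_nat A (T F) \<beta> X y" by (rule restrict_nat_apply[OF X y, symmetric])
      finally show "g X y = restrict_nat A (T F) \<beta> X y" .
    qed
    show ?thesis
      by (rule ex1I[of _ "restrict_nat A (T F) \<beta>"], rule conjI[OF fp0.ext_D[OF \<beta>(1) T(1)[OF F]] comp])
        (elim conjE, rule uniq)
  qed
  define M where "M F G f = (THE g. g \<in> Arr (fp0 A) (T F) (T G) \<and> Comp (fp A) F (T F) (T G) g (\<eta> F) = Comp (fp A) F G (T G) (\<eta> G) f)" for F G f
  have M: "M F G f \<in> Arr (fp0 A) (T F) (T G)" "Comp (fp A) F (T F) (T G) (M F G f) (\<eta> F) = Comp (fp A) F G (T G) (\<eta> G) f"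
    if "F \<in> Ob (fp A)" "G \<in> Ob (fp A)" "f \<in> Arr (fp A) F G" for F G f
    using theI'[OF univ[OF that(1) T(1)[OF that(2)] fp.comp_closed_D[OF that(3) \<eta>(1)[OF that(2)] that(1)]]]
    unfolding M_def by blast+
  have M_apply: "M F G f X (\<eta> F X x) = \<eta> G X (f X x)"
    if "F \<in> Ob (fp A)" "G \<in> Ob (fp A)" "f \<in> Arr (fp A) F G" "X \<in> Ob A" "x \<in> carrier (Fob F X)" for F G f X x
    using fun_cong[OF fun_cong[OF M(2)[OF that(1-3)], of X], of x] unfolding fp.comp_D[OF that(4,5)] .
  have eqI: "g = g'" if F: "F \<in> Ob (fp A)" and g: "g \<in> Arr (fp0 A) (T F) G" "g' \<in> Arr (fp0 A) (T F) H"
    and eq: "\<And>X x. \<lbrakk>X \<in> Ob A; x \<in> carrier (Fob F X)\<rbrakk> \<Longrightarrow> g X (\<eta> F X x) = g' X (\<eta> F X x)" for F G H g g'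
  proof (rule fp0.eq_D[OF g])
    fix X y assume X: "X \<in> Ob A" and y: "y \<in> carrier (Fob (T F) X)"
    obtain x where "x \<in> carrier (Fob F X)" "y = \<eta> F X x" using nat_surjD[OF \<eta>(3)[OF F] X y] by blast
    then show "g X y = g' X y" using eq[OF X] by simp
  qed
  let ?L = "\<lparr>Tob = T, Tmap = M\<rparr>"
  have "is_catfun (fp A) (fp0 A) ?L"
    unfolding is_catfun_def catfun.simps
  proof (intro conjI ballI)
    fix F assume F: "F \<in> Ob (fp A)"
    show "T F \<in> Ob (fp0 A)" by (rule T(1)[OF F])
    show "M F F (Ident (fp A) F) = Ident (fp0 A) (T F)"
    proof (rule eqI[OF F M(1)[OF F F fp.ident_closed_D[OF F]] fp0.ident_closed_D[OF T(1)[OF F]]])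
      fix X x assume *: "X \<in> Ob A" "x \<in> carrier (Fob F X)"
      show "M F F (Ident (fp A) F) X (\<eta> F X x) = Ident (fp0 A) (T F) X (\<eta> F X x)"
        unfolding M_apply[OF F F fp.ident_closed_D[OF F] *] fp.ident_D[OF *] fp0.ident_D[OF *(1) natural_closed[OF \<eta>(2)[OF F] *(2,1)]] ..
    qed
  next
    fix F G f assume "F \<in> Ob (fp A)" "G \<in> Ob (fp A)" "f \<in> Arr (fp A) F G"
    then show "M F G f \<in> Arr (fp0 A) (T F) (T G)" by (rule M(1))
  next
    fix F G H f g assume F: "F \<in> Ob (fp A)" and G: "G \<in> Ob (fp A)" and H: "H \<in> Ob (fp A)"
      and f: "f \<in> Arr (fp A) F G" and g: "g \<in> Arr (fp A) G H"
    note gf = fp.comp_closed_D[OF f g F]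
    show "M F H (Comp (fp A) F G H g f) = Comp (fp0 A) (T F) (T G) (T H) (M G H g) (M F G f)"
    proof (rule eqI[OF F M(1)[OF F H gf] fp0.comp_closed_D[OF M(1)[OF F G f] M(1)[OF G H g] T(1)[OF F]]])
      fix X x assume *: "X \<in> Ob A" "x \<in> carrier (Fob F X)"
      show "M F H (Comp (fp A) F G H g f) X (\<eta> F X x) = Comp (fp0 A) (T F) (T G) (T H) (M G H g) (M F G f) X (\<eta> F X x)"
        unfolding M_apply[OF F H gf *] fp.comp_D[OF *] fp0.comp_D[OF *(1) natural_closed[OF \<eta>(2)[OF F] *(2,1)]] M_apply[OF F G f *]
          M_apply[OF G H g *(1) natural_closed[OF fp.nat_D[OF f] *(2,1)]] ..
    qed
  qed
  moreover have "is_catfun (fp0 A) (fp A) incl"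
    by (simp add: is_catfun_def incl_def)
  moreover have "\<exists>\<eta>. (\<forall>X\<in>Ob (fp A). \<eta> X \<in> Arr (fp A) X (Tob incl (Tob ?L X))) \<and>
        (\<forall>X\<in>Ob (fp A). \<forall>Y\<in>Ob (fp A). \<forall>f\<in>Arr (fp A) X Y.
           Comp (fp A) X Y (Tob incl (Tob ?L Y)) (\<eta> Y) f =
           Comp (fp A) X (Tob incl (Tob ?L X)) (Tob incl (Tob ?L Y))
             (Tmap incl (Tob ?L X) (Tob ?L Y) (Tmap ?L X Y f)) (\<eta> X)) \<and>
        (\<forall>X\<in>Ob (fp A). \<forall>Y\<in>Ob (fp0 A). \<forall>f\<in>Arr (fp A) X (Tob incl Y).
           \<exists>!g. g \<in> Arr (fp0 A) (Tob ?L X) Y \<and>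
             Comp (fp A) X (Tob incl (Tob ?L X)) (Tob incl Y) (Tmap incl (Tob ?L X) Y g) (\<eta> X) = f)"
    unfolding incl_def catfun.simps
    by (intro exI[of _ \<eta>] conjI ballI \<eta>(1) M(2)[symmetric] univ)
  ultimately have "is_left_adjoint (fp A) (fp0 A) ?L incl"
    unfolding is_left_adjoint_def by blast
  then show ?thesis by blast
qed

text \<open>Every left adjoint of the inclusion is pointwise the quotient by the trace: a unit that is not
  surjective would admit two factorisations of zero, and its kernel is compared with the reflection
  constructed above.\<close>

lemma left_adjoint_unit:
  assumes L: "is_left_adjoint (fp A) (fp0 A) L incl"
  obtains \<eta> where "\<And>F. F \<in> Ob (fp A) \<Longrightarrow> natural A F (Tob L F) (\<eta> F)"
    "\<And>F. F \<in> Ob (fp A) \<Longrightarrow> nat_surj A F (Tob L F) (\<eta> F)"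
    "\<And>F X x. \<lbrakk>F \<in> Ob (fp A); X \<in> Ob A; x \<in> carrier (Fob F X)\<rbrakk> \<Longrightarrow> \<eta> F X x = \<one>\<^bsub>Fob (Tob L F) X\<^esub> \<longleftrightarrow> x \<in> trace F X"
    "\<And>F G f X x. \<lbrakk>F \<in> Ob (fp A); G \<in> Ob (fp A); f \<in> Arr (fp A) F G; X \<in> Ob A; x \<in> carrier (Fob F X)\<rbrakk>
      \<Longrightarrow> Tmap L F G f X (\<eta> F X x) = \<eta> G X (f X x)"
proof -
  have cf: "is_catfun (fp A) (fp0 A) L" using L by (simp add: is_left_adjoint_def)
  obtain \<eta> where *: "\<forall>F\<in>Ob (fp A). \<eta> F \<in> Arr (fp A) F (Tob L F)"
    "\<forall>F\<in>Ob (fp A). \<forall>G\<in>Ob (fp A). \<forall>f\<in>Arr (fp A) F G.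
        Comp (fp A) F G (Tob L G) (\<eta> G) f = Comp (fp A) F (Tob L F) (Tob L G) (Tmap L F G f) (\<eta> F)"
    "\<forall>F\<in>Ob (fp A). \<forall>G\<in>Ob (fp0 A). \<forall>f\<in>Arr (fp A) F G.
        \<exists>!g. g \<in> Arr (fp0 A) (Tob L F) G \<and> Comp (fp A) F (Tob L F) G g (\<eta> F) = f"
    using L unfolding is_left_adjoint_def incl_def catfun.simps by (elim conjE exE) (rule that)
  note \<eta> = *(1)[THEN bspec] and nat = *(2)[THEN bspec, THEN bspec, THEN bspec]
    and univ = *(3)[THEN bspec, THEN bspec, THEN bspec]
  have T: "Tob L F \<in> Ob (fp0 A)" if "F \<in> Ob (fp A)" for F using cf that by (simp add: is_catfun_def)
  have surj: "nat_surj A F (Tob L F) (\<eta> F)" if F: "F \<in> Ob (fp A)" for F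
  proof -
    have TF: "Tob L F \<in> Ob (fp A)" using T[OF F] by simp
    have FL: "Tob L F \<in> Ob (fp0 A)" using T[OF F] .
    obtain Q \<kappa> where Q: "Q \<in> Ob (fp A)" "\<kappa> \<in> Arr (fp A) (Tob L F) Q" "nat_surj A (Tob L F) Q \<kappa>"
      and ker: "\<And>X x. \<lbrakk>X \<in> Ob A; x \<in> carrier (Fob (Tob L F) X)\<rbrakk> \<Longrightarrow> \<kappa> X x = \<one>\<^bsub>Fob Q X\<^esub> \<longleftrightarrow> x \<in> \<eta> F X ` carrier (Fob F X)"
      using fp.ex_coker_pointwise[OF F TF \<eta>[OF F]] by blast
    have Q0: "Q \<in> Ob (fp0 A)" by (rule fp0.quotient_D[OF FL fp.fp_D[OF Q(1)] fp.nat_D[OF Q(2)] Q(3)])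
    let ?z = "zero_arr (fp A) (Tob L F) Q"
    have z: "?z \<in> Arr (fp A) (Tob L F) Q" using fp.zero_closed_D[OF TF Q(1)] .
    have "Comp (fp A) F (Tob L F) Q \<kappa> (\<eta> F) = Comp (fp A) F (Tob L F) Q ?z (\<eta> F)"
    proof (rule fp.eq_D[OF fp.comp_closed_D[OF \<eta>[OF F] Q(2) F] fp.comp_closed_D[OF \<eta>[OF F] z F]])
      fix X x assume *: "X \<in> Ob A" "x \<in> carrier (Fob F X)"
      have c: "\<eta> F X x \<in> carrier (Fob (Tob L F) X)" using natural_closed[OF fp.nat_D[OF \<eta>[OF F]] *(2,1)] .
      show "Comp (fp A) F (Tob L F) Q \<kappa> (\<eta> F) X x = Comp (fp A) F (Tob L F) Q ?z (\<eta> F) X x"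
        unfolding fp.comp_D[OF *] fp.zero_D[OF *(1) c] using ker[OF *(1) c] * by blast
    qed
    then have \<kappa>: "\<kappa> = ?z"
      using univ[OF F Q0 fp.comp_closed_D[OF \<eta>[OF F] Q(2) F]] Q(2) z unfolding fp_simps by metis
    show ?thesis
    proof (rule nat_surjI[OF fp.nat_D[OF \<eta>[OF F]]])
      fix X y assume *: "X \<in> Ob A" "y \<in> carrier (Fob (Tob L F) X)"
      then have "\<kappa> X y = \<one>\<^bsub>Fob Q X\<^esub>" unfolding \<kappa> by (rule fp.zero_D)
      then show "\<exists>x\<in>carrier (Fob F X). y = \<eta> F X x" using ker[OF *] by blast
    qed
  qed
  have ker: "\<eta> F X x = \<one>\<^bsub>Fob (Tob L F) X\<^esub> \<longleftrightarrow> x \<in> trace F X"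
    if F: "F \<in> Ob (fp A)" and X: "X \<in> Ob A" and x: "x \<in> carrier (Fob F X)" for F X x
  proof
    assume one: "\<eta> F X x = \<one>\<^bsub>Fob (Tob L F) X\<^esub>"
    obtain Q :: "('o, 'm, 'm) abfun" and \<kappa> where Q: "finitely_presented A Q" "vanishes_on_projectives A Q" "natural A F Q \<kappa>" "nat_surj A F Q \<kappa>"
      "\<And>X x. \<lbrakk>X \<in> Ob A; x \<in> carrier (Fob F X)\<rbrakk> \<Longrightarrow> \<kappa> X x = \<one>\<^bsub>Fob Q X\<^esub> \<longleftrightarrow> x \<in> trace F X"
      using reflection[OF fp.fp_D[OF F]] by blast
    have Q0: "Q \<in> Ob (fp0 A)" using Q by simp
    obtain g where g: "g \<in> Arr (fp0 A) (Tob L F) Q" "Comp (fp A) F (Tob L F) Q g (\<eta> F) = restrict_nat A F \<kappa>"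
      using univ[OF F Q0 fp.ext_D[OF Q(3) F]] by blast
    have "g X (\<eta> F X x) = \<kappa> X x"
      using fun_cong[OF fun_cong[OF g(2), of X], of x] unfolding fp.comp_D[OF X x] restrict_nat_apply[OF X x] .
    then have "\<kappa> X x = \<one>\<^bsub>Fob Q X\<^esub>"
      using natural_one[OF fp0.nat_D[OF g(1)] fp0.additive_D[OF T[OF F]] fp0.additive_D[OF Q0] X] one by simp
    then show "x \<in> trace F X" using Q(5)[OF X x] by blast
  next
    assume "x \<in> trace F X"
    then show "\<eta> F X x = \<one>\<^bsub>Fob (Tob L F) X\<^esub>"
      using trace_vanishes[OF _ fp0.additive_D[OF T[OF F]] trace_natural[OF fp.nat_D[OF \<eta>[OF F]] _ X] X] T[OF F] by simp
  qed
  have "Tmap L F G f X (\<eta> F X x) = \<eta> G X (f X x)"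
    if "F \<in> Ob (fp A)" "G \<in> Ob (fp A)" "f \<in> Arr (fp A) F G" "X \<in> Ob A" "x \<in> carrier (Fob F X)" for F G f X x
    using fun_cong[OF fun_cong[OF nat[OF that(1-3)], of X], of x] unfolding fp.comp_D[OF that(4,5)] by simp
  then show ?thesis using that[OF fp.nat_D[OF \<eta>] surj ker] by blast
qed

text \<open>\<open>F\<^sup>0\<close> and \<open>L\<^sub>1((-)\<^sup>0)(F)\<close> both vanish iff the complex \<open>P\<^sub>2\<^sup>0 \<rightarrow> P\<^sub>1\<^sup>0 \<rightarrow> P\<^sub>0\<^sup>0 \<rightarrow> 0\<close> is exact; its terms
  are the quotients of the \<open>P\<^sub>i\<close> by their traces.\<close>

lemma fp_shriek_iff_stably_exact:
  assumes F: "F \<in> Ob (fp A)"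
  obtains P2 P1 P0 :: "('o, 'm, 'm) abfun" and d1 d0 e where "resolution P2 P1 P0 F d1 d0 e"
    "F \<in> fp_shriek A \<longleftrightarrow> stably_exact P2 P1 P0 F d1 d0"
proof -
  let ?T = "sup0 A"
  have L: "is_left_adjoint (fp A) (fp0 A) ?T incl" unfolding sup0_def by (rule someI_ex[OF ex_left_adjoint])
  then have cf: "is_catfun (fp A) (fp0 A) ?T" by (simp add: is_left_adjoint_def)
  have T: "Tob ?T G \<in> Ob (fp0 A)" if "G \<in> Ob (fp A)" for G using cf that by (simp add: is_catfun_def)
  have Tm: "Tmap ?T G H f \<in> Arr (fp0 A) (Tob ?T G) (Tob ?T H)" if "G \<in> Ob (fp A)" "H \<in> Ob (fp A)" "f \<in> Arr (fp A) G H" for G H f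
    using cf that unfolding is_catfun_def by blast
  obtain \<eta> where \<eta>: "\<And>F. F \<in> Ob (fp A) \<Longrightarrow> natural A F (Tob ?T F) (\<eta> F)"
    and surj: "\<And>F. F \<in> Ob (fp A) \<Longrightarrow> nat_surj A F (Tob ?T F) (\<eta> F)"
    and ker: "\<And>F X x. \<lbrakk>F \<in> Ob (fp A); X \<in> Ob A; x \<in> carrier (Fob F X)\<rbrakk> \<Longrightarrow> \<eta> F X x = \<one>\<^bsub>Fob (Tob ?T F) X\<^esub> \<longleftrightarrow> x \<in> trace F X"
    and T\<eta>: "\<And>F G f X x. \<lbrakk>F \<in> Ob (fp A); G \<in> Ob (fp A); f \<in> Arr (fp A) F G; X \<in> Ob A; x \<in> carrier (Fob F X)\<rbrakk>
      \<Longrightarrow> Tmap ?T F G f X (\<eta> F X x) = \<eta> G X (f X x)"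
    using left_adjoint_unit[OF L] by blast
  have TT: "Tmap ?T G H g X (Tmap ?T E G f X y) = \<one>\<^bsub>Fob (Tob ?T H) X\<^esub>"
    if Ob: "E \<in> Ob (fp A)" "G \<in> Ob (fp A)" "H \<in> Ob (fp A)" and f: "f \<in> Arr (fp A) E G" and g: "g \<in> Arr (fp A) G H"
      and gf: "\<And>X x. \<lbrakk>X \<in> Ob A; x \<in> carrier (Fob E X)\<rbrakk> \<Longrightarrow> g X (f X x) = \<one>\<^bsub>Fob H X\<^esub>"
      and X: "X \<in> Ob A" and y: "y \<in> carrier (Fob (Tob ?T E) X)" for E G H f g X y
  proof -
    obtain x where x: "x \<in> carrier (Fob E X)" "y = \<eta> E X x" using nat_surjD[OF surj[OF Ob(1)] X y] by blast
    have fx: "f X x \<in> carrier (Fob G X)" by (rule natural_closed[OF fp.nat_D[OF f] x(1) X])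
    show ?thesis
      unfolding x(2) T\<eta>[OF Ob(1,2) f X x(1)] T\<eta>[OF Ob(2,3) g X fx] gf[OF X x(1)]
      by (rule natural_one[OF \<eta>[OF Ob(3)] fp.additive_D[OF Ob(3)] fp0.additive_D[OF T[OF Ob(3)]] X])
  qed
  have "\<exists>H P d e. proj_resolution (fp A) F P d e \<and>
      is_homology (fp0 A) (Tob ?T (P 2)) (Tob ?T (P 1)) (Tob ?T (P 0)) (Tmap ?T (P 2) (P 1) (d 1)) (Tmap ?T (P 1) (P 0) (d 0)) H"
  proof -
    obtain P d e where r: "proj_resolution (fp A) F P d e" using ex_proj_resolution_fp[OF F] by blast
    note R = proj_resolution_fp_resolution[OF F r]
    have d: "d 1 \<in> Arr (fp A) (P 2) (P 1)" "d 0 \<in> Arr (fp A) (P 1) (P 0)"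
      using R(3)[of 1] R(3)[of 0] by (simp_all only: numeral_2_eq_2 One_nat_def)
    have ex: "nat_exact A (P 2) (P 1) (P 0) (d 1) (d 0)" using R(1) by (simp add: resolution_def)
    have "Comp (fp0 A) (Tob ?T (P 2)) (Tob ?T (P 1)) (Tob ?T (P 0)) (Tmap ?T (P 1) (P 0) (d 0)) (Tmap ?T (P 2) (P 1) (d 1)) =
        zero_arr (fp0 A) (Tob ?T (P 2)) (Tob ?T (P 0))"
      unfolding fp0.comp_eq_zero_iff[OF Tm[OF R(2) R(2) d(1)] Tm[OF R(2) R(2) d(2)] T[OF R(2)] T[OF R(2)]]
      by (intro ballI TT[OF R(2) R(2) R(2) d]) (rule nat_exact_zero[OF ex])
    then show ?thesis
      using fp0.ex_homology[OF T[OF R(2)] T[OF R(2)] T[OF R(2)] Tm[OF R(2) R(2) d(1)] Tm[OF R(2) R(2) d(2)]] r by blast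
  qed
  from someI_ex[OF this] obtain P d e where r: "proj_resolution (fp A) F P d e"
    and hom: "is_homology (fp0 A) (Tob ?T (P 2)) (Tob ?T (P 1)) (Tob ?T (P 0)) (Tmap ?T (P 2) (P 1) (d 1)) (Tmap ?T (P 1) (P 0) (d 0))
        (L1 (fp A) (fp0 A) ?T F)"
    unfolding L1_def by blast
  note R = proj_resolution_fp_resolution[OF F r]
  have d: "d 1 \<in> Arr (fp A) (P 2) (P 1)" "d 0 \<in> Arr (fp A) (P 1) (P 0)"
    using R(3)[of 1] R(3)[of 0] by (simp_all only: numeral_2_eq_2 One_nat_def)
  have ex: "nat_exact A (P 2) (P 1) (P 0) (d 1) (d 0)" using R(1) by (simp add: resolution_def)
  note Td1 = Tm[OF R(2) R(2) d(1)] and Td0 = Tm[OF R(2) R(2) d(2)]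
  have zero_F: "is_zero_object (fp0 A) (Tob ?T F) \<longleftrightarrow> (\<forall>X\<in>Ob A. carrier (Fob F X) \<subseteq> trace F X)"
  proof -
    have "carrier (Fob (Tob ?T F) X) \<subseteq> {\<one>\<^bsub>Fob (Tob ?T F) X\<^esub>} \<longleftrightarrow> carrier (Fob F X) \<subseteq> trace F X" if X: "X \<in> Ob A" for X
    proof -
      have im: "\<eta> F X ` carrier (Fob F X) = carrier (Fob (Tob ?T F) X)" using surj[OF F] X by (simp add: nat_surj_def)
      have "carrier (Fob (Tob ?T F) X) \<subseteq> {\<one>\<^bsub>Fob (Tob ?T F) X\<^esub>} \<longleftrightarrow> (\<forall>x\<in>carrier (Fob F X). \<eta> F X x = \<one>\<^bsub>Fob (Tob ?T F) X\<^esub>)"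
        unfolding im[symmetric] image_subset_iff singleton_iff ..
      also have "\<dots> \<longleftrightarrow> carrier (Fob F X) \<subseteq> trace F X" using ker[OF F X] by (simp add: subset_eq)
      finally show ?thesis .
    qed
    then show ?thesis unfolding fp0.zero_object_iff using T[OF F] by blast
  qed
  have zero_L1: "is_zero_object (fp0 A) (L1 (fp A) (fp0 A) ?T F) \<longleftrightarrow>
      (\<forall>X\<in>Ob A. \<forall>x\<in>carrier (Fob (P 1) X). d 0 X x \<in> trace (P 0) X \<longrightarrow>
        (\<exists>z\<in>carrier (Fob (P 2) X). \<exists>i\<in>trace (P 1) X. x = d 1 X z \<otimes>\<^bsub>Fob (P 1) X\<^esub> i))"
    unfolding fp0.homology_zero_iff[OF hom T[OF R(2)] T[OF R(2)] T[OF R(2)] Td1 Td0]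
  proof
    assume tex: "nat_exact A (Tob ?T (P 2)) (Tob ?T (P 1)) (Tob ?T (P 0)) (Tmap ?T (P 2) (P 1) (d 1)) (Tmap ?T (P 1) (P 0) (d 0))"
    show "\<forall>X\<in>Ob A. \<forall>x\<in>carrier (Fob (P 1) X). d 0 X x \<in> trace (P 0) X \<longrightarrow>
        (\<exists>z\<in>carrier (Fob (P 2) X). \<exists>i\<in>trace (P 1) X. x = d 1 X z \<otimes>\<^bsub>Fob (P 1) X\<^esub> i)"
    proof (intro ballI impI)
      fix X x assume X: "X \<in> Ob A" and x: "x \<in> carrier (Fob (P 1) X)" and tr: "d 0 X x \<in> trace (P 0) X"
      have \<eta>x: "\<eta> (P 1) X x \<in> carrier (Fob (Tob ?T (P 1)) X)" by (rule natural_closed[OF \<eta>[OF R(2)] x X])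
      have dx: "d 0 X x \<in> carrier (Fob (P 0) X)" by (rule natural_closed[OF fp.nat_D[OF d(2)] x X])
      have "Tmap ?T (P 1) (P 0) (d 0) X (\<eta> (P 1) X x) = \<one>\<^bsub>Fob (Tob ?T (P 0)) X\<^esub>"
        unfolding T\<eta>[OF R(2) R(2) d(2) X x] using ker[OF R(2) X dx] tr by blast
      then obtain y where y: "y \<in> carrier (Fob (Tob ?T (P 2)) X)" "\<eta> (P 1) X x = Tmap ?T (P 2) (P 1) (d 1) X y"
        using nat_exactD[OF tex X \<eta>x] by blast
      obtain z where z: "z \<in> carrier (Fob (P 2) X)" "y = \<eta> (P 2) X z" using nat_surjD[OF surj[OF R(2)] X y(1)] by blast
      have dz: "d 1 X z \<in> carrier (Fob (P 1) X)" by (rule natural_closed[OF fp.nat_D[OF d(1)] z(1) X])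
      have "\<eta> (P 1) X x = \<eta> (P 1) X (d 1 X z)" unfolding y(2) z(2) by (rule T\<eta>[OF R(2) R(2) d(1) X z(1)])
      then obtain i where i: "i \<in> carrier (Fob (P 1) X)" "\<eta> (P 1) X i = \<one>\<^bsub>Fob (Tob ?T (P 1)) X\<^esub>" "x = i \<otimes>\<^bsub>Fob (P 1) X\<^esub> d 1 X z"
        using hom_eqD[OF comm_group_Fob[OF fp.additive_D[OF R(2)] X] comm_group_Fob[OF fp0.additive_D[OF T[OF R(2)]] X]
            natural_hom[OF \<eta>[OF R(2)] X] x dz] by blast
      have "x = d 1 X z \<otimes>\<^bsub>Fob (P 1) X\<^esub> i" unfolding i(3) by (rule Fob_ac(2)[OF fp.additive_D[OF R(2)] X i(1) dz])
      moreover have "i \<in> trace (P 1) X" using ker[OF R(2) X i(1)] i(2) by blast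
      ultimately show "\<exists>z\<in>carrier (Fob (P 2) X). \<exists>i\<in>trace (P 1) X. x = d 1 X z \<otimes>\<^bsub>Fob (P 1) X\<^esub> i" using z(1) by blast
    qed
  next
    assume st: "\<forall>X\<in>Ob A. \<forall>x\<in>carrier (Fob (P 1) X). d 0 X x \<in> trace (P 0) X \<longrightarrow>
        (\<exists>z\<in>carrier (Fob (P 2) X). \<exists>i\<in>trace (P 1) X. x = d 1 X z \<otimes>\<^bsub>Fob (P 1) X\<^esub> i)"
    show "nat_exact A (Tob ?T (P 2)) (Tob ?T (P 1)) (Tob ?T (P 0)) (Tmap ?T (P 2) (P 1) (d 1)) (Tmap ?T (P 1) (P 0) (d 0))"
    proof (rule nat_exactI[OF _ _ fp0.nat_D[OF Td1]])
      fix X y assume X: "X \<in> Ob A" and y: "y \<in> carrier (Fob (Tob ?T (P 2)) X)"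
      show "Tmap ?T (P 1) (P 0) (d 0) X (Tmap ?T (P 2) (P 1) (d 1) X y) = \<one>\<^bsub>Fob (Tob ?T (P 0)) X\<^esub>"
        by (rule TT[OF R(2) R(2) R(2) d _ X y]) (rule nat_exact_zero[OF ex])
    next
      fix X y assume X: "X \<in> Ob A" and y: "y \<in> carrier (Fob (Tob ?T (P 1)) X)"
        and z: "Tmap ?T (P 1) (P 0) (d 0) X y = \<one>\<^bsub>Fob (Tob ?T (P 0)) X\<^esub>"
      obtain x where x: "x \<in> carrier (Fob (P 1) X)" "y = \<eta> (P 1) X x" using nat_surjD[OF surj[OF R(2)] X y] by blast
      have dx: "d 0 X x \<in> carrier (Fob (P 0) X)" by (rule natural_closed[OF fp.nat_D[OF d(2)] x(1) X])
      have "d 0 X x \<in> trace (P 0) X" using z ker[OF R(2) X dx] unfolding x(2) T\<eta>[OF R(2) R(2) d(2) X x(1)] by blast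
      then obtain w i where w: "w \<in> carrier (Fob (P 2) X)" and i: "i \<in> trace (P 1) X" and xe: "x = d 1 X w \<otimes>\<^bsub>Fob (P 1) X\<^esub> i"
        using st X x(1) by blast
      have dw: "d 1 X w \<in> carrier (Fob (P 1) X)" by (rule natural_closed[OF fp.nat_D[OF d(1)] w X])
      have ic: "i \<in> carrier (Fob (P 1) X)" by (rule traceD(2)[OF fp.additive_D[OF R(2)] X i])
      have "y = \<eta> (P 1) X (d 1 X w) \<otimes>\<^bsub>Fob (Tob ?T (P 1)) X\<^esub> \<eta> (P 1) X i"
        unfolding x(2) xe by (rule natural_mult[OF \<eta>[OF R(2)] dw ic X])
      also have "\<eta> (P 1) X i = \<one>\<^bsub>Fob (Tob ?T (P 1)) X\<^esub>" using ker[OF R(2) X ic] i by blast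
      also have "\<eta> (P 1) X (d 1 X w) \<otimes>\<^bsub>Fob (Tob ?T (P 1)) X\<^esub> \<one>\<^bsub>Fob (Tob ?T (P 1)) X\<^esub> = \<eta> (P 1) X (d 1 X w)"
        by (rule Fob_simps(1)[OF natural_closed[OF \<eta>[OF R(2)] dw X] fp0.additive_D[OF T[OF R(2)]] X])
      also have "\<dots> = Tmap ?T (P 2) (P 1) (d 1) X (\<eta> (P 2) X w)" by (rule T\<eta>[OF R(2) R(2) d(1) X w, symmetric])
      finally show "\<exists>z\<in>carrier (Fob (Tob ?T (P 2)) X). y = Tmap ?T (P 2) (P 1) (d 1) X z"
        using natural_closed[OF \<eta>[OF R(2)] w X] by blast
    qed
  qed
  have "F \<in> fp_shriek A \<longleftrightarrow> stably_exact (P 2) (P 1) (P 0) F (d 1) (d 0)"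
    using F zero_F zero_L1 unfolding fp_shriek_def stably_exact_def by blast
  then show ?thesis using that R(1) by blast
qed

end

theorem theorem3p5:
  fixes A :: "('o, 'm) precat" and F :: "('o, 'm, 'm) abfun"
  assumes "abelian_category A"
    and "enough_projectives A"
    and "\<forall>X\<in>Ob A. \<forall>Y\<in>Ob A. \<exists>i :: 'm \<Rightarrow> 'v. inj_on i (Arr A X Y)"
    and "F \<in> Ob (fp A)"
  defines "cond1 \<equiv> F \<in> fp_shriek A"
    and "cond2 \<equiv> \<forall>X\<in>Ob A. \<forall>Y\<in>Ob A. \<forall>Z\<in>Ob A. \<forall>f\<in>Arr A X Y. \<forall>g\<in>Arr A Y Z.
      left_exact_seq A X Y Z f g \<and> gives_presentation A X Y Z f g F \<longrightarrow>
      split_epic (stab A) Y Z (stab_arr A Y Z g) \<and>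
      weak_kernel (stab A) X Y Z (stab_arr A X Y f) (stab_arr A Y Z g)"
    and "cond3 \<equiv> \<exists>X\<in>Ob A. \<exists>Y\<in>Ob A. \<exists>Z\<in>Ob A. \<exists>f\<in>Arr A X Y. \<exists>g\<in>Arr A Y Z.
      left_exact_seq A X Y Z f g \<and> gives_presentation A X Y Z f g F \<and>
      split_epic (stab A) Y Z (stab_arr A Y Z g) \<and>
      weak_kernel (stab A) X Y Z (stab_arr A X Y f) (stab_arr A Y Z g)"
    and "cond4 \<equiv> \<forall>G :: ('o, 'm, 'v) abfun. additive_functor A G \<and> vanishes_on_projectives A G \<longrightarrow>
      trivial_group (NatTr A F G) \<and> trivial_group (ExtFun A 1 F G)"
    and "cond5 \<equiv> \<forall>X\<in>Ob A.
      trivial_group (NatTr A F (ExtA A 1 X)) \<and> trivial_group (ExtFun A 1 F (ExtA A 1 X))"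
    and "cond6 \<equiv> \<forall>G\<in>Ob (fp0 A).
      trivial_group (NatTr A F G) \<and> trivial_group (ExtFun A 1 F G)"
  shows "(cond1 \<longleftrightarrow> cond2) \<and> (cond1 \<longleftrightarrow> cond3) \<and> (cond1 \<longleftrightarrow> cond4) \<and>
    (cond1 \<longleftrightarrow> cond5) \<and> (cond1 \<longleftrightarrow> cond6)"
proof -
  interpret proj_abelian A using assms(1,2) by (simp add: proj_abelian_def proj_abelian_axioms_def)
  have F: "finitely_presented A F" using assms(4) by simp
  have inj_v: "\<exists>i :: 'm \<Rightarrow> 'v. inj_on i (Arr A U W)" if "U \<in> Ob A" "W \<in> Ob A" for U W using assms(3) that by blast
  have inj_m: "\<exists>i :: 'm \<Rightarrow> 'm. inj_on i (Arr A U W)" for U W by (rule exI[of _ "\<lambda>x. x"]) simp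
  obtain X Y Z f g \<pi> where Ob: "X \<in> Ob A" "Y \<in> Ob A" "Z \<in> Ob A" and fg: "f \<in> Arr A X Y" "g \<in> Arr A Y Z"
    and R: "resolution (Rep A X) (Rep A Y) (Rep A Z) F (push A X Y f) (push A Y Z g) \<pi>"
    and iff_v: "\<And>G :: ('o, 'm, 'v) abfun. additive_functor A G \<Longrightarrow>
      trivial_group (NatTr A F G) \<and> trivial_group (ExtFun A 1 F G) \<longleftrightarrow> exact_on G X Y Z f g"
    and iff_set: "\<And>G :: ('o, 'm, 'm set) abfun. additive_functor A G \<Longrightarrow>
      trivial_group (NatTr A F G) \<and> trivial_group (ExtFun A 1 F G) \<longleftrightarrow> exact_on G X Y Z f g"
    and iff_m: "\<And>G :: ('o, 'm, 'm) abfun. additive_functor A G \<Longrightarrow>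
      trivial_group (NatTr A F G) \<and> trivial_group (ExtFun A 1 F G) \<longleftrightarrow> exact_on G X Y Z f g"
    using trivial_Hom_Ext_iff_exact_on[OF F] by blast
  note split = stably_exact_iff_stably_split[OF R fg Ob]
  have 1: "cond1 \<longleftrightarrow> stably_split X Y Z f g"
  proof -
    obtain P2 P1 P0 :: "('o, 'm, 'm) abfun" and d1 d0 e where r: "resolution P2 P1 P0 F d1 d0 e"
      and iff: "F \<in> fp_shriek A \<longleftrightarrow> stably_exact P2 P1 P0 F d1 d0"
      using fp_shriek_iff_stably_exact[OF assms(4)] .
    show ?thesis unfolding cond1_def iff split[symmetric]
      using stably_exact_transfer[OF r R] stably_exact_transfer[OF R r] by blast
  qed
  have stab: "split_epic (stab A) Y' Z' (stab_arr A Y' Z' g') \<and> weak_kernel (stab A) X' Y' Z' (stab_arr A X' Y' f') (stab_arr A Y' Z' g') \<longleftrightarrow>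
      stably_split X Y Z f g"
    if Ob': "X' \<in> Ob A" "Y' \<in> Ob A" "Z' \<in> Ob A" and fg': "f' \<in> Arr A X' Y'" "g' \<in> Arr A Y' Z'"
      and pres: "gives_presentation A X' Y' Z' f' g' F" for X' Y' Z' f' g'
  proof -
    obtain \<pi>' where R': "resolution (Rep A X') (Rep A Y') (Rep A Z') F (push A X' Y' f') (push A Y' Z' g') \<pi>'"
      using resolution_Rep[OF pres fg' Ob' finitely_presented_additive[OF F]] .
    show ?thesis
      unfolding stably_exact_iff_stab[OF R' fg' Ob', symmetric] split[symmetric]
      using stably_exact_transfer[OF R R'] stably_exact_transfer[OF R' R] by blast
  qed
  obtain X' Y' Z' f' g' where Ob': "X' \<in> Ob A" "Y' \<in> Ob A" "Z' \<in> Ob A" and fg': "f' \<in> Arr A X' Y'" "g' \<in> Arr A Y' Z'"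
    and pres: "left_exact_seq A X' Y' Z' f' g'" "gives_presentation A X' Y' Z' f' g' F"
    using ex_presentation[OF F] .
  have 2: "cond2 \<longleftrightarrow> stably_split X Y Z f g"
    unfolding cond2_def using stab stab[OF Ob' fg' pres(2)] Ob' fg' pres by blast
  have 3: "cond3 \<longleftrightarrow> stably_split X Y Z f g"
    unfolding cond3_def using stab stab[OF Ob' fg' pres(2)] Ob' fg' pres by blast
  have 4: "cond4 \<longleftrightarrow> stably_split X Y Z f g"
  proof
    assume cond4
    then show "stably_split X Y Z f g"
      using iff_v unfolding cond4_def
      by (intro stably_split_if_exact_on_cokers[where ?'v = 'v, OF fg Ob inj_v]) blast+
  next
    assume s: "stably_split X Y Z f g"
    show cond4 unfolding cond4_def
      using iff_v stably_split_imp_exact_on[OF s _ _ fg Ob] by blast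
  qed
  have 5: "cond5 \<longleftrightarrow> stably_split X Y Z f g"
  proof
    assume cond5
    then have "exact_on (ExtA A (Suc 0) K) X Y Z f g" if "K \<in> Ob A" for K
      using iff_set[OF additive_ExtA[OF that]] that unfolding cond5_def One_nat_def by blast
    then show "stably_split X Y Z f g" by (rule stably_split_if_exact_on_ExtA[OF fg Ob])
  next
    assume s: "stably_split X Y Z f g"
    show cond5 unfolding cond5_def One_nat_def
      using iff_set[OF additive_ExtA, unfolded One_nat_def] stably_split_imp_exact_on[OF s additive_ExtA vanishes_ExtA fg Ob] by blast
  qed
  have 6: "cond6 \<longleftrightarrow> stably_split X Y Z f g"
  proof
    assume c: cond6
    show "stably_split X Y Z f g"
    proof (rule stably_split_if_exact_on_cokers[where ?'v = 'm, OF fg Ob inj_m])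
      fix V W p and Q :: "('o, 'm, 'm) abfun" and \<kappa>
      assume Q: "additive_functor A Q" "vanishes_on_projectives A Q" "presentation V W p \<kappa> Q"
      then have "Q \<in> Ob (fp0 A)" using finitely_presented_iff[of Q] by auto
      then show "exact_on Q X Y Z f g" using c iff_m[OF Q(1)] unfolding cond6_def by blast
    qed
  next
    assume s: "stably_split X Y Z f g"
    show cond6 unfolding cond6_def
    proof
      fix G assume "G \<in> Ob (fp0 A)"
      then have G: "additive_functor A G" "vanishes_on_projectives A G" by (simp_all add: finitely_presented_additive)
      show "trivial_group (NatTr A F G) \<and> trivial_group (ExtFun A 1 F G)"
        unfolding iff_m[OF G(1)] by (rule stably_split_imp_exact_on[OF s G fg Ob])
    qed
  qed
  show ?thesis using 1 2 3 4 5 6 by blast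
qed

end
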